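(* Let $s\in(0,1)$ and let $\mathscr U$ be the weak solution of the extended fractional wave problem with data $f,g,h$. Let $0\le\sigma<s$, $0\le\nu<1+s$ and $0\le\theta<2\sqrt{\lambda_1}$. Then there exists $\kappa>1$ such that for all $\ell\in\mathbb N_0$: $$\|\partial_y^{\ell+1}\mathscr U\|^2_{L^2(0,T;L^2(\omega_{\alpha+2\ell-2\sigma,\theta},\mathcal C))}\lesssim\kappa^{2(\ell+1)}(\ell+1)!^2\big(\|g\|^2_{\mathbb H^{\sigma+s}(\Omega)}+\|h\|^2_{\mathbb H^{\sigma}(\Omega)}+\|f\|^2_{L^2(0,T;\mathbb H^{\sigma}(\Omega))}\big),$$ $$\|\nabla_{x'}\partial_y^{\ell+1}\mathscr U\|^2_{L^2(0,T;L^2(\omega_{\alpha+2(\ell+1)-2\nu,\theta},\mathcal C))}\lesssim\kappa^{2(\ell+1)}(\ell+1)!^2\big(\|g\|^2_{\mathbb H^{\nu+s}(\Omega)}+\|h\|^2_{\mathbb H^{\nu}(\Omega)}+\|f\|^2_{L^2(0,T;\mathbb H^{\nu}(\Omega))}\big),$$ $$\|\mathcal L_{x'}\partial_y^{\ell+1}\mathscr U\|^2_{L^2(0,T;L^2(\omega_{\alpha+2(\ell+1)-2\nu,\theta},\mathcal C))}\lesssim\kappa^{2(\ell+1)}(\ell+1)!^2\big(\|g\|^2_{\mathbb H^{1+\nu+s}(\Omega)}+\|h\|^2_{\mathbb H^{1+\nu}(\Omega)}+\|f\|^2_{L^2(0,T;\mathbb H^{1+\nu}(\Omega))}\big).$$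 The hidden constants are independent of $\mathscr U$, $\ell$, and the data $f,g,h$.
   Context: $\Omega\subset\mathbb R^n$ ($n\ge1$) is an open, bounded, convex polytope; $T>0$. $\mathcal L w=-\operatorname{div}(A\nabla w)+cw$ with homogeneous Dirichlet boundary conditions, where $A\in C^{0,1}(\Omega,GL(n,\mathbb R))$ is symmetric and uniformly positive definite and $0\le c\in L^\infty(\Omega)$. $(\lambda_k,\varphi_k)_{k\ge1}$ are its Dirichlet eigenpairs, $\lambda_k$ increasing (with multiplicity), $\{\varphi_k\}$ an orthonormal basis of $L^2(\Omega)$. For $r\ge0$, $\mathbb H^r(\Omega)=\{w=\sum_k w_k\varphi_k:\|w\|^2_{\mathbb H^r(\Omega)}=\sum_k\lambda_k^r|w_k|^2<\infty\}$; $\mathbb H^{-r}(\Omega)$ is its dual and $\langle\cdot,\cdot\rangle$ the duality pairing between $\mathbb H^{s}(\Omega)$ and $\mathbb H^{-s}(\Omega)$. For $s\in(0,1)$ set $\alpha=1-2s$, $d_s=2^\alpha\Gamma(1-s)/\Gamma(s)$, $\mathcal C=\Omega\times(0,\infty)$ with points $x=(x',y)$, $\mathbf A=\operatorname{diag}\{A,1\}$, $\mathring H^1_L(y^\alpha,\mathcal C)=\{w\in H^1(y^\alpha,\mathcal C): w=0\text{ on }\partial\Omega\times[0,\infty)\}$, $a(w,\phi)=\frac1{d_s}\int_{\mathcal C}y^\alpha(\mathbf A\nabla w\cdot\nabla\phi+c\,w\phi)\,dx$; $\operatorname{tr}$ is the trace onto $\Omega\times\{0\}$, which maps $\mathring H^1_L(y^\alpha,\mathcal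 C)$ onto $\mathbb H^s(\Omega)$. Given $f\in L^2(0,T;L^2(\Omega))$, $g\in\mathbb H^s(\Omega)$, $h\in L^2(\Omega)$, the weak solution of the extended fractional wave problem is the unique $\mathscr U\in L^\infty(0,T;\mathring H^1_L(y^\alpha,\mathcal C))$ with $\operatorname{tr}\partial_t\mathscr U\in L^\infty(0,T;L^2(\Omega))$, $\operatorname{tr}\partial_t^2\mathscr U\in L^2(0,T;\mathbb H^{-s}(\Omega))$, $\operatorname{tr}\mathscr U(0)=g$, $\operatorname{tr}\partial_t\mathscr U(0)=h$ and, for a.e. $t$, $\langle\operatorname{tr}\partial_t^2\mathscr U,\operatorname{tr}\phi\rangle+a(\mathscr U,\phi)=\langle f,\operatorname{tr}\phi\rangle$ for all $\phi\in\mathring H^1_L(y^\alpha,\mathcal C)$. Its trace $u=\operatorname{tr}\mathscr U$ solves $\partial_t^2u+\mathcal L^su=f$, $u(0)=g$, $\partial_tu(0)=h$, with $\mathcal L^sw=\sum_k\lambda_k^sw_k\varphi_k$. $\omega_{\beta,\theta}(y)=y^\beta e^{\theta y}$ and $\|v\|^2_{L^2(\omega_{\beta,\theta},\mathcal C)}=\int_0^\infty\int_\Omega\omega_{\beta,\theta}(y)|v(x',y)|^2\,dx'\,dy$. $\nabla_{x'}$ and $\mathcal L_{x'}$ act in the variable $x'$. $a\lesssim b$ means $a\le Cb$ with a constant $C>0$ with the stated independence (it may depend on the fixed $\Omega,A,c,s,T,\sigma,\nu,\theta$). Estimates are understood for data for which the right-hand side is finite. *)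

theory Defs
  imports "HOL-Analysis.Analysis"
begin

text \<open>
  Elements of function spaces are represented by functions rather than by classes modulo
  null sets; accordingly the "norms" below are seminorms on the carrier sets, and values
  outside the domain under consideration are irrelevant.
\<close>

section \<open>Test functions and weak derivatives\<close>

definition dir_deriv :: "'a::euclidean_space \<Rightarrow> ('a \<Rightarrow> real) \<Rightarrow> 'a \<Rightarrow> real" where
  "dir_deriv b f = (\<lambda>x. frechet_derivative f (at x) b)"

definition smooth_fun :: "('a::euclidean_space \<Rightarrow> real) \<Rightarrow> bool" where
  "smooth_fun f \<longleftrightarrow>
     (\<forall>bs. set bs \<subseteq> Basis \<longrightarrow> (\<forall>x. foldr dir_deriv bs f differentiable (at x)))"

definition test_functions :: "'a::euclidean_space set \<Rightarrow> ('a \<Rightarrow> real) set" where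
  "test_functions S =
     {\<zeta>. smooth_fun \<zeta> \<and> compact (closure {x. \<zeta> x \<noteq> 0}) \<and> closure {x. \<zeta> x \<noteq> 0} \<subseteq> S}"

definition locally_integrable :: "'a::euclidean_space set \<Rightarrow> ('a \<Rightarrow> real) \<Rightarrow> bool" where
  "locally_integrable S w \<longleftrightarrow> (\<forall>K. compact K \<longrightarrow> K \<subseteq> S \<longrightarrow> integrable (lebesgue_on K) w)"

text \<open>\<open>v\<close> is the weak derivative of order \<open>k\<close> of \<open>w\<close> in the direction \<open>b\<close>
  on the open set \<open>S\<close>.\<close>

definition has_weak_deriv ::
    "'a::euclidean_space set \<Rightarrow> 'a \<Rightarrow> nat \<Rightarrow> ('a \<Rightarrow> real) \<Rightarrow> ('a \<Rightarrow> real) \<Rightarrow> bool" where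
  "has_weak_deriv S b k w v \<longleftrightarrow> locally_integrable S w \<and> locally_integrable S v \<and>
     (\<forall>\<zeta> \<in> test_functions S.
        (\<integral>x. w x * (dir_deriv b ^^ k) \<zeta> x \<partial>lebesgue_on S)
          = (-1) ^ k * (\<integral>x. v x * \<zeta> x \<partial>lebesgue_on S))"

text \<open>Weak derivatives are unique almost everywhere, so the choice made here is immaterial
  under integrals.\<close>

definition weak_grad :: "'a::euclidean_space set \<Rightarrow> ('a \<Rightarrow> real) \<Rightarrow> 'a \<Rightarrow> 'a" where
  "weak_grad S w = (\<lambda>x. \<Sum>b\<in>Basis. (SOME v. has_weak_deriv S b 1 w v) x *\<^sub>R b)"


section \<open>Weighted Lebesgue and Sobolev spaces\<close>

definition wL2 ::
    "'a::euclidean_space set \<Rightarrow> ('a \<Rightarrow> real) \<Rightarrow> ('a \<Rightarrow> 'b::euclidean_space) set" where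
  "wL2 S \<omega> = {v. v \<in> borel_measurable (lebesgue_on S) \<and>
                 integrable (lebesgue_on S) (\<lambda>x. \<omega> x * (norm (v x))\<^sup>2)}"

definition wL2_norm ::
    "'a::euclidean_space set \<Rightarrow> ('a \<Rightarrow> real) \<Rightarrow> ('a \<Rightarrow> 'b::euclidean_space) \<Rightarrow> real" where
  "wL2_norm S \<omega> v = sqrt (\<integral>x. \<omega> x * (norm (v x))\<^sup>2 \<partial>lebesgue_on S)"

abbreviation L2 :: "'a::euclidean_space set \<Rightarrow> ('a \<Rightarrow> real) set" where
  "L2 S \<equiv> wL2 S (\<lambda>_. 1)"

abbreviation L2_norm :: "'a::euclidean_space set \<Rightarrow> ('a \<Rightarrow> real) \<Rightarrow> real" where
  "L2_norm S \<equiv> wL2_norm S (\<lambda>_. 1)"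

definition L2_inner ::
    "'a::euclidean_space set \<Rightarrow> ('a \<Rightarrow> real) \<Rightarrow> ('a \<Rightarrow> real) \<Rightarrow> real" where
  "L2_inner S w v = (\<integral>x. w x * v x \<partial>lebesgue_on S)"

definition wH1 :: "'a::euclidean_space set \<Rightarrow> ('a \<Rightarrow> real) \<Rightarrow> ('a \<Rightarrow> real) set" where
  "wH1 S \<omega> = {w \<in> wL2 S \<omega>. \<forall>b\<in>Basis. \<exists>v \<in> wL2 S \<omega>. has_weak_deriv S b 1 w v}"

definition wH1_norm :: "'a::euclidean_space set \<Rightarrow> ('a \<Rightarrow> real) \<Rightarrow> ('a \<Rightarrow> real) \<Rightarrow> real" where
  "wH1_norm S \<omega> w = sqrt ((wL2_norm S \<omega> w)\<^sup>2 + (wL2_norm S \<omega> (weak_grad S w))\<^sup>2)"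

text \<open>\<open>H\<^sup>1\<^sub>0(\<Omega>)\<close>: the closure of the test functions in \<open>H\<^sup>1(\<Omega>)\<close>.\<close>

definition H10 :: "'a::euclidean_space set \<Rightarrow> ('a \<Rightarrow> real) set" where
  "H10 \<Omega> = {w \<in> wH1 \<Omega> (\<lambda>_. 1). \<exists>\<zeta>. (\<forall>j. \<zeta> j \<in> test_functions \<Omega>) \<and>
                (\<lambda>j. wH1_norm \<Omega> (\<lambda>_. 1) (\<lambda>x. w x - \<zeta> j x)) \<longlonglongrightarrow> 0}"


section \<open>The elliptic operator, its eigenpairs and the spectral scale\<close>

text \<open>\<open>L w = G\<close> for \<open>L w = - div (A \<nabla>w) + c w\<close> with homogeneous Dirichlet boundary
  conditions, in the weak sense, with \<open>G\<close> square integrable.\<close>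

definition dirichlet_op ::
    "(real^'n) set \<Rightarrow> (real^'n \<Rightarrow> real^'n^'n) \<Rightarrow> (real^'n \<Rightarrow> real)
      \<Rightarrow> (real^'n \<Rightarrow> real) \<Rightarrow> (real^'n \<Rightarrow> real) \<Rightarrow> bool" where
  "dirichlet_op \<Omega> A c w G \<longleftrightarrow> w \<in> H10 \<Omega> \<and> G \<in> L2 \<Omega> \<and>
     (\<forall>v \<in> H10 \<Omega>.
        (\<integral>x. (A x *v weak_grad \<Omega> w x) \<bullet> weak_grad \<Omega> v x + c x * w x * v x \<partial>lebesgue_on \<Omega>)
          = L2_inner \<Omega> G v)"

text \<open>The eigenpairs are numbered from 0, so \<open>lam 0\<close> is the smallest eigenvalue.\<close>

definition dirichlet_eigenpairs ::
    "(real^'n) set \<Rightarrow> (real^'n \<Rightarrow> real^'n^'n) \<Rightarrow> (real^'n \<Rightarrow> real)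
      \<Rightarrow> (nat \<Rightarrow> real) \<Rightarrow> (nat \<Rightarrow> real^'n \<Rightarrow> real) \<Rightarrow> bool" where
  "dirichlet_eigenpairs \<Omega> A c lam \<phi> \<longleftrightarrow>
     mono lam \<and>
     (\<forall>k. dirichlet_op \<Omega> A c (\<phi> k) (\<lambda>x. lam k * \<phi> k x)) \<and>
     (\<forall>j k. L2_inner \<Omega> (\<phi> j) (\<phi> k) = (if j = k then 1 else 0)) \<and>
     (\<forall>w \<in> L2 \<Omega>. (\<lambda>m. L2_norm \<Omega> (\<lambda>x. w x - (\<Sum>k<m. L2_inner \<Omega> w (\<phi> k) * \<phi> k x))) \<longlonglongrightarrow> 0)"

definition Hr ::
    "(real^'n) set \<Rightarrow> (nat \<Rightarrow> real) \<Rightarrow> (nat \<Rightarrow> real^'n \<Rightarrow> real) \<Rightarrow> real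
      \<Rightarrow> (real^'n \<Rightarrow> real) set" where
  "Hr \<Omega> lam \<phi> r = {w \<in> L2 \<Omega>. summable (\<lambda>k. lam k powr r * (L2_inner \<Omega> w (\<phi> k))\<^sup>2)}"

definition Hr_norm ::
    "(real^'n) set \<Rightarrow> (nat \<Rightarrow> real) \<Rightarrow> (nat \<Rightarrow> real^'n \<Rightarrow> real) \<Rightarrow> real
      \<Rightarrow> (real^'n \<Rightarrow> real) \<Rightarrow> real" where
  "Hr_norm \<Omega> lam \<phi> r w = sqrt (\<Sum>k. lam k powr r * (L2_inner \<Omega> w (\<phi> k))\<^sup>2)"

text \<open>The dual of \<open>Hr \<Omega> lam \<phi> r\<close>; the duality pairing is function application.\<close>

definition Hr_dual ::
    "(real^'n) set \<Rightarrow> (nat \<Rightarrow> real) \<Rightarrow> (nat \<Rightarrow> real^'n \<Rightarrow> real) \<Rightarrow> real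
      \<Rightarrow> ((real^'n \<Rightarrow> real) \<Rightarrow> real) set" where
  "Hr_dual \<Omega> lam \<phi> r = {F.
     (\<forall>w \<in> Hr \<Omega> lam \<phi> r. \<forall>v \<in> Hr \<Omega> lam \<phi> r. \<forall>a b.
        F (\<lambda>x. a * w x + b * v x) = a * F w + b * F v) \<and>
     (\<exists>K. \<forall>w \<in> Hr \<Omega> lam \<phi> r. \<bar>F w\<bar> \<le> K * Hr_norm \<Omega> lam \<phi> r w)}"

definition Hr_dual_norm ::
    "(real^'n) set \<Rightarrow> (nat \<Rightarrow> real) \<Rightarrow> (nat \<Rightarrow> real^'n \<Rightarrow> real) \<Rightarrow> real
      \<Rightarrow> ((real^'n \<Rightarrow> real) \<Rightarrow> real) \<Rightarrow> real" where
  "Hr_dual_norm \<Omega> lam \<phi> r F = (SUP w \<in> {w \<in> Hr \<Omega> lam \<phi> r. Hr_norm \<Omega> lam \<phi> r w \<le> 1}. \<bar>F w\<bar>)"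


section \<open>Bochner spaces on \<open>(0,T)\<close>\<close>

text \<open>Here \<open>X\<close> is a space of functions with seminorm \<open>N\<close>.\<close>

definition strongly_measurable ::
    "real \<Rightarrow> ('a \<Rightarrow> 'b::real_vector) set \<Rightarrow> (('a \<Rightarrow> 'b) \<Rightarrow> real) \<Rightarrow> (real \<Rightarrow> 'a \<Rightarrow> 'b) \<Rightarrow> bool" where
  "strongly_measurable T X N u \<longleftrightarrow>
     (AE t in lebesgue_on {0<..<T}. u t \<in> X) \<and>
     (\<exists>p. (\<forall>j. simple_function (lebesgue_on {0<..<T}) (p j) \<and> (\<forall>t\<in>{0<..<T}. p j t \<in> X)) \<and>
          (AE t in lebesgue_on {0<..<T}. (\<lambda>j. N (\<lambda>x. p j t x - u t x)) \<longlonglongrightarrow> 0))"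

definition L2T ::
    "real \<Rightarrow> ('a \<Rightarrow> 'b::real_vector) set \<Rightarrow> (('a \<Rightarrow> 'b) \<Rightarrow> real) \<Rightarrow> (real \<Rightarrow> 'a \<Rightarrow> 'b) set" where
  "L2T T X N = {u. strongly_measurable T X N u \<and>
                   integrable (lebesgue_on {0<..<T}) (\<lambda>t. (N (u t))\<^sup>2)}"

definition L2T_norm ::
    "real \<Rightarrow> (('a \<Rightarrow> 'b::real_vector) \<Rightarrow> real) \<Rightarrow> (real \<Rightarrow> 'a \<Rightarrow> 'b) \<Rightarrow> real" where
  "L2T_norm T N u = sqrt (\<integral>t. (N (u t))\<^sup>2 \<partial>lebesgue_on {0<..<T})"

definition LinfT ::
    "real \<Rightarrow> ('a \<Rightarrow> 'b::real_vector) set \<Rightarrow> (('a \<Rightarrow> 'b) \<Rightarrow> real) \<Rightarrow> (real \<Rightarrow> 'a \<Rightarrow> 'b) set" where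
  "LinfT T X N = {u. strongly_measurable T X N u \<and>
                     (\<exists>M. AE t in lebesgue_on {0<..<T}. N (u t) \<le> M)}"

text \<open>\<open>u\<close> has a representative in \<open>C([0,T]; X)\<close> whose value at time 0 is \<open>u0\<close>.\<close>

definition initial_value ::
    "real \<Rightarrow> ('a \<Rightarrow> 'b::real_vector) set \<Rightarrow> (('a \<Rightarrow> 'b) \<Rightarrow> real) \<Rightarrow> (real \<Rightarrow> 'a \<Rightarrow> 'b)
      \<Rightarrow> ('a \<Rightarrow> 'b) \<Rightarrow> bool" where
  "initial_value T X N u u0 \<longleftrightarrow>
     (\<exists>z. (\<forall>t\<in>{0..T}. z t \<in> X \<and>
             ((\<lambda>\<tau>. N (\<lambda>x. z \<tau> x - z t x)) \<longlongrightarrow> 0) (at t within {0..T})) \<and>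
          (AE t in lebesgue_on {0<..<T}. N (\<lambda>x. z t x - u t x) = 0) \<and>
          N (\<lambda>x. z 0 x - u0 x) = 0)"


section \<open>The extended problem on the cylinder\<close>

definition cyl :: "(real^'n) set \<Rightarrow> ((real^'n) \<times> real) set" where
  "cyl \<Omega> = \<Omega> \<times> {0<..}"

definition exp_weight :: "real \<Rightarrow> real \<Rightarrow> (real^'n) \<times> real \<Rightarrow> real" where
  "exp_weight \<beta> \<theta> = (\<lambda>x. snd x powr \<beta> * exp (\<theta> * snd x))"

definition ext_weight :: "real \<Rightarrow> (real^'n) \<times> real \<Rightarrow> real" where
  "ext_weight s = (\<lambda>x. snd x powr (1 - 2 * s))"

text \<open>The functions in \<open>H\<^sup>1(y\<^sup>\<alpha>, C)\<close> that vanish on the lateral boundary: the closure of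
  the smooth functions supported away from it. Test functions on \<open>\<Omega> \<times> \<real>\<close> need not vanish
  at \<open>y = 0\<close>.\<close>

definition H1L :: "(real^'n) set \<Rightarrow> real \<Rightarrow> ((real^'n) \<times> real \<Rightarrow> real) set" where
  "H1L \<Omega> s = {w \<in> wH1 (cyl \<Omega>) (ext_weight s).
     \<exists>\<zeta>. (\<forall>j. \<zeta> j \<in> test_functions (\<Omega> \<times> UNIV)) \<and>
         (\<lambda>j. wH1_norm (cyl \<Omega>) (ext_weight s) (\<lambda>x. w x - \<zeta> j x)) \<longlonglongrightarrow> 0}"

text \<open>\<open>p\<close> is the trace of \<open>w\<close> on \<open>\<Omega> \<times> {0}\<close>: the trace operator is the continuous extension
  of the restriction of smooth functions to \<open>y = 0\<close>.\<close>

definition is_trace ::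
    "(real^'n) set \<Rightarrow> real \<Rightarrow> ((real^'n) \<times> real \<Rightarrow> real) \<Rightarrow> (real^'n \<Rightarrow> real) \<Rightarrow> bool" where
  "is_trace \<Omega> s w p \<longleftrightarrow> w \<in> H1L \<Omega> s \<and> p \<in> L2 \<Omega> \<and>
     (\<exists>\<zeta>. (\<forall>j. \<zeta> j \<in> test_functions (\<Omega> \<times> UNIV)) \<and>
         (\<lambda>j. wH1_norm (cyl \<Omega>) (ext_weight s) (\<lambda>x. w x - \<zeta> j x)) \<longlonglongrightarrow> 0 \<and>
         (\<lambda>j. L2_norm \<Omega> (\<lambda>x'. p x' - \<zeta> j (x', 0))) \<longlonglongrightarrow> 0)"

definition d_const :: "real \<Rightarrow> real" where
  "d_const s = 2 powr (1 - 2 * s) * Gamma (1 - s) / Gamma s"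

definition ext_form ::
    "(real^'n) set \<Rightarrow> (real^'n \<Rightarrow> real^'n^'n) \<Rightarrow> (real^'n \<Rightarrow> real) \<Rightarrow> real
      \<Rightarrow> ((real^'n) \<times> real \<Rightarrow> real) \<Rightarrow> ((real^'n) \<times> real \<Rightarrow> real) \<Rightarrow> real" where
  "ext_form \<Omega> A c s w v = 1 / d_const s *
     (\<integral>x. ext_weight s x *
        ((A (fst x) *v fst (weak_grad (cyl \<Omega>) w x), snd (weak_grad (cyl \<Omega>) w x))
            \<bullet> weak_grad (cyl \<Omega>) v x
         + c (fst x) * w x * v x) \<partial>lebesgue_on (cyl \<Omega>))"

text \<open>\<open>u\<close>, \<open>u1\<close>, \<open>u2\<close> are the trace of \<open>U\<close> and its first and second distributional time
  derivatives. The vector-valued time derivatives are tested against fixed elements of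
  the predual. The initial velocity is attained in the dual space, into which square
  integrable functions are embedded via the inner product.\<close>

definition weak_solution ::
    "(real^'n) set \<Rightarrow> (real^'n \<Rightarrow> real^'n^'n) \<Rightarrow> (real^'n \<Rightarrow> real)
      \<Rightarrow> (nat \<Rightarrow> real) \<Rightarrow> (nat \<Rightarrow> real^'n \<Rightarrow> real) \<Rightarrow> real \<Rightarrow> real
      \<Rightarrow> (real \<Rightarrow> real^'n \<Rightarrow> real) \<Rightarrow> (real^'n \<Rightarrow> real) \<Rightarrow> (real^'n \<Rightarrow> real)
      \<Rightarrow> (real \<Rightarrow> (real^'n) \<times> real \<Rightarrow> real) \<Rightarrow> bool" where
  "weak_solution \<Omega> A c lam \<phi> s T f g h U \<longleftrightarrow>
     U \<in> LinfT T (H1L \<Omega> s) (wH1_norm (cyl \<Omega>) (ext_weight s)) \<and>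
     (\<exists>u u1 u2.
        (AE t in lebesgue_on {0<..<T}. is_trace \<Omega> s (U t) (u t)) \<and>
        u1 \<in> LinfT T (L2 \<Omega>) (L2_norm \<Omega>) \<and>
        u2 \<in> L2T T (Hr_dual \<Omega> lam \<phi> s) (Hr_dual_norm \<Omega> lam \<phi> s) \<and>
        (\<forall>q \<in> L2 \<Omega>. has_weak_deriv {0<..<T} 1 1
            (\<lambda>t. L2_inner \<Omega> (u t) q) (\<lambda>t. L2_inner \<Omega> (u1 t) q)) \<and>
        (\<forall>q \<in> Hr \<Omega> lam \<phi> s. has_weak_deriv {0<..<T} 1 1
            (\<lambda>t. L2_inner \<Omega> (u1 t) q) (\<lambda>t. u2 t q)) \<and>
        initial_value T (L2 \<Omega>) (L2_norm \<Omega>) u g \<and>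
        initial_value T (Hr_dual \<Omega> lam \<phi> s) (Hr_dual_norm \<Omega> lam \<phi> s)
            (\<lambda>t. L2_inner \<Omega> (u1 t)) (L2_inner \<Omega> h) \<and>
        (AE t in lebesgue_on {0<..<T}. \<forall>v \<in> H1L \<Omega> s. \<forall>p. is_trace \<Omega> s v p \<longrightarrow>
            u2 t p + ext_form \<Omega> A c s (U t) v = L2_inner \<Omega> (f t) p))"

definition has_weak_grad_x' ::
    "(real^'n) set \<Rightarrow> ((real^'n) \<times> real \<Rightarrow> real) \<Rightarrow> ((real^'n) \<times> real \<Rightarrow> real^'n) \<Rightarrow> bool" where
  "has_weak_grad_x' \<Omega> w W \<longleftrightarrow>
     (\<forall>b\<in>Basis. has_weak_deriv (cyl \<Omega>) (b, 0) 1 w (\<lambda>x. W x \<bullet> b))"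

definition has_dirichlet_op_x' ::
    "(real^'n) set \<Rightarrow> (real^'n \<Rightarrow> real^'n^'n) \<Rightarrow> (real^'n \<Rightarrow> real)
      \<Rightarrow> ((real^'n) \<times> real \<Rightarrow> real) \<Rightarrow> ((real^'n) \<times> real \<Rightarrow> real) \<Rightarrow> bool" where
  "has_dirichlet_op_x' \<Omega> A c w G \<longleftrightarrow>
     (AE y in lebesgue_on {0<..}. dirichlet_op \<Omega> A c (\<lambda>x'. w (x', y)) (\<lambda>x'. G (x', y)))"

end

(* Expanding in the eigenfunctions, the trace of the solution has coefficients u_k with
 u_k'' + lam_k^s u_k = f_k, and testing the extended problem with phi_k times a test function of y
 shows that the k-th mode of U is u_k(t) Psi(sqrt(lam_k) y), where Psi is the decaying
 solution of (y^alpha Psi')' = y^alpha Psi with Psi(0) = 1. The energy identity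
 gives lam_k^s u_k(t)^2 <= C (lam_k^s g_k^2 + h_k^2 + int f_k^2) uniformly in t. An integral representation
 of Psi yields |Psi^(l+1)(z)| <= C kappa^l l! z^(2s-1-l) exp(-rho z) for every rho < 1, so that the weighted
 norm of the (l+1)-st derivative of the k-th profile is explicit in lam_k. Here theta < 2 sqrt(lam_0)
 allows the choice rho with theta < 2 rho sqrt(lam_0), and sigma < s, nu < 1 + s make the
 integrals converge at y = 0. Orthogonality then sums the modes; the gradient is controlled by the
 Dirichlet form and the operator is closed. *)

theory Submission
 imports Defs
begin

text \<open>Nothing is known about the regularity of the solution: \<open>U t\<close>, its trace and
  its gradient are limits of test functions. The profile is no test function either; it behaves like
  1 - c z^(2s) at 0 and has no compact support. The modes are therefore identified without ODE
  theory: the bilinear form of one mode is evaluated on all pairs formed from the mode and the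
  profile, approximating one entry at a time, and the form of their difference comes out as 0. The
  values of profile and flux at 0 are suprema, so the equation of a mode is carried with a factor
  \<open>cs\<close> > 0 in front of lam_k^s, and the energy bound draws on its sign. The growth
  kappa^l l! stems from bounding t^l by l! / (delta z)^l exp (delta z t) under the integral, with
  rho = 1 - 2 delta. By scaling, neither the power of lam_k nor the Gamma factor in the profile
  norms depends on l, which keeps the constants uniform. The derivatives of U are series built in
  weighted spaces of their own and recognised as weak derivatives against test functions. One V per
  order has to serve all three estimates and must exist even for data that meet none of the three
  conditions.\<close>

abbreviation leb :: "'a::euclidean_space set => 'a measure" where
 "leb \<equiv> lebesgue_on"

abbreviation lint :: "'a::euclidean_space set => ('a => 'b::{banach, second_countable_topology}) => 'b" where
 "lint S \<equiv> integral\<^sup>L (lebesgue_on S)"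

abbreviation null :: "(nat => real) => bool" where
 "null f \<equiv> f \<longlonglongrightarrow> 0"

abbreviation "meas S \<equiv> borel_measurable (leb S)"
abbreviation "intg S \<equiv> integrable (leb S)"
abbreviation "ind \<equiv> indicator"
abbreviation "dd \<equiv> dir_deriv"
abbreviation "TF \<equiv> test_functions"
abbreviation "hwd \<equiv> has_weak_deriv"
abbreviation "smooth \<equiv> smooth_fun"
abbreviation "locint \<equiv> locally_integrable"

lemmas intg_add = Bochner_Integration.integrable_add
lemmas intg_diff = Bochner_Integration.integrable_diff
lemmas intg_sum = Bochner_Integration.integrable_sum
lemmas intg_bound = Bochner_Integration.integrable_bound
lemmas lint_add = Bochner_Integration.integral_add
lemmas lint_diff = Bochner_Integration.integral_diff
lemmas lint_sum = Bochner_Integration.integral_sum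
lemmas open_ivl = open_greaterThanLessThan
lemmas continuous_meas = continuous_imp_measurable_on_sets_lebesgue

section \<open>Smooth functions\<close>

text \<open>\<open>smooth_fun\<close> speaks of all iterated derivatives along basis directions at
  once. A class of differentiable functions that is closed under one such derivative contains every
  iterate, so smoothness of f reduces to finding a closed class that contains f; choosing the class
  is the work in the uses below.\<close>

lemma smooth_coinduct:
 fixes f :: "'a::euclidean_space => real"
 assumes "f \<in> F"
  and diff: "\<And>f x. f \<in> F ==> f differentiable (at x)"
  and step: "\<And>f b. f \<in> F ==> b \<in> Basis ==> dd b f \<in> F"
 shows "smooth f"
proof -
 have "foldr dd bs f \<in> F" if "set bs \<subseteq> Basis" for bs
  using that by (induction bs) (auto simp: assms)
 then show ?thesis
  unfolding smooth_fun_def using diff by blast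
qed

lemma smooth_differentiable: "smooth f ==> f differentiable (at x)"
 unfolding smooth_fun_def by (metis empty_subsetI foldr.simps(1) id_apply list.set(1))

lemma smooth_dir_deriv:
 fixes f :: "'a::euclidean_space => real"
 assumes "smooth f" "b \<in> Basis"
 shows "smooth (dd b f)"
 using assms unfolding smooth_fun_def
proof (intro allI impI)
 fix bs :: "'a list" and x :: 'a
 assume *: "\<forall>bs. set bs \<subseteq> Basis \<longrightarrow> (\<forall>x. foldr dd bs f differentiable at x)"
  "b \<in> Basis" "set bs \<subseteq> Basis"
 have "foldr dd (bs @ [b]) f differentiable at x"
  using * by (metis Un_subset_iff empty_subsetI insert_subset list.set(1) list.simps(15) set_append)
 then show "foldr dd bs (dd b f) differentiable at x"
  by simp
qed

lemma smooth_continuous_on: "smooth f ==> continuous_on S f"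
 by (meson continuous_at_imp_continuous_on differentiable_imp_continuous_within smooth_differentiable)

lemma smooth_borel [measurable_dest]: "smooth f ==> f \<in> borel_measurable borel"
 by (simp add: borel_measurable_continuous_onI smooth_continuous_on)

lemma dir_deriv_eqI: "(f has_derivative f') (at x) ==> dd b f x = f' b"
 unfolding dir_deriv_def by (metis frechet_derivative_at)

lemma smooth_has_derivative:
 "smooth f ==> (f has_derivative frechet_derivative f (at x)) (at x)"
 using frechet_derivative_works smooth_differentiable by blast

lemma smooth_const: "smooth (%x::'a::euclidean_space. c)"
proof (rule smooth_coinduct[where F = "{f. \<exists>c. f = (%x. c)}"])
 show "\<And>(f::'a=>real) b. f \<in> {f. \<exists>c. f = (%x. c)} ==> b \<in> Basis ==> dd b f \<in> {f. \<exists>c. f = (%x. c)}"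
 proof -
  fix f::"'a=>real" and b assume "f \<in> {f. \<exists>c. f = (%x. c)}"
  then obtain c where "f = (%x. c)" by auto
  then have "dd b f = (%x. 0)"
   by (auto intro!: ext dir_deriv_eqI)
  then show "dd b f \<in> {f. \<exists>c. f = (%x. c)}" by auto
 qed
qed auto

lemma dir_deriv_mult:
 assumes "f differentiable (at x)" "g differentiable (at x)"
 shows "dd b (%x. f x * g x) x = f x * dd b g x + dd b f x * (g x :: real)"
proof -
 have "((%x. f x * g x) has_derivative
   (%h. f x * frechet_derivative g (at x) h + frechet_derivative f (at x) h * g x)) (at x)"
  using assms by (intro has_derivative_mult) (simp_all add: frechet_derivative_works)
 from dir_deriv_eqI[OF this] show ?thesis by (simp add: dir_deriv_def)
qed

lemma dir_deriv_add:
 assumes "f differentiable (at x)" "g differentiable (at x)"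
 shows "dd b (%x. f x + g x) x = dd b f x + dd b g x"
proof -
 have "((%x. f x + g x) has_derivative
   (%h. frechet_derivative f (at x) h + frechet_derivative g (at x) h)) (at x)"
  using assms by (intro has_derivative_add) (simp_all add: frechet_derivative_works)
 from dir_deriv_eqI[OF this] show ?thesis by (simp add: dir_deriv_def)
qed

text \<open>By the Leibniz rule a product has a sum of two products as its derivative, so single
  products are not a closed class but finite sums of products of smooth functions are. Such a sum is
  encoded as the list \<open>ps\<close> of its pairs of factors.\<close>

lemma smooth_mult:
 fixes f g :: "'a::euclidean_space => real"
 assumes "smooth f" "smooth g"
 shows "smooth (%x. f x * g x)"
proof -
 define pr where "pr = (%ps::(('a=>real)\<times>('a=>real)) list. %x. sum_list (map (%p. fst p x * snd p x) ps))"
 define ok where "ok = (%ps::(('a=>real)\<times>('a=>real)) list. \<forall>p\<in>set ps. smooth (fst p) \<and> smooth (snd p))"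
 have pr_simps: "pr [] = (%x. 0)" "pr (p # ps) = (%x. fst p x * snd p x + pr ps x)" for p ps
  by (auto simp: pr_def)
 have d: "pr ps differentiable (at x)" if "ok ps" for ps x
  using that
 proof (induction ps)
  case (Cons p ps)
  then have "smooth (fst p)" "smooth (snd p)" "ok ps" by (auto simp: ok_def)
  then show ?case
   unfolding pr_simps using Cons.IH[OF \<open>ok ps\<close>]
   by (simp add: differentiable_add differentiable_mult smooth_differentiable)
 qed (simp add: pr_simps)
 have s: "\<exists>qs. ok qs \<and> dd b (pr ps) = pr qs" if "ok ps" "b \<in> Basis" for ps b
  using that
 proof (induction ps)
  case Nil
  have "dd b (pr []) = pr []" unfolding pr_simps by (auto intro!: ext dir_deriv_eqI)
  then show ?case using Nil by auto
 next
  case (Cons p ps)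
  then have p: "smooth (fst p)" "smooth (snd p)" "ok ps" by (auto simp: ok_def)
  with Cons obtain qs where qs: "ok qs" "dd b (pr ps) = pr qs" by auto
  have "dd b (pr (p # ps)) = pr ((fst p, dd b (snd p)) # (dd b (fst p), snd p) # qs)"
   unfolding pr_simps using p d[OF p(3)] qs(2)
   by (auto intro!: ext simp: dir_deriv_add dir_deriv_mult smooth_differentiable)
  moreover have "ok ((fst p, dd b (snd p)) # (dd b (fst p), snd p) # qs)"
   using p qs Cons.prems by (auto simp: ok_def smooth_dir_deriv)
  ultimately show ?case by blast
 qed
 show ?thesis
 proof (rule smooth_coinduct[where F = "pr ` {ps. ok ps}"])
  have "ok [(f, g)]" "(%x. f x * g x) = pr [(f, g)]" using assms by (auto simp: ok_def pr_def)
  then show "(%x. f x * g x) \<in> pr ` {ps. ok ps}" by blast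
  show "h differentiable at x" if "h \<in> pr ` {ps. ok ps}" for h x using that d by blast
  show "dd b h \<in> pr ` {ps. ok ps}" if "h \<in> pr ` {ps. ok ps}" "b \<in> Basis" for h b
   using that s by blast
 qed
qed

lemma smooth_add:
 fixes f g :: "'a::euclidean_space => real"
 assumes "smooth f" "smooth g"
 shows "smooth (%x. f x + g x)"
proof (rule smooth_coinduct[where F = "{h. \<exists>f g. smooth f \<and> smooth g \<and> h = (%x. f x + g x)}"])
 fix h :: "'a => real" and b :: 'a
 assume "h \<in> {h. \<exists>f g. smooth f \<and> smooth g \<and> h = (%x. f x + g x)}" "b \<in> Basis"
 then obtain f g where h: "smooth f" "smooth g" "h = (%x. f x + g x)" by auto
 then have "dd b h = (%x. dd b f x + dd b g x)"
  by (auto simp: dir_deriv_add smooth_differentiable)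
 then show "dd b h \<in> {h. \<exists>f g. smooth f \<and> smooth g \<and> h = (%x. f x + g x)}"
  using h \<open>b \<in> Basis\<close> smooth_dir_deriv by blast
next
 fix h :: "'a => real" and x :: 'a
 assume "h \<in> {h. \<exists>f g. smooth f \<and> smooth g \<and> h = (%x. f x + g x)}"
 then show "h differentiable at x" by (auto simp: differentiable_add smooth_differentiable)
qed (use assms in blast)

lemma smooth_prod:
 assumes "finite I" "\<And>i. i \<in> I ==> smooth (f i)"
 shows "smooth (%x. \<Prod>i\<in>I. f i x)"
 using assms by (induction rule: finite_induct) (auto simp: smooth_const smooth_mult)

lemma smooth_real_iff:
 fixes f :: "real => real"
 assumes "f \<in> F"
  and "\<And>f. f \<in> F ==> \<exists>g\<in>F. \<forall>x. (f has_real_derivative g x) (at x)"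
 shows "smooth f"
proof (rule smooth_coinduct[where F = F])
 fix f :: "real => real" and b :: real assume "f \<in> F" "b \<in> Basis"
 then obtain g where g: "g \<in> F" "\<And>x. (f has_real_derivative g x) (at x)" and "b = 1" using assms(2) by auto
 have "dd b f x = g x" for x
  using g(2)[of x] dir_deriv_eqI[of f "(*) (g x)" x b] by (simp add: has_field_derivative_def \<open>b = 1\<close>)
 then have "dd b f = g" by auto
 with g show "dd b f \<in> F" by simp
next
 fix f :: "real => real" and x assume "f \<in> F"
 then show "f differentiable at x" using assms(2) real_differentiable_def by blast
qed (rule assms(1))

lemma dir_deriv_real: "(f has_real_derivative D) (at x) ==> dd 1 f x = D"
 using dir_deriv_eqI[of f _ x 1] by (auto simp: has_field_derivative_def)

lemma smooth_has_real_derivative: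
 "smooth f ==> (f has_real_derivative dd 1 f x) (at x)"
 by (metis dir_deriv_real differentiable_def has_field_derivative_def real_differentiable_def smooth_differentiable)

text \<open>The chain rule gives the derivative of h in direction L b. \<open>smooth_fun\<close>
  controls directions in \<open>Basis\<close>, which is why L must send each basis vector to a basis
  vector or to 0; inner products with basis vectors and the two projections of a product space are
  of this kind.\<close>

lemma smooth_comp_linear_aux:
 fixes h :: "'b::euclidean_space => real" and L :: "'a::euclidean_space => 'b"
 assumes "smooth h" and L: "bounded_linear L"
  and Lb: "\<And>b. b \<in> Basis ==> L b = 0 \<or> L b \<in> Basis"
 shows "smooth (%x. h (L x))"
proof (rule smooth_coinduct[where F = "{u. \<exists>h. smooth h \<and> u = (%x. h (L x))}"])
 have D: "((%x. h (L x)) has_derivative (%v. frechet_derivative h (at (L x)) (L v))) (at x)"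
  if "smooth h" for h x
  using has_derivative_compose[OF bounded_linear_imp_has_derivative[OF L] smooth_has_derivative[OF that]]
  by simp
 show "f differentiable (at x)" if "f \<in> {u. \<exists>h. smooth h \<and> u = (%x. h (L x))}" for f x
  using that D differentiable_def by blast
 fix f :: "'a => real" and b :: 'a
 assume "f \<in> {u. \<exists>h. smooth h \<and> u = (%x. h (L x))}" and b: "b \<in> Basis"
 then obtain h where h: "smooth h" "f = (%x. h (L x))" by auto
 have e: "dd b f x = frechet_derivative h (at (L x)) (L b)" for x
  using dir_deriv_eqI[OF D[OF h(1), of x]] by (simp add: h)
 show "dd b f \<in> {u. \<exists>h. smooth h \<and> u = (%x. h (L x))}"
 proof (cases "L b = 0")
  case True
  have "dd b f = (%x. (%_. 0) (L x))"
   using e True linear_0[OF linear_frechet_derivative[OF smooth_differentiable[OF h(1)]]] by auto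
  then show ?thesis using smooth_const by blast
 next
  case False
  then have "L b \<in> Basis" using Lb[OF b] by auto
  moreover have "dd b f = (%x. dd (L b) h (L x))" using e by (auto simp: dir_deriv_def)
  ultimately show ?thesis using smooth_dir_deriv[OF h(1)] by blast
 qed
qed (use assms in auto)

lemma smooth_inner:
 fixes h :: "real => real" and b :: "'a::euclidean_space"
 shows "smooth h ==> b \<in> Basis ==> smooth (%x. h (x \<bullet> b))"
 by (rule smooth_comp_linear_aux) (auto simp: bounded_linear_inner_left inner_Basis)

lemma smooth_fst: "smooth h ==> smooth (%x::'a::euclidean_space\<times>'b::euclidean_space. h (fst x))"
 by (rule smooth_comp_linear_aux) (auto simp: bounded_linear_fst Basis_prod_def)

lemma smooth_snd: "smooth h ==> smooth (%x::'a::euclidean_space\<times>'b::euclidean_space. h (snd x))"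
 by (rule smooth_comp_linear_aux) (auto simp: bounded_linear_snd Basis_prod_def)

lemma smooth_slice_deriv1:
 fixes h :: "'a::euclidean_space \<times> 'b::euclidean_space => real"
 assumes "smooth h"
 shows "dd b (%x. h (x, y)) x = dd (b, 0) h (x, y)"
  "(%x. h (x, y)) differentiable (at x)"
proof -
 have "((%x. (x, y)) has_derivative (%v. (v, 0))) (at x)"
  by (auto intro!: derivative_eq_intros)
 from has_derivative_compose[OF this smooth_has_derivative[OF assms]]
 have "((%x. h (x, y)) has_derivative (%v. frechet_derivative h (at (x, y)) (v, 0))) (at x)" .
 then show "dd b (%x. h (x, y)) x = dd (b, 0) h (x, y)"
  "(%x. h (x, y)) differentiable (at x)"
  using dir_deriv_eqI differentiable_def by (fastforce simp: dir_deriv_def[of _ h])+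
qed

lemma smooth_slice_deriv2:
 fixes h :: "'a::euclidean_space \<times> 'b::euclidean_space => real"
 assumes "smooth h"
 shows "dd b (%y. h (x, y)) y = dd (0, b) h (x, y)"
  "(%y. h (x, y)) differentiable (at y)"
proof -
 have "((%y. (x, y)) has_derivative (%v. (0, v))) (at y)"
  by (auto intro!: derivative_eq_intros)
 from has_derivative_compose[OF this smooth_has_derivative[OF assms]]
 have "((%y. h (x, y)) has_derivative (%v. frechet_derivative h (at (x, y)) (0, v))) (at y)" .
 then show "dd b (%y. h (x, y)) y = dd (0, b) h (x, y)"
  "(%y. h (x, y)) differentiable (at y)"
  using dir_deriv_eqI differentiable_def by (fastforce simp: dir_deriv_def[of _ h])+
qed

lemma smooth_slice1:
 fixes h :: "'a::euclidean_space \<times> 'b::euclidean_space => real"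
 assumes "smooth h"
 shows "smooth (%x. h (x, y))"
proof (rule smooth_coinduct[where F = "{u. \<exists>h. smooth h \<and> u = (%x. h (x, y))}"])
 fix f :: "'a => real" and b :: 'a
 assume "f \<in> {u. \<exists>h. smooth h \<and> u = (%x. h (x, y))}" and b: "b \<in> Basis"
 then obtain h where h: "smooth h" "f = (%x. h (x, y))" by auto
 then have "dd b f = (%x. dd (b, 0) h (x, y))" by (auto simp: smooth_slice_deriv1)
 moreover have "(b, 0) \<in> Basis" using b by (auto simp: Basis_prod_def)
 ultimately show "dd b f \<in> {u. \<exists>h. smooth h \<and> u = (%x. h (x, y))}"
  using smooth_dir_deriv[OF h(1)] by blast
qed (use assms smooth_slice_deriv1 in auto)

lemma smooth_slice2:
 fixes h :: "'a::euclidean_space \<times> 'b::euclidean_space => real"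
 assumes "smooth h"
 shows "smooth (%y. h (x, y))"
proof (rule smooth_coinduct[where F = "{u. \<exists>h. smooth h \<and> u = (%y. h (x, y))}"])
 fix f :: "'b => real" and b :: 'b
 assume "f \<in> {u. \<exists>h. smooth h \<and> u = (%y. h (x, y))}" and b: "b \<in> Basis"
 then obtain h where h: "smooth h" "f = (%y. h (x, y))" by auto
 then have "dd b f = (%y. dd (0, b) h (x, y))" by (auto simp: smooth_slice_deriv2)
 moreover have "(0, b) \<in> Basis" using b by (auto simp: Basis_prod_def)
 ultimately show "dd b f \<in> {u. \<exists>h. smooth h \<and> u = (%y. h (x, y))}"
  using smooth_dir_deriv[OF h(1)] by blast
qed (use assms smooth_slice_deriv2 in auto)

section \<open>A smooth step that is flat at 0\<close>

definition smooth_step :: "real => real" where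
 "smooth_step x = (if x > 0 then exp (- 1 / x) else 0)"

lemma poly_exp_over_tendsto:
 "((%x. poly p (1 / x) * exp (- 1 / x)) \<longlongrightarrow> 0) (at_right (0::real))"
proof -
 have "((%x. poly p x / exp x) \<longlongrightarrow> 0) at_top"
 proof (induction p)
  case 0 then show ?case by simp
 next
  case (pCons a p)
  have "((%x. a / exp x + (\<Sum>i\<le>degree p. coeff p i * (x ^ (Suc i) / exp x))) \<longlongrightarrow> 0 + (\<Sum>i\<le>degree p. coeff p i * 0)) at_top"
   by (intro tendsto_add tendsto_sum tendsto_mult tendsto_const tendsto_power_div_exp_0 tendsto_divide_0[OF tendsto_const] filterlim_at_top_imp_at_infinity exp_at_top)
  moreover have "a / exp x + (\<Sum>i\<le>degree p. coeff p i * (x ^ (Suc i) / exp x)) = poly (pCons a p) x / exp x" for x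
   unfolding poly_pCons by (simp add: poly_altdef sum_divide_distrib sum_distrib_left add_divide_distrib mult_ac)
  ultimately show ?case by simp
 qed
 then have "((%x. poly p (inverse x) / exp (inverse x)) \<longlongrightarrow> 0) (at_right (0::real))"
  by (rule filterlim_compose[OF _ filterlim_inverse_at_top_right])
 then show ?thesis by (simp add: exp_minus divide_inverse)
qed

text \<open>A class that contains exp (- 1 / x), extended by 0, and is closed under derivatives:
  differentiating only changes the polynomial in 1 / x, from p to X^2 (p - p').\<close>

definition step_fun :: "real poly => real => real" where
 "step_fun p x = (if x > 0 then poly p (1 / x) * exp (- 1 / x) else 0)"

lemma step_fun_deriv:
 "(step_fun p has_real_derivative step_fun ([:0,0,1:] * (p - pderiv p)) x) (at x)"
proof -
 consider "x > 0" | "x < 0" | "x = 0" by linarith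
 then show ?thesis
 proof cases
  case 1
  have a: "((%x. 1 / x) has_real_derivative - ((1 / x) * (1 / x))) (at x)"
   using 1 by (auto intro!: derivative_eq_intros)
  have b: "((%x. exp (- 1 / x)) has_real_derivative exp (- 1 / x) * ((1 / x) * (1 / x))) (at x)"
   using DERIV_chain2[OF DERIV_exp DERIV_minus[OF a]] by simp
  have "((%x. poly p (1 / x) * exp (- 1 / x)) has_real_derivative
    poly ([:0,0,1:] * (p - pderiv p)) (1 / x) * exp (- 1 / x)) (at x)"
   using DERIV_mult[OF DERIV_chain2[OF poly_DERIV a] b] by (simp add: algebra_simps)
  then show ?thesis
   using 1 by (subst has_field_derivative_cong_eventually[where g = "%x. poly p (1 / x) * exp (- 1 / x)"])
    (auto simp: step_fun_def eventually_at_topological intro!: exI[of _ "{0<..}"])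
 next
  case 2
  then show ?thesis
   by (subst has_field_derivative_cong_eventually[where g = "%x. 0"])
    (auto simp: step_fun_def eventually_at_topological intro!: exI[of _ "{..<0}"])
 next
  case 3
  \<comment> \<open>The difference quotient at 0 is again of the form treated by
    \<open>poly_exp_over_tendsto\<close>: dividing by x multiplies the polynomial by X.\<close>
  have r: "((%h. step_fun p h / h) \<longlongrightarrow> 0) (at_right 0)"
  proof (rule Lim_transform_eventually)
   show "((%x. poly ([:0,1:] * p) (1 / x) * exp (- 1 / x)) \<longlongrightarrow> 0) (at_right (0::real))"
    by (rule poly_exp_over_tendsto)
   show "\<forall>\<^sub>F x in at_right 0. poly ([:0, 1:] * p) (1 / x) * exp (- 1 / x) = step_fun p x / x"
    by (auto simp: eventually_at_right_field step_fun_def intro!: exI[of _ 1])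
  qed
  have l: "((%h. step_fun p h / h) \<longlongrightarrow> 0) (at_left 0)"
   by (rule tendsto_eventually) (auto simp: eventually_at_left_field step_fun_def intro!: exI[of _ "-1"])
  have "((%h. step_fun p h / h) \<longlongrightarrow> 0) (at 0)"
   by (rule filterlim_split_at[OF l r])
  then show ?thesis using 3 by (simp add: DERIV_def step_fun_def)
 qed
qed

lemma smooth_step_eq: "smooth_step = step_fun 1"
 by (auto simp: smooth_step_def step_fun_def)

lemma smooth_smooth_step_affine: "smooth (%x. smooth_step (m * x + d))"
proof (rule smooth_real_iff[where F = "range (%(p, k) x. k * step_fun p (m * x + d))"])
 show "(%x. smooth_step (m * x + d)) \<in> range (%(p, k) x. k * step_fun p (m * x + d))"
  by (auto simp: smooth_step_eq image_iff intro!: exI[of _ "1::real poly"] exI[of _ "1::real"])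
 fix f :: "real => real" assume "f \<in> range (%(p, k) x. k * step_fun p (m * x + d))"
 then obtain p k where f: "f = (%x. k * step_fun p (m * x + d))" by auto
 have "(f has_real_derivative (k * m) * step_fun ([:0,0,1:] * (p - pderiv p)) (m * x + d)) (at x)" for x
  unfolding f by (auto intro!: derivative_eq_intros DERIV_chain2[OF step_fun_deriv])
 moreover have "(%x. (k * m) * step_fun ([:0,0,1:] * (p - pderiv p)) (m * x + d)) \<in> range (%(p, k) x. k * step_fun p (m * x + d))"
  by (rule range_eqI[where x = "([:0,0,1:] * (p - pderiv p), k * m)"]) auto
 ultimately show "\<exists>g\<in>range (%(p, k) x. k * step_fun p (m * x + d)). \<forall>x. (f has_real_derivative g x) (at x)"
  by (intro bexI[where x = "%x. (k * m) * step_fun ([:0,0,1:] * (p - pderiv p)) (m * x + d)"] allI)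
qed

lemma smooth_step_bounds: "0 \<le> smooth_step x" "smooth_step x \<le> 1"
 by (auto simp: smooth_step_def)

lemma smooth_step_tendsto: "x > 0 ==> (%n. smooth_step (real (Suc n) * x)) \<longlonglongrightarrow> 1"
proof -
 assume "x > 0"
 have "(%n. exp (- (1/x) * (1 / real (Suc n)))) \<longlonglongrightarrow> exp (- (1/x) * 0)"
  by (intro tendsto_intros LIMSEQ_Suc[OF lim_1_over_n])
 moreover have "smooth_step (real (Suc n) * x) = exp (- (1/x) * (1 / real (Suc n)))" for n
  using \<open>x > 0\<close> by (simp add: smooth_step_def zero_less_mult_iff del: of_nat_Suc)
 ultimately show ?thesis by simp
qed

section \<open>Test functions\<close>

lemma test_smooth: "\<zeta> \<in> TF S ==> smooth \<zeta>"
 by (simp add: test_functions_def)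

lemma testI:
 assumes "smooth \<zeta>" "compact K" "K \<subseteq> S" "\<And>x. x \<notin> K ==> \<zeta> x = 0"
 shows "\<zeta> \<in> TF S"
proof -
 have *: "closure {x. \<zeta> x \<noteq> 0} \<subseteq> K"
  using assms by (intro closure_minimal) (auto simp: compact_imp_closed)
 then have "compact (closure {x. \<zeta> x \<noteq> 0})"
  using assms(2) by (metis closed_closure compact_Int_closed inf.absorb_iff2)
 then show ?thesis using * assms by (auto simp: test_functions_def)
qed

text \<open>K is the support itself. Its complement is open and the function is 0 there, so the
  derivatives vanish off the same compact set.\<close>

lemma testE:
 assumes "\<zeta> \<in> TF S"
 obtains K where "compact K" "K \<subseteq> S" "\<And>x. x \<notin> K ==> \<zeta> x = 0"
  "\<And>x b. x \<notin> K ==> dd b \<zeta> x = 0"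
proof
 let ?K = "closure {x. \<zeta> x \<noteq> 0}"
 show "compact ?K" "?K \<subseteq> S" using assms by (auto simp: test_functions_def)
 show "\<zeta> x = 0" if "x \<notin> ?K" for x using that closure_subset[of "{x. \<zeta> x \<noteq> 0}"] by auto
 show "dd b \<zeta> x = 0" if "x \<notin> ?K" for x b
 proof -
  have "(\<zeta> has_derivative (%h. 0)) (at x)"
  proof (rule has_derivative_transform_within_open)
   show "((%x. 0) has_derivative (%h. 0)) (at x)" by simp
   show "open (- ?K)" by auto
   show "x \<in> - ?K" using that by auto
   show "0 = \<zeta> x" if "x \<in> - ?K" for x using that closure_subset[of "{x. \<zeta> x \<noteq> 0}"] by auto
  qed
  then show ?thesis by (rule dir_deriv_eqI)
 qed
qed

lemma test_dir_deriv:
 assumes "\<zeta> \<in> TF S" "b \<in> Basis"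
 shows "dd b \<zeta> \<in> TF S"
 using assms(1)
proof (rule testE)
 fix K assume "compact K" "K \<subseteq> S" "\<And>x b. x \<notin> K ==> dd b \<zeta> x = 0"
 then show ?thesis
  using smooth_dir_deriv[OF test_smooth[OF assms(1)] assms(2)]
  by (intro testI[of _ K]) auto
qed

lemma test_dir_deriv_pow:
 "\<zeta> \<in> TF S ==> b \<in> Basis ==> (dd b ^^ k) \<zeta> \<in> TF S"
 by (induction k) (auto intro: test_dir_deriv)

lemma test_mono: "S \<subseteq> S' ==> TF S \<subseteq> TF S'"
 by (auto simp: test_functions_def)

lemma test_mult:
 assumes "\<zeta> \<in> TF S" "smooth \<eta>"
 shows "(%x. \<zeta> x * \<eta> x) \<in> TF S"
 using assms(1)
proof (rule testE)
 fix K assume "compact K" "K \<subseteq> S" "\<And>x. x \<notin> K ==> \<zeta> x = 0"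
 then show ?thesis
  using smooth_mult[OF test_smooth[OF assms(1)] assms(2)]
  by (intro testI[of _ K]) auto
qed

lemma test_add:
 assumes "\<zeta> \<in> TF S" "\<eta> \<in> TF S"
 shows "(%x. \<zeta> x + \<eta> x) \<in> TF S"
proof -
 obtain K where K: "compact K" "K \<subseteq> S" "\<And>x. x \<notin> K ==> \<zeta> x = 0" by (rule testE[OF assms(1)]) blast
 obtain L where L: "compact L" "L \<subseteq> S" "\<And>x. x \<notin> L ==> \<eta> x = 0" by (rule testE[OF assms(2)]) blast
 show ?thesis
  using K L assms test_smooth[OF assms(1)] test_smooth[OF assms(2)]
  by (intro testI[where K = "K \<union> L"] smooth_add) (auto simp: compact_Un)
qed

lemma test_cmult: "\<zeta> \<in> TF S ==> (%x. k * \<zeta> x) \<in> TF S"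
 using test_mult[of \<zeta> S "%_. k"] by (simp add: smooth_const mult.commute)

lemma test_diff:
 "\<zeta> \<in> TF S ==> \<eta> \<in> TF S ==> (%x. \<zeta> x - \<eta> x) \<in> TF S"
 using test_add[of \<zeta> S "%x. (-1) * \<eta> x"] test_cmult[of \<eta> S "-1"] by simp

lemma test_tensor:
 assumes "\<zeta> \<in> TF S" "\<eta> \<in> TF R"
 shows "(%x. \<zeta> (fst x) * \<eta> (snd x)) \<in> TF (S \<times> R)"
proof -
 obtain K where K: "compact K" "K \<subseteq> S" "\<And>x. x \<notin> K ==> \<zeta> x = 0" by (rule testE[OF assms(1)]) blast
 obtain L where L: "compact L" "L \<subseteq> R" "\<And>x. x \<notin> L ==> \<eta> x = 0" by (rule testE[OF assms(2)]) blast
 show ?thesis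
 proof (rule testI[where K = "K \<times> L"])
  show "smooth (%x. \<zeta> (fst x) * \<eta> (snd x))"
   using assms by (intro smooth_mult smooth_fst smooth_snd test_smooth)
  show "\<zeta> (fst x) * \<eta> (snd x) = 0" if "x \<notin> K \<times> L" for x
   using that K(3)[of "fst x"] L(3)[of "snd x"] by (cases x) auto
 qed (use K L in \<open>auto intro: compact_Times\<close>)
qed

lemma test_slice1:
 assumes "\<zeta> \<in> TF (S \<times> R)"
 shows "(%x. \<zeta> (x, y)) \<in> TF S"
proof -
 obtain K where K: "compact K" "K \<subseteq> S \<times> R" "\<And>x. x \<notin> K ==> \<zeta> x = 0" by (rule testE[OF assms(1)]) blast
 show ?thesis
 proof (rule testI[where K = "fst ` K"])
  show "smooth (%x. \<zeta> (x, y))" using assms by (intro smooth_slice1 test_smooth)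
  show "compact (fst ` K)" using K by (intro compact_continuous_image continuous_intros)
  show "\<And>x. x \<notin> fst ` K ==> \<zeta> (x, y) = 0" using K(3) by force
 qed (use K in auto)
qed

lemma test_slice2:
 assumes "\<zeta> \<in> TF (S \<times> R)"
 shows "(%y. \<zeta> (x, y)) \<in> TF R"
proof -
 obtain K where K: "compact K" "K \<subseteq> S \<times> R" "\<And>x. x \<notin> K ==> \<zeta> x = 0" by (rule testE[OF assms(1)]) blast
 show ?thesis
 proof (rule testI[where K = "snd ` K"])
  show "smooth (%y. \<zeta> (x, y))" using assms by (intro smooth_slice2 test_smooth)
  show "compact (snd ` K)" using K by (intro compact_continuous_image continuous_intros)
  show "\<And>y. y \<notin> snd ` K ==> \<zeta> (x, y) = 0" using K(3) by force
 qed (use K in auto)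
qed

section \<open>Smooth functions that converge to the indicator of a box\<close>

definition box_bump :: "nat => 'a::euclidean_space => 'a => 'a => real" where
 "box_bump n a b x = (\<Prod>i\<in>Basis. smooth_step (real (Suc n) * (x \<bullet> i - a \<bullet> i)) * smooth_step (real (Suc n) * (b \<bullet> i - x \<bullet> i)))"

lemma box_bump_smooth: "smooth (box_bump n a (b::'a::euclidean_space))"
proof -
 have "smooth (%x::'a. smooth_step (real (Suc n) * (x \<bullet> i - a \<bullet> i)))" if "i \<in> Basis" for i
  using smooth_inner[OF smooth_smooth_step_affine[of "real (Suc n)" "- real (Suc n) * (a \<bullet> i)"] that]
  by (simp add: algebra_simps)
 moreover have "smooth (%x::'a. smooth_step (real (Suc n) * (b \<bullet> i - x \<bullet> i)))" if "i \<in> Basis" for i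
  using smooth_inner[OF smooth_smooth_step_affine[of "- real (Suc n)" "real (Suc n) * (b \<bullet> i)"] that]
  by (simp add: algebra_simps)
 ultimately show ?thesis
  unfolding box_bump_def[abs_def] by (intro smooth_prod smooth_mult) auto
qed

lemma box_bump_zero: "x \<notin> box a b ==> box_bump n a b x = 0"
proof -
 assume "x \<notin> box a b"
 then obtain i where "i \<in> Basis" "\<not> (a \<bullet> i < x \<bullet> i \<and> x \<bullet> i < b \<bullet> i)" by (auto simp: mem_box)
 then have "smooth_step (real (Suc n) * (x \<bullet> i - a \<bullet> i)) * smooth_step (real (Suc n) * (b \<bullet> i - x \<bullet> i)) = 0"
  by (auto simp: smooth_step_def zero_less_mult_iff)
 then show ?thesis
  unfolding box_bump_def using \<open>i \<in> Basis\<close> by (meson finite_Basis prod_zero)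
qed

lemma box_bump_bounds: "0 \<le> box_bump n a b x" "box_bump n a b x \<le> 1"
 unfolding box_bump_def
 by (auto intro!: prod_nonneg prod_le_1 mult_nonneg_nonneg mult_le_one smooth_step_bounds)

lemma box_bump_tendsto: "(%n. box_bump n a b x) \<longlonglongrightarrow> ind (box a b) x"
proof (cases "x \<in> box a b")
 case True
 have "(%n. box_bump n a b x) \<longlonglongrightarrow> (\<Prod>i\<in>(Basis::'a set). 1 * 1)"
  unfolding box_bump_def using True
  by (intro tendsto_prod tendsto_mult smooth_step_tendsto) (auto simp: mem_box)
 then show ?thesis using True by simp
qed (simp add: box_bump_zero)

lemma box_bump_test: "cbox a b \<subseteq> S ==> box_bump n a b \<in> TF S"
 by (rule testI[where K = "cbox a b"])
  (auto simp: box_bump_smooth intro!: box_bump_zero subsetD[OF box_subset_cbox])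

lemma test_bounded:
 assumes "\<zeta> \<in> TF S"
 obtains B where "B > 0" "\<And>x. \<bar>\<zeta> x\<bar> \<le> B"
proof -
 obtain K where K: "compact K" "\<And>x. x \<notin> K ==> \<zeta> x = 0" by (rule testE[OF assms(1)]) blast
 have "compact (\<zeta> ` K)"
  using assms K by (intro compact_continuous_image smooth_continuous_on test_smooth)
 then obtain B where "B > 0" "\<forall>x\<in>\<zeta> ` K. norm x \<le> B"
  using compact_imp_bounded bounded_pos by metis
 then have "\<bar>\<zeta> x\<bar> \<le> B" for x
  using K(2)[of x] by (cases "x \<in> K") auto
 with \<open>B > 0\<close> show ?thesis using that by blast
qed

section \<open>Lebesgue integration on open sets and on products\<close>

lemma sets_lebesgue_open [simp]: "open S ==> S \<in> sets lebesgue"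
 by (simp add: borel_open)

lemma integral_lebesgue_on_open:
 fixes f :: "'a::euclidean_space => 'b::{banach, second_countable_topology}"
 shows "open S ==> lint S f = (\<integral>x. ind S x *\<^sub>R f x \<partial>lebesgue)"
 by (subst integral_restrict_space) auto

lemma integrable_lebesgue_on_open:
 fixes f :: "'a::euclidean_space => 'b::{banach, second_countable_topology}"
 shows "open S ==> intg S f \<longleftrightarrow> integrable lebesgue (%x. ind S x *\<^sub>R f x)"
 by (subst integrable_restrict_space) auto

lemma AE_lebesgue_on_open:
 "open (S::'a::euclidean_space set) ==> (AE x in leb S. P x) \<longleftrightarrow> (AE x in lebesgue. x \<in> S \<longrightarrow> P x)"
 by (subst AE_restrict_space_iff) auto

lemma measurable_lebesgue_on_open:
 fixes f :: "'a::euclidean_space => 'b::real_normed_vector"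
 shows "open S ==> f \<in> meas S \<longleftrightarrow> (%x. ind S x *\<^sub>R f x) \<in> borel_measurable lebesgue"
 by (subst borel_measurable_restrict_space_iff) auto

lemma borel_imp_lebesgue: "f \<in> borel_measurable borel ==> f \<in> borel_measurable lebesgue"
 by (simp add: measurable_completion)

lemma borel_imp_lebesgue_on: "f \<in> borel_measurable borel ==> f \<in> meas S"
 by (simp add: measurable_completion measurable_restrict_space1)

lemma borel_measurable_AE_lebesgue_on:
 fixes f g :: "'a::euclidean_space => real"
 assumes "open S" "f \<in> meas S" "AE x in leb S. f x = g x"
 shows "g \<in> meas S"
proof -
 have "(%x. ind S x *\<^sub>R f x) \<in> borel_measurable lebesgue"
  using assms measurable_lebesgue_on_open by blast
 moreover have "AE x in lebesgue. ind S x *\<^sub>R f x = ind S x *\<^sub>R g x"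
  using assms(3) unfolding AE_lebesgue_on_open[OF assms(1)] by eventually_elim (auto simp: indicator_def)
 ultimately have "(%x. ind S x *\<^sub>R g x) \<in> borel_measurable lebesgue"
  by (rule borel_measurable_AE)
 then show ?thesis using measurable_lebesgue_on_open[OF assms(1)] by blast
qed

lemma integrable_AE_lebesgue_on:
 fixes f g :: "'a::euclidean_space => real"
 assumes "open S" "intg S f" "AE x in leb S. f x = g x"
 shows "intg S g" "lint S g = lint S f"
proof -
 have m: "f \<in> meas S" "g \<in> meas S"
  using assms borel_measurable_AE_lebesgue_on[OF assms(1) _ assms(3)] by auto
 have s: "AE x in leb S. g x = f x" using assms(3) by eventually_elim simp
 show "intg S g" using integrable_cong_AE[OF m assms(3)] assms(2) by blast
 show "lint S g = lint S f"
  by (rule integral_cong_AE[OF m(2) m(1) s])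
qed

lemma lebesgue_borel_rep:
 fixes f :: "'a::euclidean_space => real"
 assumes "f \<in> borel_measurable lebesgue"
 obtains g where "g \<in> borel_measurable borel" "AE x in lebesgue. f x = g x"
proof -
 obtain g where "g \<in> borel_measurable lborel" "AE x in lborel. f x = g x"
  using completion_ex_borel_measurable_real[OF assms] by blast
 then show ?thesis using that[of g] by (simp add: AE_completion_iff)
qed

lemma integrable_lebesgue_borel:
 fixes g :: "'a::euclidean_space => real"
 assumes "g \<in> borel_measurable borel"
 shows "integrable lebesgue g = integrable lborel g" "integral\<^sup>L lebesgue g = integral\<^sup>L lborel g"
 using assms by (auto simp: integrable_completion integral_completion)

text \<open>The measure \<open>lebesgue\<close> on a product space is the completion of the Borel
  product and not the product of the completions. The exceptional set is therefore enlarged to a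
  Borel null set, whose slices are handled by the product theorems for
  \<open>lborel\<close>.\<close>

lemma lebesgue_AE_prod:
 fixes P :: "'a::euclidean_space \<times> 'b::euclidean_space => bool"
 assumes "AE z in lebesgue. P z"
 shows "AE y in lebesgue. AE x in lebesgue. P (x, y)" "AE x in lebesgue. AE y in lebesgue. P (x, y)"
proof -
 have "AE z in lborel. P z" using assms by (simp add: AE_completion_iff)
 then obtain N where N: "N \<in> sets lborel" "emeasure lborel N = 0" "{z\<in>space lborel. \<not> P z} \<subseteq> N"
  by (auto elim!: AE_E)
 have N1: "AE z in lborel \<Otimes>\<^sub>M lborel. z \<notin> N"
  unfolding lborel_prod using N by (intro AE_not_in) (auto simp: null_sets_def)
 have *: "AE x in lborel. AE y in lborel. (x, y) \<notin> N"
  using lborel_pair.AE_pair[OF N1] .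
 moreover have "{z \<in> space (lborel \<Otimes>\<^sub>M lborel). (fst z, snd z) \<notin> N} \<in> sets (lborel \<Otimes>\<^sub>M lborel)"
 proof -
  have "{z \<in> space (lborel \<Otimes>\<^sub>M lborel). (fst z, snd z) \<notin> N} = UNIV - N" by (auto simp: space_pair_measure)
  then show ?thesis unfolding lborel_prod using N(1) by auto
 qed
 ultimately have "AE y in lborel. AE x in lborel. (x, y) \<notin> N"
  using lborel_pair.AE_commute[of "%x y. (x, y) \<notin> N"] by simp
 moreover have "z \<notin> N ==> P z" for z using N(3) by auto
 ultimately have "AE y in lborel. AE x in lborel. P (x, y)" "AE x in lborel. AE y in lborel. P (x, y)"
  using * by (auto elim!: AE_mp)
 then show "AE y in lebesgue. AE x in lebesgue. P (x, y)" "AE x in lebesgue. AE y in lebesgue. P (x, y)"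
  by (simp_all add: AE_completion_iff)
qed

text \<open>Replacing f by a Borel representative g changes it on a null set, and almost every slice
  of that set is null. So the slice integrals of f and g agree for almost every parameter, and
  Fubini's theorem is used for g on \<open>lborel\<close>.\<close>

lemma lebesgue_Fubini:
 fixes f :: "'a::euclidean_space \<times> 'b::euclidean_space => real"
 assumes f: "integrable lebesgue f"
 shows "AE y in lebesgue. integrable lebesgue (%x. f (x, y))"
  and "integrable lebesgue (%y. \<integral>x. f (x, y) \<partial>lebesgue)"
  and "(\<integral>y. \<integral>x. f (x, y) \<partial>lebesgue \<partial>lebesgue) = integral\<^sup>L lebesgue f"
  and "AE x in lebesgue. integrable lebesgue (%y. f (x, y))"
  and "integrable lebesgue (%x. \<integral>y. f (x, y) \<partial>lebesgue)"
  and "(\<integral>x. \<integral>y. f (x, y) \<partial>lebesgue \<partial>lebesgue) = integral\<^sup>L lebesgue f"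
proof -
 obtain g where g[measurable]: "g \<in> borel_measurable borel" and fg: "AE z in lebesgue. f z = g z"
  using lebesgue_borel_rep[of f] f by blast
 have gi: "integrable lebesgue g"
  using f fg borel_imp_lebesgue[OF g] integrable_cong_AE[of f lebesgue g] by auto
 have fgi: "integral\<^sup>L lebesgue f = integral\<^sup>L lborel g"
  using f fg borel_imp_lebesgue[OF g] integral_cong_AE[of f lebesgue g] integrable_lebesgue_borel[OF g] by auto
 have gp: "integrable (lborel \<Otimes>\<^sub>M lborel) (%(x, y). g (x, y))"
  using gi integrable_lebesgue_borel[OF g] by (simp add: lborel_prod)
 have s1[measurable]: "(%x. g (x, y)) \<in> borel_measurable borel" for y by measurable
 have s2[measurable]: "(%y. g (x, y)) \<in> borel_measurable borel" for x by measurable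
 have m1: "(%y. \<integral>x. g (x, y) \<partial>lborel) \<in> borel_measurable borel"
  using lborel_pair.integrable_snd[OF gp] by simp
 have m2: "(%x. \<integral>y. g (x, y) \<partial>lborel) \<in> borel_measurable borel"
  using lborel_pair.integrable_fst[OF gp] by simp
 have sec: "h \<in> borel_measurable borel ==> integrable lborel h ==> AE x in lebesgue. h' x = h x ==> integrable lebesgue h'"
  and sec': "h \<in> borel_measurable borel ==> AE x in lebesgue. h' x = h x ==> integral\<^sup>L lebesgue h' = integral\<^sup>L lborel h"
  for h h' :: "'d::euclidean_space => real"
 proof -
  assume a: "h \<in> borel_measurable borel" "AE x in lebesgue. h' x = h x"
  then have b: "AE x in lebesgue. h x = h' x" by auto
  have c: "h' \<in> borel_measurable lebesgue" using borel_measurable_AE[OF borel_imp_lebesgue[OF a(1)] b] .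
  show "integrable lborel h ==> integrable lebesgue h'"
   using integrable_cong_AE[OF c borel_imp_lebesgue[OF a(1)] a(2)] integrable_lebesgue_borel[OF a(1)] by simp
  show "integral\<^sup>L lebesgue h' = integral\<^sup>L lborel h"
   using integral_cong_AE[OF c borel_imp_lebesgue[OF a(1)] a(2)] integrable_lebesgue_borel[OF a(1)] by simp
 qed
 have A1: "AE y in lebesgue. AE x in lebesgue. f (x, y) = g (x, y)"
  and A2: "AE x in lebesgue. AE y in lebesgue. f (x, y) = g (x, y)"
  using lebesgue_AE_prod[OF fg] by auto
 have I1: "AE y in lebesgue. integrable lborel (%x. g (x, y))"
  using lborel_pair.AE_integrable_snd[OF gp] by (simp add: AE_completion_iff)
 have I2: "AE x in lebesgue. integrable lborel (%y. g (x, y))"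
  using lborel_pair.AE_integrable_fst[OF gp] by (simp add: AE_completion_iff)
 show "AE y in lebesgue. integrable lebesgue (%x. f (x, y))"
  using A1 I1 by eventually_elim (rule sec[OF s1])
 show "AE x in lebesgue. integrable lebesgue (%y. f (x, y))"
  using A2 I2 by eventually_elim (rule sec[OF s2])
 have E1: "AE y in lebesgue. (\<integral>x. f (x, y) \<partial>lebesgue) = (\<integral>x. g (x, y) \<partial>lborel)"
  using A1 by eventually_elim (rule sec'[OF s1])
 have E2: "AE x in lebesgue. (\<integral>y. f (x, y) \<partial>lebesgue) = (\<integral>y. g (x, y) \<partial>lborel)"
  using A2 by eventually_elim (rule sec'[OF s2])
 show "integrable lebesgue (%y. \<integral>x. f (x, y) \<partial>lebesgue)"
  using sec[OF m1 _ E1] lborel_pair.integrable_snd[OF gp] by simp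
 show "integrable lebesgue (%x. \<integral>y. f (x, y) \<partial>lebesgue)"
  using sec[OF m2 _ E2] lborel_pair.integrable_fst[OF gp] by simp
 show "(\<integral>y. \<integral>x. f (x, y) \<partial>lebesgue \<partial>lebesgue) = integral\<^sup>L lebesgue f"
  using sec'[OF m1 E1] lborel_pair.integral_snd[OF gp] fgi by (simp add: lborel_prod)
 show "(\<integral>x. \<integral>y. f (x, y) \<partial>lebesgue \<partial>lebesgue) = integral\<^sup>L lebesgue f"
  using sec'[OF m2 E2] lborel_pair.integral_fst[OF gp] fgi by (simp add: lborel_prod)
qed

lemma lebesgue_on_Fubini:
 fixes f :: "'a::euclidean_space \<times> 'b::euclidean_space => real"
 assumes S: "open S" and R: "open R" and f: "intg (S \<times> R) f"
 shows "AE y in leb R. intg S (%x. f (x, y))"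
  and "intg R (%y. lint S (%x. f (x, y)))"
  and "(lint R (%y. lint S (%x. f (x, y)))) = integral\<^sup>L (leb (S \<times> R)) f"
  and "AE x in leb S. intg R (%y. f (x, y))"
  and "intg S (%x. lint R (%y. f (x, y)))"
  and "(lint S (%x. lint R (%y. f (x, y)))) = integral\<^sup>L (leb (S \<times> R)) f"
proof -
 note SR = open_Times[OF S R]
 have e: "ind (S \<times> R) (x, y) *\<^sub>R f (x, y) = ind S x *\<^sub>R (ind R y *\<^sub>R f (x, y))" for x y
  by (auto simp: indicator_def)
 have e': "ind (S \<times> R) (x, y) *\<^sub>R f (x, y) = ind R y *\<^sub>R (ind S x *\<^sub>R f (x, y))" for x y
  by (auto simp: indicator_def)
 note i = integral_lebesgue_on_open integrable_lebesgue_on_open AE_lebesgue_on_open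
 note F = lebesgue_Fubini[OF f[unfolded integrable_lebesgue_on_open[OF SR]]]
 show "AE y in leb R. intg S (%x. f (x, y))"
  using F(1) unfolding i(3)[OF R] i(2)[OF S] e' by eventually_elim auto
 show "AE x in leb S. intg R (%y. f (x, y))"
  using F(4) unfolding i(3)[OF S] i(2)[OF R] e by eventually_elim auto
 show "intg R (%y. lint S (%x. f (x, y)))"
  using F(2) unfolding i(2)[OF R] i(1)[OF S] e' by simp
 show "intg S (%x. lint R (%y. f (x, y)))"
  using F(5) unfolding i(2)[OF S] i(1)[OF R] e by simp
 show "(lint R (%y. lint S (%x. f (x, y)))) = integral\<^sup>L (leb (S \<times> R)) f"
  using F(3) unfolding i(1)[OF R] i(1)[OF S] i(1)[OF SR] e' by simp
 show "(lint S (%x. lint R (%y. f (x, y)))) = integral\<^sup>L (leb (S \<times> R)) f"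
  using F(6) unfolding i(1)[OF R] i(1)[OF S] i(1)[OF SR] e by simp
qed

lemma lebesgue_prod_AE_fst:
 fixes P :: "'a::euclidean_space => bool"
 assumes "AE x in lebesgue. P x"
 shows "AE z in (lebesgue :: ('a \<times> 'b::euclidean_space) measure). P (fst z)"
proof -
 have "AE z in lborel. P z" using assms by (simp add: AE_completion_iff)
 then obtain N where N: "N \<in> sets lborel" "emeasure lborel N = 0" "{z\<in>space lborel. \<not> P z} \<subseteq> N"
  by (auto elim!: AE_E)
 have "AE z in lborel \<Otimes>\<^sub>M lborel. fst z \<notin> N"
 proof (rule lborel_pair.AE_pair_measure)
  show "AE x in lborel. AE y in lborel. fst (x, y) \<notin> N"
   using AE_not_in[of N lborel] N by (auto simp: null_sets_def)
  show "{x \<in> space (lborel \<Otimes>\<^sub>M lborel). fst x \<notin> N} \<in> sets (lborel \<Otimes>\<^sub>M lborel)"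
   using N(1) by measurable
 qed
 then have "AE z in (lborel :: ('a \<times> 'b) measure). P (fst z)"
  unfolding lborel_prod by eventually_elim (use N(3) in auto)
 then show ?thesis by (simp add: AE_completion_iff)
qed

lemma lebesgue_prod_AE_snd:
 fixes P :: "'b::euclidean_space => bool"
 assumes "AE x in lebesgue. P x"
 shows "AE z in (lebesgue :: ('a::euclidean_space \<times> 'b) measure). P (snd z)"
proof -
 have "AE z in lborel. P z" using assms by (simp add: AE_completion_iff)
 then obtain N where N: "N \<in> sets lborel" "emeasure lborel N = 0" "{z\<in>space lborel. \<not> P z} \<subseteq> N"
  by (auto elim!: AE_E)
 have "AE z in lborel \<Otimes>\<^sub>M lborel. snd z \<notin> N"
 proof (rule lborel_pair.AE_pair_measure)
  show "AE x in lborel. AE y in lborel. snd (x, y) \<notin> N"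
   using AE_not_in[of N lborel] N by (auto simp: null_sets_def)
  show "{x \<in> space (lborel \<Otimes>\<^sub>M lborel). snd x \<notin> N} \<in> sets (lborel \<Otimes>\<^sub>M lborel)"
   using N(1) by measurable
 qed
 then have "AE z in (lborel :: ('a \<times> 'b) measure). P (snd z)"
  unfolding lborel_prod by eventually_elim (use N(3) in auto)
 then show ?thesis by (simp add: AE_completion_iff)
qed

lemma lebesgue_on_tensor_measurable:
 fixes p :: "'a::euclidean_space => real" and e :: "'b::euclidean_space => real"
 assumes S: "open S" and R: "open R"
  and p: "p \<in> meas S" and e: "e \<in> meas R"
 shows "(%z. p (fst z) * e (snd z)) \<in> meas (S \<times> R)"
proof -
 obtain p' where p': "p' \<in> borel_measurable borel" "AE x in lebesgue. ind S x *\<^sub>R p x = p' x"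
  using lebesgue_borel_rep p[unfolded measurable_lebesgue_on_open[OF S]] by blast
 obtain e' where e': "e' \<in> borel_measurable borel" "AE x in lebesgue. ind R x *\<^sub>R e x = e' x"
  using lebesgue_borel_rep e[unfolded measurable_lebesgue_on_open[OF R]] by blast
 have [measurable]: "p' \<in> borel_measurable borel" "e' \<in> borel_measurable borel" using p' e' by auto
 have "(%z::'a\<times>'b. p' (fst z) * e' (snd z)) \<in> borel_measurable (lborel \<Otimes>\<^sub>M lborel)"
  by measurable
 then have m: "(%z::'a\<times>'b. p' (fst z) * e' (snd z)) \<in> borel_measurable lebesgue"
  unfolding lborel_prod by (simp add: measurable_completion)
 have ae: "AE z in lebesgue. p' (fst z) * e' (snd z) = ind (S \<times> R) z *\<^sub>R (p (fst z) * e (snd z))"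
  using lebesgue_prod_AE_fst[OF p'(2), where 'b = 'b] lebesgue_prod_AE_snd[OF e'(2), where 'a = 'a]
 proof eventually_elim
  fix z
  assume "ind S (fst z) *\<^sub>R p (fst z) = p' (fst z)" "ind R (snd z) *\<^sub>R e (snd z) = e' (snd z)"
  from this[symmetric] show "p' (fst z) * e' (snd z) = ind (S \<times> R) z *\<^sub>R (p (fst z) * e (snd z))"
   by (cases z) (simp add: indicator_times)
 qed
 show ?thesis
  unfolding measurable_lebesgue_on_open[OF open_Times[OF S R]]
  by (rule borel_measurable_AE[OF m ae])
qed

lemma nn_integral_tensor_lborel:
 fixes p :: "'a::euclidean_space => real" and e :: "'b::euclidean_space => real"
 assumes [measurable]: "p \<in> borel_measurable borel" "e \<in> borel_measurable borel"
 shows "(\<integral>\<^sup>+z. ennreal (norm (p (fst z) * e (snd z))) \<partial>(lborel :: ('a\<times>'b) measure))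
  = (\<integral>\<^sup>+x. ennreal (norm (p x)) \<partial>lborel) * (\<integral>\<^sup>+y. ennreal (norm (e y)) \<partial>lborel)"
proof -
 have m: "(%z. ennreal (norm (p (fst z) * e (snd z)))) \<in> borel_measurable ((lborel::'a measure) \<Otimes>\<^sub>M (lborel::'b measure))"
  by measurable
 have "(\<integral>\<^sup>+z. ennreal (norm (p (fst z) * e (snd z))) \<partial>(lborel :: ('a\<times>'b) measure))
  = (\<integral>\<^sup>+x. \<integral>\<^sup>+y. ennreal (norm (p x)) * ennreal (norm (e y)) \<partial>lborel \<partial>lborel)"
  using lborel.nn_integral_fst[OF m] by (simp add: lborel_prod abs_mult ennreal_mult)
 also have "\<dots> = (\<integral>\<^sup>+x. ennreal (norm (p x)) \<partial>lborel) * (\<integral>\<^sup>+y. ennreal (norm (e y)) \<partial>lborel)"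
  by (simp add: nn_integral_cmult nn_integral_multc)
 finally show ?thesis .
qed

lemma lebesgue_on_tensor_integrable:
 fixes p :: "'a::euclidean_space => real" and e :: "'b::euclidean_space => real"
 assumes S: "open S" and R: "open R"
  and p: "intg S p" and e: "intg R e"
 shows "intg (S \<times> R) (%z. p (fst z) * e (snd z))"
  and "(lint (S \<times> R) (%z. p (fst z) * e (snd z))) = lint S p * lint R e"
proof -
 note SR = open_Times[OF S R]
 have pm: "(%x. ind S x *\<^sub>R p x) \<in> borel_measurable lebesgue"
  using p integrable_lebesgue_on_open[OF S] by blast
 have em: "(%x. ind R x *\<^sub>R e x) \<in> borel_measurable lebesgue"
  using e integrable_lebesgue_on_open[OF R] by blast
 obtain p' where p': "p' \<in> borel_measurable borel" "AE x in lebesgue. ind S x *\<^sub>R p x = p' x"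
  using lebesgue_borel_rep[OF pm] by blast
 obtain e' where e': "e' \<in> borel_measurable borel" "AE x in lebesgue. ind R x *\<^sub>R e x = e' x"
  using lebesgue_borel_rep[OF em] by blast
 have [measurable]: "p' \<in> borel_measurable borel" "e' \<in> borel_measurable borel" using p' e' by auto
 have "integrable lebesgue p'"
  using integrable_cong_AE[OF pm borel_imp_lebesgue[OF p'(1)] p'(2)] p integrable_lebesgue_on_open[OF S] by blast
 then have pi: "integrable lborel p'" using integrable_lebesgue_borel[OF p'(1)] by simp
 have "integrable lebesgue e'"
  using integrable_cong_AE[OF em borel_imp_lebesgue[OF e'(1)] e'(2)] e integrable_lebesgue_on_open[OF R] by blast
 then have ei: "integrable lborel e'" using integrable_lebesgue_borel[OF e'(1)] by simp
 have "(%z::'a\<times>'b. p' (fst z) * e' (snd z)) \<in> borel_measurable (lborel \<Otimes>\<^sub>M lborel)"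
  by measurable
 then have m: "(%z::'a\<times>'b. p' (fst z) * e' (snd z)) \<in> borel_measurable borel"
  unfolding lborel_prod by simp
 have ae: "AE z in lebesgue. ind (S \<times> R) z *\<^sub>R (p (fst z) * e (snd z)) = p' (fst z) * e' (snd z)"
  using lebesgue_prod_AE_fst[OF p'(2), where 'b = 'b] lebesgue_prod_AE_snd[OF e'(2), where 'a = 'a]
 proof eventually_elim
  fix z
  assume "ind S (fst z) *\<^sub>R p (fst z) = p' (fst z)" "ind R (snd z) *\<^sub>R e (snd z) = e' (snd z)"
  from this[symmetric] show "ind (S \<times> R) z *\<^sub>R (p (fst z) * e (snd z)) = p' (fst z) * e' (snd z)"
   by (cases z) (simp add: indicator_times)
 qed
 have "integrable lborel (%z::'a\<times>'b. p' (fst z) * e' (snd z))"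
  using m pi ei unfolding integrable_iff_bounded nn_integral_tensor_lborel[OF p'(1) e'(1)]
  by (simp add: ennreal_mult_less_top)
 then have "integrable lebesgue (%z::'a\<times>'b. p' (fst z) * e' (snd z))"
  using integrable_lebesgue_borel[OF m] by simp
 moreover have m': "(%z. ind (S \<times> R) z *\<^sub>R (p (fst z) * e (snd z))) \<in> borel_measurable lebesgue"
  by (rule iffD1[OF measurable_lebesgue_on_open[OF SR] lebesgue_on_tensor_measurable[OF S R
     borel_measurable_integrable[OF p] borel_measurable_integrable[OF e]]])
 ultimately have "integrable lebesgue (%z. ind (S \<times> R) z *\<^sub>R (p (fst z) * e (snd z)))"
  using integrable_cong_AE[OF m' borel_imp_lebesgue[OF m] ae] by simp
 then show int: "intg (S \<times> R) (%z. p (fst z) * e (snd z))"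
  using integrable_lebesgue_on_open[OF SR] by blast
 show "(lint (S \<times> R) (%z. p (fst z) * e (snd z))) = lint S p * lint R e"
  using lebesgue_on_Fubini(3)[OF S R int] by simp
qed

section \<open>The fundamental lemma of the calculus of variations\<close>

text \<open>Boxes are stable under intersection and generate the Borel sets, so by a Dynkin class
  argument the integral vanishes over every Borel set, in particular over the sets where a Borel
  representative is positive or negative. The whole space is not a box; \<open>tot\<close> supplies
  its integral for the complement step.\<close>

lemma AE_zero_of_box_integrals:
 fixes f :: "'a::euclidean_space => real"
 assumes f: "integrable lebesgue f" and box: "\<And>c d. (\<integral>x. ind (box c d) x * f x \<partial>lebesgue) = 0"
  and tot: "integral\<^sup>L lebesgue f = 0"
 shows "AE x in lebesgue. f x = 0"
proof -
 obtain g where g[measurable]: "g \<in> borel_measurable borel" and fg: "AE z in lebesgue. f z = g z"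
  using lebesgue_borel_rep[of f] f by blast
 have gi: "integrable lebesgue g"
  using f fg borel_imp_lebesgue[OF g] integrable_cong_AE[of f lebesgue g] by auto
 have fgi: "(\<integral>x. ind A x * f x \<partial>lebesgue) = (LINT x:A|lborel. g x)" if "A \<in> sets borel" for A
 proof -
  have m: "(%x. ind A x * g x) \<in> borel_measurable borel" using that by measurable
  have "(\<integral>x. ind A x * f x \<partial>lebesgue) = (\<integral>x. ind A x * g x \<partial>lebesgue)"
  proof (rule integral_cong_AE)
   show "(%x. ind A x * f x) \<in> borel_measurable lebesgue"
    using f that by (intro borel_measurable_times borel_measurable_indicator) auto
   show "(%x. ind A x * g x) \<in> borel_measurable lebesgue" by (rule borel_imp_lebesgue[OF m])
   show "AE x in lebesgue. ind A x * f x = ind A x * g x" using fg by eventually_elim simp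
  qed
  also have "\<dots> = (LINT x:A|lborel. g x)"
   using integrable_lebesgue_borel(2)[OF m] by (simp add: set_lebesgue_integral_def)
  finally show ?thesis .
 qed
 have gl: "integrable lborel g" using gi integrable_lebesgue_borel[OF g] by simp
 have gs: "set_integrable lborel A g" if "A \<in> sets borel" for A
  using gl that unfolding set_integrable_def by (intro integrable_mult_indicator) auto
 have tot': "(LINT x:UNIV|lborel. g x) = 0" using fgi[of UNIV] tot by simp
 have P: "(LINT x:A|lborel. g x) = 0" if "A \<in> sets borel" for A
 proof -
  have "Int_stable (range (%(a, b). box a b :: 'a set))" by (auto simp: Int_stable_def box_Int_box)
  moreover have "range (%(a, b). box a b :: 'a set) \<subseteq> Pow UNIV" by auto
  moreover have "A \<in> sigma_sets UNIV (range (%(a, b). box a b))"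
   using that by (simp add: borel_eq_box)
  ultimately show ?thesis
  proof (induction rule: sigma_sets_induct_disjoint)
   case (basic A)
   then obtain a b where "A = box a b" by auto
   then show ?case using fgi[of A] box by simp
  next
   case empty then show ?case by (simp add: set_lebesgue_integral_def)
  next
   case (compl A)
   then have A: "A \<in> sets borel" by (simp add: borel_eq_box)
   have "(LINT x:(UNIV - A) \<union> A|lborel. g x) = (LINT x:UNIV - A|lborel. g x) + (LINT x:A|lborel. g x)"
    using A by (intro set_integral_Un gs) auto
   then show ?case using tot' compl by simp
  next
   case (union A)
   then have A: "A i \<in> sets borel" for i by (auto simp: borel_eq_box)
   have "(LINT x:(\<Union>i. A i)|lborel. g x) = (\<Sum>i. (LINT x:(A i)|lborel. g x))"
    using union(1) A by (intro lebesgue_integral_countable_add gs) (auto simp: disjoint_family_on_def)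
   then show ?case using union by simp
  qed
 qed
 have z: "AE x in lborel. (ind A x * (k * g x) :: real) = 0"
  if "A \<in> sets borel" "\<And>x. x \<in> A ==> k * g x \<ge> 0" for A and k :: real
 proof -
  have i: "integrable lborel (%x. ind A x * (k * g x))"
   using integrable_mult_indicator[of A lborel "%x. k * g x"] gl that by auto
  have "(\<integral>x. ind A x * (k * g x) \<partial>lborel) = k * (LINT x:A|lborel. g x)"
   by (simp add: set_lebesgue_integral_def mult.left_commute)
  also have "\<dots> = 0" using P[OF that(1)] by simp
  finally show ?thesis
   using integral_nonneg_eq_0_iff_AE[OF i] that(2) by (auto simp: indicator_def)
 qed
 have "AE x in lborel. g x = 0"
 proof -
  have "{x. g x > 0} \<in> sets borel" "{x. g x < 0} \<in> sets borel" by measurable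
  from z[OF this(1), of 1] z[OF this(2), of "-1"] show ?thesis
   by (auto simp: indicator_def elim!: AE_mp split: if_splits)
 qed
 then have "AE x in lebesgue. g x = 0" by (simp add: AE_completion_iff)
 with fg show ?thesis by eventually_elim simp
qed

lemma locint_compact:
 fixes w :: "'a::euclidean_space => real"
 assumes "locint S w" "compact K" "K \<subseteq> S"
 shows "integrable lebesgue (%x. ind K x * w x)"
proof -
 have K: "K \<in> sets lebesgue" using assms by (simp add: compact_imp_closed borel_closed)
 have "intg K w" using assms unfolding locally_integrable_def by blast
 then show ?thesis
  using integrable_restrict_space[of K lebesgue w] K by simp
qed

lemma locally_integrableI:
 fixes w :: "'a::euclidean_space => real"
 assumes "\<And>K. compact K ==> K \<subseteq> S ==> integrable lebesgue (%x. ind K x * w x)"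
 shows "locint S w"
 unfolding locally_integrable_def
proof (intro allI impI)
 fix K :: "'a set" assume K: "compact K" "K \<subseteq> S"
 then have "K \<in> sets lebesgue" by (simp add: compact_imp_closed borel_closed)
 then show "intg K w"
  using integrable_restrict_space[of K lebesgue w] assms[OF K] by simp
qed

lemma locint_times:
 fixes w :: "'a::euclidean_space => real"
 assumes "open S" "locint S w" "\<zeta> \<in> borel_measurable borel" "\<And>x. \<bar>\<zeta> x\<bar> \<le> B"
  "compact K" "K \<subseteq> S" "\<And>x. x \<notin> K ==> \<zeta> x = 0"
 shows "intg S (%x. w x * \<zeta> x)"
proof -
 have i: "integrable lebesgue (%x. ind K x * w x)"
  using assms locint_compact by blast
 have "integrable lebesgue (%x. (ind K x * w x) * \<zeta> x)"
 proof (rule intg_bound)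
  show "integrable lebesgue (%x. B * norm (ind K x * w x))" using i by auto
  show "(%x. (ind K x * w x) * \<zeta> x) \<in> borel_measurable lebesgue"
   by (rule borel_measurable_times[OF borel_measurable_integrable[OF i] borel_imp_lebesgue[OF assms(3)]])
  have "0 \<le> B" using assms(4) abs_ge_zero order_trans by blast
  then show "AE x in lebesgue. norm ((ind K x * w x) * \<zeta> x) \<le> norm (B * norm (ind K x * w x))"
   using assms(4) by (auto simp: abs_mult mult.commute[of B] intro!: mult_left_mono)
 qed
 moreover have "(ind K x * w x) * \<zeta> x = ind S x *\<^sub>R (w x * \<zeta> x)" for x
  using assms(6,7) by (cases "x \<in> K") (auto simp: indicator_def)
 ultimately show ?thesis unfolding integrable_lebesgue_on_open[OF assms(1)] by simp
qed

lemma locint_test: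
 fixes w :: "'a::euclidean_space => real"
 assumes "open S" "locint S w" "\<zeta> \<in> TF S"
 shows "intg S (%x. w x * \<zeta> x)"
proof -
 obtain B where B: "\<And>x. \<bar>\<zeta> x\<bar> \<le> B" by (rule test_bounded[OF assms(3)]) blast
 obtain K where K: "compact K" "K \<subseteq> S" "\<And>x. x \<notin> K ==> \<zeta> x = 0" by (rule testE[OF assms(3)]) blast
 show ?thesis
  by (rule locint_times[OF assms(1,2) smooth_borel[OF test_smooth[OF assms(3)]] B K])
qed

lemma locint_continuous:
 fixes w :: "'a::euclidean_space => real"
 assumes "continuous_on S w"
 shows "locint S w"
proof (rule locally_integrableI)
 fix K assume K: "compact K" "K \<subseteq> S"
 have i: "integrable lborel (%x. ind K x *\<^sub>R w x)"
  by (rule borel_integrable_compact[OF K(1) continuous_on_subset[OF assms K(2)]])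
 then have m: "(%x. ind K x *\<^sub>R w x) \<in> borel_measurable borel" by auto
 show "integrable lebesgue (%x. ind K x * w x)"
  using integrable_lebesgue_borel(1)[OF m] i by simp
qed

lemma locint_add:
 "locint S w ==> locint S v ==> locint S (%x. w x + v x)"
 unfolding locally_integrable_def by (auto intro: intg_add)

lemma locint_cmult:
 "locint S w ==> locint S (%x. k * w x)"
 unfolding locally_integrable_def by (auto intro: integrable_mult_right)

lemma locint_diff:
 "locint S w ==> locint S v ==> locint S (%x. w x - v x)"
 unfolding locally_integrable_def by (auto intro: intg_diff)

lemma locint_zero: "locint S (%x. 0)"
 unfolding locally_integrable_def by auto

lemma locint_cong_AE:
 fixes w :: "'a::euclidean_space => real"
 assumes "open S" "locint S w" "AE x in leb S. w x = v x"
 shows "locint S v"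
proof (rule locally_integrableI)
 fix K assume K: "compact K" "K \<subseteq> S"
 have i: "integrable lebesgue (%x. ind K x * w x)" by (rule locint_compact[OF assms(2) K])
 have "AE x in lebesgue. x \<in> S \<longrightarrow> w x = v x" using assms(3) unfolding AE_lebesgue_on_open[OF assms(1)] .
 then have ae: "AE x in lebesgue. ind K x * w x = ind K x * v x"
  by eventually_elim (use K in \<open>auto simp: indicator_def\<close>)
 have m: "(%x. ind K x * v x) \<in> borel_measurable lebesgue"
  using borel_measurable_AE[OF borel_measurable_integrable[OF i] ae] .
 show "integrable lebesgue (%x. ind K x * v x)"
  using integrable_cong_AE[OF borel_measurable_integrable[OF i] m ae] i by blast
qed

text \<open>Testing with \<open>box_bump n c d\<close> and letting n grow gives vanishing integrals
  over all nonempty open boxes whose closure lies in S. Hence w vanishes almost everywhere on each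
  closed box in S, and S is a countable union of such boxes.\<close>

theorem fundamental_lemma_variations:
 fixes w :: "'a::euclidean_space => real"
 assumes S: "open S" and w: "locint S w"
  and zero: "\<And>\<zeta>. \<zeta> \<in> TF S ==> (lint S (%x. w x * \<zeta> x)) = 0"
 shows "AE x in leb S. w x = 0"
proof -
 have box: "AE x in lebesgue. x \<in> box a b \<longrightarrow> w x = 0" if ab: "cbox a b \<subseteq> S" for a b
 proof -
  define f where "f = (%x. ind (box a b) x * w x)"
  have "integrable lebesgue (%x. ind (box a b) x *\<^sub>R (ind (cbox a b) x * w x))"
   by (intro integrable_mult_indicator locint_compact[OF w] ab) auto
  moreover have "ind (box a b) x *\<^sub>R (ind (cbox a b) x * w x) = f x" for x
   using box_subset_cbox[of a b] by (auto simp: f_def indicator_def)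
  ultimately have fi: "integrable lebesgue f" by simp
  have sub: "(\<integral>x. ind (box c d) x * w x \<partial>lebesgue) = 0" if cd: "box c d \<subseteq> box a b" for c d
  proof (cases "box c d = {}")
   case False
   then have cds: "cbox c d \<subseteq> S"
    using cd ab by (metis box_subset_cbox closure_box closure_cbox closure_mono order_trans)
   have i: "integrable lebesgue (%x. ind (cbox c d) x * w x)"
    by (rule locint_compact[OF w compact_cbox cds])
   have z: "(\<integral>x. (ind (cbox c d) x * w x) * box_bump n c d x \<partial>lebesgue) = 0" for n
   proof -
    have "(lint S (%x. w x * box_bump n c d x)) = 0"
     by (rule zero[OF box_bump_test[OF cds]])
    moreover have e: "ind S x *\<^sub>R (w x * box_bump n c d x) = (ind (cbox c d) x * w x) * box_bump n c d x" for x
     using cds box_bump_zero[of x c d n] box_subset_cbox[of c d] by (auto simp: indicator_def)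
    ultimately show ?thesis unfolding integral_lebesgue_on_open[OF S] e by simp
   qed
   have "(%n. \<integral>x. (ind (cbox c d) x * w x) * box_bump n c d x \<partial>lebesgue)
     \<longlonglongrightarrow> (\<integral>x. (ind (cbox c d) x * w x) * ind (box c d) x \<partial>lebesgue)"
   proof (rule integral_dominated_convergence[where w = "%x. norm (ind (cbox c d) x * w x)"])
    show "(%x. (ind (cbox c d) x * w x) * ind (box c d) x) \<in> borel_measurable lebesgue"
     by (rule borel_measurable_times[OF borel_measurable_integrable[OF i] borel_measurable_indicator]) auto
    show "(%x. (ind (cbox c d) x * w x) * box_bump n c d x) \<in> borel_measurable lebesgue" for n
     by (rule borel_measurable_times[OF borel_measurable_integrable[OF i] borel_imp_lebesgue[OF smooth_borel[OF box_bump_smooth]]])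
    show "AE x in lebesgue. (%n. (ind (cbox c d) x * w x) * box_bump n c d x)
      \<longlonglongrightarrow> (ind (cbox c d) x * w x) * ind (box c d) x"
     by (intro AE_I2 tendsto_mult tendsto_const box_bump_tendsto)
    show "AE x in lebesgue. norm ((ind (cbox c d) x * w x) * box_bump n c d x) \<le> norm (ind (cbox c d) x * w x)" for n
     by (intro AE_I2) (auto simp: abs_mult box_bump_bounds intro!: mult_left_le)
   qed (use i in auto)
   then have "(\<integral>x. (ind (cbox c d) x * w x) * ind (box c d) x \<partial>lebesgue) = 0"
    unfolding z by (simp add: LIMSEQ_const_iff)
   moreover have "(ind (cbox c d) x * w x) * ind (box c d) x = ind (box c d) x * w x" for x
    using box_subset_cbox[of c d] by (auto simp: indicator_def)
   ultimately show ?thesis by simp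
  qed auto
  have "AE x in lebesgue. f x = 0"
  proof (rule AE_zero_of_box_integrals[OF fi])
   show "(\<integral>x. ind (box c d) x * f x \<partial>lebesgue) = 0" for c d
   proof -
    obtain c' d' where cd': "box c d \<inter> box a b = box c' d'" by (auto simp: box_Int_box)
    then have "ind (box c d) x * f x = ind (box c' d') x * w x" for x
     by (auto simp: f_def indicator_def)
    moreover have "(\<integral>x. ind (box c' d') x * w x \<partial>lebesgue) = 0" using cd' by (intro sub) auto
    ultimately show ?thesis by simp
   qed
   show "integral\<^sup>L lebesgue f = 0" unfolding f_def by (rule sub) simp
  qed
  then show ?thesis by eventually_elim (auto simp: f_def)
 qed
 \<comment> \<open>The faces of a box form a null set, so the result for open boxes extends to
   closed ones, which are the pieces of the countable decomposition.\<close>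
 have cbox: "AE x in lebesgue. x \<in> cbox a b \<longrightarrow> w x = 0" if ab: "cbox a b \<subseteq> S" for a b
 proof -
  have "AE x in lebesgue. x \<notin> cbox a b - box a b"
   by (rule AE_not_in) (use negligible_frontier_interval[of a b] in \<open>simp only: negligible_iff_null_sets\<close>)
  with box[OF ab] show ?thesis by eventually_elim auto
 qed
 obtain \<D> where D: "countable \<D>" "\<D> \<subseteq> Pow S" "\<And>X. X \<in> \<D> ==> \<exists>a b. X = cbox a b" "\<Union>\<D> = S"
  using open_countable_Union_open_cbox[OF S] by metis
 have "AE x in lebesgue. \<forall>X\<in>\<D>. x \<in> X \<longrightarrow> w x = 0"
  unfolding AE_ball_countable[OF D(1)]
 proof
  fix X assume "X \<in> \<D>"
  then obtain a b where "X = cbox a b" "cbox a b \<subseteq> S" using D(2,3) by blast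
  then show "AE x in lebesgue. x \<in> X \<longrightarrow> w x = 0" using cbox by simp
 qed
 then have "AE x in lebesgue. x \<in> S \<longrightarrow> w x = 0" by eventually_elim (use D(4) in auto)
 then show ?thesis unfolding AE_lebesgue_on_open[OF S] .
qed

section \<open>Weak derivatives\<close>

lemma hwdD:
 assumes "hwd S b k w v"
 shows "locint S w" "locint S v"
  "\<zeta> \<in> TF S ==> (lint S (%x. w x * (dd b ^^ k) \<zeta> x)) = (-1) ^ k * (lint S (%x. v x * \<zeta> x))"
 using assms by (auto simp: has_weak_deriv_def)

lemma hwd_unique:
 fixes S :: "'a::euclidean_space set"
 assumes S: "open S" and v: "hwd S b k w v" and v': "hwd S b k w v'"
 shows "AE x in leb S. v x = v' x"
proof -
 note D = hwdD[OF v] and D' = hwdD[OF v']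
 have "AE x in leb S. v x - v' x = 0"
 proof (rule fundamental_lemma_variations[OF S locint_diff[OF D(2) D'(2)]])
  fix \<zeta> assume z: "\<zeta> \<in> TF S"
  have "(-1) ^ k * (lint S (%x. v x * \<zeta> x)) = (-1) ^ k * (lint S (%x. v' x * \<zeta> x))"
   using D(3)[OF z] D'(3)[OF z] by simp
  then have "(lint S (%x. v x * \<zeta> x)) = (lint S (%x. v' x * \<zeta> x))" by simp
  then show "(lint S (%x. (v x - v' x) * \<zeta> x)) = 0"
   using locint_test[OF S D(2) z] locint_test[OF S D'(2) z]
   by (simp add: left_diff_distrib)
 qed
 then show ?thesis by eventually_elim simp
qed

lemma hwd_cong_AE:
 fixes S :: "'a::euclidean_space set"
 assumes S: "open S" and v: "hwd S b k w v" and b: "b \<in> Basis"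
  and w': "AE x in leb S. w x = w' x" and v': "AE x in leb S. v x = v' x"
 shows "hwd S b k w' v'"
 unfolding has_weak_deriv_def
proof (intro conjI ballI)
 note D = hwdD[OF v]
 show l: "locint S w'" "locint S v'"
  using locint_cong_AE[OF S] D w' v' by blast+
 fix \<zeta> assume z: "\<zeta> \<in> TF S"
 have "(lint S (%x. w' x * (dd b ^^ k) \<zeta> x)) = (lint S (%x. w x * (dd b ^^ k) \<zeta> x))"
  using w' by (intro integrable_AE_lebesgue_on(2)[OF S locint_test[OF S D(1) test_dir_deriv_pow[OF z b]]])
   (auto elim!: AE_mp)
 moreover have "(lint S (%x. v' x * \<zeta> x)) = (lint S (%x. v x * \<zeta> x))"
  using v' by (intro integrable_AE_lebesgue_on(2)[OF S locint_test[OF S D(2) z]]) (auto elim!: AE_mp)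
 ultimately show "(lint S (%x. w' x * (dd b ^^ k) \<zeta> x)) = (-1) ^ k * (lint S (%x. v' x * \<zeta> x))"
  using D(3)[OF z] by simp
qed

lemma hwd_add:
 fixes S :: "'a::euclidean_space set"
 assumes S: "open S" and b: "b \<in> Basis" and v: "hwd S b k w v" and v': "hwd S b k w' v'"
 shows "hwd S b k (%x. w x + w' x) (%x. v x + v' x)"
 unfolding has_weak_deriv_def
proof (intro conjI ballI)
 note D = hwdD[OF v] and D' = hwdD[OF v']
 show "locint S (%x. w x + w' x)" "locint S (%x. v x + v' x)"
  using D D' locint_add by blast+
 fix \<zeta> assume z: "\<zeta> \<in> TF S"
 note zk = test_dir_deriv_pow[OF z b, of k]
 show "(lint S (%x. (w x + w' x) * (dd b ^^ k) \<zeta> x)) = (-1) ^ k * (lint S (%x. (v x + v' x) * \<zeta> x))"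
  using locint_test[OF S D(1) zk] locint_test[OF S D'(1) zk]
   locint_test[OF S D(2) z] locint_test[OF S D'(2) z] D(3)[OF z] D'(3)[OF z]
  by (simp add: distrib_right distrib_left)
qed

lemma hwd_cmult:
 assumes v: "hwd S b k w v"
 shows "hwd S b k (%x. r * w x) (%x. r * v x)"
 using assms locint_cmult unfolding has_weak_deriv_def by (auto simp: mult.assoc mult.left_commute)

lemma hwd_zero: "hwd S b k (%x. 0) (%x. 0)"
 unfolding has_weak_deriv_def by (auto simp: locint_zero)

lemma hwd_diff:
 fixes S :: "'a::euclidean_space set"
 assumes "open S" "b \<in> Basis" "hwd S b k w v" "hwd S b k w' v'"
 shows "hwd S b k (%x. w x - w' x) (%x. v x - v' x)"
 using hwd_add[OF assms(1-3) hwd_cmult[OF assms(4), of "-1"]] by simp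

lemma hwd_sum:
 fixes S :: "'a::euclidean_space set"
 assumes "open S" "b \<in> Basis" "finite I" "\<And>i. i \<in> I ==> hwd S b k (w i) (v i)"
 shows "hwd S b k (%x. \<Sum>i\<in>I. w i x) (%x. \<Sum>i\<in>I. v i x)"
 using assms(3,4)
 by (induction rule: finite_induct) (simp_all add: hwd_zero hwd_add[OF assms(1,2)])

lemma hwd_Suc:
 assumes "b \<in> Basis" "hwd S b k w v" "hwd S b 1 v u"
 shows "hwd S b (Suc k) w u"
 unfolding has_weak_deriv_def
proof (intro conjI ballI)
 fix \<zeta> assume z: "\<zeta> \<in> TF S"
 have "(lint S (%x. w x * (dd b ^^ Suc k) \<zeta> x)) = (lint S (%x. w x * (dd b ^^ k) (dd b \<zeta>) x))"
  by (simp add: funpow_swap1)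
 also have "\<dots> = (-1) ^ k * (lint S (%x. v x * dd b \<zeta> x))"
  by (rule hwdD(3)[OF assms(2) test_dir_deriv[OF z assms(1)]])
 also have "\<dots> = (-1) ^ Suc k * (lint S (%x. u x * \<zeta> x))"
  using hwdD(3)[OF assms(3) z] by simp
 finally show "(lint S (%x. w x * (dd b ^^ Suc k) \<zeta> x)) = (-1) ^ Suc k * (lint S (%x. u x * \<zeta> x))" .
qed (use hwdD assms in blast)+

lemma weak_grad_eq:
 fixes S :: "'a::euclidean_space set"
 assumes S: "open S" and v: "\<And>b. b \<in> Basis ==> hwd S b 1 w (v b)"
 shows "AE x in leb S. weak_grad S w x = (\<Sum>b\<in>Basis. v b x *\<^sub>R b)"
proof -
 have "AE x in leb S. (SOME v. hwd S b 1 w v) x = v b x" if "b \<in> Basis" for b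
  using hwd_unique[OF S someI[where P = "%v. hwd S b 1 w v", OF v[OF that]] v[OF that]] .
 then have "AE x in leb S. \<forall>b\<in>Basis. (SOME v. hwd S b 1 w v) x = v b x"
  by (intro AE_finite_allI) auto
 then show ?thesis by eventually_elim (simp add: weak_grad_def)
qed

text \<open>The derivative is the limit of difference quotients along b, and each of these has
  integral 0 because \<open>lborel\<close> is invariant under translation. Domination is by a bound
  on the derivative times the indicator of a compact set.\<close>

lemma integral_dir_deriv_test:
 fixes \<rho> :: "'a::euclidean_space => real"
 assumes \<rho>: "\<rho> \<in> TF UNIV" and b: "b \<in> Basis"
 shows "(\<integral>x. dd b \<rho> x \<partial>lborel) = 0"
proof -
 have sm: "smooth \<rho>" using \<rho> by (rule test_smooth)
 note \<rho>b = test_dir_deriv[OF \<rho> b]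
 obtain B where B: "B > 0" "\<And>x. \<bar>dd b \<rho> x\<bar> \<le> B" using test_bounded[OF \<rho>b] by blast
 obtain K where K: "compact K" "K \<subseteq> UNIV" "\<And>x. x \<notin> K ==> \<rho> x = 0" by (rule testE[OF \<rho>]) blast
 \<comment> \<open>All points from which a step of length at most 1 in direction b can reach the
   support; outside L every quotient \<open>D n\<close> is 0, since \<open>h n\<close> is at most
   1.\<close>
 define L where "L = {x + y | x y. x \<in> K \<and> y \<in> (%t. t *\<^sub>R b) ` {-1..0}}"
 have L: "compact L"
  unfolding L_def by (intro compact_sums K compact_continuous_image continuous_intros compact_Icc)
 have der: "((%t. \<rho> (x + t *\<^sub>R b)) has_real_derivative dd b \<rho> (x + t *\<^sub>R b)) (at t)" for x t
 proof -
  have "((%t. x + t *\<^sub>R b) has_derivative (%h. h *\<^sub>R b)) (at t)" by (auto intro!: derivative_eq_intros)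
  from has_derivative_compose[OF this smooth_has_derivative[OF sm]]
  have "((%t. \<rho> (x + t *\<^sub>R b)) has_derivative (%h. frechet_derivative \<rho> (at (x + t *\<^sub>R b)) (h *\<^sub>R b))) (at t)" .
  moreover have "frechet_derivative \<rho> (at z) (h *\<^sub>R b) = h * dd b \<rho> z" for z h
   using linear_cmul[OF linear_frechet_derivative[OF smooth_differentiable[OF sm]]] by (simp add: dir_deriv_def)
  moreover have "(%h. h * dd b \<rho> (x + t *\<^sub>R b)) = (*) (dd b \<rho> (x + t *\<^sub>R b))"
   by (auto simp: mult.commute)
  ultimately show ?thesis by (simp add: has_field_derivative_def)
 qed
 define h where "h = (%n. 1 / real (Suc n))"
 have h: "0 < h n" "h n \<le> 1" for n by (auto simp: h_def)
 define D where "D = (%n x. (\<rho> (x + h n *\<^sub>R b) - \<rho> x) / h n)"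
 have [measurable]: "\<rho> \<in> borel_measurable borel" "dd b \<rho> \<in> borel_measurable borel"
  using smooth_borel[OF sm] smooth_borel[OF test_smooth[OF \<rho>b]] by auto
 have LB: "integrable lborel (%x. B * ind L x)"
  using L emeasure_compact_finite[OF L] by (intro integrable_mult_right integrable_real_indicator) (auto simp: borel_compact)
 have bd: "\<bar>D n x\<bar> \<le> B * ind L x" for n x
 proof -
  obtain t where t: "0 < t" "t < h n" "\<rho> (x + h n *\<^sub>R b) - \<rho> (x + 0 *\<^sub>R b) = (h n - 0) * dd b \<rho> (x + t *\<^sub>R b)"
   using MVT2[of 0 "h n" "%t. \<rho> (x + t *\<^sub>R b)" "%t. dd b \<rho> (x + t *\<^sub>R b)"] h[of n] der by blast
  then have "D n x = dd b \<rho> (x + t *\<^sub>R b)" using h[of n] by (simp add: D_def)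
  moreover have "D n x = 0" if "x \<notin> L"
  proof -
   have "x + r *\<^sub>R b \<notin> K" if "0 \<le> r" "r \<le> 1" for r
   proof
    assume "x + r *\<^sub>R b \<in> K"
    moreover have "(- r) *\<^sub>R b \<in> (%t. t *\<^sub>R b) ` {-1..0}" using that by (intro imageI) auto
    ultimately have "(x + r *\<^sub>R b) + (- r) *\<^sub>R b \<in> L" unfolding L_def by blast
    then show False using \<open>x \<notin> L\<close> by simp
   qed
   from this[of "h n"] this[of 0] h[of n] show ?thesis using K(3) by (simp add: D_def)
  qed
  ultimately show ?thesis using B by (auto simp: indicator_def)
 qed
 have "(%n. \<integral>x. D n x \<partial>lborel) \<longlonglongrightarrow> (\<integral>x. dd b \<rho> x \<partial>lborel)"
 proof (rule integral_dominated_convergence[OF _ _ LB])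
  show "AE x in lborel. (%n. D n x) \<longlonglongrightarrow> dd b \<rho> x"
  proof (rule AE_I2)
   fix x
   have "((%t. (\<rho> (x + t *\<^sub>R b) - \<rho> x) / t) \<longlongrightarrow> dd b \<rho> x) (at 0)"
    using der[of x 0] by (simp add: DERIV_def)
   moreover have "filterlim h (at 0) sequentially"
   proof -
    have "h \<longlonglongrightarrow> 0" unfolding h_def by (rule LIMSEQ_Suc[OF lim_1_over_n])
    moreover have "h n \<noteq> 0" for n using h(1)[of n] by simp
    ultimately show ?thesis unfolding filterlim_at by auto
   qed
   ultimately show "(%n. D n x) \<longlonglongrightarrow> dd b \<rho> x"
    unfolding D_def by (rule filterlim_compose)
  qed
  show "AE x in lborel. norm (D n x) \<le> B * ind L x" for n using bd by auto
 qed (auto simp: D_def)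
 moreover have "(\<integral>x. D n x \<partial>lborel) = 0" for n
 proof -
  have i: "integrable lborel \<rho>"
   using locint_test[OF open_UNIV locint_continuous[of UNIV "%_. 1"] \<rho>]
   by (simp add: lebesgue_on_UNIV_eq integrable_lebesgue_borel)
  have "(\<integral>x. \<rho> (h n *\<^sub>R b + x) \<partial>lborel) = (\<integral>x. \<rho> x \<partial>distr lborel borel ((+) (h n *\<^sub>R b)))"
   by (subst integral_distr) auto
  then have e: "(\<integral>x. \<rho> (x + h n *\<^sub>R b) \<partial>lborel) = (\<integral>x. \<rho> x \<partial>lborel)"
   by (simp add: lborel_distr_plus add.commute)
  have "integrable (distr lborel borel ((+) (h n *\<^sub>R b))) \<rho>"
   using i by (simp add: lborel_distr_plus)
  then have "integrable lborel (%x. \<rho> (x + h n *\<^sub>R b))"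
   by (subst (asm) integrable_distr_eq) (auto simp: add.commute)
  then show ?thesis using i e unfolding D_def by simp
 qed
 ultimately show ?thesis by (simp add: LIMSEQ_const_iff)
qed

text \<open>The product of a test function with a smooth function is a test function, and the
  integral of its derivative is 0; the product rule splits that integral into the two sides of the
  claim.\<close>

lemma hwd_smooth:
 fixes \<zeta> :: "'a::euclidean_space => real"
 assumes S: "open S" and b: "b \<in> Basis" and \<zeta>: "smooth \<zeta>"
 shows "hwd S b 1 \<zeta> (dd b \<zeta>)"
 unfolding has_weak_deriv_def
proof (intro conjI ballI)
 show l: "locint S \<zeta>" "locint S (dd b \<zeta>)"
  by (intro locint_continuous smooth_continuous_on \<zeta> smooth_dir_deriv b)+
 fix \<xi> assume \<xi>: "\<xi> \<in> TF S"
 have p: "(%x. \<xi> x * \<zeta> x) \<in> TF S" by (rule test_mult[OF \<xi> \<zeta>])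
 have pU: "(%x. \<xi> x * \<zeta> x) \<in> TF UNIV" using p test_mono by blast
 have d: "dd b (%x. \<xi> x * \<zeta> x) x = \<zeta> x * dd b \<xi> x + dd b \<zeta> x * \<xi> x" for x
  using dir_deriv_mult[OF smooth_differentiable smooth_differentiable, OF test_smooth[OF \<xi>] \<zeta>] by simp
 have dm: "dd b (%x. \<xi> x * \<zeta> x) \<in> borel_measurable borel"
  by (rule smooth_borel[OF test_smooth[OF test_dir_deriv[OF p b]]])
 have e: "ind S x *\<^sub>R dd b (%x. \<xi> x * \<zeta> x) x = dd b (%x. \<xi> x * \<zeta> x) x" for x
 proof (cases "x \<in> S")
  case False
  obtain K where K: "K \<subseteq> S" "\<And>x b. x \<notin> K ==> dd b (%x. \<xi> x * \<zeta> x) x = 0" by (rule testE[OF p]) blast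
  then show ?thesis using False by auto
 qed simp
 then have "(lint S (%x. dd b (%x. \<xi> x * \<zeta> x) x)) = 0"
  unfolding integral_lebesgue_on_open[OF S] e
  using integral_dir_deriv_test[OF pU b] integrable_lebesgue_borel(2)[OF dm] by simp
 then show "(lint S (%x. \<zeta> x * (dd b ^^ 1) \<xi> x)) = (-1) ^ 1 * (lint S (%x. dd b \<zeta> x * \<xi> x))"
  unfolding d using locint_test[OF S l(1) test_dir_deriv[OF \<xi> b]] locint_test[OF S l(2) \<xi>]
  by simp
qed

lemma locint_tensor:
 fixes p :: "'a::euclidean_space => real" and e :: "'b::euclidean_space => real"
 assumes "locint S p" "locint R e"
 shows "locint (S \<times> R) (%z. p (fst z) * e (snd z))"
proof (rule locally_integrableI)
 fix K :: "('a \<times> 'b) set" assume K: "compact K" "K \<subseteq> S \<times> R"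
 have K1: "compact (fst ` K)" "fst ` K \<subseteq> S" and K2: "compact (snd ` K)" "snd ` K \<subseteq> R"
  using K by (auto intro!: compact_continuous_image continuous_intros)
 have "integrable lebesgue (%z. (ind (fst ` K) (fst z) * p (fst z)) * (ind (snd ` K) (snd z) * e (snd z)))"
  using lebesgue_on_tensor_integrable(1)[of UNIV UNIV "%x. ind (fst ` K) x * p x" "%y. ind (snd ` K) y * e y"]
   locint_compact[OF assms(1) K1] locint_compact[OF assms(2) K2]
  by (simp add: lebesgue_on_UNIV_eq)
 then have "integrable lebesgue (%z. ind K z *\<^sub>R ((ind (fst ` K) (fst z) * p (fst z)) * (ind (snd ` K) (snd z) * e (snd z))))"
  using K by (intro integrable_mult_indicator) (auto simp: borel_compact)
 moreover have e: "ind K z *\<^sub>R ((ind (fst ` K) (fst z) * p (fst z)) * (ind (snd ` K) (snd z) * e (snd z))) = ind K z * (p (fst z) * e (snd z))" for z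
  by (auto simp: indicator_def)
 ultimately show "integrable lebesgue (%z. ind K z * (p (fst z) * e (snd z)))" by (simp only: e)
qed

lemma hwd_tensor_fst:
 fixes S :: "'a::euclidean_space set" and R :: "'b::euclidean_space set"
 assumes S: "open S" and R: "open R" and b: "b \<in> Basis"
  and p: "hwd S b 1 p q" and e: "locint R e"
 shows "hwd (S \<times> R) (b, 0) 1 (%z. p (fst z) * e (snd z)) (%z. q (fst z) * e (snd z))"
 unfolding has_weak_deriv_def
proof (intro conjI ballI)
 note D = hwdD[OF p] and SR = open_Times[OF S R]
 show l: "locint (S \<times> R) (%z. p (fst z) * e (snd z))" "locint (S \<times> R) (%z. q (fst z) * e (snd z))"
  using locint_tensor D e by blast+
 fix \<xi> assume \<xi>: "\<xi> \<in> TF (S \<times> R)"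
 have bb: "(b, 0) \<in> (Basis :: ('a \<times> 'b) set)" using b by (simp add: Basis_prod_def)
 have "(lint (S \<times> R) (%z. p (fst z) * e (snd z) * dd (b, 0) \<xi> z))
   = (lint R (%y. lint S (%x. p x * e y * dd (b, 0) \<xi> (x, y))))"
  using lebesgue_on_Fubini(3)[OF S R locint_test[OF SR l(1) test_dir_deriv[OF \<xi> bb]]] by simp
 also have "\<dots> = (lint R (%y. - (lint S (%x. q x * e y * \<xi> (x, y)))))"
 proof (rule Bochner_Integration.integral_cong[OF refl])
  fix y
  have "(lint S (%x. p x * e y * dd (b, 0) \<xi> (x, y))) = e y * (lint S (%x. p x * dd b (%x. \<xi> (x, y)) x))"
   by (simp add: smooth_slice_deriv1(1)[OF test_smooth[OF \<xi>]] mult.left_commute[of _ "e y"] mult.assoc)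
  also have "\<dots> = e y * (- (lint S (%x. q x * \<xi> (x, y))))"
   using D(3)[OF test_slice1[OF \<xi>]] by simp
  finally show "(lint S (%x. p x * e y * dd (b, 0) \<xi> (x, y))) = - (lint S (%x. q x * e y * \<xi> (x, y)))"
   by (simp add: mult_ac)
 qed
 also have "\<dots> = - (lint (S \<times> R) (%z. q (fst z) * e (snd z) * \<xi> z))"
  using lebesgue_on_Fubini(3)[OF S R locint_test[OF SR l(2) \<xi>]] by simp
 finally show "(lint (S \<times> R) (%z. p (fst z) * e (snd z) * (dd (b, 0) ^^ 1) \<xi> z))
   = (-1) ^ 1 * (lint (S \<times> R) (%z. q (fst z) * e (snd z) * \<xi> z))"
  by simp
qed

lemma hwd_tensor_snd:
 fixes S :: "'a::euclidean_space set" and R :: "'b::euclidean_space set"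
 assumes S: "open S" and R: "open R" and b: "b \<in> Basis"
  and p: "locint S p" and e: "hwd R b 1 e e'"
 shows "hwd (S \<times> R) (0, b) 1 (%z. p (fst z) * e (snd z)) (%z. p (fst z) * e' (snd z))"
 unfolding has_weak_deriv_def
proof (intro conjI ballI)
 note D = hwdD[OF e] and SR = open_Times[OF S R]
 show l: "locint (S \<times> R) (%z. p (fst z) * e (snd z))" "locint (S \<times> R) (%z. p (fst z) * e' (snd z))"
  using locint_tensor D p by blast+
 fix \<xi> assume \<xi>: "\<xi> \<in> TF (S \<times> R)"
 have bb: "(0, b) \<in> (Basis :: ('a \<times> 'b) set)" using b by (simp add: Basis_prod_def)
 have "(lint (S \<times> R) (%z. p (fst z) * e (snd z) * dd (0, b) \<xi> z))
   = (lint S (%x. lint R (%y. p x * e y * dd (0, b) \<xi> (x, y))))"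
  using lebesgue_on_Fubini(6)[OF S R locint_test[OF SR l(1) test_dir_deriv[OF \<xi> bb]]] by simp
 also have "\<dots> = (lint S (%x. - (lint R (%y. p x * e' y * \<xi> (x, y)))))"
 proof (rule Bochner_Integration.integral_cong[OF refl])
  fix x
  have "(lint R (%y. p x * e y * dd (0, b) \<xi> (x, y))) = p x * (lint R (%y. e y * dd b (%y. \<xi> (x, y)) y))"
   by (simp add: smooth_slice_deriv2(1)[OF test_smooth[OF \<xi>]] mult.assoc)
  also have "\<dots> = p x * (- (lint R (%y. e' y * \<xi> (x, y))))"
   using D(3)[OF test_slice2[OF \<xi>]] by simp
  finally show "(lint R (%y. p x * e y * dd (0, b) \<xi> (x, y))) = - (lint R (%y. p x * e' y * \<xi> (x, y)))"
   by (simp add: mult.assoc)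
 qed
 also have "\<dots> = - (lint (S \<times> R) (%z. p (fst z) * e' (snd z) * \<xi> z))"
  using lebesgue_on_Fubini(6)[OF S R locint_test[OF SR l(2) \<xi>]] by simp
 finally show "(lint (S \<times> R) (%z. p (fst z) * e (snd z) * (dd (0, b) ^^ 1) \<xi> z))
   = (-1) ^ 1 * (lint (S \<times> R) (%z. p (fst z) * e' (snd z) * \<xi> z))"
  by simp
qed

text \<open>Here e is differentiable on R and may be singular at the boundary of R, as the profile
  is at 0. Multiplied by a test function and extended by 0 it is differentiable on the whole line,
  and the fundamental theorem on an interval that contains the support gives the identity.\<close>

lemma hwd_real:
 fixes e e' :: "real => real"
 assumes R: "open R" and e: "\<And>x. x \<in> R ==> (e has_real_derivative e' x) (at x)" and e': "continuous_on R e'"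
 shows "hwd R 1 1 e e'"
 unfolding has_weak_deriv_def
proof (intro conjI ballI)
 have "continuous_on R e" by (rule DERIV_continuous_on[OF has_field_derivative_at_within[OF e]])
 then show l: "locint R e" "locint R e'"
  using e' by (simp_all add: locint_continuous)
 fix \<eta> assume \<eta>: "\<eta> \<in> TF R"
 then have \<eta>': "dd 1 \<eta> \<in> TF R" by (intro test_dir_deriv) auto
 obtain K where K: "compact K" "K \<subseteq> R" "\<And>x. x \<notin> K ==> \<eta> x = 0" "\<And>x b. x \<notin> K ==> dd b \<eta> x = 0"
  by (rule testE[OF \<eta>]) blast
 obtain N where N: "N > 0" "\<And>x. x \<in> K ==> \<bar>x\<bar> < N"
  using compact_imp_bounded[OF K(1)] by (force simp: bounded_pos_less)
 define F where "F = (%x. if x \<in> R then e x * \<eta> x else 0)"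
 define G where "G = (%x. ind R x * (e x * dd 1 \<eta> x) + ind R x * (e' x * \<eta> x))"
 have FG: "(F has_real_derivative G x) (at x)" for x
 proof (cases "x \<in> R")
  case True
  have "((%x. e x * \<eta> x) has_real_derivative G x) (at x)"
   using DERIV_mult[OF e[OF True] smooth_has_real_derivative[OF test_smooth[OF \<eta>], of x]] True
   by (simp add: G_def algebra_simps)
  then show ?thesis
   by (rule DERIV_cong_ev[THEN iffD1, rotated 3]) (use True R in \<open>auto simp: F_def eventually_nhds\<close>)
 next
  case False
  then have x: "x \<in> - K" using K by auto
  have "open (- K)" using K(1) by (simp add: compact_imp_closed open_Compl)
  then have "\<forall>\<^sub>F x in nhds x. 0 = F x"
   unfolding eventually_nhds using x K(3) by (intro exI[of _ "- K"]) (auto simp: F_def)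
  then have "(F has_real_derivative 0) (at x)"
   using DERIV_cong_ev[of x x "%_. 0" F 0 0] by simp
  then show ?thesis using False by (simp add: G_def)
 qed
 have "(G has_integral (F N - F (- N))) {-N..N}"
  using N(1) by (intro fundamental_theorem_of_calculus)
   (auto intro!: has_field_derivative_at_within[OF FG] simp: has_real_derivative_iff_has_vector_derivative[symmetric])
 moreover have "F N = 0" "F (-N) = 0"
  using N K(3)[of N] K(3)[of "-N"] by (force simp: F_def)+
 ultimately have "(G has_integral 0) {-N..N}" by simp
 then have G0: "(G has_integral 0) UNIV"
 proof (rule has_integral_on_superset)
  fix x assume "x \<notin> {-N..N}"
  then have "x \<notin> K" using N by fastforce
  then show "G x = 0" using K by (simp add: G_def)
 qed auto
 have i1: "integrable lebesgue (%x. ind R x * (e x * dd 1 \<eta> x))"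
  and i2: "integrable lebesgue (%x. ind R x * (e' x * \<eta> x))"
  using locint_test[OF R l(1) \<eta>'] locint_test[OF R l(2) \<eta>]
  unfolding integrable_lebesgue_on_open[OF R] by simp_all
 then have "integrable lebesgue G" unfolding G_def by (rule intg_add)
 then have "(G has_integral (integral\<^sup>L lebesgue G)) UNIV" by (rule has_integral_integral_lebesgue)
 then have "integral\<^sup>L lebesgue G = 0" using G0 has_integral_unique by blast
 then show "(lint R (%x. e x * (dd 1 ^^ 1) \<eta> x)) = (-1) ^ 1 * (lint R (%x. e' x * \<eta> x))"
  unfolding integral_lebesgue_on_open[OF R] G_def using i1 i2 by simp
qed

section \<open>Weighted \<open>L\<^sup>2\<close> spaces\<close>

lemma integrable_mult_L2:
 fixes f g :: "'a => real"
 assumes [measurable]: "f \<in> borel_measurable M" "g \<in> borel_measurable M"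
  and f: "integrable M (%x. (f x)^2)" and g: "integrable M (%x. (g x)^2)"
 shows "integrable M (%x. f x * g x)"
proof (rule intg_bound)
 show "integrable M (%x. (f x)^2 + (g x)^2)" using f g by auto
 have "\<bar>a * b\<bar> \<le> a\<^sup>2 + b\<^sup>2" for a b :: real
  using sum_squares_bound[of "\<bar>a\<bar>" "\<bar>b\<bar>"] abs_ge_zero[of "a * b"] unfolding abs_mult power2_abs by linarith
 then show "AE x in M. norm (f x * g x) \<le> norm ((f x)^2 + (g x)^2)" by auto
qed auto

lemma Cauchy_Schwarz_L2:
 fixes f g :: "'a => real"
 assumes m: "f \<in> borel_measurable M" "g \<in> borel_measurable M"
  and f: "integrable M (%x. (f x)^2)" and g: "integrable M (%x. (g x)^2)"
 shows "\<bar>\<integral>x. f x * g x \<partial>M\<bar> \<le> sqrt (\<integral>x. (f x)^2 \<partial>M) * sqrt (\<integral>x. (g x)^2 \<partial>M)"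
proof -
 define A B C where "A = (\<integral>x. (f x)^2 \<partial>M)" and "B = (\<integral>x. (g x)^2 \<partial>M)" and "C = (\<integral>x. f x * g x \<partial>M)"
 note i = integrable_mult_L2[OF m f g]
 have nn: "0 \<le> A" "0 \<le> B" by (auto simp: A_def B_def intro!: integral_nonneg_AE)
 have q: "0 \<le> s\<^sup>2 * A + 2 * s * t * C + t\<^sup>2 * B" for s t
 proof -
  have "0 \<le> (\<integral>x. (s * f x + t * g x)^2 \<partial>M)" by (intro integral_nonneg_AE) auto
  also have "(%x. (s * f x + t * g x)^2) = (%x. s\<^sup>2 * (f x)^2 + 2 * s * t * (f x * g x) + t\<^sup>2 * (g x)^2)"
   by (auto simp: power2_eq_square algebra_simps)
  also have "(\<integral>x. (s\<^sup>2 * (f x)^2 + 2 * s * t * (f x * g x) + t\<^sup>2 * (g x)^2) \<partial>M) = s\<^sup>2 * A + 2 * s * t * C + t\<^sup>2 * B"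
   using f g i unfolding A_def B_def C_def by (simp del: power_mult_distrib)
  finally show ?thesis .
 qed
 have "C\<^sup>2 \<le> A * B"
 proof (cases "B = 0")
  case True
  have "C = 0"
  proof (rule ccontr)
   assume "C \<noteq> 0"
   \<comment> \<open>With B = 0 the quadratic form is affine in t; this value of t makes it equal to
     -1.\<close>
   have "0 \<le> A + 2 * (- (A + 1) / (2 * C)) * C"
    using q[of 1 "- (A + 1) / (2 * C)"] True by simp
   then show False using \<open>C \<noteq> 0\<close> by (simp add: field_simps)
  qed
  then show ?thesis using True by simp
 next
  case False
  then have "0 < B" using nn by simp
  have "0 \<le> B * (A * B - C\<^sup>2)"
   using q[of B "- C"] by (simp add: power2_eq_square algebra_simps)
  then show ?thesis using \<open>0 < B\<close> by (simp add: zero_le_mult_iff)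
 qed
 then have "\<bar>C\<bar> \<le> sqrt (A * B)" by (simp add: real_le_rsqrt)
 then show ?thesis unfolding A_def B_def C_def by (simp add: real_sqrt_mult)
qed

lemma integrable_lebesgue_on_cong:
 fixes f g :: "'a::euclidean_space => 'b::{banach, second_countable_topology}"
 assumes "\<And>x. x \<in> S ==> f x = g x" "intg S f"
 shows "intg S g"
proof -
 have "intg S f = intg S g"
  by (rule Bochner_Integration.integrable_cong) (simp_all add: assms(1))
 with assms(2) show ?thesis by simp
qed

lemma integral_lebesgue_on_cong:
 fixes f g :: "'a::euclidean_space => 'b::{banach, second_countable_topology}"
 assumes "\<And>x. x \<in> S ==> f x = g x"
 shows "lint S f = lint S g"
 by (rule Bochner_Integration.integral_cong) (simp_all add: assms)

lemma wL2_norm_nonneg: "0 \<le> wL2_norm S \<omega> v" if "\<And>x. x \<in> S ==> 0 \<le> \<omega> x"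
 unfolding wL2_norm_def using that by (auto intro!: integral_nonneg_AE AE_I2)

text \<open>Continuity and positivity give a positive lower bound of the weight on every compact
  subset of S. A weight such as y^beta exp (theta y) may degenerate or blow up at y = 0 and at
  infinity; the weighted spaces still embed into the locally integrable functions, so weak
  derivatives make sense for all exponents.\<close>

locale pos_weight =
 fixes S :: "'a::euclidean_space set" and \<omega> :: "'a => real"
 assumes open_S: "open S" and cont_\<omega>: "continuous_on S \<omega>" and pos_\<omega>: "\<And>x. x \<in> S ==> 0 < \<omega> x"
begin

abbreviation nrm :: "('a => 'b::euclidean_space) => real" where
 "nrm \<equiv> wL2_norm S \<omega>"

abbreviation wsp :: "('a => 'b::euclidean_space) set" where
 "wsp \<equiv> wL2 S \<omega>"

lemma \<omega>_measurable [measurable]: "\<omega> \<in> meas S"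
 using cont_\<omega> open_S by (intro continuous_meas) auto

lemma norm_nonneg: "0 \<le> nrm v"
 using wL2_norm_nonneg[of S \<omega>] pos_\<omega> by (metis less_imp_le)

lemma norm_sq: "(nrm v)^2 = (lint S (%x. \<omega> x * (norm (v x))^2))"
 unfolding wL2_norm_def using pos_\<omega>
 by (auto intro!: real_sqrt_pow2 integral_nonneg_AE AE_I2 mult_nonneg_nonneg simp: less_imp_le)

lemma wL2D: "v \<in> wsp ==> v \<in> meas S"
 "v \<in> wsp ==> intg S (%x. \<omega> x * (norm (v x))^2)"
 by (auto simp: wL2_def)

lemma sqrt_weight:
 fixes v :: "'a => 'b::euclidean_space"
 assumes v: "v \<in> wsp"
 shows "(%x. sqrt (\<omega> x) * norm (v x)) \<in> meas S"
  "intg S (%x. (sqrt (\<omega> x) * norm (v x))^2)"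
  "(lint S (%x. (sqrt (\<omega> x) * norm (v x))^2)) = (nrm v)^2"
proof -
 have [measurable]: "v \<in> meas S" using wL2D[OF v] by auto
 show "(%x. sqrt (\<omega> x) * norm (v x)) \<in> meas S" by measurable
 have e: "(sqrt (\<omega> x) * norm (v x))^2 = \<omega> x * (norm (v x))^2" if "x \<in> S" for x
  using pos_\<omega>[OF that] by (simp add: power_mult_distrib)
 show "intg S (%x. (sqrt (\<omega> x) * norm (v x))^2)"
  using wL2D(2)[OF v] Bochner_Integration.integrable_cong[OF refl, of "leb S"] e by (metis (no_types, lifting) space_lebesgue_on)
 show "(lint S (%x. (sqrt (\<omega> x) * norm (v x))^2)) = (nrm v)^2"
  unfolding norm_sq using e by (intro Bochner_Integration.integral_cong) auto
qed

lemma norm_mult_bound: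
 fixes u :: "'a => 'b::euclidean_space" and v :: "'a => 'c::euclidean_space"
 assumes u: "u \<in> wsp" and v: "v \<in> wsp"
 shows "intg S (%x. \<omega> x * (norm (u x) * norm (v x)))"
  "(lint S (%x. \<omega> x * (norm (u x) * norm (v x)))) \<le> nrm u * nrm v"
proof -
 note U = sqrt_weight[OF u] and V = sqrt_weight[OF v]
 have e: "sqrt (\<omega> x) * norm (u x) * (sqrt (\<omega> x) * norm (v x)) = \<omega> x * (norm (u x) * norm (v x))" if "x \<in> S" for x
  using pos_\<omega>[OF that] real_sqrt_mult_self[of "\<omega> x"] by (simp add: algebra_simps)
 show "intg S (%x. \<omega> x * (norm (u x) * norm (v x)))"
  by (rule integrable_lebesgue_on_cong[OF e integrable_mult_L2[OF U(1) V(1) U(2) V(2)]])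
 have "(lint S (%x. \<omega> x * (norm (u x) * norm (v x))))
   = (lint S (%x. sqrt (\<omega> x) * norm (u x) * (sqrt (\<omega> x) * norm (v x))))"
  by (rule integral_lebesgue_on_cong[OF e[symmetric]])
 also have "\<dots> \<le> sqrt ((nrm u)^2) * sqrt ((nrm v)^2)"
  using Cauchy_Schwarz_L2[OF U(1) V(1) U(2) V(2)] unfolding U(3) V(3) by linarith
 also have "\<dots> = nrm u * nrm v" by (simp add: norm_nonneg)
 finally show "(lint S (%x. \<omega> x * (norm (u x) * norm (v x)))) \<le> nrm u * nrm v" .
qed

text \<open>The common form of the Cauchy-Schwarz estimates for (A grad u) . grad v, for c u v and
  for inner products; h is the integrand without its weight.\<close>

lemma dominated_bilinear:
 fixes u :: "'a => 'b::euclidean_space" and v :: "'a => 'c::euclidean_space"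
 assumes u: "u \<in> wsp" and v: "v \<in> wsp" and m: "h \<in> meas S"
  and b: "AE x in leb S. \<bar>h x\<bar> \<le> k * (norm (u x) * norm (v x))" and k: "0 \<le> k"
 shows "intg S (%x. \<omega> x * h x)"
  "\<bar>lint S (%x. \<omega> x * h x)\<bar> \<le> k * (nrm u * nrm v)"
proof -
 note B = norm_mult_bound[OF u v]
 have ae: "AE x in leb S. norm (\<omega> x * h x) \<le> k * (\<omega> x * (norm (u x) * norm (v x)))"
  using b AE_space
 proof eventually_elim
  case (elim x)
  then have "0 < \<omega> x" using pos_\<omega> by simp
  then have "\<omega> x * \<bar>h x\<bar> \<le> \<omega> x * (k * (norm (u x) * norm (v x)))"
   using elim by (intro mult_left_mono) auto
  then show ?case using \<open>0 < \<omega> x\<close> by (simp add: abs_mult mult.left_commute)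
 qed
 have ik: "intg S (%x. k * (\<omega> x * (norm (u x) * norm (v x))))"
  using B(1) by auto
 have hm: "(%x. \<omega> x * h x) \<in> meas S"
  using m by measurable
 show i: "intg S (%x. \<omega> x * h x)"
  by (rule intg_bound[OF ik hm]) (use ae in \<open>auto elim!: AE_mp\<close>)
 have "\<bar>lint S (%x. \<omega> x * h x)\<bar> \<le> (lint S (%x. k * (\<omega> x * (norm (u x) * norm (v x)))))"
  using order_trans[OF integral_norm_bound[of "leb S" "%x. \<omega> x * h x"] integral_mono_AE[OF integrable_norm[OF i] ik ae]] by simp
 also have "\<dots> \<le> k * (nrm u * nrm v)"
  using B(2) k by (simp add: mult_left_mono)
 finally show "\<bar>lint S (%x. \<omega> x * h x)\<bar> \<le> k * (nrm u * nrm v)" .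
qed

lemma wL2_add:
 fixes u v :: "'a => 'b::euclidean_space"
 assumes u: "u \<in> wsp" and v: "v \<in> wsp"
 shows "(%x. u x + v x) \<in> wsp"
  "nrm (%x. u x + v x) \<le> nrm u + nrm v"
proof -
 have [measurable]: "u \<in> meas S" "v \<in> meas S"
  using wL2D u v by auto
 note B = norm_mult_bound[OF u v]
 let ?G = "%x. \<omega> x * (norm (u x))^2 + 2 * (\<omega> x * (norm (u x) * norm (v x))) + \<omega> x * (norm (v x))^2"
 have iG: "intg S ?G" using wL2D(2)[OF u] wL2D(2)[OF v] B(1) by auto
 have le: "\<omega> x * (norm (u x + v x))^2 \<le> ?G x" if "x \<in> S" for x
 proof -
  have "(norm (u x + v x))^2 \<le> (norm (u x) + norm (v x))^2"
   by (intro power_mono norm_triangle_ineq) auto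
  then have "\<omega> x * (norm (u x + v x))^2 \<le> \<omega> x * (norm (u x) + norm (v x))^2"
   using pos_\<omega>[OF that] by (intro mult_left_mono) auto
  then show ?thesis by (simp add: power2_eq_square algebra_simps)
 qed
 have i: "intg S (%x. \<omega> x * (norm (u x + v x))^2)"
 proof (rule intg_bound[OF iG])
  show "AE x in leb S. norm (\<omega> x * (norm (u x + v x))^2) \<le> norm (?G x)"
  proof (rule AE_I2)
   fix x assume "x \<in> space (leb S)"
   then have x: "x \<in> S" by simp
   have "0 \<le> \<omega> x * (norm (u x + v x))^2" using pos_\<omega>[OF x] by simp
   then show "norm (\<omega> x * (norm (u x + v x))^2) \<le> norm (?G x)" using le[OF x] by simp
  qed
 qed measurable
 show "(%x. u x + v x) \<in> wsp" using i by (simp add: wL2_def)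
 have "(nrm (%x. u x + v x))^2 \<le> lint S ?G"
  unfolding norm_sq using i iG le by (intro integral_mono) auto
 also have "\<dots> = (nrm u)^2 + 2 * (lint S (%x. \<omega> x * (norm (u x) * norm (v x)))) + (nrm v)^2"
  using wL2D(2)[OF u] wL2D(2)[OF v] B(1) by (simp add: norm_sq)
 also have "\<dots> \<le> (nrm u + nrm v)^2"
  using B(2) by (simp add: power2_eq_square algebra_simps)
 finally show "nrm (%x. u x + v x) \<le> nrm u + nrm v"
  by (rule power2_le_imp_le) (simp add: norm_nonneg)
qed

lemma wL2_cmult:
 fixes u :: "'a => 'b::euclidean_space"
 assumes u: "u \<in> wsp"
 shows "(%x. r *\<^sub>R u x) \<in> wsp"
  "nrm (%x. r *\<^sub>R u x) = \<bar>r\<bar> * nrm u"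
proof -
 have [measurable]: "u \<in> meas S" using wL2D u by auto
 have e: "\<omega> x * (norm (r *\<^sub>R u x))^2 = r\<^sup>2 * (\<omega> x * (norm (u x))^2)" for x
  by (simp add: power_mult_distrib)
 show "(%x. r *\<^sub>R u x) \<in> wsp"
  unfolding wL2_def mem_Collect_eq e using wL2D(2)[OF u] by auto
 show "nrm (%x. r *\<^sub>R u x) = \<bar>r\<bar> * nrm u"
  unfolding wL2_norm_def e by (simp add: real_sqrt_mult)
qed

lemma wL2_zero: "(%x. 0) \<in> wsp" "nrm (%x. 0) = 0"
 by (auto simp: wL2_def wL2_norm_def)

lemma wL2_diff:
 fixes u v :: "'a => 'b::euclidean_space"
 assumes u: "u \<in> wsp" and v: "v \<in> wsp"
 shows "(%x. u x - v x) \<in> wsp"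
  "nrm (%x. u x - v x) \<le> nrm u + nrm v"
 using wL2_add[OF u wL2_cmult(1)[OF v, of "-1"]] wL2_cmult(2)[OF v, of "-1"] by auto

lemma wL2_norm_minus_commute:
 "nrm (%x. u x - v x) = nrm (%x. v x - (u x :: 'b::euclidean_space))"
 unfolding wL2_norm_def by (simp add: norm_minus_commute)

lemma wL2_norm_diff_triangle:
 fixes u v w :: "'a => 'b::euclidean_space"
 assumes "u \<in> wsp" "v \<in> wsp" "w \<in> wsp"
 shows "nrm (%x. u x - w x) \<le> nrm (%x. u x - v x) + nrm (%x. v x - w x)"
 using wL2_add(2)[OF wL2_diff(1)[OF assms(1,2)] wL2_diff(1)[OF assms(2,3)]] by simp

lemma wL2_norm_triangle_diff:
 fixes u v :: "'a => 'b::euclidean_space"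
 assumes "u \<in> wsp" "v \<in> wsp"
 shows "\<bar>nrm u - nrm v\<bar> \<le> nrm (%x. u x - v x)"
 using wL2_add(2)[OF wL2_diff(1)[OF assms] assms(2)] wL2_add(2)[OF wL2_diff(1)[OF assms(2,1)] assms(1)]
  wL2_norm_minus_commute[of u v] by simp

lemma wL2_sum:
 fixes u :: "'i => 'a => 'b::euclidean_space"
 assumes "finite I" "\<And>i. i \<in> I ==> u i \<in> wsp"
 shows "(%x. \<Sum>i\<in>I. u i x) \<in> wsp"
 using assms by (induction rule: finite_induct) (auto simp: wL2_zero wL2_add)

lemma wL2_inner_bound:
 fixes u v :: "'a => 'b::euclidean_space"
 assumes u: "u \<in> wsp" and v: "v \<in> wsp"
 shows "intg S (%x. \<omega> x * (u x \<bullet> v x))"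
  "\<bar>lint S (%x. \<omega> x * (u x \<bullet> v x))\<bar> \<le> nrm u * nrm v"
proof -
 have [measurable]: "u \<in> meas S" "v \<in> meas S"
  using wL2D u v by auto
 have m: "(%x. u x \<bullet> v x) \<in> meas S" by measurable
 have b: "AE x in leb S. \<bar>u x \<bullet> v x\<bar> \<le> 1 * (norm (u x) * norm (v x))"
  using Cauchy_Schwarz_ineq2 by auto
 show "intg S (%x. \<omega> x * (u x \<bullet> v x))"
  "\<bar>lint S (%x. \<omega> x * (u x \<bullet> v x))\<bar> \<le> nrm u * nrm v"
  using dominated_bilinear[OF u v m b] by auto
qed

lemma wL2_norm_cong_AE:
 fixes u v :: "'a => 'b::euclidean_space"
 assumes "AE x in leb S. u x = v x"
  and [measurable]: "u \<in> meas S" "v \<in> meas S"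
 shows "nrm u = nrm v"
proof -
 have ae: "AE x in leb S. \<omega> x * (norm (u x))^2 = \<omega> x * (norm (v x))^2"
  using assms(1) by eventually_elim simp
 have "(lint S (%x. \<omega> x * (norm (u x))^2)) = (lint S (%x. \<omega> x * (norm (v x))^2))"
  by (rule integral_cong_AE[OF _ _ ae]) measurable
 then show ?thesis unfolding wL2_norm_def by simp
qed

lemma wL2_cong_AE:
 fixes u v :: "'a => 'b::euclidean_space"
 assumes "AE x in leb S. u x = v x"
  and u: "u \<in> wsp" and [measurable]: "v \<in> meas S"
 shows "v \<in> wsp"
proof -
 have [measurable]: "u \<in> meas S" using wL2D u by auto
 have ae: "AE x in leb S. \<omega> x * (norm (u x))^2 = \<omega> x * (norm (v x))^2"
  using assms(1) by eventually_elim simp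
 have "intg S (%x. \<omega> x * (norm (v x))^2)"
  by (rule integrable_cong_AE[THEN iffD1, OF _ _ ae wL2D(2)[OF u]]) measurable
 then show ?thesis by (simp add: wL2_def)
qed

lemma wL2_norm_eq_0:
 fixes u :: "'a => 'b::euclidean_space"
 assumes u: "u \<in> wsp" and 0: "nrm u = 0"
 shows "AE x in leb S. u x = 0"
proof -
 have "(lint S (%x. \<omega> x * (norm (u x))^2)) = 0" using norm_sq[of u] 0 by simp
 moreover have "AE x in leb S. 0 \<le> \<omega> x * (norm (u x))^2"
  using pos_\<omega> by (intro AE_I2) (auto simp: less_imp_le)
 ultimately have "AE x in leb S. \<omega> x * (norm (u x))^2 = 0"
  using integral_nonneg_eq_0_iff_AE[OF wL2D(2)[OF u]] by blast
 then show ?thesis using AE_space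
 proof eventually_elim
  case (elim x)
  then show ?case using pos_\<omega>[of x] by simp
 qed
qed

lemma compact_lower_bound:
 assumes "compact K" "K \<subseteq> S"
 obtains m where "m > 0" "\<And>x. x \<in> K ==> m \<le> \<omega> x"
proof (cases "K = {}")
 case False
 obtain y where "y \<in> K" "\<And>x. x \<in> K ==> \<omega> y \<le> \<omega> x"
  using continuous_attains_inf[OF assms(1) False continuous_on_subset[OF cont_\<omega> assms(2)]] by blast
 then show ?thesis using that[of "\<omega> y"] pos_\<omega> assms(2) by blast
qed (use that[of 1] in auto)

text \<open>The integral of v zeta is the weighted inner product of v with zeta / omega. The latter
  lies in the weighted space because omega is bounded below on the compact set that carries
  zeta.\<close>

lemma compact_pairing:
 fixes v \<zeta> :: "'a => real"
 assumes v: "v \<in> wsp" and \<zeta>[measurable]: "\<zeta> \<in> borel_measurable borel" and B: "\<And>x. \<bar>\<zeta> x\<bar> \<le> B"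
  and K: "compact K" "K \<subseteq> S" "\<And>x. x \<notin> K ==> \<zeta> x = 0"
 shows "intg S (%x. v x * \<zeta> x)"
  "\<exists>C. \<forall>v\<in>wsp. \<bar>lint S (%x. v x * \<zeta> x)\<bar> \<le> C * nrm v"
proof -
 obtain m where m: "m > 0" "\<And>x. x \<in> K ==> m \<le> \<omega> x" using compact_lower_bound[OF K(1,2)] by blast
 have zm[measurable]: "\<zeta> \<in> meas S" by (rule borel_imp_lebesgue_on[OF \<zeta>])
 have B0: "0 \<le> B" using B[of undefined] by simp
 have zi: "(%x. \<zeta> x / \<omega> x) \<in> wsp"
  unfolding wL2_def
 proof (intro CollectI conjI)
  show "(%x. \<zeta> x / \<omega> x) \<in> meas S" by measurable
  have Kl: "K \<in> sets lebesgue" using K(1) by (simp add: borel_compact)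
  have fin: "emeasure lebesgue K < \<infinity>" using emeasure_compact_finite[OF K(1)] K(1) by (simp add: borel_compact)
  have "integrable lebesgue (%x. ind K x *\<^sub>R (B\<^sup>2 / m))"
   using Kl fin by (intro integrable_scaleR_left integrable_real_indicator) auto
  then have "integrable lebesgue (%x. ind S x *\<^sub>R (ind K x *\<^sub>R (B\<^sup>2 / m)))"
   by (rule integrable_mult_indicator[OF sets_lebesgue_open[OF open_S]])
  then have i: "intg S (%x. ind K x *\<^sub>R (B\<^sup>2 / m))"
   unfolding integrable_lebesgue_on_open[OF open_S] .
  show "intg S (%x. \<omega> x * (norm (\<zeta> x / \<omega> x))^2)"
  proof (rule intg_bound[OF i])
   show "AE x in leb S. norm (\<omega> x * (norm (\<zeta> x / \<omega> x))^2) \<le> norm (ind K x *\<^sub>R (B\<^sup>2 / m))"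
   proof (rule AE_I2)
    fix x assume "x \<in> space (leb S)"
    then have x: "0 < \<omega> x" using pos_\<omega> by simp
    show "norm (\<omega> x * (norm (\<zeta> x / \<omega> x))^2) \<le> norm (ind K x *\<^sub>R (B\<^sup>2 / m))"
    proof (cases "x \<in> K")
     case True
     have "\<omega> x * (norm (\<zeta> x / \<omega> x))^2 = (\<zeta> x)^2 / \<omega> x"
      using x by (simp add: power2_eq_square divide_simps)
     also have "\<dots> \<le> B\<^sup>2 / m"
      using m True B[of x] by (intro frac_le) (auto simp: abs_le_square_iff[symmetric] B0)
     finally show ?thesis using True x m by (simp add: abs_mult)
    next
     case False then show ?thesis using K(3) by simp
    qed
   qed
  qed measurable
 qed
 have e: "\<omega> x * (v x \<bullet> (\<zeta> x / \<omega> x)) = v x * \<zeta> x" if "x \<in> S" for x v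
  using pos_\<omega>[OF that] by simp
 have e': "(lint S (%x. \<omega> x * (v x \<bullet> (\<zeta> x / \<omega> x)))) = (lint S (%x. v x * \<zeta> x))" for v
  by (rule integral_lebesgue_on_cong[OF e])
 show "intg S (%x. v x * \<zeta> x)"
  by (rule integrable_lebesgue_on_cong[OF _ wL2_inner_bound(1)[OF v zi]]) (rule e)
 show "\<exists>C. \<forall>v\<in>wsp. \<bar>lint S (%x. v x * \<zeta> x)\<bar> \<le> C * nrm v"
 proof (intro exI ballI)
  fix v :: "'a => real" assume "v \<in> wsp"
  from wL2_inner_bound(2)[OF this zi]
  show "\<bar>lint S (%x. v x * \<zeta> x)\<bar> \<le> nrm (%x. \<zeta> x / \<omega> x) * nrm v"
   unfolding e' by (simp add: mult.commute)
 qed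
qed

lemma wL2_locally_integrable:
 fixes v :: "'a => real"
 assumes v: "v \<in> wsp"
 shows "locint S v"
proof (rule locally_integrableI)
 fix K assume K: "compact K" "K \<subseteq> S"
 have "intg S (%x. v x * ind K x)"
  by (rule compact_pairing(1)[OF v _ _ K, where B = 1]) (use K in \<open>auto intro!: borel_measurable_indicator borel_compact split: split_indicator\<close>)
 then have "integrable lebesgue (%x. ind S x *\<^sub>R (v x * ind K x))"
  unfolding integrable_lebesgue_on_open[OF open_S] .
 moreover have "ind S x *\<^sub>R (v x * ind K x) = ind K x * v x" for x
  using K(2) by (auto simp: indicator_def)
 ultimately show "integrable lebesgue (%x. ind K x * v x)" by (simp only:)
qed

lemma wL2_pairing_tendsto:
 fixes v :: "'a => real" and w :: "nat => 'a => real"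
 assumes v: "v \<in> wsp" and w: "\<And>n. w n \<in> wsp"
  and lim: "null (%n. nrm (%x. v x - w n x))"
  and \<zeta>: "\<zeta> \<in> borel_measurable borel" "\<And>x. \<bar>\<zeta> x\<bar> \<le> B"
  and K: "compact K" "K \<subseteq> S" "\<And>x. x \<notin> K ==> \<zeta> x = 0"
 shows "(%n. lint S (%x. w n x * \<zeta> x)) \<longlonglongrightarrow> (lint S (%x. v x * \<zeta> x))"
proof -
 obtain C where C: "\<And>v. v \<in> wsp ==> \<bar>lint S (%x. v x * \<zeta> x)\<bar> \<le> C * nrm v"
  using compact_pairing(2)[OF v \<zeta> K] by blast
 have "null (%n. (lint S (%x. v x * \<zeta> x)) - (lint S (%x. w n x * \<zeta> x)))"
 proof (rule Lim_null_comparison)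
  show "\<forall>\<^sub>F n in sequentially. norm ((lint S (%x. v x * \<zeta> x)) - (lint S (%x. w n x * \<zeta> x))) \<le> C * nrm (%x. v x - w n x)"
  proof (intro always_eventually allI)
   fix n
   have "(lint S (%x. v x * \<zeta> x)) - (lint S (%x. w n x * \<zeta> x)) = (lint S (%x. (v x - w n x) * \<zeta> x))"
    using compact_pairing(1)[OF v \<zeta> K] compact_pairing(1)[OF w \<zeta> K] by (simp add: left_diff_distrib)
   then show "norm ((lint S (%x. v x * \<zeta> x)) - (lint S (%x. w n x * \<zeta> x))) \<le> C * nrm (%x. v x - w n x)"
    using C[OF wL2_diff(1)[OF v w]] by simp
  qed
  show "null (%n. C * nrm (%x. v x - w n x))"
   using tendsto_mult_left[OF lim, of C] by simp
 qed
 then have "(%n. (lint S (%x. v x * \<zeta> x)) - ((lint S (%x. v x * \<zeta> x)) - (lint S (%x. w n x * \<zeta> x))))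
   \<longlonglongrightarrow> (lint S (%x. v x * \<zeta> x)) - 0"
  by (intro tendsto_diff tendsto_const)
 then show ?thesis by simp
qed

lemma wL2_pairing_test_tendsto:
 fixes v :: "'a => real" and w :: "nat => 'a => real"
 assumes v: "v \<in> wsp" and w: "\<And>n. w n \<in> wsp"
  and lim: "null (%n. nrm (%x. v x - w n x))" and \<zeta>: "\<zeta> \<in> TF S"
 shows "(%n. lint S (%x. w n x * \<zeta> x)) \<longlonglongrightarrow> (lint S (%x. v x * \<zeta> x))"
proof -
 obtain B where B: "\<And>x. \<bar>\<zeta> x\<bar> \<le> B" by (rule test_bounded[OF \<zeta>]) blast
 obtain K where K: "compact K" "K \<subseteq> S" "\<And>x. x \<notin> K ==> \<zeta> x = 0" by (rule testE[OF \<zeta>]) blast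
 show ?thesis
  by (rule wL2_pairing_tendsto[OF v w lim smooth_borel[OF test_smooth[OF \<zeta>]] B K])
qed

lemma test_in_wL2:
 assumes \<zeta>: "\<zeta> \<in> TF S"
 shows "\<zeta> \<in> wsp"
proof -
 have l: "locint S (%x. \<omega> x * \<zeta> x)"
  by (intro locint_continuous continuous_on_mult cont_\<omega> smooth_continuous_on test_smooth[OF \<zeta>])
 have "intg S (%x. \<omega> x * (norm (\<zeta> x))^2)"
  using locint_test[OF open_S l \<zeta>] by (simp add: power2_eq_square mult.assoc)
 then show ?thesis
  unfolding wL2_def using borel_imp_lebesgue_on[OF smooth_borel[OF test_smooth[OF \<zeta>]]] by blast
qed

end

text \<open>Both sides of the defining identity are continuous functionals of w and v. Two weights
  are allowed because a function and its derivative are approximated in spaces with different powers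
  of y.\<close>

lemma hwd_limit:
 assumes b: "b \<in> Basis"
  and W1: "pos_weight S \<omega>1" and W2: "pos_weight S \<omega>2"
  and w: "w \<in> wL2 S \<omega>1" "\<And>n. wn n \<in> wL2 S \<omega>1" "null (%n. wL2_norm S \<omega>1 (%x. w x - wn n x))"
  and v: "v \<in> wL2 S \<omega>2" "\<And>n. vn n \<in> wL2 S \<omega>2" "null (%n. wL2_norm S \<omega>2 (%x. v x - vn n x))"
  and d: "\<And>n. hwd S b k (wn n) (vn n)"
 shows "hwd S b k w v"
 unfolding has_weak_deriv_def
proof (intro conjI ballI)
 show "locint S w" "locint S v"
  using pos_weight.wL2_locally_integrable W1 W2 w v by blast+
 fix \<zeta> assume \<zeta>: "\<zeta> \<in> TF S"
 have "(%n. lint S (%x. wn n x * (dd b ^^ k) \<zeta> x)) \<longlonglongrightarrow> (lint S (%x. w x * (dd b ^^ k) \<zeta> x))"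
  by (rule pos_weight.wL2_pairing_test_tendsto[OF W1 w test_dir_deriv_pow[OF \<zeta> b]])
 moreover have "(%n. (-1) ^ k * (lint S (%x. vn n x * \<zeta> x))) \<longlonglongrightarrow> (-1) ^ k * (lint S (%x. v x * \<zeta> x))"
  by (intro tendsto_mult tendsto_const pos_weight.wL2_pairing_test_tendsto[OF W2 v \<zeta>])
 ultimately show "(lint S (%x. w x * (dd b ^^ k) \<zeta> x)) = (-1) ^ k * (lint S (%x. v x * \<zeta> x))"
  unfolding hwdD(3)[OF d \<zeta>] using LIMSEQ_unique by blast
qed

section \<open>Weak derivatives on an interval\<close>

lemma integral_lebesgue_on_subset:
 fixes f :: "'a::euclidean_space => real"
 assumes "open S" "open S'" "S' \<subseteq> S"
 shows "(lint S (%x. ind S' x * f x)) = integral\<^sup>L (leb S') f"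
  "intg S f ==> intg S' f"
  "intg S f ==> intg S (%x. ind S' x * f x)"
proof -
 have e: "ind S x *\<^sub>R (ind S' x * f x) = ind S' x *\<^sub>R f x"
  and e': "ind S x *\<^sub>R (ind S' x * f x) = ind S' x *\<^sub>R (ind S x *\<^sub>R f x)" for x
  using assms(3) by (auto simp: indicator_def)
 show "(lint S (%x. ind S' x * f x)) = integral\<^sup>L (leb S') f"
  unfolding integral_lebesgue_on_open[OF assms(1)] integral_lebesgue_on_open[OF assms(2)] e ..
 assume "intg S f"
 then have "integrable lebesgue (%x. ind S' x *\<^sub>R (ind S x *\<^sub>R f x))"
  unfolding integrable_lebesgue_on_open[OF assms(1)] by (rule integrable_mult_indicator[OF sets_lebesgue_open[OF assms(2)]])
 then show "intg S' f" "intg S (%x. ind S' x * f x)"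
  unfolding integrable_lebesgue_on_open[OF assms(1)] integrable_lebesgue_on_open[OF assms(2)] e e'[symmetric] by simp_all
qed

text \<open>Both iterated integrals integrate p r * q s over the triangle r < s.\<close>

lemma Fubini_triangle:
 fixes p q :: "real => real"
 assumes p: "intg {0<..<T} p" and q: "intg {0<..<T} q"
 shows "(lint {0<..<T} (%s. q s * lint {0<..<s} p))
  = (lint {0<..<T} (%r. p r * lint {r<..<T} q))"
  "intg {0<..<T} (%s. q s * lint {0<..<s} p)"
proof -
 let ?S = "{0<..<T}"
 have S: "open ?S" by simp
 have i0: "intg (?S \<times> ?S) (%z. p (fst z) * q (snd z))"
  by (rule lebesgue_on_tensor_integrable(1)[OF S S p q])
 have D: "open ({z. fst z < snd z} \<inter> ?S \<times> ?S)"
  by (intro open_Int open_Times S open_Collect_less continuous_intros)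
 have "intg (?S \<times> ?S) (%z. ind ({z. fst z < snd z} \<inter> ?S \<times> ?S) z * (p (fst z) * q (snd z)))"
  by (rule integral_lebesgue_on_subset(3)[OF open_Times[OF S S] D _ i0]) auto
 then have i: "intg (?S \<times> ?S) (%z. ind {z. fst z < snd z} z * (p (fst z) * q (snd z)))"
  by (rule integrable_lebesgue_on_cong[rotated]) (auto simp: indicator_def)
 note F = lebesgue_on_Fubini[OF S S i]
 have a: "(lint ?S (%x. ind {z. fst z < snd z} (x, y) * (p (fst (x, y)) * q (snd (x, y)))))
   = q y * lint {0<..<y} p" if "y \<in> ?S" for y
 proof -
  have "(lint ?S (%x. ind {z. fst z < snd z} (x, y) * (p (fst (x, y)) * q (snd (x, y)))))
    = (lint ?S (%x. q y * (ind {0<..<y} x * p x)))"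
   by (rule integral_lebesgue_on_cong) (auto simp: indicator_def)
  also have "\<dots> = q y * lint {0<..<y} p"
  proof -
   have "{0<..<y} \<subseteq> ?S" using that by auto
   then show ?thesis by (subst integral_mult_right_zero) (simp add: integral_lebesgue_on_subset(1))
  qed
  finally show ?thesis .
 qed
 have b: "(lint ?S (%y. ind {z. fst z < snd z} (x, y) * (p (fst (x, y)) * q (snd (x, y)))))
   = p x * lint {x<..<T} q" if "x \<in> ?S" for x
 proof -
  have "(lint ?S (%y. ind {z. fst z < snd z} (x, y) * (p (fst (x, y)) * q (snd (x, y)))))
    = (lint ?S (%y. p x * (ind {x<..<T} y * q y)))"
   by (rule integral_lebesgue_on_cong) (auto simp: indicator_def)
  also have "\<dots> = p x * lint {x<..<T} q"
  proof -
   have "{x<..<T} \<subseteq> ?S" using that by auto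
   then show ?thesis by (subst integral_mult_right_zero) (simp add: integral_lebesgue_on_subset(1))
  qed
  finally show ?thesis .
 qed
 show "intg ?S (%s. q s * lint {0<..<s} p)"
  by (rule integrable_lebesgue_on_cong[OF a F(2)])
 have A: "(lint ?S (%y. lint ?S (%x. ind {z. fst z < snd z} (x, y) * (p (fst (x, y)) * q (snd (x, y))))))
   = (lint ?S (%s. q s * lint {0<..<s} p))"
  by (rule integral_lebesgue_on_cong[OF a])
 have B: "(lint ?S (%x. lint ?S (%y. ind {z. fst z < snd z} (x, y) * (p (fst (x, y)) * q (snd (x, y))))))
   = (lint ?S (%r. p r * lint {r<..<T} q))"
  by (rule integral_lebesgue_on_cong[OF b])
 show "(lint ?S (%s. q s * lint {0<..<s} p))
  = (lint ?S (%r. p r * lint {r<..<T} q))"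
  by (rule trans[OF A[symmetric] trans[OF F(3) trans[OF F(6)[symmetric] B]]])
qed

lemma integral_interval_split:
 fixes p :: "real => real"
 assumes p: "intg {0<..<T} p" and t: "0 \<le> t" "t \<le> T"
 shows "lint {0<..<T} p = lint {0<..<t} p + lint {t<..<T} p"
proof -
 have s: "{0<..<t} \<subseteq> {0<..<T}" "{t<..<T} \<subseteq> {0<..<T}" using t by auto
 note i1 = integral_lebesgue_on_subset[OF open_ivl open_ivl s(1), of p]
 note i2 = integral_lebesgue_on_subset[OF open_ivl open_ivl s(2), of p]
 have ae: "AE x in leb {0<..<T}. p x = ind {0<..<t} x * p x + ind {t<..<T} x * p x"
 proof -
  have "AE x in lebesgue. x \<notin> {t}" by (rule AE_not_in) (simp add: negligible_iff_null_sets[symmetric])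
  then show ?thesis
   unfolding AE_lebesgue_on_open[OF open_ivl] by eventually_elim (auto simp: indicator_def)
 qed
 have "lint {0<..<T} p = (lint {0<..<T} (%x. ind {0<..<t} x * p x + ind {t<..<T} x * p x))"
  using integrable_AE_lebesgue_on(2)[OF open_ivl p ae] by simp
 also have "\<dots> = lint {0<..<t} p + lint {t<..<T} p"
  using i1(1) i2(1) i1(3)[OF p] i2(3)[OF p] by simp
 finally show ?thesis .
qed

text \<open>The two triangles of the square contribute equally, by symmetry. This is the chain rule
  for the square of an indefinite integral, without any pointwise derivative.\<close>

lemma square_integral:
 fixes p :: "real => real"
 assumes p: "intg {0<..<T} p"
 shows "2 * (lint {0<..<T} (%s. p s * lint {0<..<s} p)) = (lint {0<..<T} p)^2"
proof -
 let ?I = "lint {0<..<T} p"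
 have "(lint {0<..<T} (%r. p r * lint {r<..<T} p))
   = (lint {0<..<T} (%r. p r * ?I - p r * lint {0<..<r} p))"
 proof (rule integral_lebesgue_on_cong)
  fix r assume "r \<in> {0<..<T}"
  then show "p r * lint {r<..<T} p = p r * ?I - p r * lint {0<..<r} p"
   using integral_interval_split[OF p, of r] by (simp add: distrib_left)
 qed
 also have "\<dots> = ?I * ?I - (lint {0<..<T} (%s. p s * lint {0<..<s} p))"
  using p Fubini_triangle(2)[OF p p] by simp
 finally show ?thesis using Fubini_triangle(1)[OF p p] by (simp add: power2_eq_square)
qed

lemma square_indefinite_integral:
 fixes p P :: "real => real"
 assumes p: "intg {0<..<T} p" and t: "0 \<le> t" "t \<le> T"
  and P: "\<And>s. s \<in> {0..T} ==> P s = c + lint {0<..<s} p"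
 shows "(P t)^2 = c\<^sup>2 + 2 * (lint {0<..<t} (%s. P s * p s))"
  "intg {0<..<t} (%s. P s * p s)"
proof -
 have s: "{0<..<t} \<subseteq> {0<..<T}" using t by auto
 have pt: "intg {0<..<t} p"
  by (rule integral_lebesgue_on_subset(2)[OF open_ivl open_ivl s p])
 let ?I = "%s. lint {0<..<s} p"
 have e: "c * p s + p s * ?I s = P s * p s" if "s \<in> {0<..<t}" for s
  using P[of s] that t by (simp add: algebra_simps)
 have i: "intg {0<..<t} (%s. c * p s + p s * ?I s)"
  using pt Fubini_triangle(2)[OF pt pt] by simp
 show "intg {0<..<t} (%s. P s * p s)" by (rule integrable_lebesgue_on_cong[OF e i])
 have "(lint {0<..<t} (%s. P s * p s)) = (lint {0<..<t} (%s. c * p s + p s * ?I s))"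
  by (rule integral_lebesgue_on_cong[OF e[symmetric]])
 also have "\<dots> = c * ?I t + (lint {0<..<t} (%s. p s * ?I s))"
  using pt Fubini_triangle(2)[OF pt pt] by simp
 finally show "(P t)^2 = c\<^sup>2 + 2 * (lint {0<..<t} (%s. P s * p s))"
  using P[of t] t square_integral[OF pt] by (simp add: power2_eq_square algebra_simps)
qed

text \<open>The integral from 0 vanishes to the left of the support, and to its right because the
  total integral is 0; so it is again a test function.\<close>

lemma test_antiderivative:
 fixes \<eta> :: "real => real"
 assumes \<eta>: "\<eta> \<in> TF {0<..<T}" and 0: "integral\<^sup>L lebesgue \<eta> = 0"
 obtains N where "N \<in> TF {0<..<T}" "dd 1 N = \<eta>"
proof -
 have sm: "smooth \<eta>" using \<eta> by (rule test_smooth)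
 obtain K where K: "compact K" "K \<subseteq> {0<..<T}" "\<And>x. x \<notin> K ==> \<eta> x = 0" by (rule testE[OF \<eta>]) blast
 obtain a b where ab: "0 < a" "b < T" "K \<subseteq> {a..b}"
 proof (cases "K = {}")
  case True
  show ?thesis by (rule that[of 1 "T - 1"]) (use True in auto)
 next
  case False
  obtain a where "a \<in> K" "\<forall>x\<in>K. a \<le> x" using compact_attains_inf[OF K(1) False] by blast
  moreover obtain b where "b \<in> K" "\<forall>x\<in>K. x \<le> b" using compact_attains_sup[OF K(1) False] by blast
  ultimately show ?thesis using K(2) by (intro that[of a b]) auto
 qed
 define N where "N = (%x. integral {0..x} \<eta>)"
 have e0: "\<eta> x = 0" if "x \<notin> {a..b}" for x using K(3) ab that by blast
 have Na: "N x = 0" if "x < a" for x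
 proof -
  have "N x = integral {0..x} (%_. 0)" unfolding N_def
   by (rule Henstock_Kurzweil_Integration.integral_cong) (use e0 that in auto)
  then show ?thesis by simp
 qed
 have ii: "integrable lebesgue \<eta>"
  using locint_test[OF open_UNIV locint_continuous[of UNIV "%_. 1"], of \<eta>] \<eta>
   test_mono[of "{0<..<T}" UNIV] by (auto simp: lebesgue_on_UNIV_eq)
 have Nb: "N x = 0" if "x > b" for x
 proof -
  have "\<eta> integrable_on {0..x}" by (intro integrable_continuous_real smooth_continuous_on sm)
  then have "(\<eta> has_integral N x) {0..x}" unfolding N_def by (rule integrable_integral)
  then have "(\<eta> has_integral N x) UNIV"
  proof (rule has_integral_on_superset)
   fix y assume "y \<notin> {0..x}" then show "\<eta> y = 0" using e0[of y] ab that by auto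
  qed auto
  moreover have "(\<eta> has_integral 0) UNIV" using has_integral_integral_lebesgue[OF ii] 0 by simp
  ultimately show ?thesis using has_integral_unique by blast
 qed
 have der: "(N has_real_derivative \<eta> x) (at x)" for x
 proof (cases "x > 0")
  case True
  have "(N has_real_derivative \<eta> x) (at x within {0..x+1})"
   unfolding N_def by (rule integral_has_real_derivative) (use True in \<open>auto intro: smooth_continuous_on[OF sm]\<close>)
  moreover have "x \<in> interior {0..x+1}" using True by simp
  ultimately show ?thesis using at_within_interior by metis
 next
  case False
  have "\<forall>\<^sub>F y in nhds x. 0 = N y"
   unfolding eventually_nhds using False ab Na by (intro exI[of _ "{..<a}"]) auto
  then have "(N has_real_derivative 0) (at x)" using DERIV_cong_ev[of x x "%_. 0" N 0 0] by simp
  then show ?thesis using e0[of x] False ab by simp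
 qed
 have Nsm: "smooth N"
 proof (rule smooth_real_iff[where F = "insert N {f. smooth f}"])
  fix f assume "f \<in> insert N {f. smooth f}"
  then show "\<exists>g\<in>insert N {f. smooth f}. \<forall>x. (f has_real_derivative g x) (at x)"
  proof
   assume "f = N" then show ?thesis using der sm by blast
  next
   assume "f \<in> {f. smooth f}"
   then have f: "smooth f" by simp
   have "smooth (dd 1 f)" by (rule smooth_dir_deriv[OF f]) auto
   then show ?thesis using smooth_has_real_derivative[OF f] by blast
  qed
 qed simp
 show ?thesis
 proof (rule that)
  show "N \<in> TF {0<..<T}"
   by (rule testI[OF Nsm, of "{a..b}"]) (use ab Na Nb in \<open>force simp: not_le\<close>)+
  show "dd 1 N = \<eta>" using dir_deriv_real[OF der] by auto
 qed
qed

text \<open>The set where d differs from k is open and null, hence empty.\<close>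

lemma AE_eq_const_continuous:
 fixes d :: "'a::euclidean_space => real"
 assumes S: "open S" and d: "continuous_on S d" and ae: "AE x in leb S. d x = k"
 shows "\<forall>x\<in>S. d x = k"
proof (rule ccontr)
 assume "\<not> ?thesis"
 then have ne: "S \<inter> d -` (- {k}) \<noteq> {}" by auto
 have op: "open (S \<inter> d -` (- {k}))" by (rule continuous_open_preimage[OF d S]) auto
 have "AE x in lebesgue. x \<notin> S \<inter> d -` (- {k})"
  using ae unfolding AE_lebesgue_on_open[OF S] by eventually_elim auto
 then have "S \<inter> d -` (- {k}) \<in> null_sets lebesgue"
  using op by (subst (asm) AE_iff_null_sets[symmetric]) auto
 then have "negligible (S \<inter> d -` (- {k}))" by (simp add: negligible_iff_null_sets)
 then show False using open_not_negligible[OF op ne] by blast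
qed

text \<open>The argument of du Bois-Reymond. Subtracting the right multiple of a fixed test function
  \<open>\<xi>\<close> with nonzero integral gives any test function mean 0, hence makes it the
  derivative of a test function, against which d integrates to 0.\<close>

lemma weak_deriv_zero_const:
 fixes d :: "real => real"
 assumes T: "0 < T" and d: "continuous_on {0..T} d" and w: "hwd {0<..<T} 1 1 d (%_. 0)"
 shows "\<forall>t\<in>{0..T}. d t = d 0"
proof -
 let ?S = "{0<..<T}"
 have S: "open ?S" by simp
 define \<xi> where "\<xi> = box_bump 0 (T/4) (T/2)"
 have \<xi>: "\<xi> \<in> TF ?S" unfolding \<xi>_def by (rule box_bump_test) (use T in auto)
 have int: "integrable lebesgue \<zeta>" "(lint ?S (%x. d x * \<zeta> x)) = (lint ?S (%x. d x * \<zeta> x))"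
  if "\<zeta> \<in> TF ?S" for \<zeta>
  using locint_test[OF open_UNIV locint_continuous[of UNIV "%_. 1"], of \<zeta>] that
   test_mono[of ?S UNIV] by (auto simp: lebesgue_on_UNIV_eq)
 have \<xi>0: "integral\<^sup>L lebesgue \<xi> \<noteq> 0"
 proof
  assume "integral\<^sup>L lebesgue \<xi> = 0"
  then have "AE x in lebesgue. \<xi> x = 0"
   using integral_nonneg_eq_0_iff_AE[OF int(1)[OF \<xi>]] by (simp add: \<xi>_def box_bump_bounds)
  then have "AE x in leb (box (T/4) (T/2)). \<xi> x = 0"
   unfolding AE_lebesgue_on_open[OF open_box] by eventually_elim simp
  then have "\<forall>x\<in>box (T/4) (T/2). \<xi> x = 0"
   by (rule AE_eq_const_continuous[OF open_box smooth_continuous_on[OF test_smooth[OF \<xi>]]])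
  moreover have "3 * T / 8 \<in> box (T/4) (T/2)" using T by (auto simp: box_real)
  ultimately have "\<xi> (3 * T / 8) = 0" by blast
  then show False using T by (simp add: \<xi>_def box_bump_def smooth_step_def)
 qed
 \<comment> \<open>The candidate for the constant: the average of d with respect to
   \<open>\<xi>\<close>.\<close>
 define k where "k = (lint ?S (%x. d x * \<xi> x)) / integral\<^sup>L lebesgue \<xi>"
 have ld: "locint ?S d"
  by (rule locint_continuous[OF continuous_on_subset[OF d]]) auto
 have onS: "lint ?S \<zeta> = integral\<^sup>L lebesgue \<zeta>" if z: "\<zeta> \<in> TF ?S" for \<zeta>
 proof -
  obtain K where K: "K \<subseteq> ?S" "\<And>x. x \<notin> K ==> \<zeta> x = 0" by (rule testE[OF z]) blast
  have e: "ind ?S x *\<^sub>R \<zeta> x = \<zeta> x" for x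
  proof (cases "x \<in> ?S")
   case False
   then have "x \<notin> K" using K(1) by blast
   then show ?thesis using K(2) by simp
  qed simp
  show ?thesis unfolding integral_lebesgue_on_open[OF S] e ..
 qed
 have "AE x in leb ?S. d x - k = 0"
 proof (rule fundamental_lemma_variations[OF S locint_diff[OF ld locint_continuous]])
  fix \<zeta> assume \<zeta>: "\<zeta> \<in> TF ?S"
  define c where "c = integral\<^sup>L lebesgue \<zeta> / integral\<^sup>L lebesgue \<xi>"
  have \<eta>: "(%x. \<zeta> x - c * \<xi> x) \<in> TF ?S"
   by (intro test_diff test_cmult \<zeta> \<xi>)
  have "integral\<^sup>L lebesgue (%x. \<zeta> x - c * \<xi> x) = 0"
   using int(1)[OF \<zeta>] int(1)[OF \<xi>] \<xi>0 by (simp add: c_def)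
  then obtain N where N: "N \<in> TF ?S" "dd 1 N = (%x. \<zeta> x - c * \<xi> x)"
   using test_antiderivative[OF \<eta>] by blast
  have "(lint ?S (%x. d x * (\<zeta> x - c * \<xi> x))) = 0"
   using hwdD(3)[OF w N(1)] N(2) by simp
  then have "(lint ?S (%x. d x * \<zeta> x)) = c * (lint ?S (%x. d x * \<xi> x))"
   using locint_test[OF S ld \<zeta>] locint_test[OF S ld \<xi>]
   by (simp add: right_diff_distrib mult.left_commute[of _ c])
  also have "\<dots> = k * lint ?S \<zeta>"
   unfolding onS[OF \<zeta>] by (simp add: c_def k_def)
  finally show "(lint ?S (%x. (d x - k) * \<zeta> x)) = 0"
   using locint_test[OF S ld \<zeta>] locint_test[OF S locint_continuous[of ?S "%_. k"] \<zeta>]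
   by (simp add: left_diff_distrib)
 qed auto
 then have "AE x in leb ?S. d x = k" by eventually_elim simp
 moreover have "continuous_on ?S d" by (rule continuous_on_subset[OF d]) auto
 ultimately have "\<forall>x\<in>?S. d x = k" using AE_eq_const_continuous[OF S] by blast
 moreover have "closure ?S = {0..T}" using T by simp
 ultimately have "d t = k" if "t \<in> {0..T}" for t
  using continuous_constant_on_closure[of ?S d k t] d that by simp
 then show ?thesis using T by simp
qed

text \<open>The Lebesgue integral over the open interval from 0 to t equals the Henstock-Kurzweil
  integral over the closed one, whose continuity in t is at hand.\<close>

lemma indefinite_integral_continuous_on:
 fixes v :: "real => real"
 assumes v: "intg {0<..<T} v"
 shows "continuous_on {0..T} (%t. lint {0<..<t} v)"
proof -
 define f where "f = (%x. ind {0<..<T} x *\<^sub>R v x)"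
 have f: "integrable lebesgue f" using v unfolding f_def integrable_lebesgue_on_open[OF open_ivl] .
 have "intg {0..T} f"
  by (rule integrable_restrict_space[THEN iffD2]) (use integrable_mult_indicator[OF _ f, of "{0..T}"] in auto)
 then have "f integrable_on {0..T}" by (rule integrable_on_lebesgue_on) auto
 then have c: "continuous_on {0..T} (%t. integral {0..t} f)" by (rule indefinite_integral_continuous_1)
 show ?thesis
 proof (rule continuous_on_eq[OF c])
  fix t assume t: "t \<in> {0..T}"
  then have "{0<..<t} \<subseteq> {0<..<T}" by auto
  then have e: "ind {0<..<t} x *\<^sub>R v x = ind {0<..<t} x *\<^sub>R f x" for x
   by (auto simp: f_def indicator_def)
  have i: "integrable lebesgue (%x. ind {0<..<t} x *\<^sub>R f x)"
   by (rule integrable_mult_indicator[OF _ f]) auto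
  have "((%x. ind {0<..<t} x *\<^sub>R f x) has_integral lint {0<..<t} v) UNIV"
   using has_integral_integral_lebesgue[OF i] unfolding integral_lebesgue_on_open[OF open_ivl] e .
  moreover have "(%x. ind {0<..<t} x *\<^sub>R f x) = (%x. if x \<in> {0<..<t} then f x else 0)"
   by (auto simp: indicator_def)
  ultimately have "(f has_integral lint {0<..<t} v) {0<..<t}"
   by (simp only: has_integral_restrict_UNIV)
  then have "(f has_integral lint {0<..<t} v) {0..t}"
   using has_integral_Icc_iff_Ioo by blast
  then show "integral {0..t} f = lint {0<..<t} v" by (rule integral_unique)
 qed
qed

text \<open>Exchanging the order of integration on the triangle leaves the integral of the
  derivative of zeta from r to T, which is - zeta r because zeta vanishes at T.\<close>

lemma weak_deriv_indefinite_integral: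
 fixes v :: "real => real"
 assumes v: "intg {0<..<T} v"
 shows "hwd {0<..<T} 1 1 (%t. lint {0<..<t} v) v"
 unfolding has_weak_deriv_def
proof (intro conjI ballI)
 let ?S = "{0<..<T}"
 show "locint ?S (%t. lint {0<..<t} v)"
  by (rule locint_continuous[OF continuous_on_subset[OF indefinite_integral_continuous_on[OF v]]]) auto
 show "locint ?S v"
 proof (rule locally_integrableI)
  fix K assume K: "compact K" "K \<subseteq> ?S"
  have "integrable lebesgue (%x. ind K x *\<^sub>R (ind ?S x *\<^sub>R v x))"
   using v unfolding integrable_lebesgue_on_open[OF open_ivl]
   by (rule integrable_mult_indicator[rotated]) (use K(1) in \<open>auto simp: borel_compact\<close>)
  moreover have e: "ind K x *\<^sub>R (ind ?S x *\<^sub>R v x) = ind K x * v x" for x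
   using K(2) by (auto simp: indicator_def)
  ultimately show "integrable lebesgue (%x. ind K x * v x)" by (simp only: e)
 qed
 fix \<zeta> :: "real => real" assume \<zeta>: "\<zeta> \<in> TF ?S"
 have \<zeta>': "dd 1 \<zeta> \<in> TF ?S" by (rule test_dir_deriv[OF \<zeta>]) auto
 have S: "open ?S" by simp
 have q: "intg ?S (dd 1 \<zeta>)"
  using locint_test[OF S locint_continuous[of ?S "%_. 1"] \<zeta>'] by simp
 have r: "lint {r<..<T} (dd 1 \<zeta>) = - \<zeta> r" if "r \<in> ?S" for r
 proof -
  have c: "continuous_on {r..T} (dd 1 \<zeta>)"
   by (rule smooth_continuous_on[OF test_smooth[OF \<zeta>']])
  obtain K where K: "K \<subseteq> ?S" "\<And>x. x \<notin> K ==> \<zeta> x = 0" by (rule testE[OF \<zeta>]) blast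
  have "T \<notin> K" using K(1) by auto
  then have "\<zeta> T = 0" by (rule K(2))
  have "(dd 1 \<zeta> has_integral (\<zeta> T - \<zeta> r)) {r..T}"
   using that by (intro fundamental_theorem_of_calculus)
    (auto intro!: has_field_derivative_at_within[OF smooth_has_real_derivative[OF test_smooth[OF \<zeta>]]]
     simp: has_real_derivative_iff_has_vector_derivative[symmetric])
  then have A: "(dd 1 \<zeta> has_integral (- \<zeta> r)) {r<..<T}"
   using has_integral_Icc_iff_Ioo \<open>\<zeta> T = 0\<close> by force
  have "{r<..<T} \<subseteq> ?S" using that by auto
  then have "intg {r<..<T} (dd 1 \<zeta>)"
   using integral_lebesgue_on_subset(2)[OF S open_ivl _ q] by blast
  then have "(dd 1 \<zeta> has_integral lint {r<..<T} (dd 1 \<zeta>)) {r<..<T}"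
   by (rule has_integral_integral_lebesgue_on) auto
  then show ?thesis using A has_integral_unique by blast
 qed
 have "(lint ?S (%s. dd 1 \<zeta> s * lint {0<..<s} v))
   = (lint ?S (%r. v r * (- \<zeta> r)))"
  unfolding Fubini_triangle(1)[OF v q] by (rule integral_lebesgue_on_cong) (simp add: r)
 then show "(lint ?S (%x. lint {0<..<x} v * (dd 1 ^^ 1) \<zeta> x))
   = (-1) ^ 1 * (lint ?S (%x. v x * \<zeta> x))"
  by (simp add: mult.commute)
qed

text \<open>The difference of z and the indefinite integral of v has weak derivative 0 and is
  continuous up to the end points, so its value at 0 determines it.\<close>

lemma weak_deriv_integral:
 fixes z v :: "real => real"
 assumes T: "0 < T" and z: "continuous_on {0..T} z" and v: "intg {0<..<T} v"
  and w: "hwd {0<..<T} 1 1 z v" and t: "t \<in> {0..T}"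
 shows "z t = z 0 + lint {0<..<t} v"
proof -
 let ?d = "%t. z t - lint {0<..<t} v"
 have c: "continuous_on {0..T} ?d"
  by (intro continuous_on_diff z indefinite_integral_continuous_on v)
 have "hwd {0<..<T} 1 1 ?d (%t. v t - v t)"
  by (rule hwd_diff[OF _ _ w weak_deriv_indefinite_integral[OF v]]) auto
 then have "?d t = ?d 0" using weak_deriv_zero_const[OF T c] t by simp
 then show ?thesis by simp
qed

section \<open>The energy estimate for a single mode\<close>

text \<open>The energy E = w^2 + mu z^2 has derivative 2 w f in the integrated sense. Read at a
  maximum point m of E on [0,T], where |w| is at most sqrt (E m) throughout, this bounds E m by E 0
  plus sqrt (E m) times a norm of f, and half of E m is absorbed. The constants do not depend on mu,
  and T enters linearly.\<close>

lemma wave_mode_bound: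
 fixes z w f :: "real => real"
 assumes T: "0 < T" and \<mu>: "0 \<le> \<mu>" and z: "continuous_on {0..T} z" and w: "continuous_on {0..T} w"
  and zw: "hwd {0<..<T} 1 1 z w"
  and wf: "hwd {0<..<T} 1 1 w (%t. f t - \<mu> * z t)"
  and fm: "f \<in> meas {0<..<T}" and f: "intg {0<..<T} (%t. (f t)^2)"
  and t: "t \<in> {0..T}"
 shows "\<mu> * (z t)^2 \<le> 2 * ((w 0)^2 + \<mu> * (z 0)^2) + 4 * T * (lint {0<..<T} (%t. (f t)^2))"
proof -
 let ?S = "{0<..<T}"
 let ?F = "lint ?S (%t. (f t)^2)"
 have fin: "finite_measure (leb ?S)" by (rule finite_measure_lebesgue_on) auto
 have one: "intg ?S (%x. 1 :: real)"
  by (rule finite_measure.integrable_const[OF fin])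
 have oneT: "(lint ?S (%x. (1::real))) = T"
  using T by (simp add: measure_restrict_space)
 have fi: "intg ?S f"
  using integrable_mult_L2[OF fm _ f, of "%_. 1"] one by simp
 have bdd: "intg ?S u" if "continuous_on {0..T} u" for u :: "real => real"
 proof -
  have "integrable lebesgue (%x. ind {0..T} x * u x)"
   by (rule locint_compact[OF locint_continuous[OF that]]) auto
  then have "integrable lebesgue (%x. ind ?S x *\<^sub>R (ind {0..T} x * u x))"
   by (rule integrable_mult_indicator[rotated]) auto
  moreover have e: "ind ?S x *\<^sub>R (ind {0..T} x * u x) = ind ?S x *\<^sub>R u x" for x
   by (auto simp: indicator_def)
  ultimately show ?thesis unfolding integrable_lebesgue_on_open[OF open_ivl] by (simp only: e)
 qed
 have qi: "intg ?S (%t. f t - \<mu> * z t)" using fi bdd[OF z] by simp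
 have zI: "z s = z 0 + lint {0<..<s} w" if "s \<in> {0..T}" for s
  by (rule weak_deriv_integral[OF T z bdd[OF w] zw that])
 have wI: "w s = w 0 + lint {0<..<s} (%t. f t - \<mu> * z t)" if "s \<in> {0..T}" for s
  by (rule weak_deriv_integral[OF T w qi wf that])
 define E where "E = (%t. (w t)^2 + \<mu> * (z t)^2)"
 have Ec: "continuous_on {0..T} E" unfolding E_def by (intro continuous_intros z w)
 obtain m where m: "m \<in> {0..T}" "\<And>s. s \<in> {0..T} ==> E s \<le> E m"
  using continuous_attains_sup[OF compact_Icc _ Ec] T by fastforce
 have E0: "0 \<le> E s" for s using \<mu> by (simp add: E_def)
 have wb: "\<bar>w s\<bar> \<le> sqrt (E m)" if "s \<in> {0..T}" for s
 proof -
  have "(w s)^2 \<le> E s" using \<mu> by (simp add: E_def)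
  then have "(w s)^2 \<le> E m" using m(2)[OF that] by linarith
  then show ?thesis by (simp add: real_le_rsqrt)
 qed
 have mS: "{0<..<m} \<subseteq> ?S" using m by auto
 note W = square_indefinite_integral[OF qi _ _ wI, of m] and Z = square_indefinite_integral[OF bdd[OF w] _ _ zI, of m]
 have W': "(w m)^2 = (w 0)^2 + 2 * (lint {0<..<m} (%s. w s * (f s - \<mu> * z s)))"
  and Wi: "intg {0<..<m} (%s. w s * (f s - \<mu> * z s))"
  using W m by auto
 have Z': "(z m)^2 = (z 0)^2 + 2 * (lint {0<..<m} (%s. z s * w s))"
  and Zi: "intg {0<..<m} (%s. z s * w s)"
  using Z m by auto
 have i: "intg {0<..<m} (%s. w s * f s)"
  using intg_add[OF Wi integrable_mult_right[OF Zi, of \<mu>]] by (simp add: algebra_simps)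
 have "E m = E 0 + 2 * ((lint {0<..<m} (%s. w s * (f s - \<mu> * z s))) + \<mu> * (lint {0<..<m} (%s. z s * w s)))"
  unfolding E_def W' Z' by (simp add: algebra_simps)
 also have "(lint {0<..<m} (%s. w s * (f s - \<mu> * z s))) + \<mu> * (lint {0<..<m} (%s. z s * w s))
   = (lint {0<..<m} (%s. w s * (f s - \<mu> * z s) + \<mu> * (z s * w s)))"
  using Wi Zi by simp
 also have "\<dots> = (lint {0<..<m} (%s. w s * f s))"
  by (rule integral_lebesgue_on_cong) (simp add: algebra_simps)
 finally have Em: "E m = E 0 + 2 * (lint {0<..<m} (%s. w s * f s))" .
 have fim: "intg {0<..<m} f"
  by (rule integral_lebesgue_on_subset(2)[OF open_ivl open_ivl mS fi])
 have "(lint {0<..<m} (%s. w s * f s)) \<le> (lint {0<..<m} (%s. sqrt (E m) * \<bar>f s\<bar>))"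
 proof (rule integral_mono[OF i])
  show "intg {0<..<m} (%s. sqrt (E m) * \<bar>f s\<bar>)" using fim by auto
  fix s assume "s \<in> space (leb {0<..<m})"
  then have "\<bar>w s\<bar> \<le> sqrt (E m)" using wb m by auto
  then have "\<bar>w s\<bar> * \<bar>f s\<bar> \<le> sqrt (E m) * \<bar>f s\<bar>" by (rule mult_right_mono) simp
  then show "w s * f s \<le> sqrt (E m) * \<bar>f s\<bar>" using abs_ge_self[of "w s * f s"] by (simp add: abs_mult)
 qed
 also have "\<dots> = sqrt (E m) * (lint ?S (%s. ind {0<..<m} s * \<bar>f s\<bar>))"
  using integral_lebesgue_on_subset(1)[OF open_ivl open_ivl mS, of "%s. \<bar>f s\<bar>"] by simp
 also have "\<dots> \<le> sqrt (E m) * (lint ?S (%s. \<bar>f s\<bar>))"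
 proof (intro mult_left_mono integral_mono)
  show "intg ?S (%s. ind {0<..<m} s * \<bar>f s\<bar>)"
   using integral_lebesgue_on_subset(3)[OF open_ivl open_ivl mS, of "%s. \<bar>f s\<bar>"] fi by auto
  show "intg ?S (%s. \<bar>f s\<bar>)" using fi by (rule integrable_abs)
  show "ind {0<..<m} s * \<bar>f s\<bar> \<le> \<bar>f s\<bar>" for s by (simp split: split_indicator)
 qed (simp add: E0)
 also have "(lint ?S (%s. \<bar>f s\<bar>)) \<le> sqrt ?F * sqrt T"
  using Cauchy_Schwarz_L2[of "%s. \<bar>f s\<bar>" "leb ?S" "%_. 1"] fm f one oneT by (auto simp: power2_eq_square abs_mult_self_eq)
 finally have b: "(lint {0<..<m} (%s. w s * f s)) \<le> sqrt (E m) * (sqrt ?F * sqrt T)"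
  using E0 by (simp add: mult_left_mono)
 have F0: "0 \<le> ?F" by (intro integral_nonneg_AE) auto
 \<comment> \<open>Young's inequality, weighted so that exactly half of E m can be moved to the
   left; this is the source of the factors 2 and 4 T.\<close>
 have "2 * (sqrt (E m) * (sqrt ?F * sqrt T)) \<le> E m / 2 + 2 * T * ?F"
 proof -
  have "0 \<le> (sqrt (E m) / sqrt 2 - sqrt 2 * (sqrt ?F * sqrt T))^2" by simp
  also have "\<dots> = (sqrt (E m))^2 / 2 + 2 * ((sqrt ?F)^2 * (sqrt T)^2) - 2 * (sqrt (E m) * (sqrt ?F * sqrt T))"
   by (simp add: power2_diff power_divide power_mult_distrib)
  finally show ?thesis using E0[of m] F0 T by (simp add: mult_ac)
 qed
 then have "E m \<le> 2 * E 0 + 4 * T * ?F" using Em b by linarith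
 moreover have "\<mu> * (z t)^2 \<le> E t" by (simp add: E_def)
 then have "\<mu> * (z t)^2 \<le> E m" using m(2)[OF t] by linarith
 ultimately show ?thesis by (simp add: E_def)
qed

section \<open>The one-dimensional extension profile\<close>

lemma integrable_set_integrable_borel:
 fixes f :: "real => real"
 assumes "open S" "continuous_on S f" "intg S f"
 shows "set_integrable lborel S f" "lint S f = (LINT x:S|lborel. f x)"
proof -
 have m: "(%x. ind S x *\<^sub>R f x) \<in> borel_measurable borel"
  using borel_measurable_continuous_on_indicator[OF _ assms(2)] assms(1) by auto
 show "set_integrable lborel S f"
  using assms(3) integrable_lebesgue_borel(1)[OF m]
  unfolding integrable_lebesgue_on_open[OF assms(1)] set_integrable_def by blast
 show "lint S f = (LINT x:S|lborel. f x)"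
  unfolding integral_lebesgue_on_open[OF assms(1)] set_lebesgue_integral_def
  by (rule integrable_lebesgue_borel(2)[OF m])
qed

lemma FTC_Ioi:
 fixes F f :: "real => real"
 assumes F: "\<And>x. a < x ==> (F has_real_derivative f x) (at x)" and f: "continuous_on {a<..} f"
  and i: "intg {a<..} f" and A: "(F \<longlongrightarrow> A) (at_right a)" and B: "(F \<longlongrightarrow> B) at_top"
 shows "lint {a<..} f = B - A"
proof -
 note I = integrable_set_integrable_borel[OF open_greaterThan f i]
 have "(LBINT x=ereal a..\<infinity>. f x) = B - A"
 proof (rule interval_integral_FTC_integrable[where F = F])
  show "isCont f x" if "ereal a < ereal x" for x
   using f that continuous_on_eq_continuous_at[OF open_greaterThan, of a f] by auto
  show "set_integrable lborel (einterval (ereal a) \<infinity>) f" using I(1) by simp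
  show "((F \<circ> real_of_ereal) \<longlongrightarrow> A) (at_right (ereal a))" using A by (simp add: ereal_tendsto_simps)
  show "((F \<circ> real_of_ereal) \<longlongrightarrow> B) (at_left \<infinity>)" using B by (simp add: ereal_tendsto_simps)
 qed (use F in \<open>auto simp: has_real_derivative_iff_has_vector_derivative[symmetric]\<close>)
 then show ?thesis using I(2) by (simp add: interval_lebesgue_integral_def)
qed

text \<open>The mean value inequality bounds the difference quotients by g, so dominated convergence
  applies along every sequence that tends to z0; each sequence is shifted by N to lie in the
  interval from the start.\<close>

lemma has_real_derivative_integral:
 fixes f f' :: "real => 'a => real"
 assumes z0: "z0 \<in> {a<..<b}"
  and d: "\<And>z t. z \<in> {a<..<b} ==> t \<in> space M ==> ((%z. f z t) has_real_derivative f' z t) (at z)"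
  and bd: "\<And>z t. z \<in> {a<..<b} ==> t \<in> space M ==> \<bar>f' z t\<bar> \<le> g t"
  and g: "integrable M g" and f: "\<And>z. z \<in> {a<..<b} ==> integrable M (f z)"
  and m: "f' z0 \<in> borel_measurable M"
 shows "((%z. \<integral>t. f z t \<partial>M) has_real_derivative (\<integral>t. f' z0 t \<partial>M)) (at z0)"
proof -
 have "((%z. ((\<integral>t. f z t \<partial>M) - (\<integral>t. f z0 t \<partial>M)) / (z - z0)) \<longlongrightarrow> (\<integral>t. f' z0 t \<partial>M)) (at z0)"
  unfolding tendsto_at_iff_sequentially
 proof (intro allI impI)
  fix X :: "nat => real" assume X: "\<forall>i. X i \<in> UNIV - {z0}" "X \<longlonglongrightarrow> z0"
  have "\<forall>\<^sub>F i in sequentially. X i \<in> {a<..<b}"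
   using X(2) z0 by (intro topological_tendstoD) auto
  then obtain N where N: "\<And>i. i \<ge> N ==> X i \<in> {a<..<b}" unfolding eventually_sequentially by blast
  have lim: "(%i. \<integral>t. (f (X (i + N)) t - f z0 t) / (X (i + N) - z0) \<partial>M) \<longlonglongrightarrow> (\<integral>t. f' z0 t \<partial>M)"
  proof (rule integral_dominated_convergence[OF m _ g])
   show "(%t. (f (X (i + N)) t - f z0 t) / (X (i + N) - z0)) \<in> borel_measurable M" for i
    using f[OF N[of "i + N"]] f[OF z0] by auto
   show "AE t in M. (%i. (f (X (i + N)) t - f z0 t) / (X (i + N) - z0)) \<longlonglongrightarrow> f' z0 t"
   proof (rule AE_I2)
    fix t assume t: "t \<in> space M"
    have "((%z. (f z t - f z0 t) / (z - z0)) \<longlongrightarrow> f' z0 t) (at z0)"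
     using d[OF z0 t] by (simp add: has_field_derivative_iff)
    moreover have "filterlim (%i. X (i + N)) (at z0) sequentially"
     using X by (auto simp: filterlim_at intro!: LIMSEQ_ignore_initial_segment)
    ultimately show "(%i. (f (X (i + N)) t - f z0 t) / (X (i + N) - z0)) \<longlonglongrightarrow> f' z0 t"
     by (rule filterlim_compose)
   qed
   show "AE t in M. norm ((f (X (i + N)) t - f z0 t) / (X (i + N) - z0)) \<le> g t" for i
   proof (rule AE_I2)
    fix t assume t: "t \<in> space M"
    let ?x = "X (i + N)"
    have x: "?x \<in> {a<..<b}" "?x \<noteq> z0" using N[of "i + N"] X(1) by auto
    have "norm (f ?x t - f z0 t) \<le> g t * norm (?x - z0)"
    proof (rule field_differentiable_bound[of "{a<..<b}" "%z. f z t" "%z. f' z t"])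
     show "((%z. f z t) has_field_derivative f' z t) (at z within {a<..<b})" if "z \<in> {a<..<b}" for z
      by (rule has_field_derivative_at_within[OF d[OF that t]])
    qed (use x z0 bd t in auto)
    then show "norm ((f ?x t - f z0 t) / (?x - z0)) \<le> g t"
     using x by (simp add: divide_le_eq)
   qed
  qed
  have e: "(\<integral>t. (f (X (i + N)) t - f z0 t) / (X (i + N) - z0) \<partial>M) = ((\<integral>t. f (X (i + N)) t \<partial>M) - (\<integral>t. f z0 t \<partial>M)) / (X (i + N) - z0)" for i
   using f[OF N[of "i + N"]] f[OF z0] by simp
  let ?q = "(%z. ((\<integral>t. f z t \<partial>M) - (\<integral>t. f z0 t \<partial>M)) / (z - z0)) \<circ> X"
  have "(%i. ?q (i + N)) \<longlonglongrightarrow> (\<integral>t. f' z0 t \<partial>M)"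
   using lim unfolding e by (simp only: o_def)
  then show "?q \<longlonglongrightarrow> (\<integral>t. f' z0 t \<partial>M)" by (rule LIMSEQ_offset)
 qed
 then show ?thesis by (simp add: has_field_derivative_iff)
qed

text \<open>One term of the exponential series. This inequality is the source of the factorial in
  the final estimates.\<close>

lemma power_le_fact_exp: "0 \<le> x ==> x ^ l \<le> fact l * exp (x::real)"
proof -
 assume x: "0 \<le> x"
 have "(\<Sum>n\<in>{l}. inverse (fact n) *\<^sub>R x ^ n) \<le> (\<Sum>n. inverse (fact n) *\<^sub>R x ^ n)"
  using x summable_exp_generic[of x] by (intro sum_le_suminf) auto
 then have "inverse (fact l) * x ^ l \<le> exp x" by (simp add: exp_def)
 then show ?thesis by (simp add: field_simps)
qed

lemma power_exp_tendsto_0: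
 assumes "0 < (z::real)"
 shows "((%t. t ^ k * exp (- (z * t))) \<longlongrightarrow> 0) at_top"
proof -
 have "filterlim (%t. z * t) at_top at_top"
  by (rule filterlim_tendsto_pos_mult_at_top[OF tendsto_const assms filterlim_ident])
 from filterlim_compose[OF tendsto_power_div_exp_0[of k] this]
 have "((%t. (1 / z ^ k) * ((z * t) ^ k / exp (z * t))) \<longlongrightarrow> (1 / z ^ k) * 0) at_top"
  by (intro tendsto_mult tendsto_const)
 moreover have "(1 / z ^ k) * ((z * t) ^ k / exp (z * t)) = t ^ k * exp (- (z * t))" for t
  using assms by (simp add: power_mult_distrib exp_minus divide_inverse)
 ultimately show ?thesis by simp
qed

section \<open>Gamma integrals and the moments of the Bessel weight\<close>

lemma nn_integral_Gamma_scaled: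
 assumes p: "0 < p" and q: "0 < (q::real)"
 shows "(\<integral>\<^sup>+t. ennreal (ind {0..} t * t powr (p - 1) * exp (- (q * t))) \<partial>lborel) = ennreal (Gamma p * q powr (- p))"
proof -
 let ?J = "\<integral>\<^sup>+t. ennreal (ind {0..} t * t powr (p - 1) * exp (- (q * t))) \<partial>lborel"
 have "ennreal (Gamma p) = (\<integral>\<^sup>+t. ennreal (ind {0..} t * t powr (p - 1) / exp t) \<partial>lborel)"
  by (rule Gamma_conv_nn_integral_real[OF p])
 also have "\<dots> = ennreal q * (\<integral>\<^sup>+t. ennreal (ind {0..} (0 + q * t) * (0 + q * t) powr (p - 1) / exp (0 + q * t)) \<partial>lborel)"
  using q by (subst nn_integral_real_affine[where c = q and t = 0]) auto
 also have "(%t. ennreal (ind {0..} (0 + q * t) * (0 + q * t) powr (p - 1) / exp (0 + q * t)))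
   = (%t. ennreal (q powr (p - 1)) * ennreal (ind {0..} t * t powr (p - 1) * exp (- (q * t))))"
 proof
  fix t :: real
  have "ind {0..} (0 + q * t) * (0 + q * t) powr (p - 1) / exp (0 + q * t)
    = q powr (p - 1) * (ind {0..} t * t powr (p - 1) * exp (- (q * t)))"
   using q by (auto simp: indicator_def powr_mult exp_minus divide_inverse zero_le_mult_iff)
  then show "ennreal (ind {0..} (0 + q * t) * (0 + q * t) powr (p - 1) / exp (0 + q * t))
   = ennreal (q powr (p - 1)) * ennreal (ind {0..} t * t powr (p - 1) * exp (- (q * t)))"
   by (simp add: ennreal_mult)
 qed
 also have "ennreal q * (\<integral>\<^sup>+t. ennreal (q powr (p - 1)) * ennreal (ind {0..} t * t powr (p - 1) * exp (- (q * t))) \<partial>lborel)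
   = ennreal (q powr p) * ?J"
  using q by (subst nn_integral_cmult) (auto simp: mult.assoc[symmetric] ennreal_mult[symmetric] powr_diff)
 finally have "ennreal (q powr (- p)) * ennreal (Gamma p) = ennreal (q powr (- p)) * (ennreal (q powr p) * ?J)" by simp
 also have "\<dots> = ?J" using q by (simp add: mult.assoc[symmetric] ennreal_mult[symmetric] powr_add[symmetric])
 finally show ?thesis using p q by (simp add: ennreal_mult[symmetric] mult.commute)
qed

lemma nn_integral_lebesgue_on_Ioi:
 fixes f :: "real => real"
 shows "(\<integral>\<^sup>+t. ennreal (f t) \<partial>leb {a<..}) = (\<integral>\<^sup>+t. ennreal (ind {a<..} t * f t) \<partial>lborel)"
proof -
 have "(\<integral>\<^sup>+t. ennreal (f t) \<partial>leb {a<..}) = (\<integral>\<^sup>+t. ennreal (f t) * ind {a<..} t \<partial>lebesgue)"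
  by (rule nn_integral_restrict_space) auto
 also have "\<dots> = (\<integral>\<^sup>+t. ennreal (f t) * ind {a<..} t \<partial>lborel)" by (rule nn_integral_completion)
 also have "\<dots> = (\<integral>\<^sup>+t. ennreal (ind {a<..} t * f t) \<partial>lborel)"
  by (rule nn_integral_cong) (auto simp: indicator_def)
 finally show ?thesis .
qed

lemma integrableI_nn_bound:
 fixes f :: "'a => real"
 assumes "f \<in> borel_measurable M" "\<And>x. x \<in> space M ==> 0 \<le> f x" "(\<integral>\<^sup>+x. ennreal (f x) \<partial>M) \<le> ennreal c" "0 \<le> c"
 shows "integrable M f" "integral\<^sup>L M f \<le> c"
proof -
 show i: "integrable M f"
  using assms by (intro integrableI_nonneg) (auto simp: order_le_less_trans)
 have "ennreal (integral\<^sup>L M f) = (\<integral>\<^sup>+x. ennreal (f x) \<partial>M)"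
  using nn_integral_eq_integral[OF i] assms(2) by auto
 then show "integral\<^sup>L M f \<le> c" using assms(3,4) by (metis ennreal_le_iff)
qed

lemma Gamma_integral_scaled:
 assumes p: "0 < p" and q: "0 < (q::real)"
 shows "intg {0<..} (%t. t powr (p - 1) * exp (- (q * t)))"
  "(lint {0<..} (%t. t powr (p - 1) * exp (- (q * t)))) \<le> Gamma p * q powr (- p)"
proof -
 have c: "continuous_on {0<..} (%t. t powr (p - 1) * exp (- (q * t)))" by (intro continuous_intros) auto
 have m: "(%t. t powr (p - 1) * exp (- (q * t))) \<in> meas {0<..}"
  by (rule continuous_meas[OF c]) auto
 have "(\<integral>\<^sup>+t. ennreal (t powr (p - 1) * exp (- (q * t))) \<partial>leb {0<..}) \<le> ennreal (Gamma p * q powr (- p))"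
  unfolding nn_integral_lebesgue_on_Ioi nn_integral_Gamma_scaled[OF p q, symmetric]
  by (intro nn_integral_mono ennreal_leI) (auto simp: indicator_def)
 moreover have "0 \<le> Gamma p * q powr (- p)" using Gamma_real_pos[OF p] by simp
 ultimately show "intg {0<..} (%t. t powr (p - 1) * exp (- (q * t)))"
  "(lint {0<..} (%t. t powr (p - 1) * exp (- (q * t)))) \<le> Gamma p * q powr (- p)"
  using integrableI_nn_bound[OF m] by auto
qed

text \<open>The weight in the integral over {1<..} that represents the modified Bessel function K of
  order nu has exponent nu - 1/2; here nu = 1 - s. This order belongs to the derivative of the
  profile, since z^s K_s has derivative - z^s K_(1-s).\<close>

definition bw :: "real => real => real" where
 "bw s t = (t\<^sup>2 - 1) powr (1 / 2 - s)"

text \<open>Up to a constant, \<open>z * bmom s 0 z\<close> is \<open>z powr s\<close> times the modified Bessel function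
 \<open>K\<close> of order \<open>1 - s\<close>; the higher moments are its derivatives up to sign.\<close>

definition bmom :: "real => nat => real => real" where
 "bmom s l z = (lint {1<..} (%t. t ^ l * exp (- (z * t)) * bw s t))"

lemma bw_nonneg: "0 \<le> bw s t" by (simp add: bw_def)

lemma one_less_sq: "1 < t ==> 1 < (t::real)\<^sup>2"
 using less_1_mult[of t t] by (simp add: power2_eq_square)

lemma continuous_on_bw: "continuous_on {1<..} (bw s)"
proof -
 have "t\<^sup>2 - 1 \<noteq> 0" if "t \<in> {1<..}" for t :: real
 proof -
  have "1 < t\<^sup>2" by (rule one_less_sq) (use that in simp)
  then show ?thesis by linarith
 qed
 then show ?thesis unfolding bw_def[abs_def] by (intro continuous_intros) auto
qed

text \<open>Since t^2 - 1 lies between (t - 1)^2 and t^2, the weight is at most t^(1-2s) when its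
  exponent is nonnegative and at most (t - 1)^(1-2s) otherwise. Both comparisons lead to the Gamma
  integral with parameter 2 - 2s, in the second case after a shift by 1.\<close>

lemma bessel_base:
 assumes s: "s < 1" and z: "0 < z"
 shows "intg {1<..} (%t. exp (- (z * t)) * bw s t)"
  "(lint {1<..} (%t. exp (- (z * t)) * bw s t)) \<le> Gamma (2 - 2 * s) * z powr (2 * s - 2)"
proof -
 define g where "g = (%t::real. ennreal (ind {0..} t * t powr ((2 - 2 * s) - 1) * exp (- (z * t))))"
 have [measurable]: "g \<in> borel_measurable borel" unfolding g_def by measurable
 have G: "(\<integral>\<^sup>+t. g t \<partial>lborel) = ennreal (Gamma (2 - 2 * s) * z powr (2 * s - 2))"
  unfolding g_def using nn_integral_Gamma_scaled[of "2 - 2 * s" z] s z by simp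
 have sq: "t\<^sup>2 - 1 = (t - 1) * (t + 1)" for t :: real by (simp add: power2_eq_square algebra_simps)
 have le: "(\<integral>\<^sup>+t. ennreal (ind {1<..} t * (exp (- (z * t)) * bw s t)) \<partial>lborel) \<le> (\<integral>\<^sup>+t. g t \<partial>lborel)"
 proof (cases "s \<le> 1 / 2")
  case True
  show ?thesis
  proof (rule nn_integral_mono)
   fix t :: real
   show "ennreal (ind {1<..} t * (exp (- (z * t)) * bw s t)) \<le> g t"
   proof (cases "1 < t")
    case t: True
    have "bw s t \<le> (t\<^sup>2) powr (1 / 2 - s)"
     unfolding bw_def using True one_less_sq[OF t] by (intro powr_mono2) auto
    also have "\<dots> = t powr (2 - 2 * s - 1)"
    proof -
     have "t\<^sup>2 = t powr 2" using t by (simp add: powr_numeral)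
     then have "(t\<^sup>2) powr (1 / 2 - s) = t powr (2 * (1 / 2 - s))" by (simp only: powr_powr)
     then show ?thesis by (simp add: algebra_simps)
    qed
    finally have "exp (- (z * t)) * bw s t \<le> t powr (2 - 2 * s - 1) * exp (- (z * t))"
     by (simp add: mult.commute)
    then show ?thesis unfolding g_def using t by (intro ennreal_leI) auto
   qed simp
  qed
 next
  case False
  have "(\<integral>\<^sup>+t. ennreal (ind {1<..} t * (exp (- (z * t)) * bw s t)) \<partial>lborel) \<le> (\<integral>\<^sup>+t. g (-1 + 1 * t) \<partial>lborel)"
  proof (rule nn_integral_mono)
   fix t :: real
   show "ennreal (ind {1<..} t * (exp (- (z * t)) * bw s t)) \<le> g (-1 + 1 * t)"
   proof (cases "1 < t")
    case t: True
    have "(t - 1) * (t - 1) \<le> t\<^sup>2 - 1" unfolding sq using t by (intro mult_left_mono) auto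
    then have "bw s t \<le> ((t - 1) * (t - 1)) powr (1 / 2 - s)"
     unfolding bw_def using False t by (intro powr_mono2') auto
    also have "\<dots> = (t - 1) powr (2 - 2 * s - 1)"
     using t by (simp add: powr_mult powr_add[symmetric])
    finally have "exp (- (z * t)) * bw s t \<le> exp (- (z * (t - 1))) * (t - 1) powr (2 - 2 * s - 1)"
     using z by (intro mult_mono) (auto simp: bw_nonneg)
    then show ?thesis unfolding g_def using t by (intro ennreal_leI) (simp add: mult.commute)
   qed simp
  qed
  also have "\<dots> = (\<integral>\<^sup>+t. g t \<partial>lborel)"
   by (subst (2) nn_integral_real_affine[where c = 1 and t = "-1"]) auto
  finally show ?thesis .
 qed
 have c: "continuous_on {1<..} (%t. exp (- (z * t)) * bw s t)" by (intro continuous_intros continuous_on_bw)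
 have m: "(%t. exp (- (z * t)) * bw s t) \<in> meas {1<..}"
  by (rule continuous_meas[OF c]) auto
 have "0 \<le> Gamma (2 - 2 * s) * z powr (2 * s - 2)" using Gamma_real_pos[of "2 - 2 * s"] s by simp
 moreover have "(\<integral>\<^sup>+t. ennreal (exp (- (z * t)) * bw s t) \<partial>leb {1<..}) \<le> ennreal (Gamma (2 - 2 * s) * z powr (2 * s - 2))"
  unfolding nn_integral_lebesgue_on_Ioi using le G by simp
 ultimately show "intg {1<..} (%t. exp (- (z * t)) * bw s t)"
  "(lint {1<..} (%t. exp (- (z * t)) * bw s t)) \<le> Gamma (2 - 2 * s) * z powr (2 * s - 2)"
  using integrableI_nn_bound[OF m] bw_nonneg by auto
qed

text \<open>The exponent z t is split into three parts. One delta z t pays for t^l through (delta z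
  t)^l <= l! exp (delta z t), another delta z t is kept for integrability, and the rest is estimated
  by its value at t = 1 and gives the decay in z.\<close>

lemma moment_pointwise:
 fixes z \<delta> t :: real
 assumes z: "0 < z" and d: "0 < \<delta>" "\<delta> < 1/2" and t: "1 < t"
 shows "t ^ l * exp (- (z * t)) \<le> fact l / (\<delta> * z) ^ l * exp (- ((1 - 2 * \<delta>) * z)) * exp (- (\<delta> * z * t))"
proof -
 have "(\<delta> * z * t) ^ l \<le> fact l * exp (\<delta> * z * t)" using z d t by (intro power_le_fact_exp) auto
 then have "t ^ l \<le> fact l / (\<delta> * z) ^ l * exp (\<delta> * z * t)"
  using z d by (simp add: power_mult_distrib divide_simps mult_ac)
 then have "t ^ l * exp (- (z * t)) \<le> fact l / (\<delta> * z) ^ l * exp (\<delta> * z * t) * exp (- (z * t))"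
  by (rule mult_right_mono) simp
 also have "\<dots> = fact l / (\<delta> * z) ^ l * (exp (- ((1 - 2 * \<delta>) * z * t)) * exp (- (\<delta> * z * t)))"
  by (simp add: exp_add[symmetric] algebra_simps)
 also have "\<dots> \<le> fact l / (\<delta> * z) ^ l * (exp (- ((1 - 2 * \<delta>) * z)) * exp (- (\<delta> * z * t)))"
  using z d t by (intro mult_left_mono mult_right_mono) auto
 finally show ?thesis by (simp add: mult.assoc)
qed

lemma bmom_bounds:
 assumes s: "s < 1" and z: "0 < z"
 shows "intg {1<..} (%t. t ^ l * exp (- (z * t)) * bw s t)"
  "0 \<le> bmom s l z"
  "0 < \<delta> ==> \<delta> < 1/2 ==>
   bmom s l z \<le> fact l / (\<delta> * z) ^ l * exp (- ((1 - 2 * \<delta>) * z)) * (Gamma (2 - 2 * s) * (\<delta> * z) powr (2 * s - 2))"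
proof -
 have c: "continuous_on {1<..} (%t. t ^ l * exp (- (z * t)) * bw s t)" by (intro continuous_intros continuous_on_bw)
 have m: "(%t. t ^ l * exp (- (z * t)) * bw s t) \<in> meas {1<..}"
  by (rule continuous_meas[OF c]) auto
 have b: "intg {1<..} (%t. t ^ l * exp (- (z * t)) * bw s t)"
  "bmom s l z \<le> fact l / (\<delta> * z) ^ l * exp (- ((1 - 2 * \<delta>) * z)) * (Gamma (2 - 2 * s) * (\<delta> * z) powr (2 * s - 2))"
  if d: "0 < \<delta>" "\<delta> < 1/2" for \<delta>
 proof -
  let ?k = "fact l / (\<delta> * z) ^ l * exp (- ((1 - 2 * \<delta>) * z))"
  have k: "0 \<le> ?k" using d z by simp
  have dz: "0 < \<delta> * z" using d z by simp
  have ik: "intg {1<..} (%t. ?k * (exp (- (\<delta> * z * t)) * bw s t))"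
   by (rule integrable_mult_right) (rule bessel_base(1)[OF s dz])
  have le: "t ^ l * exp (- (z * t)) * bw s t \<le> ?k * (exp (- (\<delta> * z * t)) * bw s t)" if "1 < t" for t
   using mult_right_mono[OF moment_pointwise[OF z d that, of l] bw_nonneg] by (simp add: mult.assoc)
  show i: "intg {1<..} (%t. t ^ l * exp (- (z * t)) * bw s t)"
  proof (rule intg_bound[OF ik m], rule AE_I2)
   fix t :: real assume "t \<in> space (leb {1<..})"
   then have t: "1 < t" by simp
   have "0 \<le> t ^ l * exp (- (z * t)) * bw s t" using t bw_nonneg by simp
   then show "norm (t ^ l * exp (- (z * t)) * bw s t) \<le> norm (?k * (exp (- (\<delta> * z * t)) * bw s t))"
    using order_trans[OF le[OF t] abs_ge_self] by (simp only: real_norm_def abs_of_nonneg)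
  qed
  have "bmom s l z \<le> (lint {1<..} (%t. ?k * (exp (- (\<delta> * z * t)) * bw s t)))"
   unfolding bmom_def by (rule integral_mono[OF i ik]) (use le in auto)
  also have "\<dots> = ?k * (lint {1<..} (%t. exp (- (\<delta> * z * t)) * bw s t))" by simp
  also have "\<dots> \<le> ?k * (Gamma (2 - 2 * s) * (\<delta> * z) powr (2 * s - 2))"
   by (intro mult_left_mono bessel_base(2)[OF s dz] k)
  finally show "bmom s l z \<le> ?k * (Gamma (2 - 2 * s) * (\<delta> * z) powr (2 * s - 2))" .
 qed
 show "intg {1<..} (%t. t ^ l * exp (- (z * t)) * bw s t)"
  \<comment> \<open>The integrand does not involve delta, so any admissible value serves.\<close>
  using b(1)[of "1/4"] by simp
 show "0 \<le> bmom s l z"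
  unfolding bmom_def by (intro integral_nonneg_AE AE_I2) (auto simp: bw_nonneg)
 show "bmom s l z \<le> fact l / (\<delta> * z) ^ l * exp (- ((1 - 2 * \<delta>) * z)) * (Gamma (2 - 2 * s) * (\<delta> * z) powr (2 * s - 2))"
  if "0 < \<delta>" "\<delta> < 1/2" using b(2)[OF that] .
qed

text \<open>A nonnegative continuous integrand with integral 0 would vanish identically, but this
  one is nonzero at t = 2.\<close>

lemma bmom_pos:
 assumes s: "s < 1" and z: "0 < z"
 shows "0 < bmom s l z"
proof (rule ccontr)
 let ?f = "%t. t ^ l * exp (- (z * t)) * bw s t"
 assume "\<not> 0 < bmom s l z"
 then have "lint {1<..} ?f = 0"
  using bmom_bounds(2)[OF s z, of l] by (simp add: bmom_def)
 moreover have "AE t in leb {1<..}. 0 \<le> ?f t" by (intro AE_I2) (auto simp: bw_nonneg)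
 ultimately have "AE t in leb {1<..}. ?f t = 0"
  using integral_nonneg_eq_0_iff_AE[OF bmom_bounds(1)[OF s z, of l]] by blast
 then have "\<forall>t\<in>{1<..}. ?f t = 0"
  by (rule AE_eq_const_continuous[rotated 2]) (auto intro!: continuous_intros continuous_on_bw)
 from bspec[OF this, of 2] show False by (simp add: bw_def)
qed

text \<open>For parameters between z / 2 and 2 z the derivatives of the integrand are dominated by
  the integrand of the next moment at z / 2.\<close>

lemma bmom_deriv:
 assumes s: "s < 1" and z: "0 < z"
 shows "(bmom s l has_real_derivative - bmom s (Suc l) z) (at z)"
proof -
 have "((%z. lint {1<..} (%t. t ^ l * exp (- (z * t)) * bw s t)) has_real_derivative
   (lint {1<..} (%t. - (t ^ Suc l * exp (- (z * t)) * bw s t)))) (at z)"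
 proof (rule has_real_derivative_integral[where a = "z/2" and b = "2 * z"])
  show "intg {1<..} (%t. t ^ Suc l * exp (- (z / 2 * t)) * bw s t)"
   using z by (intro bmom_bounds(1)[OF s]) simp
  show "intg {1<..} (%t. t ^ l * exp (- (y * t)) * bw s t)" if "y \<in> {z/2<..<2*z}" for y
   using z that by (intro bmom_bounds(1)[OF s]) simp
  show "((%y. t ^ l * exp (- (y * t)) * bw s t) has_real_derivative - (t ^ Suc l * exp (- (y * t)) * bw s t)) (at y)" for y t
   by (auto intro!: derivative_eq_intros)
  show "\<bar>- (t ^ Suc l * exp (- (y * t)) * bw s t)\<bar> \<le> t ^ Suc l * exp (- (z / 2 * t)) * bw s t"
   if "y \<in> {z/2<..<2*z}" "t \<in> space (leb {1<..})" for y t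
  proof -
   have t: "1 < t" using that by simp
   have "z / 2 * t \<le> y * t" using that t by (intro mult_right_mono) auto
   then have "t ^ Suc l * exp (- (y * t)) * bw s t \<le> t ^ Suc l * exp (- (z / 2 * t)) * bw s t"
    using t by (intro mult_right_mono mult_left_mono) (auto simp: bw_nonneg)
   then show ?thesis using t bw_nonneg[of s t] by (simp add: abs_mult)
  qed
  have "continuous_on {1<..} (%t. - (t ^ Suc l * exp (- (z * t)) * bw s t))" by (intro continuous_intros continuous_on_bw)
  then show "(%t. - (t ^ Suc l * exp (- (z * t)) * bw s t)) \<in> meas {1<..}"
   by (rule continuous_meas) auto
 qed (use z in auto)
 then show ?thesis unfolding bmom_def[abs_def] by simp
qed

text \<open>The Bessel equation in terms of moments. It results from integrating the derivative of
  (t^2 - 1)^(3/2-s) exp (- z t) over {1<..}; the boundary term at 1 vanishes because 3/2 - s is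
  positive, the one at infinity because of the exponential.\<close>

lemma bmom_recurrence:
 assumes s: "0 < s" "s < 1" and z: "0 < z"
 shows "z * bmom s 2 z - z * bmom s 0 z = (3 - 2 * s) * bmom s 1 z"
proof -
 let ?F = "%t. (t\<^sup>2 - 1) powr (3 / 2 - s) * exp (- (z * t))"
 let ?f = "%t. (3 - 2 * s) * (t ^ 1 * exp (- (z * t)) * bw s t) - z * (t ^ 2 * exp (- (z * t)) * bw s t) + z * (t ^ 0 * exp (- (z * t)) * bw s t)"
 have i: "intg {1<..} (%t. t ^ l * exp (- (z * t)) * bw s t)" for l
  by (rule bmom_bounds(1)[OF s(2) z])
 have fi: "intg {1<..} ?f"
  by (intro intg_add intg_diff integrable_mult_right i)
 have "lint {1<..} ?f = 0 - 0"
 proof (rule FTC_Ioi[where F = ?F, OF _ _ fi])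
  fix t :: real assume t: "1 < t"
  have p: "0 < t\<^sup>2 - 1" using one_less_sq[OF t] by simp
  have e: "(t\<^sup>2 - 1) powr (3 / 2 - s) = (t\<^sup>2 - 1) * bw s t"
   using p powr_add[of "t\<^sup>2 - 1" 1 "1/2 - s"] by (simp add: bw_def)
  have "((%t. (t\<^sup>2 - 1) powr (3 / 2 - s)) has_real_derivative (3 / 2 - s) * (t\<^sup>2 - 1) powr (3 / 2 - s - 1) * (2 * t)) (at t)"
   by (rule DERIV_chain2[where f = "%u. u powr (3 / 2 - s)" and g = "%t. t\<^sup>2 - 1", OF has_real_derivative_powr[OF p]])
    (auto intro!: derivative_eq_intros)
  then have d: "((%t. (t\<^sup>2 - 1) powr (3 / 2 - s)) has_real_derivative (3 - 2 * s) * t * bw s t) (at t)"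
   by (simp add: bw_def algebra_simps)
  have d2: "((%t. exp (- (z * t))) has_real_derivative - z * exp (- (z * t))) (at t)"
   by (auto intro!: derivative_eq_intros)
  show "(?F has_real_derivative ?f t) (at t)"
   using DERIV_mult[OF d d2] unfolding e by (simp add: algebra_simps)
 next
  show "continuous_on {1<..} ?f" by (intro continuous_intros continuous_on_bw)
  have "((%t. (t\<^sup>2 - 1) powr (3 / 2 - s) * exp (- (z * t))) \<longlongrightarrow> (1\<^sup>2 - 1) powr (3 / 2 - s) * exp (- (z * 1))) (at_right 1)"
  proof (intro tendsto_mult tendsto_powr2)
   show "((%t. t\<^sup>2 - 1) \<longlongrightarrow> 1\<^sup>2 - 1) (at_right (1::real))" by (intro tendsto_intros)
   show "\<forall>\<^sub>F t in at_right 1. 0 \<le> t\<^sup>2 - (1::real)"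
    using one_less_sq by (auto simp: eventually_at_right_field intro!: exI[of _ 2] less_imp_le)
   show "((%t. exp (- (z * t))) \<longlongrightarrow> exp (- (z * 1))) (at_right 1)" by (intro tendsto_intros)
  qed (use s in auto)
  then show "(?F \<longlongrightarrow> 0) (at_right 1)" using s by simp
  show "(?F \<longlongrightarrow> 0) at_top"
  proof (rule tendsto_sandwich[OF _ _ tendsto_const power_exp_tendsto_0[OF z, of 4]])
   show "\<forall>\<^sub>F t in at_top. 0 \<le> ?F t" by simp
   show "\<forall>\<^sub>F t in at_top. ?F t \<le> t ^ 4 * exp (- (z * t))"
    unfolding eventually_at_top_linorder
   proof (intro exI allI impI mult_right_mono)
    fix t :: real assume t: "2 \<le> t"
    have "1 \<le> t\<^sup>2 - 1" using power_mono[OF t, of 2] by simp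
    then have "(t\<^sup>2 - 1) powr (3 / 2 - s) \<le> (t\<^sup>2 - 1) powr 2" using s by (intro powr_mono) auto
    also have "\<dots> = (t\<^sup>2 - 1)^2" using \<open>1 \<le> t\<^sup>2 - 1\<close> by (simp add: powr_numeral)
    also have "\<dots> \<le> (t\<^sup>2)^2" using \<open>1 \<le> t\<^sup>2 - 1\<close> by (intro power_mono) auto
    finally show "(t\<^sup>2 - 1) powr (3 / 2 - s) \<le> t ^ 4" by (simp add: power_mult[symmetric])
   qed simp
  qed
 qed
 then show ?thesis unfolding bmom_def using i[of 0] i[of 1] i[of 2] by simp
qed

text \<open>Up to a constant, z^s K_s. With nu = 1 - s the moments 0 and 1 are the same multiple of
  z^(-nu) K_nu and z^(-nu) K_(nu+1), so this is the relation K_(nu-1) = K_(nu+1) - (2 nu / z) K_nu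
  multiplied by z^(1-nu). One weight thus represents both the profile and its derivative.\<close>

definition profile0 :: "real => real => real" where
 "profile0 s z = z * bmom s 1 z - (2 - 2 * s) * bmom s 0 z"

text \<open>Equal to - z^(1-2s) times the derivative of \<open>profile0\<close>, the conormal
  derivative of the extension up to sign; its limit at 0 links a mode to the fractional power of its
  eigenvalue.\<close>

definition flux0 :: "real => real => real" where
 "flux0 s z = z powr (2 - 2 * s) * bmom s 0 z"

text \<open>Together the two derivatives form the first-order system equivalent to (z^alpha Psi')' =
  z^alpha Psi. The first of them is where the recurrence of the moments enters.\<close>

lemma profile0_deriv:
 assumes s: "0 < s" "s < 1" and z: "0 < z"
 shows "(profile0 s has_real_derivative - (z * bmom s 0 z)) (at z)"
  "(flux0 s has_real_derivative - (z powr (1 - 2 * s) * profile0 s z)) (at z)"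
proof -
 note d = bmom_deriv[OF s(2) z]
 have "((%z. z * bmom s 1 z - (2 - 2 * s) * bmom s 0 z) has_real_derivative
   (1 * bmom s 1 z + - bmom s (Suc 1) z * z - (2 - 2 * s) * (- bmom s (Suc 0) z))) (at z)"
  by (intro DERIV_diff DERIV_mult DERIV_ident DERIV_cmult d)
 moreover have "1 * bmom s 1 z + - bmom s (Suc 1) z * z - (2 - 2 * s) * (- bmom s (Suc 0) z) = - (z * bmom s 0 z)"
  using bmom_recurrence[OF s z] by (simp add: numeral_2_eq_2 algebra_simps)
 ultimately show "(profile0 s has_real_derivative - (z * bmom s 0 z)) (at z)"
  unfolding profile0_def[abs_def] by simp
 have "((%z. z powr (2 - 2 * s) * bmom s 0 z) has_real_derivative
   ((2 - 2 * s) * z powr (2 - 2 * s - 1) * bmom s 0 z + - bmom s (Suc 0) z * z powr (2 - 2 * s))) (at z)"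
  by (intro DERIV_mult has_real_derivative_powr z d)
 moreover have "z powr (2 - 2 * s) = z powr (1 - 2 * s) * z"
  using z powr_add[of z "1 - 2 * s" 1] by (simp add: algebra_simps)
 then have "(2 - 2 * s) * z powr (2 - 2 * s - 1) * bmom s 0 z + - bmom s (Suc 0) z * z powr (2 - 2 * s)
   = - (z powr (1 - 2 * s) * profile0 s z)"
  by (simp add: profile0_def algebra_simps)
 ultimately show "(flux0 s has_real_derivative - (z powr (1 - 2 * s) * profile0 s z)) (at z)"
  unfolding flux0_def[abs_def] by simp
qed

section \<open>The profile at 0 and at infinity\<close>

lemma low_moment_bound:
 assumes s: "0 < s" "s < 1"
 obtains K where "0 < K" "\<And>z. 0 < z ==> bmom s 0 z \<le> K * z powr (2 * s - 2) * exp (- (z / 2))"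
  "\<And>z. 0 < z ==> z * bmom s 1 z \<le> K * z powr (2 * s - 2) * exp (- (z / 2))"
proof
 \<comment> \<open>Delta = 1/4 in the moment bounds leaves the decay exp (- z / 2); the factor 4 is
   1 / delta from the first moment.\<close>
 let ?c = "Gamma (2 - 2 * s) * (1/4) powr (2 * s - 2)"
 have c: "0 < ?c" using Gamma_real_pos[of "2 - 2 * s"] s by simp
 show "0 < 4 * ?c" using c by simp
 fix z :: real assume z: "0 < z"
 have e: "Gamma (2 - 2 * s) * (1/4 * z) powr (2 * s - 2) = ?c * z powr (2 * s - 2)"
  using powr_mult[of "1/4" z "2 * s - 2"] z by simp
 have "bmom s 0 z \<le> exp (- (z / 2)) * (?c * z powr (2 * s - 2))"
  using bmom_bounds(3)[OF s(2) z, of "1/4" 0] unfolding e by simp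
 also have "\<dots> \<le> exp (- (z / 2)) * (4 * ?c * z powr (2 * s - 2))"
  using c by (intro mult_left_mono mult_right_mono) auto
 finally show "bmom s 0 z \<le> 4 * ?c * z powr (2 * s - 2) * exp (- (z / 2))" by (simp add: mult_ac)
 have "bmom s 1 z \<le> 4 / z * exp (- (z / 2)) * (?c * z powr (2 * s - 2))"
  using bmom_bounds(3)[OF s(2) z, of "1/4" 1] unfolding e by simp
 then have "z * bmom s 1 z \<le> z * (4 / z * exp (- (z / 2)) * (?c * z powr (2 * s - 2)))"
  using z by (intro mult_left_mono) auto
 then show "z * bmom s 1 z \<le> 4 * ?c * z powr (2 * s - 2) * exp (- (z / 2))"
  using z by (simp add: mult_ac)
qed

lemma exp_half_tendsto_0: "((%z. K * exp (- (z / 2 :: real))) \<longlongrightarrow> 0) at_top"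
 using tendsto_mult[OF tendsto_const[of K] power_exp_tendsto_0[of "1/2" 0]] by simp

lemma decreasing_bounded_limit:
 fixes f :: "real => real"
 assumes dec: "\<And>x y. 0 < x ==> x < y ==> f y < f x" and bd: "\<And>x. 0 < x ==> f x \<le> B"
 shows "(f \<longlongrightarrow> (SUP z\<in>{0<..}. f z)) (at_right 0)" "0 < x ==> f x \<le> (SUP z\<in>{0<..}. f z)"
proof -
 have bdd: "bdd_above (f ` {0<..})" using bd by (intro bdd_aboveI2) auto
 show le: "f x \<le> (SUP z\<in>{0<..}. f z)" if "0 < x" for x using that bdd by (intro cSUP_upper) auto
 show "(f \<longlongrightarrow> (SUP z\<in>{0<..}. f z)) (at_right 0)"
 proof (rule order_tendstoI)
  fix a assume "a < (SUP z\<in>{0<..}. f z)"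
  then obtain x0 where x0: "0 < x0" "a < f x0" using bdd by (subst (asm) less_cSUP_iff) auto
  have "a < f y" if "0 < y" "y < x0" for y using dec[OF that] x0(2) by simp
  then show "\<forall>\<^sub>F x in at_right 0. a < f x" using x0(1) by (auto simp: eventually_at_right_field)
 next
  fix a assume "(SUP z\<in>{0<..}. f z) < a"
  then have "f y < a" if "0 < y" for y using le[OF that] by simp
  then show "\<forall>\<^sub>F x in at_right 0. f x < a" by (auto simp: eventually_at_right_field intro!: exI[of _ 1])
 qed
qed

text \<open>Both functions decrease, so their suprema over the half-line are their limits at 0.
  These serve as the values there in place of closed forms.\<close>

definition profile_lim :: "real => real" where "profile_lim s = (SUP z\<in>{0<..}. profile0 s z)"
definition flux_lim :: "real => real" where "flux_lim s = (SUP z\<in>{0<..}. flux0 s z)"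

text \<open>The derivative - z * \<open>bmom s 0 z\<close> is negative, so \<open>profile0\<close>
  decreases; together with its limit 0 at infinity this makes it positive, and its positivity in
  turn makes \<open>flux0\<close> decrease.\<close>

lemma profile0_props:
 assumes s: "0 < s" "s < 1"
 shows "(profile0 s \<longlongrightarrow> profile_lim s) (at_right 0)" "\<And>z. 0 < z ==> profile0 s z \<le> profile_lim s"
  "\<And>z. 0 < z ==> 0 < profile0 s z"
  "(flux0 s \<longlongrightarrow> flux_lim s) (at_right 0)" "\<And>z. 0 < z ==> flux0 s z \<le> flux_lim s"
  "\<And>z. 0 < z ==> 0 < flux0 s z" "(flux0 s \<longlongrightarrow> 0) at_top"
  "\<exists>K. \<forall>z>0. profile0 s z \<le> K * exp (- (z / 2))"
proof -
 obtain K where K: "0 < K" "\<And>z. 0 < z ==> bmom s 0 z \<le> K * z powr (2 * s - 2) * exp (- (z / 2))"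
  "\<And>z. 0 < z ==> z * bmom s 1 z \<le> K * z powr (2 * s - 2) * exp (- (z / 2))"
  by (rule low_moment_bound[OF s]) blast
 have pw: "z powr (2 * s - 2) \<le> 1" if "1 \<le> z" for z
  using powr_mono[of "2 * s - 2" 0 z] that s by simp
 have m0: "0 < bmom s 0 z" if "0 < z" for z by (rule bmom_pos[OF s(2) that])
 have up: "profile0 s z \<le> K * exp (- (z / 2))" if "1 \<le> z" for z
 proof -
  have "profile0 s z \<le> z * bmom s 1 z" using m0[of z] s that by (simp add: profile0_def)
  also have "\<dots> \<le> K * z powr (2 * s - 2) * exp (- (z / 2))" using K(3) that by simp
  also have "\<dots> \<le> K * 1 * exp (- (z / 2))" using K(1) pw[OF that] by (intro mult_right_mono mult_left_mono) auto
  finally show ?thesis by simp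
 qed
 have lo: "- (2 * K) * exp (- (z / 2)) \<le> profile0 s z" if "1 \<le> z" for z
 proof -
  have "0 \<le> bmom s 1 z" using bmom_bounds(2)[OF s(2)] that by simp
  then have "- ((2 - 2 * s) * bmom s 0 z) \<le> profile0 s z" using that by (simp add: profile0_def)
  moreover have "(2 - 2 * s) * bmom s 0 z \<le> 2 * (K * 1 * exp (- (z / 2)))"
  proof (rule mult_mono)
   have "bmom s 0 z \<le> K * z powr (2 * s - 2) * exp (- (z / 2))" using K(2) that by simp
   also have "\<dots> \<le> K * 1 * exp (- (z / 2))" using K(1) pw[OF that] by (intro mult_right_mono mult_left_mono) auto
   finally show "bmom s 0 z \<le> K * 1 * exp (- (z / 2))" .
  qed (use s m0[of z] that in auto)
  ultimately show ?thesis by simp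
 qed
 have top: "(profile0 s \<longlongrightarrow> 0) at_top"
  by (rule tendsto_sandwich[OF _ _ exp_half_tendsto_0[of "- (2 * K)"] exp_half_tendsto_0[of K]])
   (use up lo in \<open>auto simp: eventually_at_top_linorder intro!: exI[of _ 1]\<close>)
 have dec: "profile0 s y < profile0 s x" if "0 < x" "x < y" for x y
 proof (rule DERIV_neg_imp_decreasing[OF that(2)])
  fix z assume "x \<le> z" "z \<le> y"
  then show "\<exists>d. (profile0 s has_real_derivative d) (at z) \<and> d < 0"
   using profile0_deriv(1)[OF s, of z] m0[of z] that by (intro exI[of _ "- (z * bmom s 0 z)"]) auto
 qed
 show pos: "0 < profile0 s z" if "0 < z" for z
 proof -
  have "0 \<le> profile0 s (z + 1)"
  proof (rule tendsto_upperbound[OF top])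
   show "\<forall>\<^sub>F x in at_top. profile0 s x \<le> profile0 s (z + 1)"
    unfolding eventually_at_top_dense using that by (intro exI[of _ "z + 1"]) (auto intro!: less_imp_le dec)
  qed simp
  then show ?thesis using dec[of z "z + 1"] that by simp
 qed
 \<comment> \<open>For x below 1 the derivative of \<open>profile0\<close> is at least - K x^(2s-1),
   which is integrable at 0 because s > 0; K / (2 s) is the integral of K x^(2s-1) from 0 to
   1.\<close>
 define B where "B = profile0 s 1 + K / (2 * s)"
 have bd: "profile0 s z \<le> B" if "0 < z" for z
 proof (cases "z < 1")
  case True
  let ?h = "%z. profile0 s z + K / (2 * s) * z powr (2 * s)"
  have "?h z \<le> ?h 1"
  proof (rule DERIV_nonneg_imp_nondecreasing[where f = ?h])
   fix x assume x: "z \<le> x" "x \<le> 1"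
   have x0: "0 < x" using x that by simp
   have d1: "(?h has_real_derivative - (x * bmom s 0 x) + K / (2 * s) * (2 * s * x powr (2 * s - 1))) (at x)"
    by (intro DERIV_add DERIV_cmult has_real_derivative_powr x0 profile0_deriv(1)[OF s x0])
   moreover have "x * bmom s 0 x \<le> K * x powr (2 * s - 1)"
   proof -
    have "x * bmom s 0 x \<le> x * (K * x powr (2 * s - 2) * exp (- (x / 2)))"
     using K(2)[OF x0] x0 by (intro mult_left_mono) auto
    also have "\<dots> \<le> x * (K * x powr (2 * s - 2) * 1)"
     using x0 K(1) by (intro mult_left_mono) auto
    also have "\<dots> = K * x powr (2 * s - 1)"
     using x0 powr_add[of x 1 "2 * s - 2"] by simp
    finally show ?thesis .
   qed
   then have d2: "0 \<le> - (x * bmom s 0 x) + K / (2 * s) * (2 * s * x powr (2 * s - 1))"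
    using s by simp
   show "\<exists>d. (?h has_real_derivative d) (at x) \<and> 0 \<le> d"
    by (rule exI, rule conjI[OF d1 d2])
  qed (use True in simp)
  moreover have "0 \<le> K / (2 * s) * z powr (2 * s)" using K(1) s by simp
  ultimately show ?thesis unfolding B_def by simp
 next
  case False
  then have "profile0 s z \<le> profile0 s 1" using dec[of 1 z] by (cases "z = 1") auto
  moreover have "0 \<le> K / (2 * s)" using K(1) s by simp
  ultimately show ?thesis unfolding B_def by linarith
 qed
 note lim = decreasing_bounded_limit[of "profile0 s" B, OF dec bd, folded profile_lim_def]
 show "(profile0 s \<longlongrightarrow> profile_lim s) (at_right 0)" by (rule lim(1))
 show le: "profile0 s z \<le> profile_lim s" if "0 < z" for z
  unfolding profile_lim_def by (rule decreasing_bounded_limit(2)[of "profile0 s" B z, OF dec bd that])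
 have fb: "flux0 s z \<le> K * exp (- (z / 2))" if "0 < z" for z
 proof -
  have "flux0 s z \<le> z powr (2 - 2 * s) * (K * z powr (2 * s - 2) * exp (- (z / 2)))"
   unfolding flux0_def using K(2)[OF that] by (intro mult_left_mono) auto
  also have "\<dots> = K * exp (- (z / 2)) * (z powr (2 - 2 * s) * z powr (2 * s - 2))" by (simp add: mult_ac)
  also have "z powr (2 - 2 * s) * z powr (2 * s - 2) = 1" using that by (simp add: powr_add[symmetric])
  finally show ?thesis by simp
 qed
 show fpos: "0 < flux0 s z" if "0 < z" for z using m0[OF that] that by (simp add: flux0_def)
 have fdec: "flux0 s y < flux0 s x" if "0 < x" "x < y" for x y
 proof (rule DERIV_neg_imp_decreasing[OF that(2)])
  fix z assume "x \<le> z" "z \<le> y"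
  then show "\<exists>d. (flux0 s has_real_derivative d) (at z) \<and> d < 0"
   using profile0_deriv(2)[OF s, of z] pos[of z] that by (intro exI[of _ "- (z powr (1 - 2 * s) * profile0 s z)"]) auto
 qed
 have fB: "flux0 s z \<le> K" if "0 < z" for z
 proof -
  have "K * exp (- (z / 2)) \<le> K * 1" using K(1) that by (intro mult_left_mono) auto
  then show ?thesis using fb[OF that] by simp
 qed
 note flim = decreasing_bounded_limit[of "flux0 s" K, OF fdec fB, folded flux_lim_def]
 show "(flux0 s \<longlongrightarrow> flux_lim s) (at_right 0)" by (rule flim(1))
 show "flux0 s z \<le> flux_lim s" if "0 < z" for z
  unfolding flux_lim_def by (rule decreasing_bounded_limit(2)[of "flux0 s" K z, OF fdec fB that])
 show "(flux0 s \<longlongrightarrow> 0) at_top"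
  by (rule tendsto_sandwich[OF _ _ tendsto_const exp_half_tendsto_0[of K]])
   (auto simp: eventually_at_top_dense intro!: exI[of _ 0] fb less_imp_le[OF fpos])
 have B0: "0 < B" using bd[of 1] pos[of 1] by simp
 have "profile0 s z \<le> (K + B * exp 1) * exp (- (z / 2))" if "0 < z" for z
 proof (cases "z < 1")
  case True
  have "B * 1 \<le> B * (exp 1 * exp (- (z / 2)))"
   using B0 True by (intro mult_left_mono) (auto simp: exp_add[symmetric])
  then have "profile0 s z \<le> B * exp 1 * exp (- (z / 2))" using bd[OF that] by (simp add: mult.assoc)
  also have "\<dots> \<le> (K + B * exp 1) * exp (- (z / 2))" using K(1) by (intro mult_right_mono) auto
  finally show ?thesis .
 next
  case False
  then have "profile0 s z \<le> K * exp (- (z / 2))" using up by simp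
  also have "\<dots> \<le> (K + B * exp 1) * exp (- (z / 2))" using B0 by (intro mult_right_mono) auto
  finally show ?thesis .
 qed
 then show "\<exists>K. \<forall>z>0. profile0 s z \<le> K * exp (- (z / 2))" by blast
qed

lemma profile_lim_pos:
 assumes s: "0 < s" "s < 1"
 shows "0 < profile_lim s" "0 < flux_lim s"
 using profile0_props(2,3,5,6)[OF s, of 1] by auto

text \<open>\<open>profile s l\<close> is the \<open>l\<close>-th derivative of the solution of
 \<open>u'' + (1 - 2 s) / z * u' = u\<close> on the half-line with \<open>u 0 = 1\<close> that decays at infinity.\<close>

fun profile :: "real => nat => real => real" where
 "profile s 0 z = profile0 s z / profile_lim s"
| "profile s (Suc l) z = - ((-1) ^ l * (z * bmom s l z - real l * bmom s (l - 1) z) / profile_lim s)"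

text \<open>Differentiating z times a moment repeatedly leaves two Leibniz terms, because z has no
  second derivative.\<close>

lemma profile_deriv:
 assumes s: "0 < s" "s < 1" and z: "0 < z"
 shows "(profile s l has_real_derivative profile s (Suc l) z) (at z)"
proof (cases l)
 case 0
 have "((%z. profile0 s z / profile_lim s) has_real_derivative - (z * bmom s 0 z) / profile_lim s) (at z)"
  by (rule DERIV_cdivide[OF profile0_deriv(1)[OF s z]])
 moreover have "profile s 0 = (%z. profile0 s z / profile_lim s)" by auto
 ultimately show ?thesis using 0 by simp
next
 case (Suc m)
 note d = bmom_deriv[OF s(2) z]
 \<comment> \<open>For m = 0 the truncated difference m - 1 is 0, and the factor
   \<open>real m\<close> removes the spurious term.\<close>
 have d2: "((%z. real m * bmom s (m - 1) z) has_real_derivative - (real m * bmom s m z)) (at z)"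
 proof (cases m)
  case (Suc k)
  then show ?thesis using DERIV_cmult[OF d[of k], of "real m"] by simp
 qed simp
 have "((%z. - ((-1) ^ m * (z * bmom s m z - real m * bmom s (m - 1) z) / profile_lim s)) has_real_derivative
   - ((-1) ^ m * (1 * bmom s m z + - bmom s (Suc m) z * z - - (real m * bmom s m z)) / profile_lim s)) (at z)"
  by (intro DERIV_minus DERIV_cdivide DERIV_cmult DERIV_diff DERIV_mult DERIV_ident d d2)
 moreover have "- ((-1) ^ m * (1 * bmom s m z + - bmom s (Suc m) z * z - - (real m * bmom s m z)) / profile_lim s)
   = profile s (Suc (Suc m)) z"
  by (simp add: algebra_simps)
 moreover have "profile s (Suc m) = (%z. - ((-1) ^ m * (z * bmom s m z - real m * bmom s (m - 1) z) / profile_lim s))"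
  by auto
 ultimately show ?thesis using Suc by simp
qed

text \<open>The rate rho is prescribed, which fixes delta = (1 - rho) / 2 and kappa = 1 / delta. The
  two Leibniz terms are of the same order: l times the bound for moment l - 1 equals delta times z
  times the bound for moment l. Together they cost a factor 2.\<close>

lemma profile_bound:
 assumes s: "0 < s" "s < 1" and \<rho>: "0 < \<rho>" "\<rho> < 1"
 obtains C \<kappa> where "0 < C" "1 \<le> \<kappa>"
  "\<And>l z. 0 < z ==> \<bar>profile s (Suc l) z\<bar> \<le> C * \<kappa> ^ l * fact l * z powr (2 * s - 1 - real l) * exp (- (\<rho> * z))"
proof
 define \<delta> where "\<delta> = (1 - \<rho>) / 2"
 have d: "0 < \<delta>" "\<delta> < 1/2" "1 - 2 * \<delta> = \<rho>" using \<rho> by (auto simp: \<delta>_def field_simps)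
 define G where "G = Gamma (2 - 2 * s) * \<delta> powr (2 * s - 2)"
 have G: "0 < G" using Gamma_real_pos[of "2 - 2 * s"] s d by (simp add: G_def)
 note L = profile_lim_pos(1)[OF s]
 show "0 < 2 * G / profile_lim s" using G L by simp
 show "1 \<le> 1 / \<delta>" using d by simp
 fix l :: nat and z :: real assume z: "0 < z"
 let ?E = "exp (- (\<rho> * z)) * (G * z powr (2 * s - 2))"
 have M: "bmom s k z \<le> fact k / (\<delta> * z) ^ k * ?E" for k
  using bmom_bounds(3)[OF s(2) z d(1,2), of k] z d unfolding d(3) by (simp add: powr_mult G_def mult_ac)
 have M0: "0 \<le> bmom s k z" for k by (rule bmom_bounds(2)[OF s(2) z])
 have E0: "0 \<le> ?E" using G by simp
 have a: "z * bmom s l z \<le> z * (fact l / (\<delta> * z) ^ l * ?E)" using M z by (intro mult_left_mono) auto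
 have b: "real l * bmom s (l - 1) z \<le> z * (fact l / (\<delta> * z) ^ l * ?E)"
 proof (cases l)
  case 0 then show ?thesis using z E0 d G by simp
 next
  case (Suc k)
  have "real l * bmom s (l - 1) z \<le> real l * (fact k / (\<delta> * z) ^ k * ?E)"
   using M[of k] Suc by (intro mult_left_mono) auto
  also have "\<dots> = \<delta> * (z * (fact l / (\<delta> * z) ^ l * ?E))" using Suc z d by (simp add: field_simps)
  also have "\<dots> \<le> 1 * (z * (fact l / (\<delta> * z) ^ l * ?E))"
   using d z E0 by (intro mult_right_mono) auto
  finally show ?thesis by simp
 qed
 have ab: "\<bar>z * bmom s l z - real l * bmom s (l - 1) z\<bar> \<le> 2 * (z * (fact l / (\<delta> * z) ^ l * ?E))"
 proof -
  have "0 \<le> z * bmom s l z" "0 \<le> real l * bmom s (l - 1) z" using M0 z by auto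
  moreover have "0 \<le> p ==> 0 \<le> q ==> p \<le> B ==> q \<le> B ==> \<bar>p - q\<bar> \<le> 2 * B" for p q B :: real by linarith
  ultimately show ?thesis using a b by blast
 qed
 have "\<bar>profile s (Suc l) z\<bar> = \<bar>z * bmom s l z - real l * bmom s (l - 1) z\<bar> / profile_lim s"
  using L by (simp add: abs_mult)
 also have "\<dots> \<le> 2 * (z * (fact l / (\<delta> * z) ^ l * ?E)) / profile_lim s"
  by (rule divide_right_mono[OF ab less_imp_le[OF L]])
 also have "z * (fact l / (\<delta> * z) ^ l * ?E) = (1 / \<delta>) ^ l * fact l * G * exp (- (\<rho> * z)) * (z * z powr (2 * s - 2) / z ^ l)"
  using z d by (simp add: power_mult_distrib field_simps)
 also have "z * z powr (2 * s - 2) / z ^ l = z powr (2 * s - 1 - real l)"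
  using z powr_add[of z 1 "2 * s - 2"] by (simp add: powr_diff powr_realpow)
 finally show "\<bar>profile s (Suc l) z\<bar> \<le> 2 * G / profile_lim s * (1 / \<delta>) ^ l * fact l * z powr (2 * s - 1 - real l) * exp (- (\<rho> * z))"
  by (simp add: mult_ac)
qed

section \<open>Weighted Sobolev spaces\<close>

definition grad :: "('a::euclidean_space => real) => 'a => 'a" where
 "grad f x = (\<Sum>b\<in>Basis. dd b f x *\<^sub>R b)"

lemma grad_inner: "b \<in> Basis ==> grad f x \<bullet> b = dd b f x"
 by (simp add: grad_def inner_sum_left inner_Basis if_distrib cong: if_cong)

context pos_weight
begin

lemma wL2_bound:
 fixes u :: "'a => 'b::euclidean_space" and v :: "'a => 'c::euclidean_space"
 assumes [measurable]: "u \<in> meas S" and v: "v \<in> wsp"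
  and b: "AE x in leb S. norm (u x) \<le> k * norm (v x)" and k: "0 \<le> k"
 shows "u \<in> wsp" "nrm u \<le> k * nrm v"
proof -
 have i: "intg S (%x. k\<^sup>2 * (\<omega> x * (norm (v x))^2))" using wL2D(2)[OF v] by auto
 have ae: "AE x in leb S. norm (\<omega> x * (norm (u x))^2) \<le> k\<^sup>2 * (\<omega> x * (norm (v x))^2)"
  using b AE_space
 proof eventually_elim
  case (elim x)
  then have o: "0 < \<omega> x" using pos_\<omega> by simp
  have "(norm (u x))^2 \<le> (k * norm (v x))^2" using elim by (intro power_mono) auto
  then have "\<omega> x * (norm (u x))^2 \<le> \<omega> x * (k * norm (v x))^2" using o by (intro mult_left_mono) auto
  then show ?case using o by (simp add: power_mult_distrib abs_mult mult.left_commute)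
 qed
 have iu: "intg S (%x. \<omega> x * (norm (u x))^2)"
  by (rule intg_bound[OF i]) (measurable, use ae in \<open>auto elim!: AE_mp\<close>)
 then show "u \<in> wsp" by (simp add: wL2_def)
 have "(nrm u)^2 \<le> (lint S (%x. k\<^sup>2 * (\<omega> x * (norm (v x))^2)))"
  unfolding norm_sq using ae by (intro integral_mono_AE[OF iu i]) (auto elim!: AE_mp)
 also have "\<dots> = (k * nrm v)^2" by (simp add: norm_sq power_mult_distrib)
 finally show "nrm u \<le> k * nrm v"
  by (rule power2_le_imp_le) (simp add: norm_nonneg k)
qed

lemma wL2_component:
 fixes W :: "'a => 'b::euclidean_space"
 assumes W: "W \<in> wsp" and b: "b \<in> Basis"
 shows "(%x. W x \<bullet> b) \<in> wsp" "nrm (%x. W x \<bullet> b) \<le> nrm W"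
proof -
 have m: "(%x. W x \<bullet> b) \<in> meas S" using wL2D(1)[OF W] by measurable
 have "AE x in leb S. norm (W x \<bullet> b) \<le> 1 * norm (W x)" using b by (simp add: Basis_le_norm)
 from wL2_bound[OF m W this] show "(%x. W x \<bullet> b) \<in> wsp" "nrm (%x. W x \<bullet> b) \<le> nrm W" by auto
qed

lemma wL2_of_components:
 fixes W :: "'a => 'b::euclidean_space"
 assumes "\<And>b. b \<in> Basis ==> (%x. W x \<bullet> b) \<in> wsp"
 shows "W \<in> wsp"
proof -
 have "(%x. (W x \<bullet> b) *\<^sub>R b) \<in> wsp" if b: "b \<in> Basis" for b
 proof (rule wL2_bound(1)[OF _ assms[OF b]])
  show "(%x. (W x \<bullet> b) *\<^sub>R b) \<in> meas S" using wL2D(1)[OF assms[OF b]] by measurable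
  show "AE x in leb S. norm ((W x \<bullet> b) *\<^sub>R b) \<le> 1 * norm (W x \<bullet> b)" using b by simp
 qed simp
 then have "(%x. \<Sum>b\<in>Basis. (W x \<bullet> b) *\<^sub>R b) \<in> wsp" by (intro wL2_sum) auto
 then show ?thesis by (simp add: euclidean_representation)
qed

text \<open>\<open>weak_grad\<close> is assembled from arbitrary choices. Uniqueness of weak
  derivatives almost everywhere carries measurability and integrability over to it from any
  witnesses.\<close>

lemma wH1_weak_grad:
 assumes w: "w \<in> wH1 S \<omega>"
 shows "weak_grad S w \<in> wsp" "b \<in> Basis ==> hwd S b 1 w (%x. weak_grad S w x \<bullet> b)"
proof -
 have "\<forall>b\<in>Basis. \<exists>v. v \<in> wsp \<and> hwd S b 1 w v" using w unfolding wH1_def by blast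
 then obtain v where v: "\<And>b. b \<in> Basis ==> v b \<in> wsp" "\<And>b. b \<in> Basis ==> hwd S b 1 w (v b)"
  by (metis (no_types, lifting))
 have aeW: "AE x in leb S. weak_grad S w x = (\<Sum>b\<in>Basis. v b x *\<^sub>R b)" by (rule weak_grad_eq[OF open_S v(2)])
 have ae: "AE x in leb S. v b x = weak_grad S w x \<bullet> b" if b: "b \<in> Basis" for b
  using aeW by eventually_elim (use b in \<open>simp add: inner_sum_left inner_Basis if_distrib cong: if_cong\<close>)
 show "weak_grad S w \<in> wsp"
 proof (rule wL2_of_components)
  fix b :: 'a assume b: "b \<in> Basis"
  show "(%x. weak_grad S w x \<bullet> b) \<in> wsp"
   by (rule wL2_cong_AE[OF ae[OF b] v(1)[OF b] borel_measurable_AE_lebesgue_on[OF open_S wL2D(1)[OF v(1)[OF b]] ae[OF b]]])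
 qed
 show "hwd S b 1 w (%x. weak_grad S w x \<bullet> b)" if b: "b \<in> Basis"
  by (rule hwd_cong_AE[OF open_S v(2)[OF b] b _ ae[OF b]]) simp
qed

lemma wH1I:
 assumes w: "w \<in> wsp" and W: "W \<in> wsp" and d: "\<And>b. b \<in> Basis ==> hwd S b 1 w (%x. W x \<bullet> b)"
 shows "w \<in> wH1 S \<omega>" "AE x in leb S. weak_grad S w x = W x"
proof -
 show "w \<in> wH1 S \<omega>" unfolding wH1_def using w wL2_component(1)[OF W] d by blast
 have "AE x in leb S. weak_grad S w x = (\<Sum>b\<in>Basis. (W x \<bullet> b) *\<^sub>R b)"
  by (rule weak_grad_eq[OF open_S d])
 then show "AE x in leb S. weak_grad S w x = W x"
  by eventually_elim (simp add: euclidean_representation)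
qed

lemma wH1_wL2: "w \<in> wH1 S \<omega> ==> w \<in> wsp" by (simp add: wH1_def)

lemma wH1_lincomb:
 assumes w: "w \<in> wH1 S \<omega>" and v: "v \<in> wH1 S \<omega>"
 shows "(%x. r * w x + t * v x) \<in> wH1 S \<omega>"
  "AE x in leb S. weak_grad S (%x. r * w x + t * v x) x = r *\<^sub>R weak_grad S w x + t *\<^sub>R weak_grad S v x"
proof -
 note W = wH1_weak_grad[OF w] and V = wH1_weak_grad[OF v]
 have 1: "(%x. r * w x + t * v x) \<in> wsp"
  using wL2_add(1)[OF wL2_cmult(1)[OF wH1_wL2[OF w], of r] wL2_cmult(1)[OF wH1_wL2[OF v], of t]] by simp
 have 2: "(%x. r *\<^sub>R weak_grad S w x + t *\<^sub>R weak_grad S v x) \<in> wsp"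
  by (rule wL2_add(1)[OF wL2_cmult(1)[OF W(1)] wL2_cmult(1)[OF V(1)]])
 have 3: "hwd S b 1 (%x. r * w x + t * v x) (%x. (r *\<^sub>R weak_grad S w x + t *\<^sub>R weak_grad S v x) \<bullet> b)" if b: "b \<in> Basis" for b
  using hwd_add[OF open_S b hwd_cmult[OF W(2)[OF b], of r] hwd_cmult[OF V(2)[OF b], of t]]
  by (simp add: inner_add_left)
 show "(%x. r * w x + t * v x) \<in> wH1 S \<omega>"
  "AE x in leb S. weak_grad S (%x. r * w x + t * v x) x = r *\<^sub>R weak_grad S w x + t *\<^sub>R weak_grad S v x"
  using wH1I[OF 1 2 3] by auto
qed

lemma wH1_diff:
 assumes w: "w \<in> wH1 S \<omega>" and v: "v \<in> wH1 S \<omega>"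
 shows "(%x. w x - v x) \<in> wH1 S \<omega>"
  "AE x in leb S. weak_grad S (%x. w x - v x) x = weak_grad S w x - weak_grad S v x"
 using wH1_lincomb[OF w v, of 1 "-1"] by auto

lemma wH1_norm_bounds:
 "nrm w \<le> wH1_norm S \<omega> w" "nrm (weak_grad S w) \<le> wH1_norm S \<omega> w"
 "wH1_norm S \<omega> w \<le> nrm w + nrm (weak_grad S w)"
 unfolding wH1_norm_def by (auto simp: norm_nonneg intro!: real_le_rsqrt sqrt_sum_squares_le_sum)

lemma wH1_diff_norm:
 assumes w: "w \<in> wH1 S \<omega>" and v: "v \<in> wH1 S \<omega>"
 shows "nrm (weak_grad S (%x. w x - v x)) = nrm (%x. weak_grad S w x - weak_grad S v x)"
 by (rule wL2_norm_cong_AE[OF wH1_diff(2)[OF w v]])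
  (use wL2D(1) wH1_weak_grad(1) wH1_diff(1)[OF w v] w v wL2_diff(1) in blast)+

lemma wH1_tendstoD:
 assumes w: "w \<in> wH1 S \<omega>" and v: "\<And>n::nat. v n \<in> wH1 S \<omega>"
  and lim: "null (%n. wH1_norm S \<omega> (%x. w x - v n x))"
 shows "null (%n. nrm (%x. w x - v n x))"
  "null (%n. nrm (%x. weak_grad S w x - weak_grad S (v n) x))"
proof -
 show "null (%n. nrm (%x. w x - v n x))"
  by (rule tendsto_sandwich[OF _ _ tendsto_const lim]) (simp_all add: wH1_norm_bounds(1) norm_nonneg)
 show "null (%n. nrm (%x. weak_grad S w x - weak_grad S (v n) x))"
  unfolding wH1_diff_norm[OF w v, symmetric]
  by (rule tendsto_sandwich[OF _ _ tendsto_const lim]) (simp_all add: wH1_norm_bounds(2) norm_nonneg)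
qed

lemma wH1_tendstoI:
 assumes w: "w \<in> wH1 S \<omega>" and v: "\<And>n::nat. v n \<in> wH1 S \<omega>"
  and 1: "null (%n. nrm (%x. w x - v n x))"
  and 2: "null (%n. nrm (%x. weak_grad S w x - weak_grad S (v n) x))"
 shows "null (%n. wH1_norm S \<omega> (%x. w x - v n x))"
proof (rule tendsto_sandwich[OF _ _ tendsto_const tendsto_add_zero[OF 1 2]])
 show "\<forall>\<^sub>F n in sequentially. 0 \<le> wH1_norm S \<omega> (%x. w x - v n x)"
  using order_trans[OF norm_nonneg wH1_norm_bounds(1)] by simp
 show "\<forall>\<^sub>F n in sequentially. wH1_norm S \<omega> (%x. w x - v n x)
   \<le> nrm (%x. w x - v n x) + nrm (%x. weak_grad S w x - weak_grad S (v n) x)"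
  using wH1_norm_bounds(3) wH1_diff_norm[OF w v] by (intro always_eventually allI) metis
qed

lemma wH1_smooth:
 assumes \<zeta>: "smooth \<zeta>" "\<zeta> \<in> wsp" "\<And>b. b \<in> Basis ==> dd b \<zeta> \<in> wsp"
 shows "\<zeta> \<in> wH1 S \<omega>" "AE x in leb S. weak_grad S \<zeta> x = grad \<zeta> x" "grad \<zeta> \<in> wsp"
proof -
 show 1: "grad \<zeta> \<in> wsp"
  by (rule wL2_of_components) (simp add: grad_inner \<zeta>(3))
 have 2: "hwd S b 1 \<zeta> (%x. grad \<zeta> x \<bullet> b)" if "b \<in> Basis" for b
  using hwd_smooth[OF open_S that \<zeta>(1)] that by (simp add: grad_inner)
 show "\<zeta> \<in> wH1 S \<omega>" "AE x in leb S. weak_grad S \<zeta> x = grad \<zeta> x"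
  using wH1I[OF \<zeta>(2) 1 2] by auto
qed

lemma wH1_test:
 assumes \<zeta>: "\<zeta> \<in> TF S"
 shows "\<zeta> \<in> wH1 S \<omega>" "AE x in leb S. weak_grad S \<zeta> x = grad \<zeta> x" "grad \<zeta> \<in> wsp"
 using wH1_smooth[OF test_smooth[OF \<zeta>] test_in_wL2[OF \<zeta>] test_in_wL2[OF test_dir_deriv[OF \<zeta>]]] by auto

end

lemma pos_weight_1: "open S ==> pos_weight S (%_. 1)"
 by unfold_locales auto

lemma test_in_H10:
 assumes "open S" and \<zeta>: "\<zeta> \<in> TF S"
 shows "\<zeta> \<in> H10 S"
proof -
 interpret pos_weight S "%_. 1" by (rule pos_weight_1[OF assms(1)])
 note h = wH1_test(1)[OF \<zeta>]
 have "null (%j::nat. wH1_norm S (%_. 1) (%x. \<zeta> x - \<zeta> x))"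
  by (rule wH1_tendstoI[OF h h]) (simp_all add: wL2_zero)
 then show ?thesis unfolding H10_def using h \<zeta> by (intro CollectI conjI exI[of _ "%_. \<zeta>"]) auto
qed

text \<open>A diagonal sequence: for each n one test function within 1 / (n + 1) of v n.\<close>

lemma H10_closed:
 assumes S: "open S" and w: "w \<in> wH1 S (%_. 1)" and v: "\<And>n. v n \<in> H10 S"
  and lim: "null (%n. wH1_norm S (%_. 1) (%x. w x - v n x))"
 shows "w \<in> H10 S"
proof -
 interpret pos_weight S "%_. 1" by (rule pos_weight_1[OF S])
 have vH: "v n \<in> wH1 S (%_. 1)" for n using v unfolding H10_def by blast
 have "\<exists>\<zeta>. \<zeta> \<in> TF S \<and> wH1_norm S (%_. 1) (%x. v n x - \<zeta> x) < 1 / real (Suc n)" for n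
 proof -
  obtain \<zeta> where z: "\<And>j. \<zeta> j \<in> TF S" "null (%j. wH1_norm S (%_. 1) (%x. v n x - \<zeta> j x))"
   using v[of n] unfolding H10_def by blast
  have "\<forall>\<^sub>F j in sequentially. wH1_norm S (%_. 1) (%x. v n x - \<zeta> j x) < 1 / real (Suc n)"
   by (rule order_tendstoD(2)[OF z(2)]) simp
  then obtain j where "wH1_norm S (%_. 1) (%x. v n x - \<zeta> j x) < 1 / real (Suc n)"
   unfolding eventually_sequentially by blast
  then show ?thesis using z(1) by blast
 qed
 then obtain \<zeta> where z: "\<And>n. \<zeta> n \<in> TF S" "\<And>n. wH1_norm S (%_. 1) (%x. v n x - \<zeta> n x) < 1 / real (Suc n)"
  by metis
 have zH: "\<zeta> n \<in> wH1 S (%_. 1)" for n by (rule wH1_test(1)[OF z(1)])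
 note D = wH1_tendstoD[OF w vH lim]
 have s: "null (%n. 1 / real (Suc n))" by (rule LIMSEQ_Suc[OF lim_1_over_n])
 have a: "wL2_norm S (%_. 1) (%x. v n x - \<zeta> n x) \<le> 1 / real (Suc n)" for n
  using wH1_norm_bounds(1)[of "%x. v n x - \<zeta> n x"] z(2)[of n] by linarith
 have b: "wL2_norm S (%_. 1) (%x. weak_grad S (v n) x - weak_grad S (\<zeta> n) x) \<le> 1 / real (Suc n)" for n
  using wH1_norm_bounds(2)[of "%x. v n x - \<zeta> n x"] z(2)[of n] wH1_diff_norm[OF vH zH, of n n] by simp
 have "null (%n. wH1_norm S (%_. 1) (%x. w x - \<zeta> n x))"
 proof (rule wH1_tendstoI[OF w zH])
  show "null (%n. wL2_norm S (%_. 1) (%x. w x - \<zeta> n x))"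
  proof (rule tendsto_sandwich[OF _ _ tendsto_const tendsto_add_zero[OF D(1) s]])
   show "\<forall>\<^sub>F n in sequentially. wL2_norm S (%_. 1) (%x. w x - \<zeta> n x) \<le> wL2_norm S (%_. 1) (%x. w x - v n x) + 1 / real (Suc n)"
   proof (intro always_eventually allI)
    fix n
    show "wL2_norm S (%_. 1) (%x. w x - \<zeta> n x) \<le> wL2_norm S (%_. 1) (%x. w x - v n x) + 1 / real (Suc n)"
     using wL2_norm_diff_triangle[OF wH1_wL2[OF w] wH1_wL2[OF vH[of n]] wH1_wL2[OF zH[of n]]] a[of n] by linarith
   qed
  qed (simp add: norm_nonneg)
  show "null (%n. wL2_norm S (%_. 1) (%x. weak_grad S w x - weak_grad S (\<zeta> n) x))"
  proof (rule tendsto_sandwich[OF _ _ tendsto_const tendsto_add_zero[OF D(2) s]])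
   show "\<forall>\<^sub>F n in sequentially. wL2_norm S (%_. 1) (%x. weak_grad S w x - weak_grad S (\<zeta> n) x)
     \<le> wL2_norm S (%_. 1) (%x. weak_grad S w x - weak_grad S (v n) x) + 1 / real (Suc n)"
   proof (intro always_eventually allI)
    fix n
    show "wL2_norm S (%_. 1) (%x. weak_grad S w x - weak_grad S (\<zeta> n) x)
      \<le> wL2_norm S (%_. 1) (%x. weak_grad S w x - weak_grad S (v n) x) + 1 / real (Suc n)"
     using wL2_norm_diff_triangle[OF wH1_weak_grad(1)[OF w] wH1_weak_grad(1)[OF vH[of n]] wH1_weak_grad(1)[OF zH[of n]]] b[of n] by linarith
   qed
  qed (simp add: norm_nonneg)
 qed
 then show ?thesis unfolding H10_def using w z(1) by blast
qed

lemma H10_lincomb: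
 assumes S: "open S" and w: "w \<in> H10 S" and v: "v \<in> H10 S"
 shows "(%x. r * w x + t * v x) \<in> H10 S"
proof -
 interpret pos_weight S "%_. 1" by (rule pos_weight_1[OF S])
 obtain \<zeta> where z: "\<And>j. \<zeta> j \<in> TF S" "null (%j. wH1_norm S (%_. 1) (%x. w x - \<zeta> j x))"
  using w unfolding H10_def by blast
 obtain \<eta> where e: "\<And>j. \<eta> j \<in> TF S" "null (%j. wH1_norm S (%_. 1) (%x. v x - \<eta> j x))"
  using v unfolding H10_def by blast
 have wH: "w \<in> wH1 S (%_. 1)" and vH: "v \<in> wH1 S (%_. 1)" using w v unfolding H10_def by auto
 have zH: "\<zeta> n \<in> wH1 S (%_. 1)" and eH: "\<eta> n \<in> wH1 S (%_. 1)" for n using wH1_test(1) z e by blast+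
 note Z = wH1_tendstoD[OF wH zH z(2)] and E = wH1_tendstoD[OF vH eH e(2)]
 have t: "(%x. r * \<zeta> n x + t * \<eta> n x) \<in> TF S" for n
  by (intro test_add test_cmult z e)
 note tH = wH1_test(1)[OF t]
 have s: "null (%n. \<bar>r\<bar> * f n + \<bar>t\<bar> * g n)" if "f \<longlonglongrightarrow> 0" "g \<longlonglongrightarrow> 0" for f g :: "nat => real"
  using tendsto_add[OF tendsto_mult_left[OF that(1), of "\<bar>r\<bar>"] tendsto_mult_left[OF that(2), of "\<bar>t\<bar>"]] by simp
 have tri: "wL2_norm S (%_. 1) (%x. (r *\<^sub>R a x + t *\<^sub>R b x) - (r *\<^sub>R a' x + t *\<^sub>R b' x))
   \<le> \<bar>r\<bar> * wL2_norm S (%_. 1) (%x. a x - a' x) + \<bar>t\<bar> * wL2_norm S (%_. 1) (%x. b x - b' x)"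
  if "a \<in> wL2 S (%_. 1)" "b \<in> wL2 S (%_. 1)" "a' \<in> wL2 S (%_. 1)" "b' \<in> wL2 S (%_. 1)"
  for a b a' b' :: "'a => 'c::euclidean_space"
 proof -
  have e: "(r *\<^sub>R a x + t *\<^sub>R b x) - (r *\<^sub>R a' x + t *\<^sub>R b' x) = r *\<^sub>R (a x - a' x) + t *\<^sub>R (b x - b' x)" for x
   by (simp add: algebra_simps)
  note A = wL2_diff(1)[OF that(1,3)] and B = wL2_diff(1)[OF that(2,4)]
  show ?thesis unfolding e
   using wL2_add(2)[OF wL2_cmult(1)[OF A, of r] wL2_cmult(1)[OF B, of t]] wL2_cmult(2)[OF A, of r] wL2_cmult(2)[OF B, of t]
   by simp
 qed
 show ?thesis
 proof (rule H10_closed[OF S wH1_lincomb(1)[OF wH vH] test_in_H10[OF S t]], rule wH1_tendstoI[OF wH1_lincomb(1)[OF wH vH] tH])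
  show "null (%n. wL2_norm S (%_. 1) (%x. r * w x + t * v x - (r * \<zeta> n x + t * \<eta> n x)))"
   by (rule tendsto_sandwich[OF _ _ tendsto_const s[OF Z(1) E(1)]])
    (use tri[OF wH1_wL2[OF wH] wH1_wL2[OF vH] wH1_wL2[OF zH] wH1_wL2[OF eH]] in \<open>simp_all add: norm_nonneg\<close>)
  have "wL2_norm S (%_. 1) (%x. weak_grad S (%x. r * w x + t * v x) x - weak_grad S (%x. r * \<zeta> n x + t * \<eta> n x) x)
    = wL2_norm S (%_. 1) (%x. (r *\<^sub>R weak_grad S w x + t *\<^sub>R weak_grad S v x) - (r *\<^sub>R weak_grad S (\<zeta> n) x + t *\<^sub>R weak_grad S (\<eta> n) x))" for n
  proof (rule wL2_norm_cong_AE)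
   show "AE x in leb S. weak_grad S (%x. r * w x + t * v x) x - weak_grad S (%x. r * \<zeta> n x + t * \<eta> n x) x
     = (r *\<^sub>R weak_grad S w x + t *\<^sub>R weak_grad S v x) - (r *\<^sub>R weak_grad S (\<zeta> n) x + t *\<^sub>R weak_grad S (\<eta> n) x)"
    using wH1_lincomb(2)[OF wH vH, of r t] wH1_lincomb(2)[OF zH eH, of r n t n] by eventually_elim simp
   show "(%x. weak_grad S (%x. r * w x + t * v x) x - weak_grad S (%x. r * \<zeta> n x + t * \<eta> n x) x) \<in> meas S"
    by (rule wL2D(1)[OF wL2_diff(1)[OF wH1_weak_grad(1)[OF wH1_lincomb(1)[OF wH vH]] wH1_weak_grad(1)[OF tH]]])
   show "(%x. (r *\<^sub>R weak_grad S w x + t *\<^sub>R weak_grad S v x) - (r *\<^sub>R weak_grad S (\<zeta> n) x + t *\<^sub>R weak_grad S (\<eta> n) x)) \<in> meas S"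
    by (rule wL2D(1), intro wL2_diff(1) wL2_add(1) wL2_cmult(1) wH1_weak_grad(1) wH vH zH eH)
  qed
  then show "null (%n. wL2_norm S (%_. 1) (%x. weak_grad S (%x. r * w x + t * v x) x - weak_grad S (%x. r * \<zeta> n x + t * \<eta> n x) x))"
   by (intro tendsto_sandwich[OF _ _ tendsto_const s[OF Z(2) E(2)]])
    (use tri[OF wH1_weak_grad(1)[OF wH] wH1_weak_grad(1)[OF vH] wH1_weak_grad(1)[OF zH] wH1_weak_grad(1)[OF eH]] in \<open>simp_all add: norm_nonneg\<close>)
 qed
qed

section \<open>Functions on the cylinder\<close>

lemma open_cyl:
 assumes "open \<Omega>"
 shows "open (cyl \<Omega>)"
 unfolding cyl_def by (rule open_Times[OF assms open_greaterThan])

lemma pos_weight_exp: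
 assumes "open \<Omega>"
 shows "pos_weight (cyl \<Omega>) (exp_weight \<beta> \<theta>)"
proof
 show "open (cyl \<Omega>)" by (rule open_cyl[OF assms])
 show "continuous_on (cyl \<Omega>) (exp_weight \<beta> \<theta>)"
  unfolding exp_weight_def cyl_def by (intro continuous_intros) auto
 show "0 < exp_weight \<beta> \<theta> x" if "x \<in> cyl \<Omega>" for x
  using that by (auto simp: exp_weight_def cyl_def)
qed

lemma ext_weight_eq: "ext_weight s = exp_weight (1 - 2 * s) 0"
 by (auto simp: ext_weight_def exp_weight_def)

lemma pos_weight_ext: "open \<Omega> ==> pos_weight (cyl \<Omega>) (ext_weight s)"
 unfolding ext_weight_eq by (rule pos_weight_exp)

lemma pos_weight_half_line: "pos_weight {0<..} (%y::real. y powr \<beta> * exp (\<theta> * y))"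
 by unfold_locales (auto intro!: continuous_intros)

lemma wL2_tensor:
 fixes W :: "real^'n => 'b::euclidean_space" and e :: "real => real"
 assumes \<Omega>: "open \<Omega>" and W: "W \<in> wL2 \<Omega> (%_. 1)" and e: "e \<in> wL2 {0<..} (%y. y powr \<beta> * exp (\<theta> * y))"
 shows "(%z. e (snd z) *\<^sub>R W (fst z)) \<in> wL2 (cyl \<Omega>) (exp_weight \<beta> \<theta>)"
  "wL2_norm (cyl \<Omega>) (exp_weight \<beta> \<theta>) (%z. e (snd z) *\<^sub>R W (fst z))
   = wL2_norm \<Omega> (%_. 1) W * wL2_norm {0<..} (%y. y powr \<beta> * exp (\<theta> * y)) e"
proof -
 let ?w = "%y::real. y powr \<beta> * exp (\<theta> * y)"
 have R: "open ({0<..} :: real set)" by simp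
 have Wm[measurable]: "W \<in> meas \<Omega>" and Wi: "intg \<Omega> (%x. (norm (W x))^2)"
  using W by (auto simp: wL2_def)
 have em: "e \<in> meas {0<..}" and ei: "intg {0<..} (%y. ?w y * (norm (e y))^2)"
  using e by (auto simp: wL2_def)
 have m: "(%z. e (snd z) *\<^sub>R W (fst z)) \<in> meas (cyl \<Omega>)"
 proof (rule borel_measurable_euclidean_space[THEN iffD2], intro ballI)
  fix b :: 'b assume "b \<in> Basis"
  have "(%x. W x \<bullet> b) \<in> meas \<Omega>" by measurable
  from lebesgue_on_tensor_measurable[OF \<Omega> R this em]
  show "(%z. e (snd z) *\<^sub>R W (fst z) \<bullet> b) \<in> meas (cyl \<Omega>)"
   unfolding cyl_def by (simp add: mult.commute)
 qed
 have eq: "exp_weight \<beta> \<theta> z * (norm (e (snd z) *\<^sub>R W (fst z)))^2 = (norm (W (fst z)))^2 * (?w (snd z) * (norm (e (snd z)))^2)" for z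
  by (simp add: exp_weight_def power_mult_distrib mult_ac)
 note T = lebesgue_on_tensor_integrable[OF \<Omega> R Wi ei]
 show "(%z. e (snd z) *\<^sub>R W (fst z)) \<in> wL2 (cyl \<Omega>) (exp_weight \<beta> \<theta>)"
  unfolding wL2_def mem_Collect_eq eq using m T(1) unfolding cyl_def by blast
 show "wL2_norm (cyl \<Omega>) (exp_weight \<beta> \<theta>) (%z. e (snd z) *\<^sub>R W (fst z)) = wL2_norm \<Omega> (%_. 1) W * wL2_norm {0<..} ?w e"
  unfolding wL2_norm_def eq using T(2) unfolding cyl_def by (simp add: real_sqrt_mult)
qed

section \<open>The scaled profile as a limit of test functions\<close>

abbreviation hw :: "real => real => real => real" where
 "hw \<beta> \<theta> \<equiv> (%y. y powr \<beta> * exp (\<theta> * y))"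

definition scaled_profile :: "real => real => nat => real => real" where
 "scaled_profile s lam l y = sqrt lam ^ l * profile s l (sqrt lam * y)"

text \<open>The limit at y = 0 of - y^(1-2s) times the derivative of Psi (sqrt lam * y): the
  Dirichlet-to-Neumann factor of one mode, proportional to lam^s.\<close>

definition mode_flux :: "real => real => real" where
 "mode_flux s lam = lam powr s * flux_lim s / profile_lim s"

text \<open>The squared norm is a Gamma integral; the first hypothesis is its convergence at 0, the
  second its convergence at infinity.\<close>

lemma powr_exp_wL2:
 assumes "2 * p + \<beta> > - 1" "\<theta> < 2 * q"
 shows "(%y. y powr p * exp (- (q * y))) \<in> wL2 {0<..} (hw \<beta> \<theta>)"
  "(wL2_norm {0<..} (hw \<beta> \<theta>) (%y. y powr p * exp (- (q * y))))^2
   \<le> Gamma (2 * p + \<beta> + 1) * (2 * q - \<theta>) powr (- (2 * p + \<beta> + 1))"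
proof -
 interpret pos_weight "{0<..}" "hw \<beta> \<theta>" by (rule pos_weight_half_line)
 have e: "y powr (2 * p + \<beta> + 1 - 1) * exp (- ((2 * q - \<theta>) * y)) = hw \<beta> \<theta> y * (norm (y powr p * exp (- (q * y))))^2" if "y \<in> {0<..}" for y
 proof -
  have "(y powr p)^2 = y powr (2 * p)" using that powr_power[of y p 2] by simp
  moreover have "exp (\<theta> * y) * (exp (- (q * y)))^2 = exp (- ((2 * q - \<theta>) * y))"
   by (simp add: exp_add[symmetric] power2_eq_square algebra_simps)
  ultimately show ?thesis
   using that by (simp add: power_mult_distrib powr_add mult_ac)
 qed
 have c: "continuous_on {0<..} (%y. y powr p * exp (- (q * y)))" by (intro continuous_intros) auto
 have m: "(%y. y powr p * exp (- (q * y))) \<in> meas {0<..}"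
  by (rule continuous_meas[OF c]) auto
 note G = Gamma_integral_scaled[of "2 * p + \<beta> + 1" "2 * q - \<theta>"]
 show "(%y. y powr p * exp (- (q * y))) \<in> wL2 {0<..} (hw \<beta> \<theta>)"
  unfolding wL2_def using m integrable_lebesgue_on_cong[OF e G(1)] assms by auto
 show "(wL2_norm {0<..} (hw \<beta> \<theta>) (%y. y powr p * exp (- (q * y))))^2
   \<le> Gamma (2 * p + \<beta> + 1) * (2 * q - \<theta>) powr (- (2 * p + \<beta> + 1))"
 proof -
  have "(lint {0<..} (%y. hw \<beta> \<theta> y * (norm (y powr p * exp (- (q * y))))^2))
    = (lint {0<..} (%y. y powr (2 * p + \<beta> + 1 - 1) * exp (- ((2 * q - \<theta>) * y))))"
   by (rule integral_lebesgue_on_cong[OF e[symmetric]])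
  also have "\<dots> \<le> Gamma (2 * p + \<beta> + 1) * (2 * q - \<theta>) powr (- (2 * p + \<beta> + 1))"
   by (rule G(2)) (use assms in auto)
  finally show ?thesis unfolding norm_sq .
 qed
qed

lemma scaled_profile_deriv:
 assumes s: "0 < s" "s < 1" and lam: "0 < lam" and y: "0 < y"
 shows "(scaled_profile s lam l has_real_derivative scaled_profile s lam (Suc l) y) (at y)"
proof -
 have "((%y. profile s l (sqrt lam * y)) has_real_derivative profile s (Suc l) (sqrt lam * y) * sqrt lam) (at y)"
  by (rule DERIV_chain2[where f = "profile s l" and g = "%y. sqrt lam * y", OF profile_deriv[OF s]])
   (use lam y in \<open>auto intro!: derivative_eq_intros\<close>)
 from DERIV_cmult[OF this, of "sqrt lam ^ l"] show ?thesis
  unfolding scaled_profile_def[abs_def] by (simp add: mult_ac del: profile.simps)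
qed

lemma scaled_profile_continuous:
 assumes s: "0 < s" "s < 1" and lam: "0 < lam"
 shows "continuous_on {0<..} (scaled_profile s lam l)"
proof (rule DERIV_continuous_on)
 fix y :: real assume "y \<in> {0<..}"
 then show "(scaled_profile s lam l has_real_derivative scaled_profile s lam (Suc l) y) (at y within {0<..})"
  by (intro has_field_derivative_at_within[OF scaled_profile_deriv[OF s lam]]) simp
qed

lemma scaled_profile_measurable:
 assumes s: "0 < s" "s < 1" and lam: "0 < lam"
 shows "scaled_profile s lam l \<in> meas {0<..}"
 by (rule continuous_meas[OF scaled_profile_continuous[OF assms]]) auto

lemma scaled_profile_0_bound:
 assumes s: "0 < s" "s < 1"
 obtains K where "0 < K" "\<And>lam y. 0 < lam ==> 0 < y ==> \<bar>scaled_profile s lam 0 y\<bar> \<le> K * exp (- (sqrt lam / 2 * y))"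
proof -
 obtain K where K: "\<And>z. 0 < z ==> profile0 s z \<le> K * exp (- (z / 2))" using profile0_props(8)[OF s] by blast
 note L = profile_lim_pos(1)[OF s]
 have K0: "0 < K"
 proof -
  have "0 < K * exp (- (1 / 2))" using profile0_props(3)[OF s, of 1] K[of 1] by simp
  then show ?thesis by (simp add: zero_less_mult_iff)
 qed
 show ?thesis
 proof (rule that[of "K / profile_lim s"])
  show "0 < K / profile_lim s" using K0 L by simp
  fix lam y :: real assume "0 < lam" "0 < y"
  then have z: "0 < sqrt lam * y" by simp
  have "\<bar>scaled_profile s lam 0 y\<bar> = profile0 s (sqrt lam * y) / profile_lim s"
   using profile0_props(3)[OF s z] L by (simp add: scaled_profile_def)
  also have "\<dots> \<le> K * exp (- (sqrt lam * y / 2)) / profile_lim s"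
   by (rule divide_right_mono[OF K[OF z] less_imp_le[OF L]])
  finally show "\<bar>scaled_profile s lam 0 y\<bar> \<le> K / profile_lim s * exp (- (sqrt lam / 2 * y))" by simp
 qed
qed

text \<open>The l + 1 factors sqrt lam of the chain rule meet (sqrt lam)^(2s-1-l) from the profile
  bound, and l cancels: for every order of derivative lam^s remains.\<close>

lemma scaled_profile_Suc_bound:
 assumes s: "0 < s" "s < 1" and \<rho>: "0 < \<rho>" "\<rho> < 1"
 obtains C \<kappa> where "0 < C" "1 \<le> \<kappa>"
  "\<And>lam l y. 0 < lam ==> 0 < y ==> \<bar>scaled_profile s lam (Suc l) y\<bar>
   \<le> C * \<kappa> ^ l * fact l * lam powr s * (y powr (2 * s - 1 - real l) * exp (- (\<rho> * sqrt lam * y)))"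
proof -
 obtain C \<kappa> where C: "0 < C" "1 \<le> \<kappa>"
  "\<And>l z. 0 < z ==> \<bar>profile s (Suc l) z\<bar> \<le> C * \<kappa> ^ l * fact l * z powr (2 * s - 1 - real l) * exp (- (\<rho> * z))"
  by (rule profile_bound[OF s \<rho>]) blast
 show ?thesis
 proof (rule that[OF C(1,2)])
  fix lam y :: real and l assume lam: "0 < lam" and y: "0 < y"
  have z: "0 < sqrt lam * y" using lam y by simp
  have X: "sqrt lam ^ Suc l * (sqrt lam * y) powr (2 * s - 1 - real l) = lam powr s * y powr (2 * s - 1 - real l)"
  proof -
   have "sqrt lam ^ Suc l = sqrt lam powr (real l + 1)" using lam powr_realpow[of "sqrt lam" "Suc l"] by (simp add: add.commute)
   then have "sqrt lam ^ Suc l * (sqrt lam * y) powr (2 * s - 1 - real l)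
     = (sqrt lam powr (real l + 1) * sqrt lam powr (2 * s - 1 - real l)) * y powr (2 * s - 1 - real l)"
    using lam y by (simp add: powr_mult)
   also have "sqrt lam powr (real l + 1) * sqrt lam powr (2 * s - 1 - real l) = sqrt lam powr (2 * s)"
    by (simp add: powr_add[symmetric])
   also have "sqrt lam powr (2 * s) = lam powr s"
    using lam by (simp add: powr_half_sqrt[symmetric] powr_powr)
   finally show ?thesis .
  qed
  have "\<bar>scaled_profile s lam (Suc l) y\<bar> \<le> sqrt lam ^ Suc l *
    (C * \<kappa> ^ l * fact l * (sqrt lam * y) powr (2 * s - 1 - real l) * exp (- (\<rho> * (sqrt lam * y))))"
   unfolding scaled_profile_def abs_mult using C(3)[OF z, of l] lam
   by (simp add: mult_left_mono del: profile.simps)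
  also have "\<dots> = C * \<kappa> ^ l * fact l * (sqrt lam ^ Suc l * (sqrt lam * y) powr (2 * s - 1 - real l)) * exp (- (\<rho> * (sqrt lam * y)))"
   by (simp only: mult_ac)
  also have "\<dots> = C * \<kappa> ^ l * fact l * lam powr s * (y powr (2 * s - 1 - real l) * exp (- (\<rho> * sqrt lam * y)))"
   unfolding X by (simp only: mult_ac)
  finally show "\<bar>scaled_profile s lam (Suc l) y\<bar>
    \<le> C * \<kappa> ^ l * fact l * lam powr s * (y powr (2 * s - 1 - real l) * exp (- (\<rho> * sqrt lam * y)))" .
 qed
qed

lemma scaled_profile_wL2:
 assumes s: "0 < s" "s < 1" and lam: "0 < lam"
 shows "scaled_profile s lam 0 \<in> wL2 {0<..} (hw (1 - 2 * s) 0)" "scaled_profile s lam 1 \<in> wL2 {0<..} (hw (1 - 2 * s) 0)"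
proof -
 interpret pos_weight "{0<..}" "hw (1 - 2 * s) 0" by (rule pos_weight_half_line)
 obtain K where K: "0 < K" "\<And>lam y. 0 < lam ==> 0 < y ==> \<bar>scaled_profile s lam 0 y\<bar> \<le> K * exp (- (sqrt lam / 2 * y))"
  by (rule scaled_profile_0_bound[OF s]) blast
 have e: "(%y. y powr 0 * exp (- (sqrt lam / 2 * y))) \<in> wL2 {0<..} (hw (1 - 2 * s) 0)"
  by (rule powr_exp_wL2(1)) (use s lam in auto)
 show "scaled_profile s lam 0 \<in> wL2 {0<..} (hw (1 - 2 * s) 0)"
 proof (rule wL2_bound(1)[OF scaled_profile_measurable[OF s lam] e])
  show "AE x in leb {0<..}. norm (scaled_profile s lam 0 x) \<le> K * norm (x powr 0 * exp (- (sqrt lam / 2 * x)))"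
   by (rule AE_I2) (use K(2)[OF lam] in simp)
 qed (use K in simp)
 obtain C \<kappa> where C: "0 < C" "1 \<le> \<kappa>"
  "\<And>lam l y. 0 < lam ==> 0 < y ==> \<bar>scaled_profile s lam (Suc l) y\<bar>
   \<le> C * \<kappa> ^ l * fact l * lam powr s * (y powr (2 * s - 1 - real l) * exp (- (1/2 * sqrt lam * y)))"
  by (rule scaled_profile_Suc_bound[OF s, of "1/2"]) auto
 have e: "(%y. y powr (2 * s - 1) * exp (- (1/2 * sqrt lam * y))) \<in> wL2 {0<..} (hw (1 - 2 * s) 0)"
  by (rule powr_exp_wL2(1)) (use s lam in auto)
 show "scaled_profile s lam 1 \<in> wL2 {0<..} (hw (1 - 2 * s) 0)"
 proof (rule wL2_bound(1)[OF scaled_profile_measurable[OF s lam] e, where k = "C * lam powr s"])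
  show "AE x in leb {0<..}. norm (scaled_profile s lam 1 x) \<le> C * lam powr s * norm (x powr (2 * s - 1) * exp (- (1 / 2 * sqrt lam * x)))"
   using C(3)[OF lam, of _ 0] by (intro AE_I2) (auto simp: mult_ac)
  show "0 \<le> C * lam powr s" using C by simp
 qed
qed

lemma scaled_flux:
 assumes s: "0 < s" "s < 1" and lam: "0 < lam" and y: "0 < y"
 shows "y powr (1 - 2 * s) * scaled_profile s lam 1 y = - (lam powr s * flux0 s (sqrt lam * y) / profile_lim s)"
  "((%y. - (lam powr s * flux0 s (sqrt lam * y) / profile_lim s)) has_real_derivative
   lam * y powr (1 - 2 * s) * scaled_profile s lam 0 y) (at y)"
proof -
 let ?q = "sqrt lam"
 have q: "0 < ?q" "0 < ?q * y" using lam y by auto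
 have qs: "?q powr (2 * s) = lam powr s" using lam by (simp add: powr_half_sqrt[symmetric] powr_powr)
 have "lam powr s * (?q * y) powr (2 - 2 * s) = ?q powr (2 * s) * ?q powr (2 - 2 * s) * y powr (2 - 2 * s)"
  unfolding qs[symmetric] using q y by (simp add: powr_mult)
 also have "?q powr (2 * s) * ?q powr (2 - 2 * s) = ?q * ?q"
  using q by (simp add: powr_add[symmetric] powr_numeral power2_eq_square)
 also have "y powr (2 - 2 * s) = y * y powr (1 - 2 * s)"
  using y powr_add[of y 1 "1 - 2 * s"] by simp
 finally have a: "lam powr s * (?q * y) powr (2 - 2 * s) = y powr (1 - 2 * s) * (?q * (?q * y))" by (simp add: mult_ac)
 show "y powr (1 - 2 * s) * scaled_profile s lam 1 y = - (lam powr s * flux0 s (?q * y) / profile_lim s)"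
  using a by (simp add: scaled_profile_def flux0_def mult_ac)
 have "((%y. flux0 s (?q * y)) has_real_derivative - ((?q * y) powr (1 - 2 * s) * profile0 s (?q * y)) * ?q) (at y)"
  by (rule DERIV_chain2[where f = "flux0 s" and g = "%y. ?q * y", OF profile0_deriv(2)[OF s q(2)]])
   (auto intro!: derivative_eq_intros)
 then have "((%y. - (lam powr s * flux0 s (?q * y) / profile_lim s)) has_real_derivative
   - (lam powr s * (- ((?q * y) powr (1 - 2 * s) * profile0 s (?q * y)) * ?q) / profile_lim s)) (at y)"
  by (intro DERIV_minus DERIV_cdivide DERIV_cmult)
 moreover have "lam powr s * ((?q * y) powr (1 - 2 * s) * ?q) = lam * y powr (1 - 2 * s)"
 proof -
  have "lam powr s * ((?q * y) powr (1 - 2 * s) * ?q) = (?q powr (2 * s) * ?q powr (1 - 2 * s)) * ?q * y powr (1 - 2 * s)"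
   unfolding qs[symmetric] using q y by (simp add: powr_mult)
  also have "?q powr (2 * s) * ?q powr (1 - 2 * s) = ?q" using q by (simp add: powr_add[symmetric])
  finally show ?thesis using lam by simp
 qed
 then have "- (lam powr s * (- ((?q * y) powr (1 - 2 * s) * profile0 s (?q * y)) * ?q) / profile_lim s)
   = lam * y powr (1 - 2 * s) * scaled_profile s lam 0 y"
  by (simp add: scaled_profile_def mult_ac)
 ultimately show "((%y. - (lam powr s * flux0 s (?q * y) / profile_lim s)) has_real_derivative
   lam * y powr (1 - 2 * s) * scaled_profile s lam 0 y) (at y)" by simp
qed

text \<open>These functions may be nonzero at y = 0; the weight y^(1-2s) is integrable there because
  s < 1.\<close>

lemma test_in_half_line_wL2:
 assumes z: "z \<in> TF UNIV" and s: "s < 1"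
 shows "z \<in> wL2 {0<..} (hw (1 - 2 * s) 0)"
proof -
 interpret pos_weight "{0<..}" "hw (1 - 2 * s) 0" by (rule pos_weight_half_line)
 obtain B where B: "0 < B" "\<And>x. \<bar>z x\<bar> \<le> B" using test_bounded[OF z] by blast
 obtain K where K: "compact K" "\<And>x. x \<notin> K ==> z x = 0" by (rule testE[OF z]) blast
 obtain N where N: "\<And>x. x \<in> K ==> \<bar>x\<bar> \<le> N" using compact_imp_bounded[OF K(1)] by (auto simp: bounded_iff)
 have e: "(%y. y powr 0 * exp (- (1 * y))) \<in> wL2 {0<..} (hw (1 - 2 * s) 0)"
  by (rule powr_exp_wL2(1)) (use s in auto)
 have m: "z \<in> meas {0<..}"
  by (rule borel_imp_lebesgue_on[OF smooth_borel[OF test_smooth[OF z]]])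
 have bd: "\<bar>z y\<bar> \<le> B * exp N * exp (- y)" for y
 proof (cases "y \<in> K")
  case True
  have "B * 1 \<le> B * (exp N * exp (- y))" using N[OF True] B by (intro mult_left_mono) (auto simp: exp_add[symmetric])
  then show ?thesis using B(2)[of y] by (simp add: mult.assoc)
 next
  case False then show ?thesis using K B by simp
 qed
 show ?thesis
 proof (rule wL2_bound(1)[OF m e])
  show "AE x in leb {0<..}. norm (z x) \<le> (B * exp N) * norm (x powr 0 * exp (- (1 * x)))"
   by (rule AE_I2) (use bd in simp)
 qed (use B in simp)
qed

text \<open>The form of the extended problem on functions e(y) phi_k(x), without the factor 1 / d_s.
  Derivatives are separate arguments, so that limits of test functions and limits of their
  derivatives can be inserted directly.\<close>

definition mode_form :: "real => real => (real => real) => (real => real) => (real => real) => (real => real) => real" where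
 "mode_form s lam z z' e e' = (lint {0<..} (%y. hw (1 - 2 * s) 0 y * (lam * (z y * e y) + z' y * e' y)))"

lemma mode_form_split:
 assumes "z \<in> wL2 {0<..} (hw (1 - 2 * s) 0)" "z' \<in> wL2 {0<..} (hw (1 - 2 * s) 0)"
  "e \<in> wL2 {0<..} (hw (1 - 2 * s) 0)" "e' \<in> wL2 {0<..} (hw (1 - 2 * s) 0)"
 shows "intg {0<..} (%y. hw (1 - 2 * s) 0 y * (lam * (z y * e y) + z' y * e' y))"
  "mode_form s lam z z' e e' = lam * (lint {0<..} (%y. hw (1 - 2 * s) 0 y * (z y * e y)))
   + (lint {0<..} (%y. hw (1 - 2 * s) 0 y * (z' y * e' y)))"
  "0 \<le> lam ==> \<bar>mode_form s lam z z' e e'\<bar> \<le> lam * (wL2_norm {0<..} (hw (1 - 2 * s) 0) z * wL2_norm {0<..} (hw (1 - 2 * s) 0) e)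
   + wL2_norm {0<..} (hw (1 - 2 * s) 0) z' * wL2_norm {0<..} (hw (1 - 2 * s) 0) e'"
proof -
 interpret pos_weight "{0<..}" "hw (1 - 2 * s) 0" by (rule pos_weight_half_line)
 note a = wL2_inner_bound[OF assms(1,3), unfolded inner_real_def] and b = wL2_inner_bound[OF assms(2,4), unfolded inner_real_def]
 have e: "hw (1 - 2 * s) 0 y * (lam * (z y * e y) + z' y * e' y) = lam * (hw (1 - 2 * s) 0 y * (z y * e y)) + hw (1 - 2 * s) 0 y * (z' y * e' y)" for y
  by (simp add: algebra_simps)
 show "intg {0<..} (%y. hw (1 - 2 * s) 0 y * (lam * (z y * e y) + z' y * e' y))"
  unfolding e by (intro intg_add integrable_mult_right a b)
 show sp: "mode_form s lam z z' e e' = lam * (lint {0<..} (%y. hw (1 - 2 * s) 0 y * (z y * e y)))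
   + (lint {0<..} (%y. hw (1 - 2 * s) 0 y * (z' y * e' y)))"
  unfolding mode_form_def e
  by (subst lint_add[OF integrable_mult_right[OF a(1)] b(1)]) simp
 assume l: "0 \<le> lam"
 have "\<bar>mode_form s lam z z' e e'\<bar> \<le> lam * \<bar>lint {0<..} (%y. hw (1 - 2 * s) 0 y * (z y * e y))\<bar>
   + \<bar>lint {0<..} (%y. hw (1 - 2 * s) 0 y * (z' y * e' y))\<bar>"
  unfolding sp using l abs_triangle_ineq[of "lam * (lint {0<..} (%y. hw (1 - 2 * s) 0 y * (z y * e y)))"] by (simp only: abs_mult abs_of_nonneg)
 then show "\<bar>mode_form s lam z z' e e'\<bar> \<le> lam * (wL2_norm {0<..} (hw (1 - 2 * s) 0) z * wL2_norm {0<..} (hw (1 - 2 * s) 0) e)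
   + wL2_norm {0<..} (hw (1 - 2 * s) 0) z' * wL2_norm {0<..} (hw (1 - 2 * s) 0) e'"
  using mult_left_mono[OF a(2) l] b(2) by linarith
qed

text \<open>The integrand is the derivative of y^(1-2s) Psi' z, and the boundary value at 0 is all
  that survives: in this form the profile represents evaluation at 0, up to the factor
  \<open>mode_flux s lam\<close>.\<close>

lemma mode_form_profile:
 assumes s: "0 < s" "s < 1" and lam: "0 < lam" and z: "z \<in> TF UNIV"
 shows "mode_form s lam z (dd 1 z) (scaled_profile s lam 0) (scaled_profile s lam 1) = mode_flux s lam * z 0"
proof -
 have z': "dd 1 z \<in> TF UNIV" by (rule test_dir_deriv[OF z]) auto
 let ?P0 = "scaled_profile s lam 0" and ?P1 = "scaled_profile s lam 1"
 let ?g = "%y. - (lam powr s * flux0 s (sqrt lam * y) / profile_lim s)"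
 let ?f = "%y. hw (1 - 2 * s) 0 y * (lam * (z y * ?P0 y) + dd 1 z y * ?P1 y)"
 note W = scaled_profile_wL2[OF s lam] and Z = test_in_half_line_wL2[OF z s(2)] test_in_half_line_wL2[OF z' s(2)]
 have "lint {0<..} ?f = 0 - (- mode_flux s lam) * z 0"
 proof (rule FTC_Ioi[where F = "%y. ?g y * z y"])
  show "((%y. ?g y * z y) has_real_derivative ?f y) (at y)" if y: "0 < y" for y
  proof -
   have "((%y. ?g y * z y) has_real_derivative (lam * y powr (1 - 2 * s) * ?P0 y) * z y + dd 1 z y * ?g y) (at y)"
    by (rule DERIV_mult[OF scaled_flux(2)[OF s lam y] smooth_has_real_derivative[OF test_smooth[OF z]]])
   then show ?thesis unfolding scaled_flux(1)[OF s lam y, symmetric] by (simp add: algebra_simps)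
  qed
  show "continuous_on {0<..} ?f"
   by (intro continuous_intros scaled_profile_continuous[OF s lam] smooth_continuous_on test_smooth[OF z] test_smooth[OF z']) auto
  show "intg {0<..} ?f" by (rule mode_form_split(1)[OF Z W])
  show "((%y. ?g y * z y) \<longlongrightarrow> (- mode_flux s lam) * z 0) (at_right 0)"
  proof (intro tendsto_mult)
   have "filterlim (%y. sqrt lam * y) (at_right 0) (at_right 0)"
   proof -
    have "((%y. sqrt lam * y) \<longlongrightarrow> sqrt lam * 0) (at_right 0)" by (intro tendsto_intros)
    moreover have "\<forall>\<^sub>F y in at_right 0. sqrt lam * y \<in> {0<..} \<and> sqrt lam * y \<noteq> 0"
     using lam by (auto simp: eventually_at_right_field intro!: exI[of _ 1])
    ultimately show ?thesis unfolding filterlim_at by simp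
   qed
   from filterlim_compose[OF profile0_props(4)[OF s] this]
   have "((%y. - (lam powr s * flux0 s (sqrt lam * y) / profile_lim s)) \<longlongrightarrow> - (lam powr s * flux_lim s / profile_lim s)) (at_right 0)"
    using profile_lim_pos(1)[OF s] by (intro tendsto_intros) auto
   then show "(?g \<longlongrightarrow> - mode_flux s lam) (at_right 0)" by (simp add: mode_flux_def)
   have "isCont z 0" using smooth_continuous_on[OF test_smooth[OF z], of UNIV] by (simp add: continuous_on_eq_continuous_at)
   then show "(z \<longlongrightarrow> z 0) (at_right 0)" by (simp add: isCont_def filterlim_at_split)
  qed
  obtain K where K: "compact K" "\<And>x. x \<notin> K ==> z x = 0" by (rule testE[OF z]) blast
  obtain N where N: "\<And>x. x \<in> K ==> \<bar>x\<bar> \<le> N" using compact_imp_bounded[OF K(1)] by (auto simp: bounded_iff)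
  have "z y = 0" if "N < y" for y using K(2)[of y] N[of y] that by force
  then show "((%y. ?g y * z y) \<longlongrightarrow> 0) at_top"
   by (intro tendsto_eventually) (auto simp: eventually_at_top_dense intro!: exI[of _ N])
 qed
 then show ?thesis by (simp add: mode_form_def)
qed

text \<open>The functions k l are successive derivatives on S alone. Finite sums of products of a
  test function on S with some k l form a class that is closed under derivatives on the whole
  line.\<close>

lemma smooth_cutoff_test:
 fixes k :: "nat => real => real"
 assumes S: "open S" and d: "\<And>l x. x \<in> S ==> (k l has_real_derivative k (Suc l) x) (at x)" and \<rho>: "\<rho> \<in> TF S"
 shows "(%x. \<rho> x * k 0 x) \<in> TF UNIV"
  "x \<in> S ==> dd 1 (%x. \<rho> x * k 0 x) x = dd 1 \<rho> x * k 0 x + \<rho> x * k 1 x"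
proof -
 have D: "((%x. \<eta> x * k l x) has_real_derivative dd 1 \<eta> x * k l x + \<eta> x * k (Suc l) x) (at x)"
  if \<eta>: "\<eta> \<in> TF S" for \<eta> l x
 proof (cases "x \<in> S")
  case True
  show ?thesis using DERIV_mult[OF smooth_has_real_derivative[OF test_smooth[OF \<eta>]] d[OF True]]
   by (simp add: algebra_simps)
 next
  case False
  obtain K where K: "compact K" "K \<subseteq> S" "\<And>x. x \<notin> K ==> \<eta> x = 0" "\<And>x b. x \<notin> K ==> dd b \<eta> x = 0"
   by (rule testE[OF \<eta>]) blast
  have x: "x \<in> - K" using False K(2) by auto
  have "open (- K)" using K(1) by (simp add: compact_imp_closed open_Compl)
  then have "\<forall>\<^sub>F y in nhds x. 0 = \<eta> y * k l y"
   unfolding eventually_nhds using x K(3) by (intro exI[of _ "- K"]) auto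
  then have "((%x. \<eta> x * k l x) has_real_derivative 0) (at x)"
   using DERIV_cong_ev[of x x "%_. 0" "%x. \<eta> x * k l x" 0 0] by simp
  then show ?thesis using x K by simp
 qed
 define pr where "pr = (%(ps::((real=>real)\<times>nat) list) x. sum_list (map (%p. fst p x * k (snd p) x) ps))"
 define ok where "ok = (%ps::((real=>real)\<times>nat) list. \<forall>p\<in>set ps. fst p \<in> TF S)"
 have step: "\<exists>qs. ok qs \<and> (\<forall>x. (pr ps has_real_derivative pr qs x) (at x))" if "ok ps" for ps
  using that
 proof (induction ps)
  case Nil
  have "pr [] = (%x. 0)" by (simp add: pr_def)
  then show ?case by (intro exI[of _ "[]"]) (simp add: ok_def)
 next
  case (Cons p ps)
  then have p: "fst p \<in> TF S" and "ok ps" by (auto simp: ok_def)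
  then obtain qs where qs: "ok qs" "\<And>x. (pr ps has_real_derivative pr qs x) (at x)" using Cons.IH by blast
  have e: "pr (p # ps) = (%x. fst p x * k (snd p) x + pr ps x)" by (auto simp: pr_def)
  have "(pr (p # ps) has_real_derivative pr ((dd 1 (fst p), snd p) # (fst p, Suc (snd p)) # qs) x) (at x)" for x
   unfolding e using DERIV_add[OF D[OF p, of "snd p"] qs(2)] by (simp add: pr_def add.assoc)
  moreover have "ok ((dd 1 (fst p), snd p) # (fst p, Suc (snd p)) # qs)"
   using p qs(1) test_dir_deriv[OF p, of 1] by (auto simp: ok_def)
  ultimately show ?case by blast
 qed
 have sm: "smooth (%x. \<rho> x * k 0 x)"
 proof (rule smooth_real_iff[where F = "pr ` {ps. ok ps}"])
  have "(%x. \<rho> x * k 0 x) = pr [(\<rho>, 0)]" "ok [(\<rho>, 0)]" using \<rho> by (auto simp: pr_def ok_def)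
  then show "(%x. \<rho> x * k 0 x) \<in> pr ` {ps. ok ps}" by blast
  show "\<exists>g\<in>pr ` {ps. ok ps}. \<forall>x. (f has_real_derivative g x) (at x)" if "f \<in> pr ` {ps. ok ps}" for f
   using that step by blast
 qed
 obtain K where K: "compact K" "\<And>x. x \<notin> K ==> \<rho> x = 0" by (rule testE[OF \<rho>]) blast
 show "(%x. \<rho> x * k 0 x) \<in> TF UNIV"
  by (rule testI[OF sm K(1)]) (use K in auto)
 show "dd 1 (%x. \<rho> x * k 0 x) x = dd 1 \<rho> x * k 0 x + \<rho> x * k 1 x"
  using dir_deriv_real[OF D[OF \<rho>, of 0]] by simp
qed

lemma (in pos_weight) wL2_dominated_convergence:
 fixes f :: "'a => real" and fn :: "nat => 'a => real"
 assumes [measurable]: "f \<in> meas S" "\<And>n. fn n \<in> meas S"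
  and D: "D \<in> wsp" and b: "\<And>n x. x \<in> S ==> \<bar>f x - fn n x\<bar> \<le> D x"
  and lim: "\<And>x. x \<in> S ==> (%n. fn n x) \<longlonglongrightarrow> f x"
 shows "null (%n. nrm (%x. f x - fn n x))"
proof -
 have "(%n. lint S (%x. \<omega> x * (norm (f x - fn n x))^2)) \<longlonglongrightarrow> (lint S (%x. 0))"
 proof (rule integral_dominated_convergence[OF _ _ wL2D(2)[OF D]])
  show "AE x in leb S. null (%n. \<omega> x * (norm (f x - fn n x))^2)"
  proof (rule AE_I2)
   fix x assume "x \<in> space (leb S)"
   then have "(%n. \<omega> x * (norm (f x - fn n x))^2) \<longlonglongrightarrow> \<omega> x * (norm (f x - f x))^2"
    by (intro tendsto_intros lim) simp
   then show "null (%n. \<omega> x * (norm (f x - fn n x))^2)" by simp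
  qed
  show "AE x in leb S. norm (\<omega> x * (norm (f x - fn n x))^2) \<le> \<omega> x * (norm (D x))^2" for n
  proof (rule AE_I2)
   fix x assume "x \<in> space (leb S)"
   then have x: "0 < \<omega> x" "\<bar>f x - fn n x\<bar> \<le> \<bar>D x\<bar>" using pos_\<omega> b[of x n] by auto
   then have "(norm (f x - fn n x))^2 \<le> (norm (D x))^2" by (intro power_mono) auto
   then show "norm (\<omega> x * (norm (f x - fn n x))^2) \<le> \<omega> x * (norm (D x))^2" using x(1) by (simp add: abs_mult)
  qed
 qed measurable
 from tendsto_real_sqrt[OF this] show ?thesis by (simp add: wL2_norm_def)
qed

text \<open>The derivative is exp (- 1 / x) / x^2 for x > 0. The bound 2 holds everywhere, as 2! in
  \<open>power_le_fact_exp\<close>; the bound 1 / x^2 is for large arguments, where cutoffs become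
  flat.\<close>

lemma smooth_step_deriv:
 obtains h' :: "real => real" where "\<And>x. (smooth_step has_real_derivative h' x) (at x)" "\<And>x. 0 \<le> h' x" "\<And>x. h' x \<le> 2"
  "\<And>x. 0 < x ==> h' x \<le> 1 / x\<^sup>2"
proof (rule that)
 let ?h = "step_fun ([:0,0,1:] * (1 - pderiv 1))"
 show "(smooth_step has_real_derivative ?h x) (at x)" for x
  unfolding smooth_step_eq by (rule step_fun_deriv)
 have e: "?h x = (if x > 0 then (1 / x)\<^sup>2 * exp (- 1 / x) else 0)" for x
  by (simp add: step_fun_def power2_eq_square)
 show "0 \<le> ?h x" for x unfolding e by simp
 show "?h x \<le> 2" for x
 proof (cases "x > 0")
  case True
  have "(1 / x)^2 \<le> fact 2 * exp (1 / x)" using True by (intro power_le_fact_exp) auto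
  then have "(1 / x)^2 * exp (- 1 / x) \<le> fact 2 * exp (1 / x) * exp (- 1 / x)" by (rule mult_right_mono) simp
  also have "\<dots> = 2" by (simp add: mult.assoc exp_add[symmetric] fact_2)
  finally show ?thesis unfolding e using True by simp
 next
  case False
  then show ?thesis unfolding e by simp
 qed
 show "?h x \<le> 1 / x\<^sup>2" if "0 < x" for x
 proof -
  have "(1 / x)^2 * exp (- 1 / x) \<le> (1 / x)^2 * 1" using that by (intro mult_left_mono) auto
  then show ?thesis unfolding e using that by (simp add: power_one_over)
 qed
qed

lemma smooth_step_at_top: "(smooth_step \<longlongrightarrow> 1) at_top"
proof -
 have "((%x::real. exp (- (1 / x))) \<longlongrightarrow> exp (- 0)) at_top"
  by (intro tendsto_intros tendsto_divide_0[OF tendsto_const] filterlim_at_top_imp_at_infinity filterlim_ident)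
 then have "((%x::real. exp (- (1 / x))) \<longlongrightarrow> 1) at_top" by simp
 then show ?thesis
  by (rule Lim_transform_eventually) (auto simp: eventually_at_top_dense smooth_step_def intro!: exI[of _ 0])
qed

text \<open>The profile has to be continued across y = 0 and truncated at infinity. Shifting it to
  the left by 2 / M makes it smooth near the closed half-line, and a cutoff that vanishes left of -
  1 / M and right of M gives it compact support. Functions and derivatives then converge by
  domination.\<close>

lemma profile_approximation:
 assumes s: "0 < s" "s < 1" and lam: "0 < lam"
 obtains \<eta> :: "nat => real => real" where "\<And>m. \<eta> m \<in> TF UNIV" "(%m. \<eta> m 0) \<longlonglongrightarrow> 1"
  "null (%m. wL2_norm {0<..} (hw (1 - 2 * s) 0) (%y. scaled_profile s lam 0 y - \<eta> m y))"
  "null (%m. wL2_norm {0<..} (hw (1 - 2 * s) 0) (%y. scaled_profile s lam 1 y - dd 1 (\<eta> m) y))"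
proof -
 interpret pos_weight "{0<..}" "hw (1 - 2 * s) 0" by (rule pos_weight_half_line)
 let ?P = "scaled_profile s lam"
 define q where "q = sqrt lam / 2"
 have q: "0 < q" using lam by (simp add: q_def)
 obtain K where K: "0 < K" "\<And>lam y. 0 < lam ==> 0 < y ==> \<bar>scaled_profile s lam 0 y\<bar> \<le> K * exp (- (sqrt lam / 2 * y))"
  by (rule scaled_profile_0_bound[OF s]) blast
 obtain C0 \<kappa> where C0: "0 < C0" "1 \<le> \<kappa>"
  "\<And>lam l y. 0 < lam ==> 0 < y ==> \<bar>scaled_profile s lam (Suc l) y\<bar>
   \<le> C0 * \<kappa> ^ l * fact l * lam powr s * (y powr (2 * s - 1 - real l) * exp (- (1/2 * sqrt lam * y)))"
  by (rule scaled_profile_Suc_bound[OF s, of "1/2"]) auto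
 define C where "C = C0 * lam powr s"
 have C: "0 < C" using C0 lam by (simp add: C_def)
 have P0: "\<bar>?P 0 y\<bar> \<le> K * exp (- (q * y))" if "0 < y" for y using K(2)[OF lam that] by (simp add: q_def)
 have P1: "\<bar>?P 1 y\<bar> \<le> C * (y powr (2 * s - 1) * exp (- (q * y)))" if "0 < y" for y
  using C0(3)[OF lam that, of 0] by (simp add: q_def C_def)
 obtain h' :: "real => real" where h': "\<And>x. (smooth_step has_real_derivative h' x) (at x)" "\<And>x. 0 \<le> h' x" "\<And>x. h' x \<le> 2"
  "\<And>x. 0 < x ==> h' x \<le> 1 / x\<^sup>2" by (rule smooth_step_deriv) blast
 define M where "M = (%m. real (Suc m))"
 have M: "1 \<le> M m" for m by (simp add: M_def)
 have Mtop: "filterlim M at_top sequentially" unfolding M_def by (rule filterlim_compose[OF filterlim_real_sequentially filterlim_Suc])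
 have iM: "null (%m. 1 / M m)" unfolding M_def by (rule LIMSEQ_Suc[OF lim_1_over_n])
 \<comment> \<open>The argument M^3 y + M^2 of the first factor is negative left of - 1 / M and at
   least M^2 for y >= 0. As the step has derivative at most 1 / x^2, this factor has slope at most
   M^3 / M^4 on the half-line, so the slope tends to 0 although the transition region shrinks to the
   point 0.\<close>
 define \<rho> where "\<rho> = (%m y. smooth_step (M m ^ 3 * y + (M m)^2) * smooth_step (- 1 * y + M m))"
 define k where "k = (%m l y. ?P l (y + 2 / M m))"
 define \<eta> where "\<eta> = (%m y. \<rho> m y * k m 0 y)"
 have \<rho>t: "\<rho> m \<in> TF {- 2 / M m<..}" for m
 proof (rule testI[where K = "{- 1 / M m..M m}"])
  show "smooth (\<rho> m)" unfolding \<rho>_def by (intro smooth_mult smooth_smooth_step_affine)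
  show "{- 1 / M m..M m} \<subseteq> {- 2 / M m<..}"
  proof
   fix x assume "x \<in> {- 1 / M m..M m}"
   moreover have "- 2 / M m < - 1 / M m" using M[of m] by (simp add: divide_strict_right_mono)
   ultimately show "x \<in> {- 2 / M m<..}" by auto
  qed
  fix y assume "y \<notin> {- 1 / M m..M m}"
  then consider "y < - 1 / M m" | "M m < y" by force
  then show "\<rho> m y = 0"
  proof cases
   case 1
   then have "M m * y < M m * (- 1 / M m)" using M[of m] by (intro mult_strict_left_mono) auto
   then have "M m * y < - 1" using M[of m] by simp
   then have "(M m)^2 * (M m * y) < (M m)\<^sup>2 * (- 1)" using M[of m] by (intro mult_strict_left_mono) auto
   then have "M m ^ 3 * y + (M m)^2 < 0" by (simp add: power2_eq_square power3_eq_cube mult.assoc)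
   then show ?thesis by (simp add: \<rho>_def smooth_step_def)
  next
   case 2 then show ?thesis by (simp add: \<rho>_def smooth_step_def)
  qed
 qed simp
 have kd: "(k m l has_real_derivative k m (Suc l) x) (at x)" if "x \<in> {- 2 / M m<..}" for m l x
 proof -
  have "0 < x + 2 / M m" using that by simp
  moreover have "((%y. y + 2 / M m) has_real_derivative 1) (at x)" by (auto intro!: derivative_eq_intros)
  ultimately show ?thesis
   unfolding k_def using DERIV_chain2[where f = "?P l" and g = "%y. y + 2 / M m", OF scaled_profile_deriv[OF s lam]] by fastforce
 qed
 have \<eta>t: "\<eta> m \<in> TF UNIV" for m
  unfolding \<eta>_def by (rule smooth_cutoff_test(1)[where k = "k m", OF open_greaterThan kd \<rho>t])
 have \<rho>d: "dd 1 (\<rho> m) y = M m ^ 3 * h' (M m ^ 3 * y + (M m)^2) * smooth_step (- 1 * y + M m)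
   - smooth_step (M m ^ 3 * y + (M m)^2) * h' (- 1 * y + M m)" for m y
 proof (rule dir_deriv_real)
  have a: "((%y. smooth_step (r * y + t)) has_real_derivative h' (r * y + t) * r) (at y)" for r t :: real
   by (rule DERIV_chain2[where f = smooth_step and g = "%y. r * y + t", OF h'(1)]) (auto intro!: derivative_eq_intros)
  show "(\<rho> m has_real_derivative M m ^ 3 * h' (M m ^ 3 * y + (M m)^2) * smooth_step (- 1 * y + M m)
   - smooth_step (M m ^ 3 * y + (M m)^2) * h' (- 1 * y + M m)) (at y)"
   unfolding \<rho>_def using DERIV_mult[OF a[of "M m ^ 3" "(M m)^2"] a[of "- 1" "M m"]] by (simp add: algebra_simps)
 qed
 have \<eta>d: "dd 1 (\<eta> m) y = dd 1 (\<rho> m) y * k m 0 y + \<rho> m y * k m 1 y" if "0 < y" for m y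
 proof -
  have "- 2 / M m \<le> 0" using M[of m] by simp
  then have "- 2 / M m < y" using that by linarith
  then have "y \<in> {- 2 / M m<..}" unfolding greaterThan_iff .
  note y = this
  show ?thesis unfolding \<eta>_def
   by (rule smooth_cutoff_test(2)[where k = "k m" and S = "{- 2 / M m<..}" and \<rho> = "\<rho> m" and x = y])
    (fact open_greaterThan kd \<rho>t y)+
 qed
 have big: "M m \<le> M m ^ 3 * y + (M m)^2" "(M m)^2 \<le> M m ^ 3 * y + (M m)^2" if "0 \<le> y" for y m
 proof -
  have "0 \<le> M m ^ 3 * y" using that M[of m] by simp
  moreover have "M m * 1 \<le> M m * M m" using M[of m] by (intro mult_left_mono) auto
  ultimately show "M m \<le> M m ^ 3 * y + (M m)^2" "(M m)^2 \<le> M m ^ 3 * y + (M m)^2" by (simp_all add: power2_eq_square)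
 qed
 have t1: "filterlim (%m. M m ^ 3 * y + (M m)^2) at_top sequentially" if "0 \<le> y" for y
  using big(1)[OF that] by (intro filterlim_at_top_mono[OF Mtop]) auto
 have t2: "filterlim (%m. - 1 * y + M m) at_top sequentially" for y
  by (rule filterlim_tendsto_add_at_top[OF tendsto_const Mtop])
 have \<rho>1: "(%m. \<rho> m y) \<longlonglongrightarrow> 1" if "0 \<le> y" for y
  using tendsto_mult[OF filterlim_compose[OF smooth_step_at_top t1[OF that]] filterlim_compose[OF smooth_step_at_top t2[of y]]]
  by (simp add: \<rho>_def)
 have h'M: "M m ^ 3 * h' (M m ^ 3 * y + (M m)^2) \<le> 1 / M m" if "0 \<le> y" for y m
 proof -
  let ?x = "M m ^ 3 * y + (M m)^2"
  have p: "0 < (M m)\<^sup>2" using M[of m] by simp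
  have "h' ?x \<le> 1 / ?x\<^sup>2" using h'(4)[of ?x] big(2)[OF that, of m] p by linarith
  also have "\<dots> \<le> 1 / ((M m)^2)^2" using big(2)[OF that, of m] p by (intro frac_le power_mono) auto
  finally have "M m ^ 3 * h' ?x \<le> M m ^ 3 * (1 / ((M m)^2)^2)" using M[of m] by (intro mult_left_mono) auto
  also have "\<dots> = 1 / M m" using M[of m] by (simp add: power2_eq_square power3_eq_cube)
  finally show ?thesis .
 qed
 have h'0: "null (%m. h' (- 1 * y + M m))" for y
 proof (rule tendsto_sandwich[OF _ _ tendsto_const])
  show "\<forall>\<^sub>F m in sequentially. 0 \<le> h' (- 1 * y + M m)" using h'(2) by simp
  have "\<forall>\<^sub>F m in sequentially. 0 < - 1 * y + M m" using t2[of y] unfolding filterlim_at_top_dense by blast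
  then show "\<forall>\<^sub>F m in sequentially. h' (- 1 * y + M m) \<le> (1 / (- 1 * y + M m))^2"
   by eventually_elim (use h'(4) in \<open>simp add: power_one_over\<close>)
  have "(%m. (1 / (- 1 * y + M m))^2) \<longlonglongrightarrow> 0\<^sup>2"
   by (intro tendsto_power tendsto_divide_0[OF tendsto_const] filterlim_at_top_imp_at_infinity t2)
  then show "null (%m. (1 / (- 1 * y + M m))^2)" by simp
 qed
 have \<rho>d0: "null (%m. dd 1 (\<rho> m) y)" if "0 \<le> y" for y
 proof -
  have "null (%m. M m ^ 3 * h' (M m ^ 3 * y + (M m)^2))"
  proof (rule tendsto_sandwich[OF _ _ tendsto_const iM])
   have "0 \<le> M m ^ 3 * h' (M m ^ 3 * y + (M m)^2)" for m using h'(2) M[of m] by simp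
   then show "\<forall>\<^sub>F m in sequentially. 0 \<le> M m ^ 3 * h' (M m ^ 3 * y + (M m)^2)" by (intro always_eventually allI)
   show "\<forall>\<^sub>F m in sequentially. M m ^ 3 * h' (M m ^ 3 * y + (M m)^2) \<le> 1 / M m" by (intro always_eventually allI h'M that)
  qed
  from tendsto_diff[OF tendsto_mult[OF this filterlim_compose[OF smooth_step_at_top t2[of y]]]
    tendsto_mult[OF filterlim_compose[OF smooth_step_at_top t1[OF that]] h'0[of y]]]
  show ?thesis unfolding \<rho>d by simp
 qed
 have \<rho>db: "\<bar>dd 1 (\<rho> m) y\<bar> \<le> 3" if "0 \<le> y" for m y
 proof -
  have a: "0 \<le> M m ^ 3 * h' (M m ^ 3 * y + (M m)^2)" "M m ^ 3 * h' (M m ^ 3 * y + (M m)^2) \<le> 1"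
  proof -
   show "0 \<le> M m ^ 3 * h' (M m ^ 3 * y + (M m)^2)" using h'(2) M[of m] by simp
   have "1 / M m \<le> 1" using M[of m] by simp
   then show "M m ^ 3 * h' (M m ^ 3 * y + (M m)^2) \<le> 1" using h'M[OF that, of m] by linarith
  qed
  have "0 \<le> M m ^ 3 * h' (M m ^ 3 * y + (M m)^2) * smooth_step (- 1 * y + M m)"
   "M m ^ 3 * h' (M m ^ 3 * y + (M m)^2) * smooth_step (- 1 * y + M m) \<le> 1"
   using a smooth_step_bounds by (auto intro!: mult_nonneg_nonneg mult_le_one)
  moreover have "0 \<le> smooth_step (M m ^ 3 * y + (M m)^2) * h' (- 1 * y + M m)"
   using smooth_step_bounds h'(2) by (intro mult_nonneg_nonneg)
  moreover have "smooth_step (M m ^ 3 * y + (M m)^2) * h' (- 1 * y + M m) \<le> 1 * 2"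
   using smooth_step_bounds h'(2,3) by (intro mult_mono) auto
  ultimately show ?thesis unfolding \<rho>d by (simp add: abs_le_iff)
 qed
 have \<rho>b: "0 \<le> \<rho> m y" "\<rho> m y \<le> 1" for m y
  unfolding \<rho>_def using smooth_step_bounds by (auto intro!: mult_nonneg_nonneg mult_le_one)
 have sh: "(%m. y + 2 / M m) \<longlonglongrightarrow> y" for y
  using tendsto_add[OF tendsto_const[of y] tendsto_mult[OF tendsto_const[of 2] iM]] by simp
 have kl: "(%m. k m l y) \<longlonglongrightarrow> ?P l y" if "0 < y" for l y
 proof -
  have "isCont (?P l) y" using scaled_profile_continuous[OF s lam, of l] that by (simp add: continuous_on_eq_continuous_at)
  then show ?thesis unfolding k_def by (rule isCont_tendsto_compose[OF _ sh])
 qed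
 have e2: "0 < 2 / M m" "2 / M m \<le> 2" for m using M[of m] by (auto simp: divide_le_eq)
 have k0: "\<bar>k m 0 y\<bar> \<le> K * exp (- (q * y))" if "0 < y" for m y
 proof -
  have "\<bar>k m 0 y\<bar> \<le> K * exp (- (q * (y + 2 / M m)))" unfolding k_def by (rule P0[OF add_pos_pos[OF that e2(1)]])
  also have "\<dots> \<le> K * exp (- (q * y))" using K(1) q e2[of m] by (intro mult_left_mono) auto
  finally show ?thesis .
 qed
 \<comment> \<open>One dominating function for both signs of 2 s - 1: for a nonpositive exponent the
   shift only decreases the power, for a positive one the shifted power is at most y + 2.\<close>
 have k1: "\<bar>k m 1 y\<bar> \<le> C * ((y powr (2 * s - 1) + y + 2) * exp (- (q * y)))" if "0 < y" for m y
 proof -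
  let ?x = "y + 2 / M m"
  have x: "0 < ?x" "y \<le> ?x" "?x \<le> y + 2"
   by (rule add_pos_pos[OF that e2(1)]) (use less_imp_le[OF e2(1)[of m]] e2(2)[of m] in linarith)+
  have "?x powr (2 * s - 1) \<le> y powr (2 * s - 1) + y + 2"
  proof (cases "2 * s - 1 \<le> 0")
   case True
   then have "?x powr (2 * s - 1) \<le> y powr (2 * s - 1)" using x that by (intro powr_mono2') auto
   then show ?thesis using that by simp
  next
   case False
   then have "?x powr (2 * s - 1) \<le> (y + 2) powr (2 * s - 1)" using x that by (intro powr_mono2) auto
   also have "\<dots> \<le> (y + 2) powr 1" using s that by (intro powr_mono) auto
   finally show ?thesis using that powr_ge_zero[of y "2 * s - 1"] powr_one[of "y + 2"] by linarith
  qed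
  then have "?x powr (2 * s - 1) * exp (- (q * ?x)) \<le> (y powr (2 * s - 1) + y + 2) * exp (- (q * y))"
   using that q e2[of m] by (intro mult_mono) auto
  then have "C * (?x powr (2 * s - 1) * exp (- (q * ?x))) \<le> C * ((y powr (2 * s - 1) + y + 2) * exp (- (q * y)))"
   using C by (intro mult_left_mono) auto
  then show ?thesis unfolding k_def using P1[OF x(1)] by linarith
 qed
 have E: "(%y. y powr p * exp (- (q * y))) \<in> wL2 {0<..} (hw (1 - 2 * s) 0)" if "2 * p + (1 - 2 * s) > - 1" for p
  by (rule powr_exp_wL2(1)) (use that q in auto)
 have \<eta>m: "\<eta> m \<in> meas {0<..}" "dd 1 (\<eta> m) \<in> meas {0<..}" for m
  using test_dir_deriv[OF \<eta>t, of 1 m]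
  by (auto intro!: borel_imp_lebesgue_on smooth_borel intro: test_smooth \<eta>t)
 show ?thesis
 proof (rule that[OF \<eta>t])
  have "filterlim (%m. sqrt lam * (2 / M m)) (at_right 0) sequentially"
   unfolding filterlim_at
  proof
   have "0 < sqrt lam * (2 / M m)" for m using e2(1) lam by (intro mult_pos_pos) auto
   then show "\<forall>\<^sub>F m in sequentially. sqrt lam * (2 / M m) \<in> {0<..} \<and> sqrt lam * (2 / M m) \<noteq> 0"
    by (intro always_eventually allI) (metis greaterThan_iff less_irrefl)
   have "(%m. sqrt lam * 2 * (1 / M m)) \<longlonglongrightarrow> sqrt lam * 2 * 0" by (intro tendsto_mult tendsto_const iM)
   then show "null (%m. sqrt lam * (2 / M m))" by simp
  qed
  from filterlim_compose[OF profile0_props(1)[OF s] this]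
  have "(%m. profile0 s (sqrt lam * (2 / M m)) / profile_lim s) \<longlonglongrightarrow> profile_lim s / profile_lim s"
   using profile_lim_pos(1)[OF s] by (intro tendsto_divide tendsto_const) auto
  then have "(%m. k m 0 0) \<longlonglongrightarrow> 1" using profile_lim_pos(1)[OF s] by (simp add: k_def scaled_profile_def)
  from tendsto_mult[OF \<rho>1[of 0] this] show "(%m. \<eta> m 0) \<longlonglongrightarrow> 1" by (simp add: \<eta>_def)
  show "null (%m. wL2_norm {0<..} (hw (1 - 2 * s) 0) (%y. ?P 0 y - \<eta> m y))"
  proof (rule wL2_dominated_convergence[OF scaled_profile_measurable[OF s lam] \<eta>m(1) wL2_cmult(1)[OF E[of 0], of "2 * K"]])
   fix m and y :: real assume "y \<in> {0<..}"
   then have y: "0 < y" by simp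
   have "\<bar>\<eta> m y\<bar> \<le> 1 * (K * exp (- (q * y)))"
    unfolding \<eta>_def abs_mult using \<rho>b[of m y] k0[OF y, of m] by (intro mult_mono) auto
   then show "\<bar>?P 0 y - \<eta> m y\<bar> \<le> (2 * K) *\<^sub>R (y powr 0 * exp (- (q * y)))" using P0[OF y] y by simp
  next
   fix y :: real assume "y \<in> {0<..}"
   then show "(%n. \<eta> n y) \<longlonglongrightarrow> ?P 0 y"
    unfolding \<eta>_def using tendsto_mult[OF \<rho>1[of y] kl[of y 0]] by simp
  qed (use s in auto)
  let ?D = "%y. (2 * C) *\<^sub>R (y powr (2 * s - 1) * exp (- (q * y))) + (C *\<^sub>R (y powr 1 * exp (- (q * y))) + (2 * C + 3 * K) *\<^sub>R (y powr 0 * exp (- (q * y))))"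
  have D: "?D \<in> wL2 {0<..} (hw (1 - 2 * s) 0)"
   by (intro wL2_add(1) wL2_cmult(1) E) (use s in auto)
  show "null (%m. wL2_norm {0<..} (hw (1 - 2 * s) 0) (%y. ?P 1 y - dd 1 (\<eta> m) y))"
  proof (rule wL2_dominated_convergence[OF scaled_profile_measurable[OF s lam] \<eta>m(2) D])
   fix m and y :: real assume "y \<in> {0<..}"
   then have y: "0 < y" by simp
   have "\<bar>\<rho> m y * k m 1 y\<bar> \<le> 1 * (C * ((y powr (2 * s - 1) + y + 2) * exp (- (q * y))))"
    unfolding abs_mult using \<rho>b[of m y] k1[OF y, of m] by (intro mult_mono) auto
   moreover have "\<bar>dd 1 (\<rho> m) y * k m 0 y\<bar> \<le> 3 * (K * exp (- (q * y)))"
    unfolding abs_mult using \<rho>db[of y m] k0[OF y, of m] y by (intro mult_mono) auto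
   ultimately have "\<bar>?P 1 y - dd 1 (\<eta> m) y\<bar> \<le> C * (y powr (2 * s - 1) * exp (- (q * y)))
     + (C * ((y powr (2 * s - 1) + y + 2) * exp (- (q * y))) + 3 * (K * exp (- (q * y))))"
    unfolding \<eta>d[OF y] using P1[OF y] by linarith
   also have "\<dots> = ?D y" using y by (simp add: algebra_simps)
   finally show "\<bar>?P 1 y - dd 1 (\<eta> m) y\<bar> \<le> ?D y" .
  next
   fix y :: real assume "y \<in> {0<..}"
   then have y: "0 < y" by simp
   have "(%m. dd 1 (\<rho> m) y * k m 0 y + \<rho> m y * k m 1 y) \<longlonglongrightarrow> 0 * ?P 0 y + 1 * ?P 1 y"
    using y by (intro tendsto_add tendsto_mult \<rho>d0 \<rho>1 kl) auto
   then show "(%n. dd 1 (\<eta> n) y) \<longlonglongrightarrow> ?P 1 y" unfolding \<eta>d[OF y] by simp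
  qed
 qed
qed

section \<open>Identification of the modes of the extended problem\<close>

lemma measurable_matrix_form:
 fixes P :: "'a => real^'n^'n" and G H :: "'a => real^'n"
 assumes P: "\<And>i j. (%x. P x $ i $ j) \<in> borel_measurable M"
  and G: "G \<in> borel_measurable M" and H: "H \<in> borel_measurable M"
 shows "(%x. (P x *v G x) \<bullet> H x) \<in> borel_measurable M"
proof -
 have c: "(%v::real^'n. v $ i) \<in> borel_measurable borel" for i
  by (intro borel_measurable_continuous_onI continuous_intros)
 have [measurable]: "(%x. G x $ i) \<in> borel_measurable M" "(%x. H x $ i) \<in> borel_measurable M" for i
  using measurable_compose[OF G c] measurable_compose[OF H c] by auto
 note P[measurable]
 show ?thesis
  unfolding inner_vec_def matrix_vector_mult_def by simp
qed

lemma AE_cyl_fst: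
 assumes \<Omega>: "open \<Omega>" and P: "AE x in leb \<Omega>. P x"
 shows "AE z in leb (cyl \<Omega>). P (fst z)"
proof -
 have "AE x in lebesgue. x \<in> \<Omega> \<longrightarrow> P x" using P unfolding AE_lebesgue_on_open[OF \<Omega>] .
 from lebesgue_prod_AE_fst[OF this] show ?thesis
  unfolding AE_lebesgue_on_open[OF open_cyl[OF \<Omega>]] by eventually_elim (auto simp: cyl_def)
qed

lemma measurable_cyl_fst:
 fixes p :: "real^'n => real"
 assumes \<Omega>: "open \<Omega>" and p: "p \<in> meas \<Omega>"
 shows "(%z. p (fst z)) \<in> meas (cyl \<Omega>)"
 using lebesgue_on_tensor_measurable[OF \<Omega> open_greaterThan[of "0::real"] p, of "%_. 1"] unfolding cyl_def by simp

lemma Basis_cyl: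
 "(b :: (real^'n) \<times> real) \<in> Basis \<longleftrightarrow> (\<exists>b'\<in>Basis. b = (b', 0)) \<or> b = (0, 1)"
 by (auto simp: Basis_prod_def)

lemma grad_slice:
 fixes \<zeta> :: "(real^'n) \<times> real => real"
 assumes \<zeta>: "smooth \<zeta>"
 shows "fst (grad \<zeta> (x, y)) = grad (%x. \<zeta> (x, y)) x" "snd (grad \<zeta> (x, y)) = dd (0, 1) \<zeta> (x, y)"
proof -
 show "fst (grad \<zeta> (x, y)) = grad (%x. \<zeta> (x, y)) x"
 proof (rule euclidean_eqI)
  fix b :: "real^'n" assume b: "b \<in> Basis"
  have bb: "(b, 0) \<in> (Basis :: ((real^'n) \<times> real) set)" using b by (simp add: Basis_cyl)
  have "fst (grad \<zeta> (x, y)) \<bullet> b = grad \<zeta> (x, y) \<bullet> (b, 0)" by (cases "grad \<zeta> (x, y)") simp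
  also have "\<dots> = grad (%x. \<zeta> (x, y)) x \<bullet> b"
   unfolding grad_inner[OF bb] grad_inner[OF b] smooth_slice_deriv1(1)[OF \<zeta>] ..
  finally show "fst (grad \<zeta> (x, y)) \<bullet> b = grad (%x. \<zeta> (x, y)) x \<bullet> b" .
 qed
 have bb: "(0, 1) \<in> (Basis :: ((real^'n) \<times> real) set)" by (simp add: Basis_cyl)
 have "snd (grad \<zeta> (x, y)) = grad \<zeta> (x, y) \<bullet> (0, 1)" by (cases "grad \<zeta> (x, y)") simp
 then show "snd (grad \<zeta> (x, y)) = dd (0, 1) \<zeta> (x, y)" using grad_inner[OF bb] by simp
qed

lemma norm_fst_snd: "norm (fst z) \<le> norm z" "norm (snd z) \<le> norm z"
 using norm_fst_le[of "fst z" "snd z"] norm_snd_le[of "snd z" "fst z"] by auto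

lemma (in pos_weight) wL2_Pair:
 fixes X :: "'a => 'b::euclidean_space" and Y :: "'a => 'c::euclidean_space"
 assumes X: "X \<in> wsp" and Y: "Y \<in> wsp"
 shows "(%z. (X z, Y z)) \<in> wsp" "nrm (%z. (X z, Y z)) \<le> nrm X + nrm Y"
proof -
 have [measurable]: "X \<in> meas S" "Y \<in> meas S" using wL2D X Y by auto
 have x: "(%z. (X z, 0 :: 'c)) \<in> wsp" "nrm (%z. (X z, 0 :: 'c)) \<le> 1 * nrm X"
  using wL2_bound[of "%z. (X z, 0 :: 'c)" X 1, OF _ X] by (simp_all add: norm_Pair)
 have y: "(%z. (0 :: 'b, Y z)) \<in> wsp" "nrm (%z. (0 :: 'b, Y z)) \<le> 1 * nrm Y"
  using wL2_bound[of "%z. (0 :: 'b, Y z)" Y 1, OF _ Y] by (simp_all add: norm_Pair)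
 show "(%z. (X z, Y z)) \<in> wsp" "nrm (%z. (X z, Y z)) \<le> nrm X + nrm Y"
  using wL2_add[OF x(1) y(1)] x(2) y(2) by auto
qed

lemma (in pos_weight) wL2_fst_snd:
 fixes G :: "'a => 'b::euclidean_space \<times> 'c::euclidean_space"
 assumes G: "G \<in> wsp"
 shows "(%z. fst (G z)) \<in> wsp" "(%z. snd (G z)) \<in> wsp"
proof -
 have [measurable]: "G \<in> meas S" using wL2D G by auto
 have f: "fst \<in> borel_measurable (borel :: ('b \<times> 'c) measure)" and s: "snd \<in> borel_measurable (borel :: ('b \<times> 'c) measure)"
  by (intro borel_measurable_continuous_onI continuous_intros)+
 show "(%z. fst (G z)) \<in> wsp"
  by (rule wL2_bound(1)[OF measurable_compose[OF _ f] G, where k = 1]) (auto simp: norm_fst_snd)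
 show "(%z. snd (G z)) \<in> wsp"
  by (rule wL2_bound(1)[OF measurable_compose[OF _ s] G, where k = 1]) (auto simp: norm_fst_snd)
qed

text \<open>The hypotheses of the theorem in the form in which the proof uses them: a is the
  ellipticity constant, B bounds the form of A, and M bounds c from above. Positivity of
  \<open>lam 0\<close> is among them; the range of theta supplies it.\<close>

locale elliptic =
 fixes \<Omega> :: "(real^'n) set" and A :: "real^'n => real^'n^'n" and c :: "real^'n => real"
  and lam :: "nat => real" and \<phi> :: "nat => real^'n => real" and s a B M :: real
 assumes open_\<Omega>: "open \<Omega>" and finite_\<Omega>: "\<Omega> \<in> lmeasurable"
  and A_cont: "continuous_on \<Omega> A"
  and A_bd: "\<And>x \<xi> \<eta>. x \<in> \<Omega> ==> \<bar>(A x *v \<xi>) \<bullet> \<eta>\<bar> \<le> B * (norm \<xi> * norm \<eta>)" and B0: "0 \<le> B"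
  and A_sym: "\<And>x \<xi> \<eta>. x \<in> \<Omega> ==> (A x *v \<xi>) \<bullet> \<eta> = (A x *v \<eta>) \<bullet> \<xi>"
  and a0: "0 < a" and A_pos: "\<And>x \<xi>. x \<in> \<Omega> ==> a * (norm \<xi>)^2 \<le> (A x *v \<xi>) \<bullet> \<xi>"
  and c_meas: "c \<in> meas \<Omega>"
  and c_nonneg: "AE x in leb \<Omega>. 0 \<le> c x" and c_le: "AE x in leb \<Omega>. c x \<le> M" and M0: "0 \<le> M"
  and eig: "dirichlet_eigenpairs \<Omega> A c lam \<phi>" and lam0: "0 < lam 0"
  and s0: "0 < s" and s1: "s < 1"
begin

sublocale O: pos_weight \<Omega> "%_. 1" by (rule pos_weight_1[OF open_\<Omega>])
sublocale C: pos_weight "cyl \<Omega>" "ext_weight s" by (rule pos_weight_ext[OF open_\<Omega>])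
sublocale R: pos_weight "{0<..}" "hw (1 - 2 * s) 0" by (rule pos_weight_half_line)

abbreviation "NC \<equiv> wL2_norm (cyl \<Omega>) (ext_weight s)"
abbreviation "LC \<equiv> wL2 (cyl \<Omega>) (ext_weight s)"
abbreviation "NR \<equiv> wL2_norm {0<..} (hw (1 - 2 * s) 0)"
abbreviation "LR \<equiv> wL2 {0<..} (hw (1 - 2 * s) 0)"
abbreviation "NE \<beta> \<theta> \<equiv> wL2_norm (cyl \<Omega>) (exp_weight \<beta> \<theta>)"
abbreviation "LE \<beta> \<theta> \<equiv> wL2 (cyl \<Omega>) (exp_weight \<beta> \<theta>)"
abbreviation "NO \<equiv> wL2_norm \<Omega> (%_. 1)"
abbreviation "LO \<equiv> wL2 \<Omega> (%_. 1)"
abbreviation "ip \<equiv> L2_inner \<Omega>"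
abbreviation "NH \<equiv> Hr_norm \<Omega> lam \<phi>"
abbreviation "HS \<equiv> Hr \<Omega> lam \<phi>"
abbreviation "ND \<equiv> Hr_dual_norm \<Omega> lam \<phi>"
abbreviation "HD \<equiv> Hr_dual \<Omega> lam \<phi>"
abbreviation "dop \<equiv> dirichlet_op \<Omega> A c"
abbreviation "wg \<equiv> weak_grad \<Omega>"
abbreviation "wgC \<equiv> weak_grad (cyl \<Omega>)"
abbreviation "ef \<equiv> ext_form \<Omega> A c s"
abbreviation "Psi k \<equiv> scaled_profile s (lam k)"

section \<open>Eigenfunctions and the forms on Omega and on the cylinder\<close>

lemma lam_pos: "0 < lam k"
 using eig lam0 unfolding dirichlet_eigenpairs_def mono_def by (metis le0 less_le_trans)

lemma phi_op: "dop (\<phi> k) (%x. lam k * \<phi> k x)"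
 using eig unfolding dirichlet_eigenpairs_def by blast

lemma phi_H10: "\<phi> k \<in> H10 \<Omega>" and phi_eq: "v \<in> H10 \<Omega> ==>
  (lint \<Omega> (%x. (A x *v wg (\<phi> k) x) \<bullet> wg v x + c x * \<phi> k x * v x)) = lam k * ip (\<phi> k) v"
 using phi_op[of k] unfolding dirichlet_op_def by (auto simp: L2_inner_def mult.assoc)

lemma phi_wH1: "\<phi> k \<in> wH1 \<Omega> (%_. 1)" using phi_H10 unfolding H10_def by blast
lemma phi_L2: "\<phi> k \<in> LO" by (rule O.wH1_wL2[OF phi_wH1])

lemma phi_ortho: "ip (\<phi> j) (\<phi> k) = (if j = k then 1 else 0)"
 using eig unfolding dirichlet_eigenpairs_def by blast

lemma L2_norm_sq_inner: "(NO v)^2 = ip v v"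
 unfolding O.norm_sq L2_inner_def by (simp add: power2_eq_square)

lemma phi_norm: "NO (\<phi> k) = 1"
 using L2_norm_sq_inner[of "\<phi> k"] phi_ortho[of k k] O.norm_nonneg[of "\<phi> k"] by (simp add: power2_eq_1_iff)

lemma L2_inner_bound:
 assumes "u \<in> LO" "v \<in> LO"
 shows "intg \<Omega> (%x. u x * v x)" "\<bar>ip u v\<bar> \<le> NO u * NO v"
 using O.wL2_inner_bound[OF assms] by (auto simp: L2_inner_def)

lemma L2_inner_diff:
 assumes "u \<in> LO" "u' \<in> LO" "v \<in> LO"
 shows "ip (%x. u x - u' x) v = ip u v - ip u' v"
 using L2_inner_bound(1)[OF assms(1,3)] L2_inner_bound(1)[OF assms(2,3)] by (simp add: L2_inner_def left_diff_distrib)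

lemma A_entry_meas: "(%x. A x $ i $ j) \<in> meas \<Omega>"
proof -
 have "continuous_on \<Omega> (%x. A x $ i $ j)" by (intro continuous_intros A_cont)
 then show ?thesis by (rule continuous_meas) (simp add: open_\<Omega>)
qed

lemma form_integrable:
 fixes G H :: "real^'n => real^'n"
 assumes G: "G \<in> LO" and H: "H \<in> LO" and g: "g \<in> LO" and h: "h \<in> LO"
 shows "intg \<Omega> (%x. (A x *v G x) \<bullet> H x)" "intg \<Omega> (%x. c x * g x * h x)"
  "\<bar>lint \<Omega> (%x. (A x *v G x) \<bullet> H x)\<bar> \<le> B * (NO G * NO H)"
  "\<bar>lint \<Omega> (%x. c x * g x * h x)\<bar> \<le> M * (NO g * NO h)"
proof -
 note Gm = O.wL2D(1)[OF G] and Hm = O.wL2D(1)[OF H]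
 have m: "(%x. (A x *v G x) \<bullet> H x) \<in> meas \<Omega>" by (rule measurable_matrix_form[OF A_entry_meas Gm Hm])
 have b: "AE x in leb \<Omega>. \<bar>(A x *v G x) \<bullet> H x\<bar> \<le> B * (norm (G x) * norm (H x))"
  by (rule AE_I2) (simp add: A_bd)
 show "intg \<Omega> (%x. (A x *v G x) \<bullet> H x)"
  "\<bar>lint \<Omega> (%x. (A x *v G x) \<bullet> H x)\<bar> \<le> B * (NO G * NO H)"
  using O.dominated_bilinear[OF G H m b B0] by auto
 have [measurable]: "c \<in> meas \<Omega>" "g \<in> meas \<Omega>" "h \<in> meas \<Omega>"
  using c_meas O.wL2D(1)[OF g] O.wL2D(1)[OF h] by auto
 have m2: "(%x. c x * g x * h x) \<in> meas \<Omega>" by measurable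
 have b2: "AE x in leb \<Omega>. \<bar>c x * g x * h x\<bar> \<le> M * (norm (g x) * norm (h x))"
  using c_nonneg c_le by eventually_elim (simp add: abs_mult mult.assoc mult_right_mono)
 show "intg \<Omega> (%x. c x * g x * h x)"
  "\<bar>lint \<Omega> (%x. c x * g x * h x)\<bar> \<le> M * (NO g * NO h)"
  using O.dominated_bilinear[OF g h m2 b2 M0] by auto
qed

text \<open>The form of the extended problem, without the factor 1 / d_s, with the gradients as
  explicit arguments. \<open>weak_grad\<close> is a choice of representatives; here it can be
  exchanged for a concrete field that agrees with it almost everywhere.\<close>

definition cyl_form where
 "cyl_form G g H h = (lint (cyl \<Omega>) (%z. ext_weight s z * ((A (fst z) *v fst (G z), snd (G z)) \<bullet> H z + c (fst z) * g z * h z)))"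

lemma cyl_form_bound:
 fixes G H :: "(real^'n) \<times> real => (real^'n) \<times> real"
 assumes G: "G \<in> LC" and g: "g \<in> LC"
  and H: "H \<in> LC" and h: "h \<in> LC"
 shows "intg (cyl \<Omega>) (%z. ext_weight s z * ((A (fst z) *v fst (G z), snd (G z)) \<bullet> H z + c (fst z) * g z * h z))"
  "\<bar>cyl_form G g H h\<bar> \<le> (B + 1) * (NC G * NC H)
   + M * (NC g * NC h)"
proof -
 let ?w = "ext_weight s"
 have e: "(A (fst z) *v fst (G z), snd (G z)) \<bullet> H z = (A (fst z) *v fst (G z)) \<bullet> fst (H z) + snd (G z) * snd (H z)" for z
  by (simp add: inner_prod_def)
 have m1: "(%z. (A (fst z) *v fst (G z)) \<bullet> fst (H z)) \<in> meas (cyl \<Omega>)"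
  by (rule measurable_matrix_form[OF measurable_cyl_fst[OF open_\<Omega> A_entry_meas]
     C.wL2D(1)[OF C.wL2_fst_snd(1)[OF G]] C.wL2D(1)[OF C.wL2_fst_snd(1)[OF H]]])
 have [measurable]: "(%z. snd (G z)) \<in> meas (cyl \<Omega>)" "(%z. snd (H z)) \<in> meas (cyl \<Omega>)"
  using C.wL2D(1)[OF C.wL2_fst_snd(2)[OF G]] C.wL2D(1)[OF C.wL2_fst_snd(2)[OF H]] by auto
 have m: "(%z. (A (fst z) *v fst (G z), snd (G z)) \<bullet> H z) \<in> meas (cyl \<Omega>)"
  unfolding e using m1 by measurable
 have b: "AE z in leb (cyl \<Omega>). \<bar>(A (fst z) *v fst (G z), snd (G z)) \<bullet> H z\<bar> \<le> (B + 1) * (norm (G z) * norm (H z))"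
 proof (rule AE_I2)
  fix z assume "z \<in> space (leb (cyl \<Omega>))"
  then have z: "fst z \<in> \<Omega>" by (auto simp: cyl_def)
  have "\<bar>(A (fst z) *v fst (G z)) \<bullet> fst (H z)\<bar> \<le> B * (norm (fst (G z)) * norm (fst (H z)))" by (rule A_bd[OF z])
  also have "\<dots> \<le> B * (norm (G z) * norm (H z))" by (intro mult_left_mono mult_mono norm_fst_snd B0) auto
  finally have 1: "\<bar>(A (fst z) *v fst (G z)) \<bullet> fst (H z)\<bar> \<le> B * (norm (G z) * norm (H z))" .
  have "\<bar>snd (G z) * snd (H z)\<bar> \<le> norm (G z) * norm (H z)"
   unfolding abs_mult using norm_fst_snd(2)[of "G z"] norm_fst_snd(2)[of "H z"] by (intro mult_mono) auto
  then show "\<bar>(A (fst z) *v fst (G z), snd (G z)) \<bullet> H z\<bar> \<le> (B + 1) * (norm (G z) * norm (H z))"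
   unfolding e using 1 by (simp add: algebra_simps abs_le_iff)
 qed
 have [measurable]: "(%z. c (fst z)) \<in> meas (cyl \<Omega>)" "g \<in> meas (cyl \<Omega>)" "h \<in> meas (cyl \<Omega>)"
  using measurable_cyl_fst[OF open_\<Omega> c_meas] C.wL2D(1)[OF g] C.wL2D(1)[OF h] by auto
 have m2: "(%z. c (fst z) * g z * h z) \<in> meas (cyl \<Omega>)" by measurable
 have b2: "AE z in leb (cyl \<Omega>). \<bar>c (fst z) * g z * h z\<bar> \<le> M * (norm (g z) * norm (h z))"
  using AE_cyl_fst[OF open_\<Omega> c_nonneg] AE_cyl_fst[OF open_\<Omega> c_le]
  by eventually_elim (simp add: abs_mult mult.assoc mult_right_mono)
 have B1: "0 \<le> B + 1" using B0 by simp
 note I = C.dominated_bilinear[OF G H m b B1] and J = C.dominated_bilinear[OF g h m2 b2 M0]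
 show "intg (cyl \<Omega>) (%z. ?w z * ((A (fst z) *v fst (G z), snd (G z)) \<bullet> H z + c (fst z) * g z * h z))"
  unfolding distrib_left by (intro intg_add I J)
 have "cyl_form G g H h = (lint (cyl \<Omega>) (%z. ?w z * ((A (fst z) *v fst (G z), snd (G z)) \<bullet> H z)))
   + (lint (cyl \<Omega>) (%z. ?w z * (c (fst z) * g z * h z)))"
  unfolding cyl_form_def distrib_left by (rule lint_add[OF I(1) J(1)])
 then show "\<bar>cyl_form G g H h\<bar> \<le> (B + 1) * (wL2_norm (cyl \<Omega>) ?w G * wL2_norm (cyl \<Omega>) ?w H)
   + M * (wL2_norm (cyl \<Omega>) ?w g * wL2_norm (cyl \<Omega>) ?w h)"
  using I(2) J(2) by linarith
qed

lemma cyl_form_diff: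
 fixes G G' H :: "(real^'n) \<times> real => (real^'n) \<times> real"
 assumes G: "G \<in> LC" "G' \<in> LC"
  and g: "g \<in> LC" "g' \<in> LC"
  and H: "H \<in> LC" and h: "h \<in> LC"
 shows "cyl_form (%z. G z - G' z) (%z. g z - g' z) H h = cyl_form G g H h - cyl_form G' g' H h"
proof -
 have e: "ext_weight s z * ((A (fst z) *v fst (G z - G' z), snd (G z - G' z)) \<bullet> H z + c (fst z) * (g z - g' z) * h z)
   = ext_weight s z * ((A (fst z) *v fst (G z), snd (G z)) \<bullet> H z + c (fst z) * g z * h z)
    - ext_weight s z * ((A (fst z) *v fst (G' z), snd (G' z)) \<bullet> H z + c (fst z) * g' z * h z)" for z
  by (simp add: inner_prod_def matrix_vector_mult_diff_distrib inner_diff_left algebra_simps)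
 show ?thesis
  unfolding cyl_form_def e
  by (rule lint_diff[OF cyl_form_bound(1)[OF G(1) g(1) H h] cyl_form_bound(1)[OF G(2) g(2) H h]])
qed

lemma cyl_form_cong:
 fixes G G' H H' :: "(real^'n) \<times> real => (real^'n) \<times> real"
 assumes G: "G \<in> LC" and g: "g \<in> LC"
  and H: "H \<in> LC" and h: "h \<in> LC"
  and GG: "AE z in leb (cyl \<Omega>). G z = G' z" and HH: "AE z in leb (cyl \<Omega>). H z = H' z"
 shows "cyl_form G' g H' h = cyl_form G g H h"
 unfolding cyl_form_def
 by (rule integrable_AE_lebesgue_on(2)[OF open_cyl[OF open_\<Omega>] cyl_form_bound(1)[OF G g H h]])
  (use GG HH in eventually_elim, simp)

text \<open>A bounded function with compact support is at most a constant times exp (- y), and the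
  latter, as a tensor product with the constant 1, lies in the weighted space because Omega has
  finite measure and s < 1.\<close>

lemma test_cyl:
 fixes \<zeta> :: "(real^'n) \<times> real => real"
 assumes \<zeta>: "\<zeta> \<in> TF (\<Omega> \<times> UNIV)"
 shows "\<zeta> \<in> LC"
proof -
 obtain b where b: "0 < b" "\<And>x. \<bar>\<zeta> x\<bar> \<le> b" using test_bounded[OF \<zeta>] by blast
 obtain K where K: "compact K" "\<And>x. x \<notin> K ==> \<zeta> x = 0" by (rule testE[OF \<zeta>]) blast
 obtain N where N: "\<And>x. x \<in> K ==> norm x \<le> N" using compact_imp_bounded[OF K(1)] by (auto simp: bounded_iff)
 have e: "(%y. y powr 0 * exp (- (1 * y))) \<in> LR"
  by (rule powr_exp_wL2(1)) (use s1 in auto)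
 have "intg \<Omega> (%x. 1 :: real)"
  by (rule finite_measure.integrable_const[OF finite_measure_lebesgue_on[OF finite_\<Omega>]])
 then have one: "(%x. 1 :: real) \<in> LO" by (simp add: wL2_def)
 note T = wL2_tensor(1)[OF open_\<Omega> one e, folded ext_weight_eq]
 have bd: "\<bar>\<zeta> z\<bar> \<le> b * exp N * exp (- snd z)" for z
 proof (cases "z \<in> K")
  case True
  then have "snd z \<le> N" using N[OF True] norm_fst_snd(2)[of z] by (simp add: abs_le_iff)
  then have "b * 1 \<le> b * (exp N * exp (- snd z))" using b by (intro mult_left_mono) (auto simp: exp_add[symmetric])
  then show ?thesis using b(2)[of z] by (simp add: mult.assoc)
 next
  case False then show ?thesis using K b by simp
 qed
 show ?thesis
 proof (rule C.wL2_bound(1)[OF borel_imp_lebesgue_on[OF smooth_borel[OF test_smooth[OF \<zeta>]]] T])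
  show "AE z in leb (cyl \<Omega>). norm (\<zeta> z) \<le> (b * exp N) * norm ((snd z powr 0 * exp (- (1 * snd z))) *\<^sub>R (1::real))"
   by (rule AE_I2) (use bd in \<open>auto simp: cyl_def\<close>)
 qed (use b in simp)
qed

lemma test_cyl_wH1:
 fixes \<zeta> :: "(real^'n) \<times> real => real"
 assumes \<zeta>: "\<zeta> \<in> TF (\<Omega> \<times> UNIV)"
 shows "\<zeta> \<in> wH1 (cyl \<Omega>) (ext_weight s)" "AE z in leb (cyl \<Omega>). wgC \<zeta> z = grad \<zeta> z"
  "grad \<zeta> \<in> LC"
 using C.wH1_smooth[OF test_smooth[OF \<zeta>] test_cyl[OF \<zeta>] test_cyl[OF test_dir_deriv[OF \<zeta>]]] by auto

section \<open>Projection onto one eigenfunction and separation of variables\<close>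

definition proj :: "nat => ((real^'n) \<times> real => real) => real => real" where
 "proj k \<zeta> y = (lint \<Omega> (%x. \<zeta> (x, y) * \<phi> k x))"

lemma test_slice_L2:
 assumes "\<zeta> \<in> TF (\<Omega> \<times> (UNIV :: real set))"
 shows "(%x. \<zeta> (x, y)) \<in> LO"
 by (rule O.test_in_wL2[OF test_slice1[OF assms]])

lemma proj_deriv:
 assumes \<zeta>: "\<zeta> \<in> TF (\<Omega> \<times> UNIV)"
 shows "(proj k \<zeta> has_real_derivative proj k (dd (0, 1) \<zeta>) y) (at y)"
proof -
 have bb: "(0, 1) \<in> (Basis :: ((real^'n) \<times> real) set)" by (simp add: Basis_cyl)
 note \<zeta>' = test_dir_deriv[OF \<zeta> bb]
 obtain b where b: "0 < b" "\<And>x. \<bar>dd (0, 1) \<zeta> x\<bar> \<le> b" using test_bounded[OF \<zeta>'] by blast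
 have i: "intg \<Omega> (\<phi> k)"
 proof -
  have "intg \<Omega> (%x. 1 :: real)"
   by (rule finite_measure.integrable_const[OF finite_measure_lebesgue_on[OF finite_\<Omega>]])
  then have "(%x. 1 :: real) \<in> LO" by (simp add: wL2_def)
  from L2_inner_bound(1)[OF this phi_L2] show ?thesis by simp
 qed
 show ?thesis
  unfolding proj_def[abs_def]
 proof (rule has_real_derivative_integral[where a = "y - 1" and b = "y + 1" and g = "%x. b * \<bar>\<phi> k x\<bar>"])
  show "((%z. \<zeta> (t, z) * \<phi> k t) has_real_derivative dd (0, 1) \<zeta> (t, z) * \<phi> k t) (at z)" for z t
  proof -
   have "((%z. \<zeta> (t, z)) has_real_derivative dd (0, 1) \<zeta> (t, z)) (at z)"
    using smooth_has_real_derivative[OF smooth_slice2[OF test_smooth[OF \<zeta>]], of t z]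
    unfolding smooth_slice_deriv2(1)[OF test_smooth[OF \<zeta>]] .
   then show ?thesis by (rule DERIV_cmult_right)
  qed
  show "\<bar>dd (0, 1) \<zeta> (t, z) * \<phi> k t\<bar> \<le> b * \<bar>\<phi> k t\<bar>" for z t
   unfolding abs_mult by (intro mult_right_mono b) auto
  show "intg \<Omega> (%x. \<zeta> (x, z) * \<phi> k x)" for z
   by (rule L2_inner_bound(1)[OF test_slice_L2[OF \<zeta>] phi_L2])
  show "(%x. dd (0, 1) \<zeta> (x, y) * \<phi> k x) \<in> meas \<Omega>"
   by (rule borel_measurable_integrable[OF L2_inner_bound(1)[OF test_slice_L2[OF \<zeta>'] phi_L2]])
 qed (use i in auto)
qed

text \<open>Projection commutes with the derivative in y, so the projections of all test functions
  form a class that is closed under derivatives.\<close>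

lemma proj_test:
 assumes \<zeta>: "\<zeta> \<in> TF (\<Omega> \<times> UNIV)"
 shows "proj k \<zeta> \<in> TF UNIV" "dd 1 (proj k \<zeta>) = proj k (dd (0, 1) \<zeta>)"
proof -
 have bb: "(0, 1) \<in> (Basis :: ((real^'n) \<times> real) set)" by (simp add: Basis_cyl)
 show "dd 1 (proj k \<zeta>) = proj k (dd (0, 1) \<zeta>)" using dir_deriv_real[OF proj_deriv[OF \<zeta>]] by auto
 have sm: "smooth (proj k \<zeta>)"
 proof (rule smooth_real_iff[where F = "proj k ` TF (\<Omega> \<times> UNIV)"])
  show "proj k \<zeta> \<in> proj k ` TF (\<Omega> \<times> UNIV)" using \<zeta> by blast
  fix f assume "f \<in> proj k ` TF (\<Omega> \<times> UNIV)"
  then obtain \<xi> where \<xi>: "\<xi> \<in> TF (\<Omega> \<times> UNIV)" "f = proj k \<xi>" by blast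
  then show "\<exists>g\<in>proj k ` TF (\<Omega> \<times> UNIV). \<forall>x. (f has_real_derivative g x) (at x)"
   using proj_deriv[OF \<xi>(1)] test_dir_deriv[OF \<xi>(1) bb] by blast
 qed
 obtain K where K: "compact K" "\<And>x. x \<notin> K ==> \<zeta> x = 0" by (rule testE[OF \<zeta>]) blast
 show "proj k \<zeta> \<in> TF UNIV"
 proof (rule testI[OF sm, of "snd ` K"])
  show "compact (snd ` K)" using K(1) by (intro compact_continuous_image continuous_intros)
  show "proj k \<zeta> y = 0" if "y \<notin> snd ` K" for y
  proof -
   have "\<zeta> (x, y) = 0" for x using K(2)[of "(x, y)"] that by force
   then show ?thesis by (simp add: proj_def)
  qed
 qed simp
qed

definition tensor_grad :: "(real^'n => real) => (real => real) => (real^'n) \<times> real => (real^'n) \<times> real" where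
 "tensor_grad p \<eta> z = (\<eta> (snd z) *\<^sub>R wg p (fst z), dd 1 \<eta> (snd z) *\<^sub>R p (fst z))"

lemma tensor_wH1:
 assumes p: "p \<in> wH1 \<Omega> (%_. 1)" and \<eta>: "\<eta> \<in> TF UNIV"
 shows "(%z. p (fst z) * \<eta> (snd z)) \<in> wH1 (cyl \<Omega>) (ext_weight s)"
  "AE z in leb (cyl \<Omega>). wgC (%z. p (fst z) * \<eta> (snd z)) z = tensor_grad p \<eta> z"
  "tensor_grad p \<eta> \<in> LC"
proof -
 have \<eta>': "dd 1 \<eta> \<in> TF UNIV" by (rule test_dir_deriv[OF \<eta>]) auto
 note E = test_in_half_line_wL2[OF \<eta> s1] and E' = test_in_half_line_wL2[OF \<eta>' s1]
 note W = O.wH1_weak_grad[OF p] and P = O.wH1_wL2[OF p]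
 have 1: "(%z. p (fst z) * \<eta> (snd z)) \<in> LC"
  using wL2_tensor(1)[OF open_\<Omega> P E, folded ext_weight_eq] by (simp add: mult.commute)
 show 2: "tensor_grad p \<eta> \<in> LC"
  unfolding tensor_grad_def[abs_def]
  by (intro C.wL2_Pair(1) wL2_tensor(1)[OF open_\<Omega> W(1) E, folded ext_weight_eq] wL2_tensor(1)[OF open_\<Omega> P E', folded ext_weight_eq])
 have 3: "hwd (cyl \<Omega>) b 1 (%z. p (fst z) * \<eta> (snd z)) (%z. tensor_grad p \<eta> z \<bullet> b)" if b: "b \<in> Basis" for b
  using b unfolding Basis_cyl
 proof (elim disjE bexE)
  fix b' :: "real^'n" assume b': "b' \<in> Basis" "b = (b', 0)"
  have l: "locint {0<..} \<eta>"
   by (rule locint_continuous[OF smooth_continuous_on[OF test_smooth[OF \<eta>]]])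
  show ?thesis
   using hwd_tensor_fst[OF open_\<Omega> open_greaterThan b'(1) W(2)[OF b'(1)] l]
   by (simp add: b'(2) cyl_def tensor_grad_def mult.commute)
 next
  assume b': "b = (0, 1)"
  have l: "locint \<Omega> p" by (rule O.wL2_locally_integrable[OF P])
  have "hwd {0<..} 1 1 \<eta> (dd 1 \<eta>)"
   by (rule hwd_smooth[OF open_greaterThan _ test_smooth[OF \<eta>]]) auto
  from hwd_tensor_snd[OF open_\<Omega> open_greaterThan _ l this]
  show ?thesis by (simp add: b' cyl_def tensor_grad_def mult.commute)
 qed
 show "(%z. p (fst z) * \<eta> (snd z)) \<in> wH1 (cyl \<Omega>) (ext_weight s)"
  "AE z in leb (cyl \<Omega>). wgC (%z. p (fst z) * \<eta> (snd z)) z = tensor_grad p \<eta> z"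
  using C.wH1I[OF 1 2 3] by auto
qed

text \<open>If test functions rho_j approach p in H^1, the products rho_j eta are admissible
  approximations on the cylinder, where eta may be nonzero at 0, and their restrictions to y = 0
  converge to eta(0) p.\<close>

lemma tensor_trace:
 assumes p: "p \<in> H10 \<Omega>" and \<eta>: "\<eta> \<in> TF UNIV"
 shows "is_trace \<Omega> s (%z. p (fst z) * \<eta> (snd z)) (%x. \<eta> 0 * p x)"
proof -
 have \<eta>': "dd 1 \<eta> \<in> TF UNIV" by (rule test_dir_deriv[OF \<eta>]) auto
 note E = test_in_half_line_wL2[OF \<eta> s1] and E' = test_in_half_line_wL2[OF \<eta>' s1]
 have pH: "p \<in> wH1 \<Omega> (%_. 1)" using p unfolding H10_def by blast
 obtain \<rho> where \<rho>: "\<And>j. \<rho> j \<in> TF \<Omega>" "null (%j. wH1_norm \<Omega> (%_. 1) (%x. p x - \<rho> j x))"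
  using p unfolding H10_def by blast
 have \<rho>H: "\<rho> j \<in> wH1 \<Omega> (%_. 1)" for j by (rule O.wH1_test(1)[OF \<rho>(1)])
 have dH: "(%x. p x - \<rho> j x) \<in> wH1 \<Omega> (%_. 1)" for j by (rule O.wH1_diff(1)[OF pH \<rho>H])
 define \<zeta> where "\<zeta> = (%j z. \<rho> j (fst z) * \<eta> (snd z))"
 have \<zeta>: "\<zeta> j \<in> TF (\<Omega> \<times> UNIV)" for j unfolding \<zeta>_def by (rule test_tensor[OF \<rho>(1) \<eta>])
 let ?v = "%z. p (fst z) * \<eta> (snd z)"
 note V = tensor_wH1[OF pH \<eta>]
 let ?C = "NR"
 have b: "wH1_norm (cyl \<Omega>) (ext_weight s) (%z. ?v z - \<zeta> j z) \<le> (2 * ?C \<eta> + ?C (dd 1 \<eta>)) * wH1_norm \<Omega> (%_. 1) (%x. p x - \<rho> j x)" for j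
 proof -
  let ?d = "%x. p x - \<rho> j x"
  have e: "(%z. ?v z - \<zeta> j z) = (%z. ?d (fst z) * \<eta> (snd z))" by (auto simp: \<zeta>_def left_diff_distrib)
  note T = tensor_wH1[OF dH \<eta>, of j]
  note P = O.wH1_wL2[OF dH, of j] and W = O.wH1_weak_grad(1)[OF dH, of j]
  have n1: "NC (%z. ?d (fst z) * \<eta> (snd z)) = NO ?d * ?C \<eta>"
   using wL2_tensor(2)[OF open_\<Omega> P E, folded ext_weight_eq] by (simp add: mult.commute)
  have "NC (wgC (%z. ?d (fst z) * \<eta> (snd z))) = NC (tensor_grad ?d \<eta>)"
   by (rule C.wL2_norm_cong_AE[OF T(2) C.wL2D(1)[OF C.wH1_weak_grad(1)[OF T(1)]] C.wL2D(1)[OF T(3)]])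
  also have "\<dots> \<le> NO (wg ?d) * ?C \<eta> + NO ?d * ?C (dd 1 \<eta>)"
   unfolding tensor_grad_def[abs_def]
   using C.wL2_Pair(2)[OF wL2_tensor(1)[OF open_\<Omega> W E, folded ext_weight_eq] wL2_tensor(1)[OF open_\<Omega> P E', folded ext_weight_eq]]
   unfolding wL2_tensor(2)[OF open_\<Omega> W E, folded ext_weight_eq] wL2_tensor(2)[OF open_\<Omega> P E', folded ext_weight_eq] .
  also have "\<dots> \<le> wH1_norm \<Omega> (%_. 1) ?d * ?C \<eta> + wH1_norm \<Omega> (%_. 1) ?d * ?C (dd 1 \<eta>)"
   by (intro add_mono mult_right_mono O.wH1_norm_bounds R.norm_nonneg)
  finally have n2: "NC (wgC (%z. ?d (fst z) * \<eta> (snd z)))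
    \<le> wH1_norm \<Omega> (%_. 1) ?d * ?C \<eta> + wH1_norm \<Omega> (%_. 1) ?d * ?C (dd 1 \<eta>)" .
  have "NO ?d * ?C \<eta> \<le> wH1_norm \<Omega> (%_. 1) ?d * ?C \<eta>"
   by (intro mult_right_mono O.wH1_norm_bounds R.norm_nonneg)
  then show ?thesis unfolding e
   using C.wH1_norm_bounds(3)[of "%z. ?d (fst z) * \<eta> (snd z)"] n1 n2 by (simp add: algebra_simps)
 qed
 have lim: "null (%j. wH1_norm (cyl \<Omega>) (ext_weight s) (%z. ?v z - \<zeta> j z))"
 proof (rule tendsto_sandwich[OF _ _ tendsto_const])
  show "\<forall>\<^sub>F j in sequentially. 0 \<le> wH1_norm (cyl \<Omega>) (ext_weight s) (%z. ?v z - \<zeta> j z)"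
   by (intro always_eventually allI order_trans[OF C.norm_nonneg C.wH1_norm_bounds(1)])
  show "\<forall>\<^sub>F j in sequentially. wH1_norm (cyl \<Omega>) (ext_weight s) (%z. ?v z - \<zeta> j z)
    \<le> (2 * ?C \<eta> + ?C (dd 1 \<eta>)) * wH1_norm \<Omega> (%_. 1) (%x. p x - \<rho> j x)"
   by (intro always_eventually allI b)
  show "null (%j. (2 * ?C \<eta> + ?C (dd 1 \<eta>)) * wH1_norm \<Omega> (%_. 1) (%x. p x - \<rho> j x))"
   using tendsto_mult_left[OF \<rho>(2), of "2 * ?C \<eta> + ?C (dd 1 \<eta>)"] by simp
 qed
 have "?v \<in> H1L \<Omega> s" unfolding H1L_def using V(1) \<zeta> lim by blast
 moreover have "(%x. \<eta> 0 * p x) \<in> LO" using O.wL2_cmult(1)[OF O.wH1_wL2[OF pH], of "\<eta> 0"] by simp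
 moreover have "null (%j. NO (%x. \<eta> 0 * p x - \<zeta> j (x, 0)))"
 proof -
  have "NO (%x. \<eta> 0 * p x - \<zeta> j (x, 0)) = \<bar>\<eta> 0\<bar> * NO (%x. p x - \<rho> j x)" for j
   using O.wL2_cmult(2)[OF O.wH1_wL2[OF dH], of "\<eta> 0" j] by (simp add: \<zeta>_def algebra_simps)
  then show ?thesis using tendsto_mult_left[OF O.wH1_tendstoD(1)[OF pH \<rho>H \<rho>(2)], of "\<bar>\<eta> 0\<bar>"] by simp
 qed
 ultimately show ?thesis unfolding is_trace_def using \<zeta> lim by blast
qed

text \<open>Separation of variables. For fixed y the slice of zeta is a test function on Omega, so
  the weak eigenvalue equation turns the integral over x into lam k times the projection; symmetry
  of A moves the gradient of the eigenfunction into the first slot.\<close>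

lemma cyl_form_tensor:
 assumes \<zeta>: "\<zeta> \<in> TF (\<Omega> \<times> UNIV)" and \<eta>: "\<eta> \<in> TF UNIV"
 shows "cyl_form (grad \<zeta>) \<zeta> (tensor_grad (\<phi> k) \<eta>) (%z. \<phi> k (fst z) * \<eta> (snd z))
  = mode_form s (lam k) (proj k \<zeta>) (dd 1 (proj k \<zeta>)) \<eta> (dd 1 \<eta>)"
proof -
 have bb: "(0, 1) \<in> (Basis :: ((real^'n) \<times> real) set)" by (simp add: Basis_cyl)
 note \<zeta>' = test_dir_deriv[OF \<zeta> bb] and T = tensor_wH1[OF phi_wH1 \<eta>, of k]
 note i = cyl_form_bound(1)[OF test_cyl_wH1(3)[OF \<zeta>] test_cyl[OF \<zeta>] T(3) C.wH1_wL2[OF T(1)], unfolded cyl_def]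
 have "cyl_form (grad \<zeta>) \<zeta> (tensor_grad (\<phi> k) \<eta>) (%z. \<phi> k (fst z) * \<eta> (snd z))
  = (lint {0<..} (%y. lint \<Omega> (%x. ext_weight s (x, y) * ((A (fst (x, y)) *v fst (grad \<zeta> (x, y)), snd (grad \<zeta> (x, y))) \<bullet> tensor_grad (\<phi> k) \<eta> (x, y)
    + c (fst (x, y)) * \<zeta> (x, y) * (\<phi> k (fst (x, y)) * \<eta> (snd (x, y)))))))"
  unfolding cyl_form_def cyl_def by (rule lebesgue_on_Fubini(3)[OF open_\<Omega> open_greaterThan i, symmetric])
 also have "\<dots> = mode_form s (lam k) (proj k \<zeta>) (dd 1 (proj k \<zeta>)) \<eta> (dd 1 \<eta>)"
  unfolding mode_form_def
 proof (rule integral_lebesgue_on_cong)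
  fix y :: real
  let ?v = "%x. \<zeta> (x, y)"
  note v = test_slice1[OF \<zeta>, of y]
  note W = O.wH1_weak_grad(1)[OF phi_wH1, of k]
  note g = O.wH1_test(2,3)[OF v]
  note F = form_integrable[OF W g(2) phi_L2[of k] test_slice_L2[OF \<zeta>, of y]]
  have "(lint \<Omega> (%x. (A x *v wg (\<phi> k) x) \<bullet> grad ?v x + c x * \<phi> k x * ?v x))
    = (lint \<Omega> (%x. (A x *v wg (\<phi> k) x) \<bullet> wg ?v x + c x * \<phi> k x * ?v x))"
   by (rule integrable_AE_lebesgue_on(2)[OF open_\<Omega> intg_add[OF F(1,2)], symmetric])
    (use g(1) in eventually_elim, simp)
  also have "\<dots> = lam k * proj k \<zeta> y"
   unfolding phi_eq[OF test_in_H10[OF open_\<Omega> v]] by (simp add: proj_def L2_inner_def mult.commute)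
  finally have I: "(lint \<Omega> (%x. (A x *v wg (\<phi> k) x) \<bullet> grad ?v x + c x * \<phi> k x * ?v x)) = lam k * proj k \<zeta> y" .
  let ?a = "%x. (A x *v wg (\<phi> k) x) \<bullet> grad ?v x + c x * \<phi> k x * ?v x"
  let ?b = "%x. dd (0, 1) \<zeta> (x, y) * \<phi> k x"
  have "(lint \<Omega> (%x. ext_weight s (x, y) * ((A (fst (x, y)) *v fst (grad \<zeta> (x, y)), snd (grad \<zeta> (x, y))) \<bullet> tensor_grad (\<phi> k) \<eta> (x, y)
    + c (fst (x, y)) * \<zeta> (x, y) * (\<phi> k (fst (x, y)) * \<eta> (snd (x, y))))))
   = (lint \<Omega> (%x. hw (1 - 2 * s) 0 y * (\<eta> y * ?a x + dd 1 \<eta> y * ?b x)))"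
  proof (rule integral_lebesgue_on_cong)
   fix x assume "x \<in> \<Omega>"
   from A_sym[OF this, of "wg (\<phi> k) x" "grad ?v x"]
   show "ext_weight s (x, y) * ((A (fst (x, y)) *v fst (grad \<zeta> (x, y)), snd (grad \<zeta> (x, y))) \<bullet> tensor_grad (\<phi> k) \<eta> (x, y)
    + c (fst (x, y)) * \<zeta> (x, y) * (\<phi> k (fst (x, y)) * \<eta> (snd (x, y)))) = hw (1 - 2 * s) 0 y * (\<eta> y * ?a x + dd 1 \<eta> y * ?b x)"
    unfolding grad_slice[OF test_smooth[OF \<zeta>]]
    by (simp add: inner_prod_def tensor_grad_def ext_weight_def algebra_simps)
  qed
  also have "\<dots> = hw (1 - 2 * s) 0 y * (\<eta> y * (lam k * proj k \<zeta> y) + dd 1 \<eta> y * proj k (dd (0, 1) \<zeta>) y)"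
  proof -
   have a: "intg \<Omega> ?a" by (rule intg_add[OF F(1,2)])
   have b: "intg \<Omega> ?b" by (rule L2_inner_bound(1)[OF test_slice_L2[OF \<zeta>'] phi_L2])
   have "(lint \<Omega> (%x. \<eta> y * ?a x + dd 1 \<eta> y * ?b x)) = \<eta> y * lint \<Omega> ?a + dd 1 \<eta> y * lint \<Omega> ?b"
    using lint_add[OF integrable_mult_right[OF a] integrable_mult_right[OF b]]
    by (simp only: integral_mult_right_zero)
   then show ?thesis unfolding I integral_mult_right_zero by (simp only: proj_def)
  qed
  finally show "(lint \<Omega> (%x. ext_weight s (x, y) * ((A (fst (x, y)) *v fst (grad \<zeta> (x, y)), snd (grad \<zeta> (x, y))) \<bullet> tensor_grad (\<phi> k) \<eta> (x, y)
    + c (fst (x, y)) * \<zeta> (x, y) * (\<phi> k (fst (x, y)) * \<eta> (snd (x, y))))))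
   = hw (1 - 2 * s) 0 y * (lam k * (proj k \<zeta> y * \<eta> y) + dd 1 (proj k \<zeta>) y * dd 1 \<eta> y)"
   unfolding proj_test(2)[OF \<zeta>] by (simp add: algebra_simps)
 qed
 finally show ?thesis .
qed

end

section \<open>Completeness of the weighted spaces\<close>

lemma sigma_finite_lebesgue: "sigma_finite_measure (lebesgue :: 'a::euclidean_space measure)"
proof
 have "(\<Union>n. cball (0::'a) (real n)) = UNIV" using real_arch_simple by (fastforce simp: mem_cball_0)
 moreover have "emeasure lborel (cball (0::'a) r) \<noteq> top" for r using emeasure_lborel_cball_finite[of "0::'a" r] by simp
 ultimately show "\<exists>A. countable A \<and> A \<subseteq> sets (lebesgue :: 'a measure) \<and> \<Union> A = space lebesgue \<and> (\<forall>a\<in>A. emeasure lebesgue a \<noteq> \<infinity>)"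
  by (intro exI[of _ "range (%n. cball 0 (real n))"]) auto
qed

context pos_weight
begin

text \<open>Multiplying by omega psi turns the Cauchy condition in the weighted space into one in
  L^1, by Cauchy-Schwarz with a strictly positive psi of finite norm. A subsequence then converges
  almost everywhere, and Fatou's lemma carries the bounds to the limit. The modulus e m + e n is the
  form in which series and coercivity deliver the Cauchy condition.\<close>

lemma wL2_complete:
 fixes u :: "nat => 'a => 'b::euclidean_space"
 assumes u: "\<And>n. u n \<in> wsp" and e: "\<And>m n. nrm (%x. u m x - u n x) \<le> e m + e n" and e0: "e \<longlonglongrightarrow> 0"
 obtains v where "v \<in> wsp" "null (%n. nrm (%x. v x - u n x))"
proof -
 have [measurable]: "u n \<in> meas S" for n using wL2D(1)[OF u] .
 have ud: "(%x. u m x - u n x) \<in> wsp" for m n by (rule wL2_diff(1)[OF u u])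
 have small: "\<exists>N. \<forall>m\<ge>N. e m < r" if "0 < r" for r
  using order_tendstoD(2)[OF e0 that] unfolding eventually_sequentially .
 from sigma_finite_measure_restrict_space[OF sigma_finite_lebesgue, of S]
 have sf: "sigma_finite_measure (leb S)" using sets_lebesgue_open[OF open_S] by simp
 obtain h :: "'a => real" where h: "h \<in> meas S" "\<And>x. 0 < h x" "intg S h"
  by (rule sigma_finite_measure.obtain_positive_integrable_function[OF sf]) blast
 \<comment> \<open>Chosen so that omega psi^2 is a positive integrable function. S may have infinite
   weighted measure, so a constant would not do.\<close>
 define \<psi> where "\<psi> = (%x. sqrt (h x / \<omega> x))"
 have [measurable]: "\<psi> \<in> meas S" unfolding \<psi>_def using h(1) by measurable
 have \<psi>0: "0 < \<psi> x" if "x \<in> S" for x using h(2)[of x] pos_\<omega>[OF that] by (simp add: \<psi>_def)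
 have "\<omega> x * (norm (\<psi> x))^2 = h x" if "x \<in> S" for x using h(2)[of x] pos_\<omega>[OF that] by (simp add: \<psi>_def)
 then have \<psi>: "\<psi> \<in> wsp"
  unfolding wL2_def using integrable_lebesgue_on_cong[of S h "%x. \<omega> x * (norm (\<psi> x))^2"] h(3) by simp
 define g where "g = (%n x. (\<omega> x * \<psi> x) *\<^sub>R u n x)"
 have gm[measurable]: "g n \<in> meas S" for n unfolding g_def by measurable
 have ng: "norm (g n x) = \<omega> x * (norm (\<psi> x) * norm (u n x))"
  "norm (g m x - g n x) = \<omega> x * (norm (\<psi> x) * norm (u m x - u n x))" if "x \<in> S" for m n x
 proof -
  show "norm (g n x) = \<omega> x * (norm (\<psi> x) * norm (u n x))"
   using pos_\<omega>[OF that] by (simp add: g_def abs_mult)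
  have "g m x - g n x = (\<omega> x * \<psi> x) *\<^sub>R (u m x - u n x)" by (simp add: g_def scaleR_diff_right)
  then show "norm (g m x - g n x) = \<omega> x * (norm (\<psi> x) * norm (u m x - u n x))"
   using pos_\<omega>[OF that] by (simp add: abs_mult)
 qed
 have gi: "intg S (g n)" for n
 proof (rule intg_bound[OF norm_mult_bound(1)[OF \<psi> u] gm])
  show "AE x in leb S. norm (g n x) \<le> norm (\<omega> x * (norm (\<psi> x) * norm (u n x)))"
   by (rule AE_I2) (use ng in auto)
 qed
 have gd: "(lint S (%x. norm (g m x - g n x))) \<le> nrm \<psi> * nrm (%x. u m x - u n x)" for m n
  using norm_mult_bound(2)[OF \<psi> ud, of m n] integral_lebesgue_on_cong[of S, OF ng(2)[of _ m n]] by simp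
 obtain r where r: "strict_mono r" "AE x in leb S. Cauchy (%i. g (r i) x)"
 proof (rule cauchy_L1_AE_cauchy_subseq[OF gi])
  fix d :: real assume d: "0 < d"
  define b where "b = 2 * (nrm \<psi> + 1)"
  have b: "0 < b" using norm_nonneg[of \<psi>] by (simp add: b_def)
  obtain N where N: "\<And>m. m \<ge> N ==> e m < d / b" using small[of "d / b"] d b by auto
  have "(lint S (%x. norm (g i x - g j x))) < d" if "i \<ge> N" "j \<ge> N" for i j
  proof -
   have "nrm (%x. u i x - u j x) < 2 * d / b" using e[of i j] N[OF that(1)] N[OF that(2)] by simp
   then have "nrm \<psi> * nrm (%x. u i x - u j x) \<le> nrm \<psi> * (2 * d / b)"
    by (intro mult_left_mono norm_nonneg) simp
   also have "\<dots> < d" using norm_nonneg[of \<psi>] d by (simp add: b_def divide_simps)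
   finally show ?thesis using gd[of i j] by simp
  qed
  then show "\<exists>N. \<forall>i\<ge>N. \<forall>j\<ge>N. (LINT x|leb S. norm (g i x - g j x)) < d" by blast
 qed
 define v where "v = (%x. lim (%i. u (r i) x))"
 have [measurable]: "v \<in> meas S" unfolding v_def by measurable
 have lim: "AE x in leb S. (%i. u (r i) x) \<longlonglongrightarrow> v x"
  using r(2) AE_space
 proof eventually_elim
  case (elim x)
  then have x: "x \<in> S" by simp
  obtain L where "(%i. g (r i) x) \<longlonglongrightarrow> L" using Cauchy_convergent[OF elim(1)] by (auto simp: convergent_def)
  from tendsto_scaleR[OF tendsto_const[of "1 / (\<omega> x * \<psi> x)"] this]
  have "convergent (%i. (1 / (\<omega> x * \<psi> x)) *\<^sub>R g (r i) x)" by (rule convergentI)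
  moreover have "(%i. (1 / (\<omega> x * \<psi> x)) *\<^sub>R g (r i) x) = (%i. u (r i) x)"
   using pos_\<omega>[OF x] \<psi>0[OF x] by (simp add: g_def)
  ultimately show ?case unfolding v_def by (simp add: convergent_LIMSEQ_iff)
 qed
 have main: "(%x. v x - u n x) \<in> wsp \<and> nrm (%x. v x - u n x) \<le> d"
  if d: "0 \<le> d" and N: "\<And>m. m \<ge> n ==> nrm (%x. u m x - u n x) \<le> d" for n d
 proof -
  have i: "(\<integral>\<^sup>+x. ennreal (\<omega> x * (norm (u m x - u n x))^2) \<partial>leb S) = ennreal ((nrm (%x. u m x - u n x))^2)" for m
   unfolding norm_sq by (rule nn_integral_eq_integral[OF wL2D(2)[OF ud]]) (rule AE_I2, use pos_\<omega> in \<open>simp add: less_imp_le\<close>)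
  have "(\<integral>\<^sup>+x. ennreal (\<omega> x * (norm (v x - u n x))^2) \<partial>leb S)
    = (\<integral>\<^sup>+x. liminf (%m. ennreal (\<omega> x * (norm (u (r m) x - u n x))^2)) \<partial>leb S)"
  proof (rule nn_integral_cong_AE)
   show "AE x in leb S. ennreal (\<omega> x * (norm (v x - u n x))^2) = liminf (%m. ennreal (\<omega> x * (norm (u (r m) x - u n x))^2))"
    using lim
   proof eventually_elim
    case (elim x)
    have "(%m. ennreal (\<omega> x * (norm (u (r m) x - u n x))^2)) \<longlonglongrightarrow> ennreal (\<omega> x * (norm (v x - u n x))^2)"
     by (intro tendsto_ennrealI tendsto_intros elim)
    from lim_imp_Liminf[OF sequentially_bot this] show ?case by simp
   qed
  qed
  also have "\<dots> \<le> liminf (%m. \<integral>\<^sup>+x. ennreal (\<omega> x * (norm (u (r m) x - u n x))^2) \<partial>leb S)"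
   by (rule nn_integral_liminf) measurable
  also have "\<dots> \<le> limsup (%m. \<integral>\<^sup>+x. ennreal (\<omega> x * (norm (u (r m) x - u n x))^2) \<partial>leb S)"
   by (rule Liminf_le_Limsup) simp
  also have "\<dots> \<le> ennreal (d\<^sup>2)"
  proof (rule Limsup_bounded)
   show "\<forall>\<^sub>F m in sequentially. (\<integral>\<^sup>+x. ennreal (\<omega> x * (norm (u (r m) x - u n x))^2) \<partial>leb S) \<le> ennreal (d\<^sup>2)"
    unfolding i eventually_sequentially
   proof (intro exI[of _ n] allI impI ennreal_leI power_mono N norm_nonneg)
    fix m assume "n \<le> m" then show "n \<le> r m" using seq_suble[OF r(1), of m] by linarith
   qed
  qed
  finally have F: "(\<integral>\<^sup>+x. ennreal (\<omega> x * (norm (v x - u n x))^2) \<partial>leb S) \<le> ennreal (d\<^sup>2)" .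
  have int: "intg S (%x. \<omega> x * (norm (v x - u n x))^2)"
  proof (rule integrableI_bounded)
   have "(\<integral>\<^sup>+x. ennreal (norm (\<omega> x * (norm (v x - u n x))^2)) \<partial>leb S) = (\<integral>\<^sup>+x. ennreal (\<omega> x * (norm (v x - u n x))^2) \<partial>leb S)"
    by (rule nn_integral_cong) (use pos_\<omega> in \<open>simp add: less_imp_le\<close>)
   also have "\<dots> < \<infinity>" using F by (rule le_less_trans) simp
   finally show "(\<integral>\<^sup>+x. ennreal (norm (\<omega> x * (norm (v x - u n x))^2)) \<partial>leb S) < \<infinity>" .
  qed measurable
  then have w: "(%x. v x - u n x) \<in> wsp" unfolding wL2_def by simp
  have "AE x in leb S. 0 \<le> \<omega> x * (norm (v x - u n x))^2" by (rule AE_I2) (use pos_\<omega> in \<open>simp add: less_imp_le\<close>)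
  from F[unfolded nn_integral_eq_integral[OF int this]]
  have "ennreal ((nrm (%x. v x - u n x))^2) \<le> ennreal (d\<^sup>2)" unfolding norm_sq .
  then have "nrm (%x. v x - u n x) \<le> d"
   using d by (auto simp: ennreal_le_iff intro: power2_le_imp_le)
  with w show ?thesis by blast
 qed
 have ev: "\<exists>N. \<forall>n\<ge>N. (%x. v x - u n x) \<in> wsp \<and> nrm (%x. v x - u n x) \<le> d" if "0 < d" for d
 proof -
  obtain N where N: "\<And>m. m \<ge> N ==> e m < d / 2" using small[of "d / 2"] \<open>0 < d\<close> by auto
  have "(%x. v x - u n x) \<in> wsp \<and> nrm (%x. v x - u n x) \<le> d" if n: "n \<ge> N" for n
  proof (rule main)
   show "nrm (%x. u m x - u n x) \<le> d" if "m \<ge> n" for m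
    using e[of m n] N[of m] N[OF n] n that by simp
  qed (use \<open>0 < d\<close> in simp)
  then show ?thesis by blast
 qed
 obtain N where "\<forall>n\<ge>N. (%x. v x - u n x) \<in> wsp \<and> nrm (%x. v x - u n x) \<le> 1" using ev[OF zero_less_one] ..
 then have "(%x. v x - u N x) \<in> wsp" by blast
 from wL2_add(1)[OF this u[of N]] have v: "v \<in> wsp" by simp
 moreover have "null (%n. nrm (%x. v x - u n x))"
 proof (rule LIMSEQ_I)
  fix d :: real assume d: "0 < d"
  obtain N where N: "\<forall>n\<ge>N. (%x. v x - u n x) \<in> wsp \<and> nrm (%x. v x - u n x) \<le> d / 2"
   using ev[OF half_gt_zero[OF d]] ..
  show "\<exists>N. \<forall>n\<ge>N. norm (nrm (%x. v x - u n x) - 0) < d"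
  proof (intro exI[of _ N] allI impI)
   fix n assume "N \<le> n"
   then have "nrm (%x. v x - u n x) \<le> d / 2" using N by blast
   then show "norm (nrm (%x. v x - u n x) - 0) < d"
    unfolding real_norm_def diff_zero abs_of_nonneg[OF norm_nonneg] using d by linarith
  qed
 qed
 ultimately show ?thesis by (rule that)
qed

end

section \<open>Passing to the limit in the form of one mode\<close>

lemma mode_form_commute: "mode_form s lam z z' e e' = mode_form s lam e e' z z'"
 unfolding mode_form_def by (simp add: mult.commute)

lemma mode_form_cmult: "mode_form s lam z z' (%y. r * e y) (%y. r * e' y) = r * mode_form s lam z z' e e'"
 unfolding mode_form_def by (subst integral_mult_right_zero[symmetric]) (simp add: algebra_simps)

lemma mode_form_diff:
 assumes "z \<in> wL2 {0<..} (hw (1 - 2 * s) 0)" "z' \<in> wL2 {0<..} (hw (1 - 2 * s) 0)"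
  "e \<in> wL2 {0<..} (hw (1 - 2 * s) 0)" "e' \<in> wL2 {0<..} (hw (1 - 2 * s) 0)"
  "f \<in> wL2 {0<..} (hw (1 - 2 * s) 0)" "f' \<in> wL2 {0<..} (hw (1 - 2 * s) 0)"
 shows "mode_form s lam z z' (%y. e y - f y) (%y. e' y - f' y) = mode_form s lam z z' e e' - mode_form s lam z z' f f'"
 unfolding mode_form_def
 by (subst lint_diff[OF mode_form_split(1)[OF assms(1-4)] mode_form_split(1)[OF assms(1,2,5,6)], symmetric])
  (simp add: algebra_simps)

lemma mode_form_tendsto:
 assumes lam: "0 \<le> lam" and z: "z \<in> wL2 {0<..} (hw (1 - 2 * s) 0)" "z' \<in> wL2 {0<..} (hw (1 - 2 * s) 0)"
  and e: "e \<in> wL2 {0<..} (hw (1 - 2 * s) 0)" "e' \<in> wL2 {0<..} (hw (1 - 2 * s) 0)"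
  and f: "\<And>n::nat. f n \<in> wL2 {0<..} (hw (1 - 2 * s) 0)" "\<And>n. f' n \<in> wL2 {0<..} (hw (1 - 2 * s) 0)"
  and lim: "null (%n. wL2_norm {0<..} (hw (1 - 2 * s) 0) (%y. e y - f n y))"
   "null (%n. wL2_norm {0<..} (hw (1 - 2 * s) 0) (%y. e' y - f' n y))"
 shows "(%n. mode_form s lam z z' (f n) (f' n)) \<longlonglongrightarrow> mode_form s lam z z' e e'"
proof -
 interpret pos_weight "{0<..}" "hw (1 - 2 * s) 0" by (rule pos_weight_half_line)
 let ?N = "wL2_norm {0<..} (hw (1 - 2 * s) 0)"
 have "null (%n. mode_form s lam z z' e e' - mode_form s lam z z' (f n) (f' n))"
 proof (rule Lim_null_comparison)
  show "\<forall>\<^sub>F n in sequentially. norm (mode_form s lam z z' e e' - mode_form s lam z z' (f n) (f' n))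
    \<le> lam * (?N z * ?N (%y. e y - f n y)) + ?N z' * ?N (%y. e' y - f' n y)"
   unfolding mode_form_diff[OF z e f, symmetric] real_norm_def
   by (intro always_eventually allI mode_form_split(3) z wL2_diff(1) e f lam)
  show "null (%n. lam * (?N z * ?N (%y. e y - f n y)) + ?N z' * ?N (%y. e' y - f' n y))"
   using tendsto_add[OF tendsto_mult_left[OF tendsto_mult_left[OF lim(1), of "?N z"], of lam] tendsto_mult_left[OF lim(2), of "?N z'"]] by simp
 qed
 from tendsto_diff[OF tendsto_const[of "mode_form s lam z z' e e'"] this] show ?thesis by simp
qed

lemma integrable_cmult_cancel:
 fixes f :: "'a => real"
 shows "integrable M (%x. r * f x) ==> r \<noteq> 0 ==> integrable M f"
 by (simp add: integrable_mult_right_iff)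

context elliptic
begin

text \<open>The product w p need not be integrable over the cylinder. The auxiliary factor
  \<open>?e\<close> is chosen so that its product with p lies in the weighted space for every beta
  and theta; Fubini's theorem applies to the weighted product, and the positive function of y is
  divided out slice by slice.\<close>

lemma slice_integrable:
 fixes w :: "(real^'n) \<times> real => real"
 assumes w: "w \<in> LE \<beta> \<theta>" and p: "p \<in> LO"
 shows "AE y in leb {0<..}. intg \<Omega> (%x. w (x, y) * p x)"
  "(%y. lint \<Omega> (%x. w (x, y) * p x)) \<in> meas {0<..}"
proof -
 interpret E: pos_weight "cyl \<Omega>" "exp_weight \<beta> \<theta>" by (rule pos_weight_exp[OF open_\<Omega>])
 let ?e = "%y::real. y powr \<bar>\<beta>\<bar> * exp (- ((\<bar>\<theta>\<bar> + 1) * y))"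
 let ?k = "%y. hw \<beta> \<theta> y * ?e y"
 have e: "?e \<in> wL2 {0<..} (hw \<beta> \<theta>)" by (rule powr_exp_wL2(1)) auto
 note T = wL2_tensor(1)[OF open_\<Omega> p e]
 note i = E.wL2_inner_bound(1)[OF w T, unfolded cyl_def]
 note F = lebesgue_on_Fubini[OF open_\<Omega> open_greaterThan i]
 have k: "exp_weight \<beta> \<theta> (x, y) * (w (x, y) \<bullet> (?e (snd (x, y)) *\<^sub>R p (fst (x, y)))) = ?k y * (w (x, y) * p x)" for x y
  by (simp add: exp_weight_def)
 have k0: "0 < ?k y" if "0 < y" for y using that by simp
 show "AE y in leb {0<..}. intg \<Omega> (%x. w (x, y) * p x)"
  using F(1)[unfolded k] AE_space
 proof eventually_elim
  case (elim y)
  then have "0 < y" by simp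
  show ?case by (rule integrable_cmult_cancel[OF elim(1) less_imp_neq[OF k0[OF \<open>0 < y\<close>], symmetric]])
 qed
 have "(%y. (1 / ?k y) * (lint \<Omega> (%x. ?k y * (w (x, y) * p x)))) \<in> meas {0<..}"
 proof (rule borel_measurable_times)
  show "(%y. lint \<Omega> (%x. ?k y * (w (x, y) * p x))) \<in> meas {0<..}"
   by (rule borel_measurable_integrable[OF F(2)[unfolded k]])
  have "?k \<in> borel_measurable borel" by measurable
  then show "(%y. 1 / ?k y) \<in> meas {0<..}" by (intro borel_measurable_divide borel_measurable_const borel_imp_lebesgue_on)
 qed
 then show "(%y. lint \<Omega> (%x. w (x, y) * p x)) \<in> meas {0<..}"
 proof (rule measurable_cong[THEN iffD1, rotated])
  fix y assume "y \<in> space (leb {0::real<..})"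
  then show "(1 / ?k y) * (lint \<Omega> (%x. ?k y * (w (x, y) * p x))) = (lint \<Omega> (%x. w (x, y) * p x))"
   using k0[of y] by (subst integral_mult_right_zero) simp
 qed
qed

lemma slice_norm:
 fixes w :: "(real^'n) \<times> real => 'b::euclidean_space"
 assumes w: "w \<in> LE \<beta> \<theta>"
 shows "AE y in leb {0<..}. intg \<Omega> (%x. (norm (w (x, y)))^2)"
  "intg {0<..} (%y. hw \<beta> \<theta> y * (NO (%x. w (x, y)))^2)"
  "(NE \<beta> \<theta> w)^2 = (lint {0<..} (%y. hw \<beta> \<theta> y * (NO (%x. w (x, y)))^2))"
proof -
 interpret E: pos_weight "cyl \<Omega>" "exp_weight \<beta> \<theta>" by (rule pos_weight_exp[OF open_\<Omega>])
 note F = lebesgue_on_Fubini[OF open_\<Omega> open_greaterThan E.wL2D(2)[OF w, unfolded cyl_def]]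
 have k: "exp_weight \<beta> \<theta> (x, y) * (norm (w (x, y)))^2 = hw \<beta> \<theta> y * (norm (w (x, y)))^2" for x y
  by (simp add: exp_weight_def)
 have n: "(lint \<Omega> (%x. hw \<beta> \<theta> y * (norm (w (x, y)))^2)) = hw \<beta> \<theta> y * (NO (%x. w (x, y)))^2" for y
  unfolding O.norm_sq by (subst integral_mult_right_zero) simp
 show "AE y in leb {0<..}. intg \<Omega> (%x. (norm (w (x, y)))^2)"
  using F(1)[unfolded k] AE_space
 proof eventually_elim
  case (elim y)
  then show ?case by (intro integrable_cmult_cancel[OF elim(1)]) simp
 qed
 show "intg {0<..} (%y. hw \<beta> \<theta> y * (NO (%x. w (x, y)))^2)" by (rule F(2)[unfolded k n])
 show "(NE \<beta> \<theta> w)^2 = (lint {0<..} (%y. hw \<beta> \<theta> y * (NO (%x. w (x, y)))^2))"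
  unfolding E.norm_sq using F(3)[unfolded k n] by (simp add: cyl_def k split_beta exp_weight_def)
qed

lemma slice_L2:
 fixes w :: "(real^'n) \<times> real => real"
 assumes w: "w \<in> LE \<beta> \<theta>"
 shows "AE y in leb {0<..}. (%x. w (x, y)) \<in> LO"
proof -
 have "intg \<Omega> (%x. 1 :: real)"
  by (rule finite_measure.integrable_const[OF finite_measure_lebesgue_on[OF finite_\<Omega>]])
 then have one: "(%x. 1 :: real) \<in> LO" by (simp add: wL2_def)
 show ?thesis using slice_integrable(1)[OF w one] slice_norm(1)[OF w] by eventually_elim (simp add: wL2_def)
qed

text \<open>The squared norm on the cylinder is the L^1 norm of the weighted squared slice norms,
  and convergence in L^1 gives convergence almost everywhere along a subsequence.\<close>

lemma slice_tendsto:
 fixes w :: "nat => (real^'n) \<times> real => real"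
 assumes w: "\<And>n::nat. w n \<in> LE \<beta> \<theta>"
  and lim: "null (%n. NE \<beta> \<theta> (w n))"
 obtains r where "strict_mono r" "AE y in leb {0<..}. null (%n. NO (%x. w (r n) (x, y)))"
proof -
 have "null (%n. lint {0<..} (%y. norm (hw \<beta> \<theta> y * (NO (%x. w n (x, y)))^2)))"
  using tendsto_power[OF lim, of 2] by (simp add: slice_norm(3)[OF w])
 from tendsto_L1_AE_subseq[OF slice_norm(2)[OF w] this]
 obtain r where r: "strict_mono r" "AE y in leb {0<..}. null (%n. hw \<beta> \<theta> y * (NO (%x. w (r n) (x, y)))^2)"
  by blast
 have "AE y in leb {0<..}. null (%n. NO (%x. w (r n) (x, y)))"
  using r(2) AE_space
 proof eventually_elim
  case (elim y)
  then obtain h where h: "h = hw \<beta> \<theta> y" "0 < h" by simp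
  from tendsto_mult_left[OF elim(1), of "1 / h"] h(2)
  have "null (%n. (NO (%x. w (r n) (x, y)))^2)" unfolding h(1)[symmetric] by simp
  from tendsto_real_sqrt[OF this] show ?case by (simp add: O.norm_nonneg)
 qed
 then show ?thesis by (rule that[OF r(1)])
qed

lemma proj_bound:
 assumes w: "w \<in> LC"
 shows "proj k w \<in> LR"
  "NR (proj k w) \<le> NC w"
proof -
 note W = w[unfolded ext_weight_eq]
 note L = slice_L2[OF W] slice_norm(2,3)[OF W] and I = slice_integrable[OF W phi_L2]
 have b: "AE y in leb {0<..}. hw (1 - 2 * s) 0 y * (norm (proj k w y))^2 \<le> hw (1 - 2 * s) 0 y * (NO (%x. w (x, y)))^2"
  using L(1)
 proof eventually_elim
  case (elim y)
  have "\<bar>proj k w y\<bar> \<le> NO (%x. w (x, y))"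
   using L2_inner_bound(2)[OF elim phi_L2, of k] by (simp add: phi_norm L2_inner_def proj_def)
  then have "(norm (proj k w y))^2 \<le> (NO (%x. w (x, y)))^2" by (intro power_mono) auto
  then show ?case by (intro mult_left_mono) auto
 qed
 have m: "proj k w \<in> meas {0<..}" using I(2) by (simp add: proj_def[abs_def])
 have "intg {0<..} (%y. hw (1 - 2 * s) 0 y * (norm (proj k w y))^2)"
 proof (rule intg_bound[OF L(2)])
  show "(%y. hw (1 - 2 * s) 0 y * (norm (proj k w y))^2) \<in> meas {0<..}"
   using m R.\<omega>_measurable by measurable
  show "AE y in leb {0<..}. norm (hw (1 - 2 * s) 0 y * (norm (proj k w y))^2) \<le> norm (hw (1 - 2 * s) 0 y * (NO (%x. w (x, y)))^2)"
   using b by eventually_elim simp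
 qed
 then show 1: "proj k w \<in> LR" using m by (simp add: wL2_def)
 have "(NR (proj k w))^2 \<le> (NC w)^2"
  unfolding R.norm_sq ext_weight_eq L(3) by (rule integral_mono_AE[OF R.wL2D(2)[OF 1] L(2) b])
 then show "NR (proj k w) \<le> NC w"
  by (rule power2_le_imp_le) (rule C.norm_nonneg)
qed

lemma proj_diff_AE:
 assumes w: "w \<in> LC" and v: "v \<in> LC"
 shows "AE y in leb {0<..}. proj k (%z. w z - v z) y = proj k w y - proj k v y"
 using slice_integrable(1)[OF w[unfolded ext_weight_eq] phi_L2[of k]] slice_integrable(1)[OF v[unfolded ext_weight_eq] phi_L2[of k]]
 by eventually_elim (simp add: proj_def left_diff_distrib)

lemma proj_tendsto:
 assumes w: "w \<in> LC" and v: "\<And>n::nat. v n \<in> LC"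
  and lim: "null (%n. NC (%z. w z - v n z))"
 shows "null (%n. NR (%y. proj k w y - proj k (v n) y))"
proof (rule Lim_null_comparison[OF _ lim], intro always_eventually allI)
 fix n
 note d = C.wL2_diff(1)[OF w v[of n]]
 have "NR (%y. proj k w y - proj k (v n) y) = NR (proj k (%z. w z - v n z))"
  by (rule R.wL2_norm_cong_AE[symmetric, OF proj_diff_AE[OF w v] R.wL2D(1)[OF proj_bound(1)[OF d]] R.wL2D(1)[OF R.wL2_diff(1)[OF proj_bound(1)[OF w] proj_bound(1)[OF v]]]])
 then show "norm (NR (%y. proj k w y - proj k (v n) y)) \<le> NC (%z. w z - v n z)"
  unfolding real_norm_def abs_of_nonneg[OF R.norm_nonneg] using proj_bound(2)[OF d, of k] by (simp only:)
qed

text \<open>Almost every slice has all its coefficients equal to 0 and vanishes by completeness of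
  the eigenfunctions.\<close>

lemma proj_eq_0:
 assumes w: "w \<in> LC" and 0: "\<And>k. AE y in leb {0<..}. proj k w y = 0"
 shows "NC w = 0"
proof -
 note L = slice_L2[OF w[unfolded ext_weight_eq]] slice_norm(2,3)[OF w[unfolded ext_weight_eq]]
 have "AE y in leb {0<..}. \<forall>k. proj k w y = 0" using 0 by (simp add: AE_all_countable)
 then have "AE y in leb {0<..}. hw (1 - 2 * s) 0 y * (NO (%x. w (x, y)))^2 = 0"
  using L(1)
 proof eventually_elim
  case (elim y)
  have "null (%m. NO (%x. w (x, y) - (\<Sum>k<m. ip (%x. w (x, y)) (\<phi> k) * \<phi> k x)))"
   using eig bspec[OF _ elim(2)] unfolding dirichlet_eigenpairs_def by fast
  moreover have "ip (%x. w (x, y)) (\<phi> k) = 0" for k using elim(1) by (simp add: L2_inner_def proj_def)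
  ultimately have "NO (%x. w (x, y)) = 0" by (simp add: LIMSEQ_const_iff)
  then show ?case by simp
 qed
 then have "(lint {0<..} (%y. hw (1 - 2 * s) 0 y * (NO (%x. w (x, y)))^2)) = 0"
  by (rule integral_eq_zero_AE)
 then show ?thesis using L(3) by (simp add: ext_weight_eq)
qed

text \<open>Let Z be the projection of w, Z' that of its derivative in y, and p_k the coefficient of
  the trace. By hypothesis the form of the mode, paired with (Z, Z'), is delta times evaluation at
  0; with the profile it is gamma times evaluation at 0. Pairing Z with the profile and
  approximating either of the two by test functions yields delta = gamma p_k. The form of Z - p_k
  Psi with itself is then delta p_k - 2 gamma p_k^2 + gamma p_k^2 = 0, and positivity of lam k
  forces Z = p_k Psi.\<close>

lemma mode_identification:
 assumes tr: "is_trace \<Omega> s w p"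
  and eq: "\<And>\<eta>. \<eta> \<in> TF UNIV ==> ef w (%z. \<phi> k (fst z) * \<eta> (snd z)) = \<beta> * \<eta> 0"
 shows "d_const s * \<beta> = mode_flux s (lam k) * ip p (\<phi> k)"
  "AE y in leb {0<..}. proj k w y = ip p (\<phi> k) * Psi k 0 y"
proof -
 let ?N = "NR"
 let ?L = "LR"
 let ?C = "NC"
 let ?mf = "mode_form s (lam k)"
 let ?\<gamma> = "mode_flux s (lam k)"
 define pk where "pk = ip p (\<phi> k)"
 define \<delta> where "\<delta> = d_const s * \<beta>"
 have d0: "0 < d_const s" unfolding d_const_def using s0 s1 by (simp add: Gamma_real_pos)
 obtain \<zeta> where wH: "w \<in> wH1 (cyl \<Omega>) (ext_weight s)" and p: "p \<in> LO"
  and \<zeta>: "\<And>j. \<zeta> j \<in> TF (\<Omega> \<times> UNIV)"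
  and l1: "null (%j. wH1_norm (cyl \<Omega>) (ext_weight s) (%x. w x - \<zeta> j x))"
  and l2: "null (%j. NO (%x'. p x' - \<zeta> j (x', 0)))"
  using tr unfolding is_trace_def H1L_def by blast
 have bb: "(0, 1) \<in> (Basis :: ((real^'n) \<times> real) set)" by (simp add: Basis_cyl)
 note wL = C.wH1_wL2[OF wH] and W = C.wH1_weak_grad(1)[OF wH]
 note \<zeta>H = test_cyl_wH1(1)[OF \<zeta>] and \<zeta>L = test_cyl[OF \<zeta>] and \<zeta>G = test_cyl_wH1(3)[OF \<zeta>]
 note \<zeta>' = test_dir_deriv[OF \<zeta> bb]
 note t = C.wH1_tendstoD[OF wH \<zeta>H l1]
 have Gt: "null (%j. ?C (%z. wgC w z - grad (\<zeta> j) z))"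
 proof -
  have "?C (%z. wgC w z - wgC (\<zeta> j) z) = ?C (%z. wgC w z - grad (\<zeta> j) z)" for j
  proof (rule C.wL2_norm_cong_AE)
   show "AE z in leb (cyl \<Omega>). wgC w z - wgC (\<zeta> j) z = wgC w z - grad (\<zeta> j) z"
    using test_cyl_wH1(2)[OF \<zeta>] by eventually_elim simp
  qed (intro C.wL2D(1)[OF C.wL2_diff(1)] W \<zeta>G C.wH1_weak_grad(1)[OF \<zeta>H])+
  then show ?thesis using t(2) by simp
 qed
 define z where "z = (%j. proj k (\<zeta> j))"
 have zt: "z j \<in> TF UNIV" for j unfolding z_def by (rule proj_test(1)[OF \<zeta>])
 have z1: "dd 1 (z j) = proj k (dd (0, 1) (\<zeta> j))" for j unfolding z_def by (rule proj_test(2)[OF \<zeta>])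
 note zL = test_in_half_line_wL2[OF zt s1]
 have z1L: "dd 1 (z j) \<in> ?L" for j by (rule test_in_half_line_wL2[OF test_dir_deriv[OF zt] s1]) simp
 define Z where "Z = proj k w"
 have ZL: "Z \<in> ?L" and Zt: "null (%j. ?N (%y. Z y - z j y))"
  unfolding Z_def z_def by (rule proj_bound(1)[OF wL] proj_tendsto[OF wL \<zeta>L t(1)])+
 define Z' where "Z' = proj k (%z. wgC w z \<bullet> (0, 1))"
 have Z't: "null (%j. ?C (%z. wgC w z \<bullet> (0, 1) - dd (0, 1) (\<zeta> j) z))"
 proof (rule Lim_null_comparison[OF _ Gt], intro always_eventually allI)
  fix j
  show "norm (?C (%z. wgC w z \<bullet> (0, 1) - dd (0, 1) (\<zeta> j) z)) \<le> ?C (%z. wgC w z - grad (\<zeta> j) z)"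
   unfolding real_norm_def abs_of_nonneg[OF C.norm_nonneg]
   using C.wL2_component(2)[OF C.wL2_diff(1)[OF W \<zeta>G] bb, of j] by (simp only: inner_diff_left grad_inner[OF bb])
 qed
 have Z'L: "Z' \<in> ?L" and Z't: "null (%j. ?N (%y. Z' y - dd 1 (z j) y))"
  unfolding Z'_def z1 by (rule proj_bound(1)[OF C.wL2_component(1)[OF W bb]], rule proj_tendsto[OF C.wL2_component(1)[OF W bb] test_cyl[OF \<zeta>'] Z't])
 have z0: "(%j. z j 0) \<longlonglongrightarrow> pk"
 proof -
  have "null (%j. pk - z j 0)"
  proof (rule Lim_null_comparison[OF _ l2], intro always_eventually allI)
   fix j
   have "pk - z j 0 = ip (%x. p x - \<zeta> j (x, 0)) (\<phi> k)"
    using L2_inner_diff[OF p test_slice_L2[OF \<zeta>] phi_L2, of j 0 k] by (simp add: pk_def z_def proj_def L2_inner_def)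
   then show "norm (pk - z j 0) \<le> NO (%x'. p x' - \<zeta> j (x', 0))"
    using L2_inner_bound(2)[OF O.wL2_diff(1)[OF p test_slice_L2[OF \<zeta>]] phi_L2, of j 0 k] by (simp add: phi_norm)
  qed
  from tendsto_diff[OF tendsto_const[of pk] this] show ?thesis by simp
 qed
 \<comment> \<open>The function phi_k eta is kept fixed while w is approximated by the zeta_j, for
   which the separated form is available.\<close>
 have ZH: "?mf Z Z' \<eta> (dd 1 \<eta>) = \<delta> * \<eta> 0" if \<eta>: "\<eta> \<in> TF UNIV" for \<eta>
 proof -
  note T = tensor_wH1[OF phi_wH1 \<eta>, of k]
  let ?v = "%z. \<phi> k (fst z) * \<eta> (snd z)"
  let ?g = "tensor_grad (\<phi> k) \<eta>"
  note vL = C.wH1_wL2[OF T(1)]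
  have "ef w ?v = 1 / d_const s * cyl_form (wgC w) w (wgC ?v) ?v"
   unfolding ext_form_def cyl_form_def ..
  also have "cyl_form (wgC w) w (wgC ?v) ?v = cyl_form (wgC w) w ?g ?v"
   by (rule cyl_form_cong[symmetric, OF W wL C.wH1_weak_grad(1)[OF T(1)] vL _ T(2)]) simp
  finally have e: "cyl_form (wgC w) w ?g ?v = \<delta> * \<eta> 0" using eq[OF \<eta>] d0 by (simp add: \<delta>_def field_simps)
  have "null (%j. cyl_form (wgC w) w ?g ?v - cyl_form (grad (\<zeta> j)) (\<zeta> j) ?g ?v)"
  proof (rule Lim_null_comparison)
   show "\<forall>\<^sub>F j in sequentially. norm (cyl_form (wgC w) w ?g ?v - cyl_form (grad (\<zeta> j)) (\<zeta> j) ?g ?v)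
    \<le> (B + 1) * (?C (%z. wgC w z - grad (\<zeta> j) z) * ?C ?g) + M * (?C (%z. w z - \<zeta> j z) * ?C ?v)"
    unfolding cyl_form_diff[OF W \<zeta>G wL \<zeta>L T(3) vL, symmetric] real_norm_def
    by (intro always_eventually allI cyl_form_bound(2) C.wL2_diff(1) W \<zeta>G wL \<zeta>L T(3) vL)
   show "null (%j. (B + 1) * (?C (%z. wgC w z - grad (\<zeta> j) z) * ?C ?g) + M * (?C (%z. w z - \<zeta> j z) * ?C ?v))"
    using tendsto_add[OF tendsto_mult_left[OF tendsto_mult_right[OF Gt, of "?C ?g"], of "B + 1"]
      tendsto_mult_left[OF tendsto_mult_right[OF t(1), of "?C ?v"], of M]] by simp
  qed
  from tendsto_diff[OF tendsto_const[of "cyl_form (wgC w) w ?g ?v"] this]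
  have "(%j. ?mf (z j) (dd 1 (z j)) \<eta> (dd 1 \<eta>)) \<longlonglongrightarrow> \<delta> * \<eta> 0"
   unfolding cyl_form_tensor[OF \<zeta> \<eta>] z_def[symmetric] e by (simp add: z_def)
  moreover have "(%j. ?mf (z j) (dd 1 (z j)) \<eta> (dd 1 \<eta>)) \<longlonglongrightarrow> ?mf Z Z' \<eta> (dd 1 \<eta>)"
   unfolding mode_form_commute[of _ _ _ _ \<eta>] by (intro mode_form_tendsto ZL Z'L zL z1L Zt Z't less_imp_le[OF lam_pos]
     test_in_half_line_wL2[OF \<eta> s1] test_in_half_line_wL2[OF test_dir_deriv[OF \<eta>] s1]) simp
  ultimately show ?thesis using LIMSEQ_unique by blast
 qed
 let ?P = "Psi k 0" and ?P1 = "Psi k 1"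
 note P = scaled_profile_wL2[OF s0 s1 lam_pos, of k] and l0 = less_imp_le[OF lam_pos[of k]]
 obtain \<eta> where \<eta>: "\<And>m. \<eta> m \<in> TF UNIV" and \<eta>0: "(%m. \<eta> m 0) \<longlonglongrightarrow> 1"
  and \<eta>t: "null (%m. ?N (%y. ?P y - \<eta> m y))" "null (%m. ?N (%y. ?P1 y - dd 1 (\<eta> m) y))"
  by (rule profile_approximation[OF s0 s1 lam_pos[of k]]) (rule that)
 note \<eta>L = test_in_half_line_wL2[OF \<eta> s1]
 have \<eta>1L: "dd 1 (\<eta> m) \<in> ?L" for m by (rule test_in_half_line_wL2[OF test_dir_deriv[OF \<eta>] s1]) simp
 \<comment> \<open>Here Z is approximated by the z_j, whose values at 0 tend to p_k.\<close>
 have "(%j. ?mf ?P ?P1 (z j) (dd 1 (z j))) \<longlonglongrightarrow> ?mf ?P ?P1 Z Z'" by (rule mode_form_tendsto[OF l0 P ZL Z'L zL z1L Zt Z't])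
 then have "(%j. ?\<gamma> * z j 0) \<longlonglongrightarrow> ?mf Z Z' ?P ?P1"
  unfolding mode_form_commute[of _ _ ?P] mode_form_profile[OF s0 s1 lam_pos zt] .
 from LIMSEQ_unique[OF this tendsto_mult_left[OF z0]] have 2: "?mf Z Z' ?P ?P1 = ?\<gamma> * pk" .
 \<comment> \<open>Here the profile is approximated instead, with values at 0 tending to 1;
   comparing the two limits gives the first claim.\<close>
 have "(%m. ?mf Z Z' (\<eta> m) (dd 1 (\<eta> m))) \<longlonglongrightarrow> ?mf Z Z' ?P ?P1" by (rule mode_form_tendsto[OF l0 ZL Z'L P \<eta>L \<eta>1L \<eta>t])
 from LIMSEQ_unique[OF this[unfolded ZH[OF \<eta>]] tendsto_mult_left[OF \<eta>0]] have 3: "?mf Z Z' ?P ?P1 = \<delta>" by simp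
 show "d_const s * \<beta> = mode_flux s (lam k) * ip p (\<phi> k)" using 2 3 by (simp add: \<delta>_def pk_def)
 have "(%j. ?mf Z Z' (z j) (dd 1 (z j))) \<longlonglongrightarrow> ?mf Z Z' Z Z'" by (rule mode_form_tendsto[OF l0 ZL Z'L ZL Z'L zL z1L Zt Z't])
 from LIMSEQ_unique[OF this[unfolded ZH[OF zt]] tendsto_mult_left[OF z0]] have 4: "?mf Z Z' Z Z' = \<delta> * pk" .
 have "(%m. ?mf ?P ?P1 (\<eta> m) (dd 1 (\<eta> m))) \<longlonglongrightarrow> ?mf ?P ?P1 ?P ?P1" by (rule mode_form_tendsto[OF l0 P P \<eta>L \<eta>1L \<eta>t])
 then have "(%m. ?\<gamma> * \<eta> m 0) \<longlonglongrightarrow> ?mf ?P ?P1 ?P ?P1"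
  unfolding mode_form_commute[of _ _ ?P ?P1 "\<eta> _"] mode_form_profile[OF s0 s1 lam_pos \<eta>] .
 from LIMSEQ_unique[OF this tendsto_mult_left[OF \<eta>0]] have 5: "?mf ?P ?P1 ?P ?P1 = ?\<gamma>" by simp
 let ?D = "%y. Z y - pk * ?P y" and ?D1 = "%y. Z' y - pk * ?P1 y"
 have pP: "(%y. pk * ?P y) \<in> ?L" "(%y. pk * ?P1 y) \<in> ?L" using R.wL2_cmult(1)[OF P(1), of pk] R.wL2_cmult(1)[OF P(2), of pk] by auto
 note D = R.wL2_diff(1)[OF ZL pP(1)] R.wL2_diff(1)[OF Z'L pP(2)]
 have a: "?mf ?D ?D1 e e' = ?mf Z Z' e e' - pk * ?mf ?P ?P1 e e'" if "e \<in> ?L" "e' \<in> ?L" for e e'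
  unfolding mode_form_commute[of _ _ _ _ e] mode_form_diff[OF that ZL Z'L pP] mode_form_cmult ..
 have "?mf ?D ?D1 ?D ?D1 = (?mf Z Z' Z Z' - pk * ?mf ?P ?P1 Z Z') - pk * (?mf Z Z' ?P ?P1 - pk * ?mf ?P ?P1 ?P ?P1)"
  unfolding mode_form_diff[OF D ZL Z'L pP] mode_form_cmult a[OF ZL Z'L] a[OF P] ..
 also have "\<dots> = 0" unfolding mode_form_commute[of _ _ ?P ?P1 Z] 4 5 using 2 3 by (simp add: algebra_simps)
 finally have "lam k * (?N ?D)^2 + (?N ?D1)^2 = 0"
  unfolding mode_form_split(2)[OF D D] R.norm_sq by (simp add: power2_eq_square)
 moreover have "0 \<le> lam k * (?N ?D)^2" using l0 by simp
 ultimately have "lam k * (?N ?D)^2 = 0" using zero_le_power2[of "?N ?D1"] by linarith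
 then have "?N ?D = 0" using lam_pos[of k] by simp
 from R.wL2_norm_eq_0[OF D(1) this]
 show "AE y in leb {0<..}. proj k w y = ip p (\<phi> k) * Psi k 0 y"
  by eventually_elim (simp add: Z_def pk_def)
qed

end

section \<open>Eigenfunction series\<close>

context pos_weight
begin

text \<open>The hypothesis \<open>bessel\<close> stands in for orthogonality and makes the partial
  sums Cauchy once the weighted squares of the coefficients are summable. It also covers the
  gradients of the eigenfunctions, which are in general not orthogonal in L^2.\<close>

lemma wL2_series:
 fixes \<Phi> :: "nat => 'a => 'b::euclidean_space"
 assumes \<Phi>: "\<And>k. \<Phi> k \<in> wsp"
  and bessel: "\<And>K b. finite K ==> (nrm (%x. \<Sum>k\<in>K. b k *\<^sub>R \<Phi> k x))\<^sup>2 \<le> (\<Sum>k\<in>K. (b k)^2 * N k)"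
  and N: "\<And>k. 0 \<le> N k" and sum: "summable (%k. (b k)^2 * N k)"
 obtains v where "v \<in> wsp" "null (%m. nrm (%x. v x - (\<Sum>k<m. b k *\<^sub>R \<Phi> k x)))"
  "(nrm v)^2 \<le> (\<Sum>k. (b k)^2 * N k)"
proof -
 let ?S = "%m x. \<Sum>k<m. b k *\<^sub>R \<Phi> k x"
 define e where "e = (%m. sqrt (\<Sum>k. (b (k + m))^2 * N (k + m)))"
 have S: "?S m \<in> wsp" for m by (intro wL2_sum wL2_cmult(1) \<Phi>) simp
 have nn: "0 \<le> (b k)^2 * N k" for k using N by simp
 have e0: "e \<longlonglongrightarrow> 0"
  using tendsto_real_sqrt[OF suminf_exist_split2[OF sum]] by (simp add: e_def)
 have enn: "0 \<le> e m" for m unfolding e_def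
  by (rule real_sqrt_ge_zero[OF suminf_nonneg[OF summable_ignore_initial_segment[OF sum] nn]])
 have le: "nrm (%x. ?S m x - ?S n x) \<le> e n" if "n \<le> m" for m n
 proof -
  have "?S m x - ?S n x = (\<Sum>k\<in>{n..<m}. b k *\<^sub>R \<Phi> k x)" for x
   using sum_diff_nat_ivl[OF le0 that, of "%k. b k *\<^sub>R \<Phi> k x"] by (simp add: atLeast0LessThan)
  then have "(nrm (%x. ?S m x - ?S n x))^2 \<le> (\<Sum>k\<in>{n..<m}. (b k)^2 * N k)" using bessel[of "{n..<m}" b] by simp
  also have "\<dots> = (\<Sum>k<m - n. (b (k + n))^2 * N (k + n))"
   using sum.shift_bounds_nat_ivl[of "%k. (b k)^2 * N k" 0 n "m - n"] that by (simp add: atLeast0LessThan)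
  also have "\<dots> \<le> (\<Sum>k. (b (k + n))^2 * N (k + n))"
   by (rule sum_le_suminf[OF summable_ignore_initial_segment[OF sum]]) (use nn in auto)
  finally show ?thesis unfolding e_def by (rule real_le_rsqrt)
 qed
 have "nrm (%x. ?S m x - ?S n x) \<le> e m + e n" for m n
 proof (cases "n \<le> m")
  case True then show ?thesis using le[OF True] enn[of m] by simp
 next
  case False then show ?thesis using le[of m n] enn[of n] unfolding wL2_norm_minus_commute[of "?S m"] by simp
 qed
 from wL2_complete[OF S this e0] obtain v where v: "v \<in> wsp" "null (%m. nrm (%x. v x - ?S m x))" .
 have "nrm v \<le> e 0"
 proof (rule LIMSEQ_le_const)
  show "(%m. nrm (%x. v x - ?S m x) + e 0) \<longlonglongrightarrow> e 0" using tendsto_add[OF v(2) tendsto_const[of "e 0"]] by simp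
  have "nrm v \<le> nrm (%x. v x - ?S m x) + e 0" for m
   using wL2_add(2)[OF wL2_diff(1)[OF v(1) S[of m]] S[of m]] le[of 0 m] by simp
  then show "\<exists>M. \<forall>m\<ge>M. nrm v \<le> nrm (%x. v x - ?S m x) + e 0" by blast
 qed
 then have "(nrm v)^2 \<le> (e 0)^2" by (intro power_mono norm_nonneg)
 also have "\<dots> = (\<Sum>k. (b k)^2 * N k)" unfolding e_def using suminf_nonneg[OF sum nn] by simp
 finally show ?thesis by (rule that[OF v])
qed

text \<open>For almost every t the series is summed separately and a limit is chosen, so strong
  measurability of the resulting V has to come from explicit simple functions. The bound B is
  uniform in t, which accounts for the factor T.\<close>

lemma series_L2T:
 fixes \<Phi> :: "nat => 'a => 'b::euclidean_space"
 assumes T: "0 < T" and u: "\<And>k. u k \<in> meas {0<..<T}"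
  and B: "AE t in leb {0<..<T}. \<forall>k. (u k t)^2 \<le> B k"
  and \<Phi>: "\<And>k. \<Phi> k \<in> wsp"
  and bessel: "\<And>K b. finite K ==> (nrm (%x. \<Sum>k\<in>K. b k *\<^sub>R \<Phi> k x))\<^sup>2 \<le> (\<Sum>k\<in>K. (b k)^2 * N k)"
  and N: "\<And>k. 0 \<le> N k" and sum: "summable (%k. B k * N k)"
 obtains V where "V \<in> L2T T (wsp) (nrm)" "(L2T_norm T (nrm) V)^2 \<le> T * (\<Sum>k. B k * N k)"
  "AE t in leb {0<..<T}. V t \<in> wsp \<and> null (%m. nrm (%x. V t x - (\<Sum>k<m. u k t *\<^sub>R \<Phi> k x)))"
proof -
 let ?M = "leb {0<..<T}"
 define good where "good t \<longleftrightarrow> (\<forall>k. (u k t)^2 \<le> B k)" for t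
 have s': "summable (%k. (u k t)^2 * N k)" "(\<Sum>k. (u k t)^2 * N k) \<le> (\<Sum>k. B k * N k)" if "good t" for t
 proof -
  have le: "(u k t)^2 * N k \<le> B k * N k" for k using that N unfolding good_def by (intro mult_right_mono) auto
  show 1: "summable (%k. (u k t)^2 * N k)"
   by (rule summable_comparison_test'[OF sum, of 0]) (use le N in auto)
  show "(\<Sum>k. (u k t)^2 * N k) \<le> (\<Sum>k. B k * N k)" by (rule suminf_le[OF le 1 sum])
 qed
 have ex: "\<exists>v. good t \<longrightarrow> v \<in> wsp \<and> (%m. nrm (%x. v x - (\<Sum>k<m. u k t *\<^sub>R \<Phi> k x))) \<longlonglongrightarrow> 0
   \<and> (nrm v)\<^sup>2 \<le> (\<Sum>k. B k * N k)" for t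
 proof (cases "good t")
  case True
  obtain v where "v \<in> wsp" "null (%m. nrm (%x. v x - (\<Sum>k<m. u k t *\<^sub>R \<Phi> k x)))"
   "(nrm v)^2 \<le> (\<Sum>k. (u k t)^2 * N k)"
   by (rule wL2_series[where \<Phi> = \<Phi> and b = "%k. u k t", OF \<Phi> bessel N s'(1)[OF True]])
  then show ?thesis using s'(2)[OF True] by (intro exI[of _ v]) auto
 qed auto
 have "\<exists>V. \<forall>t. good t \<longrightarrow> V t \<in> wsp \<and> (%m. nrm (%x. V t x - (\<Sum>k<m. u k t *\<^sub>R \<Phi> k x))) \<longlonglongrightarrow> 0
   \<and> (nrm (V t))\<^sup>2 \<le> (\<Sum>k. B k * N k)"
  by (rule choice) (intro allI ex)
 then obtain V where V: "\<forall>t. good t \<longrightarrow> V t \<in> wsp \<and> (%m. nrm (%x. V t x - (\<Sum>k<m. u k t *\<^sub>R \<Phi> k x))) \<longlonglongrightarrow> 0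
   \<and> (nrm (V t))\<^sup>2 \<le> (\<Sum>k. B k * N k)" ..
 note V = V[rule_format, THEN conjunct1] V[rule_format, THEN conjunct2, THEN conjunct1] V[rule_format, THEN conjunct2, THEN conjunct2]
 have g: "AE t in ?M. good t" using B unfolding good_def .
 \<comment> \<open>Simple approximations bounded by 2 |u_k|, so that their differences from u_k are
   dominated by 3 |u_k| independently of the index.\<close>
 have exF: "\<exists>F. (\<forall>i. simple_function ?M (F i)) \<and> (\<forall>x\<in>space ?M. (%i. F i x) \<longlonglongrightarrow> u k x) \<and>
  (\<forall>i. \<forall>x\<in>space ?M. dist (F i x) 0 \<le> 2 * dist (u k x) 0)" for k
  by (rule borel_measurable_implies_sequence_metric[OF u])
 have "\<exists>F. \<forall>k. (\<forall>i. simple_function ?M (F k i)) \<and> (\<forall>x\<in>space ?M. (%i. F k i x) \<longlonglongrightarrow> u k x) \<and>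
  (\<forall>i. \<forall>x\<in>space ?M. dist (F k i x) 0 \<le> 2 * dist (u k x) 0)"
  by (rule choice) (intro allI exF)
 then obtain F where F0: "\<forall>k. (\<forall>i. simple_function ?M (F k i)) \<and> (\<forall>x\<in>space ?M. (%i. F k i x) \<longlonglongrightarrow> u k x) \<and>
  (\<forall>i. \<forall>x\<in>space ?M. dist (F k i x) 0 \<le> 2 * dist (u k x) 0)" ..
 have F: "\<And>k i. simple_function ?M (F k i)" "\<And>k t. t \<in> {0<..<T} ==> (%i. F k i t) \<longlonglongrightarrow> u k t"
  "\<And>k i t. t \<in> {0<..<T} ==> \<bar>F k i t\<bar> \<le> 2 * \<bar>u k t\<bar>" using F0 by simp_all
 \<comment> \<open>A diagonal choice: j terms, each with its j-th simple approximation.\<close>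
 define p where "p = (%j t x. \<Sum>k<j. F k j t *\<^sub>R \<Phi> k x)"
 have p1: "p j t \<in> wsp" for j t unfolding p_def by (intro wL2_sum wL2_cmult(1) \<Phi>) simp
 have p2: "simple_function ?M (p j)" for j
 proof -
  have "simple_function ?M (%t x. \<Sum>k<m. F k j t *\<^sub>R \<Phi> k x)" for m
  proof (induction m)
   case (Suc m)
   have "simple_function ?M (%t. (%f r x. f x + r *\<^sub>R \<Phi> m x) (%x. \<Sum>k<m. F k j t *\<^sub>R \<Phi> k x) (F m j t))"
    by (rule simple_function_compose2[OF Suc F(1)])
   then show ?case by simp
  qed simp
  then show ?thesis unfolding p_def .
 qed
 have p3: "null (%j. nrm (%x. p j t x - V t x))" if t: "good t" "t \<in> {0<..<T}" for t
 proof -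
  let ?S = "%j x. \<Sum>k<j. u k t *\<^sub>R \<Phi> k x"
  have S: "?S j \<in> wsp" for j by (intro wL2_sum wL2_cmult(1) \<Phi>) simp
  let ?a = "%k j. if k < j then (F k j t - u k t)\<^sup>2 * N k else 0"
  have "((%j. \<Sum>k. ?a k j) \<longlongrightarrow> (\<Sum>k::nat. 0)) sequentially"
  \<comment> \<open>Tannery's theorem passes to the limit in a sum whose length and terms vary
    together; 9 is the square of the 3 in the bound on the differences.\<close>
  proof (rule tannerys_theorem[where M = "%k. 9 * (B k * N k)", THEN conjunct2, THEN conjunct2])
   fix k
   have "(%j. (F k j t - u k t)^2 * N k) \<longlonglongrightarrow> (u k t - u k t)\<^sup>2 * N k" by (intro tendsto_intros F(2) t)
   then have "null (%j. (F k j t - u k t)^2 * N k)" by simp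
   then show "null (%j. ?a k j)"
    by (rule Lim_transform_eventually) (rule eventually_mono[OF eventually_gt_at_top[of k]], simp)
  next
   have "norm (?a k j) \<le> 9 * (B k * N k)" for k j
   proof -
    have "\<bar>F k j t - u k t\<bar> \<le> 3 * \<bar>u k t\<bar>" using F(3)[OF t(2), of k j] by linarith
    then have "(F k j t - u k t)^2 \<le> (3 * \<bar>u k t\<bar>)^2" by (intro power2_le_iff_abs_le[THEN iffD2]) auto
    also have "\<dots> = 9 * (u k t)^2" by (simp add: power_mult_distrib)
    also have "\<dots> \<le> 9 * B k" using t(1) by (simp add: good_def)
    finally have "(F k j t - u k t)^2 * N k \<le> 9 * B k * N k" by (rule mult_right_mono) (rule N)
    moreover have "0 \<le> B k" using t(1) order_trans[OF zero_le_power2[of "u k t"]] by (simp add: good_def)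
    ultimately show ?thesis using N[of k] by simp
   qed
   then show "\<forall>\<^sub>F (k, j) in sequentially \<times>\<^sub>F sequentially. norm (?a k j) \<le> 9 * (B k * N k)" by (intro always_eventually) auto
  qed (use sum in \<open>auto intro: summable_mult\<close>)
  then have lim: "null (%j. \<Sum>k. ?a k j)" by simp
  have "(nrm (%x. p j t x - ?S j x))^2 \<le> (\<Sum>k. ?a k j)" for j
  proof -
   have "p j t x - ?S j x = (\<Sum>k<j. (F k j t - u k t) *\<^sub>R \<Phi> k x)" for x by (simp add: p_def sum_subtractf scaleR_diff_left)
   then have "(nrm (%x. p j t x - ?S j x))^2 \<le> (\<Sum>k<j. (F k j t - u k t)^2 * N k)"
    using bessel[of "{..<j}" "%k. F k j t - u k t"] by simp
   also have "\<dots> = (\<Sum>k. ?a k j)" by (subst suminf_finite[of "{..<j}"]) auto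
   finally show ?thesis .
  qed
  then have sq: "nrm (%x. p j t x - ?S j x) \<le> sqrt (\<Sum>k. ?a k j)" for j by (rule real_le_rsqrt)
  have le: "nrm (%x. p j t x - V t x) \<le> sqrt (\<Sum>k. ?a k j) + nrm (%x. V t x - ?S j x)" for j
   using wL2_norm_diff_triangle[OF p1[of j t] S[of j] V(1)[OF t(1)]] wL2_norm_minus_commute[of "?S j" "V t"] sq[of j] by linarith
  have lim2: "null (%j. sqrt (\<Sum>k. ?a k j) + nrm (%x. V t x - ?S j x))"
   using tendsto_add[OF tendsto_real_sqrt[OF lim] V(2)[OF t(1)]] by simp
  show ?thesis
  proof (rule Lim_null_comparison[OF _ lim2], intro always_eventually allI)
   show "norm (nrm (%x. p j t x - V t x)) \<le> sqrt (\<Sum>k. ?a k j) + nrm (%x. V t x - ?S j x)" for j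
    unfolding real_norm_def abs_of_nonneg[OF norm_nonneg] by (rule le)
  qed
 qed
 have p3': "AE t in ?M. null (%j. nrm (%x. p j t x - V t x))"
  using g AE_space
 proof eventually_elim
  case (elim t)
  then have "t \<in> {0<..<T}" by simp
  then show ?case by (rule p3[OF elim(1)])
 qed
 have gV: "AE t in ?M. V t \<in> wsp" using g by eventually_elim (rule V(1))
 have sm: "strongly_measurable T (wsp) (nrm) V"
  unfolding strongly_measurable_def by (intro conjI exI[of _ p] allI ballI gV p1 p2 p3')
 have m: "(%t. (nrm (V t))^2) \<in> borel_measurable ?M"
 proof (rule borel_measurable_AE_lebesgue_on)
  have [measurable]: "(%t. nrm (p j t)) \<in> borel_measurable ?M" for j
   by (rule borel_measurable_simple_function[OF simple_function_compose1[OF p2]])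
  show "(%t. (lim (%j. nrm (p j t)))^2) \<in> borel_measurable ?M" by measurable
  show "AE t in ?M. (lim (%j. nrm (p j t)))^2 = (nrm (V t))^2"
   using p3' gV
  proof eventually_elim
   case (elim t)
   have "null (%j. nrm (p j t) - nrm (V t))"
    by (rule Lim_null_comparison[OF _ elim(1)]) (use wL2_norm_triangle_diff[OF p1 elim(2)] in simp)
   from tendsto_add[OF this tendsto_const[of "nrm (V t)"]] show ?case by (simp add: limI)
  qed
 qed simp
 have bd: "AE t in ?M. (nrm (V t))^2 \<le> (\<Sum>k. B k * N k)" using g by eventually_elim (rule V(3))
 have fin: "finite_measure ?M" by (rule finite_measure_lebesgue_on) simp
 have i: "integrable ?M (%t. (nrm (V t))^2)"
  by (rule finite_measure.integrable_const_bound[OF fin _ m]) (use bd in simp)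
 have "(\<integral>t. (nrm (V t))^2 \<partial>?M) \<le> (\<integral>t. (\<Sum>k. B k * N k) \<partial>?M)"
  by (rule integral_mono_AE[OF i finite_measure.integrable_const[OF fin] bd])
 also have "\<dots> = T * (\<Sum>k. B k * N k)" using T by (simp add: measure_restrict_space)
 finally have "(L2T_norm T (nrm) V)^2 \<le> T * (\<Sum>k. B k * N k)" by (simp add: L2T_norm_def)
 moreover have "AE t in ?M. V t \<in> wsp \<and> null (%m. nrm (%x. V t x - (\<Sum>k<m. u k t *\<^sub>R \<Phi> k x)))"
  using g by eventually_elim (simp add: V(1,2))
 ultimately show ?thesis by (intro that[of V]) (use sm i in \<open>auto simp: L2T_def\<close>)
qed

end

text \<open>A Lipschitz functional maps the simple approximations of u to real simple functions,
  which converge almost everywhere.\<close>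

lemma strongly_measurable_functional:
 assumes u: "strongly_measurable T X N u"
  and L: "\<And>v w. v \<in> X ==> w \<in> X ==> \<bar>L v - L w\<bar> \<le> K * N (%x. v x - w x)"
 shows "(%t. L (u t) :: real) \<in> meas {0<..<T}"
proof -
 let ?M = "leb {0<..<T}"
 obtain p where p: "\<And>j. simple_function ?M (p j)" "\<And>j t. t \<in> {0<..<T} ==> p j t \<in> X"
  "AE t in ?M. null (%j. N (%x. p j t x - u t x))" and uX: "AE t in ?M. u t \<in> X"
  using u unfolding strongly_measurable_def by blast
 have [measurable]: "(%t. L (p j t)) \<in> borel_measurable ?M" for j
  by (rule borel_measurable_simple_function[OF simple_function_compose1[OF p(1)]])
 show ?thesis
 proof (rule borel_measurable_AE_lebesgue_on)
  show "(%t. lim (%j. L (p j t))) \<in> borel_measurable ?M" by measurable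
  show "AE t in ?M. lim (%j. L (p j t)) = L (u t)"
   using p(3) uX AE_space
  proof eventually_elim
   case (elim t)
   then have t: "t \<in> {0<..<T}" by simp
   have "null (%j. L (p j t) - L (u t))"
   proof (rule Lim_null_comparison)
    show "\<forall>\<^sub>F j in sequentially. norm (L (p j t) - L (u t)) \<le> K * N (%x. p j t x - u t x)"
     using L[OF p(2)[OF t] elim(2)] by simp
    show "null (%j. K * N (%x. p j t x - u t x))" using tendsto_mult_left[OF elim(1), of K] by simp
   qed
   from tendsto_add[OF this tendsto_const[of "L (u t)"]] show ?case by (simp add: limI)
  qed
 qed simp
qed

context elliptic
begin

text \<open>For fixed y the factors e k y only rescale the coefficients, so the Bessel inequality on
  Omega applies slice by slice and is then integrated against the weight.\<close>

lemma tensor_bessel: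
 fixes W :: "nat => real^'n => 'b::euclidean_space"
 assumes W: "\<And>k. W k \<in> LO" and e: "\<And>k. e k \<in> wL2 {0<..} (hw \<beta> \<theta>)"
  and n: "\<And>K b. finite K ==> (NO (%x. \<Sum>k\<in>K. b k *\<^sub>R W k x))\<^sup>2 \<le> (\<Sum>k\<in>K. (b k)^2 * n k)"
  and K: "finite K"
 shows "(NE \<beta> \<theta> (%z. \<Sum>k\<in>K. b k *\<^sub>R (e k (snd z) *\<^sub>R W k (fst z))))^2
  \<le> (\<Sum>k\<in>K. (b k)^2 * (n k * (wL2_norm {0<..} (hw \<beta> \<theta>) (e k))^2))"
proof -
 interpret E: pos_weight "cyl \<Omega>" "exp_weight \<beta> \<theta>" by (rule pos_weight_exp[OF open_\<Omega>])
 interpret H: pos_weight "{0<..}" "hw \<beta> \<theta>" by (rule pos_weight_half_line)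
 let ?w = "%z. \<Sum>k\<in>K. b k *\<^sub>R (e k (snd z) *\<^sub>R W k (fst z))"
 have w: "?w \<in> LE \<beta> \<theta>" by (intro E.wL2_sum K E.wL2_cmult(1) wL2_tensor(1)[OF open_\<Omega>] W e)
 have i: "intg {0<..} (%y. (b k)^2 * n k * (hw \<beta> \<theta> y * (norm (e k y))^2))" for k
  by (intro integrable_mult_right H.wL2D(2) e)
 have "(NE \<beta> \<theta> ?w)^2
   \<le> (lint {0<..} (%y. (\<Sum>k\<in>K. (b k)^2 * n k * (hw \<beta> \<theta> y * (norm (e k y))^2))))"
  unfolding slice_norm(3)[OF w]
 proof (rule integral_mono[OF slice_norm(2)[OF w] intg_sum[OF i]])
  fix y :: real
  have "(NO (%x. ?w (x, y)))^2 \<le> (\<Sum>k\<in>K. (b k * e k y)^2 * n k)" using n[OF K, of "%k. b k * e k y"] by simp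
  then have "hw \<beta> \<theta> y * (NO (%x. ?w (x, y)))^2 \<le> hw \<beta> \<theta> y * (\<Sum>k\<in>K. (b k * e k y)^2 * n k)"
   by (intro mult_left_mono) auto
  also have "\<dots> = (\<Sum>k\<in>K. (b k)^2 * n k * (hw \<beta> \<theta> y * (norm (e k y))^2))"
   unfolding sum_distrib_left by (intro sum.cong) (simp_all add: power_mult_distrib)
  finally show "hw \<beta> \<theta> y * (NO (%x. ?w (x, y)))^2 \<le> (\<Sum>k\<in>K. (b k)^2 * n k * (hw \<beta> \<theta> y * (norm (e k y))^2))" .
 qed
 also have "\<dots> = (\<Sum>k\<in>K. (b k)^2 * (n k * (wL2_norm {0<..} (hw \<beta> \<theta>) (e k))^2))"
  unfolding lint_sum[OF i] H.norm_sq by (intro sum.cong) (simp_all add: mult.assoc)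
 finally show ?thesis .
qed

lemma phi_bessel:
 assumes K: "finite K"
 shows "(NO (%x. \<Sum>k\<in>K. b k *\<^sub>R \<phi> k x))^2 = (\<Sum>k\<in>K. (b k)^2)"
proof -
 have i: "intg \<Omega> (%x. b j * b k * (\<phi> j x * \<phi> k x))" for j k
  by (intro integrable_mult_right L2_inner_bound(1) phi_L2)
 have o: "(lint \<Omega> (%x. \<phi> j x * \<phi> k x)) = (if j = k then 1 else 0)" for j k
  using phi_ortho[of j k] by (simp add: L2_inner_def)
 have "(NO (%x. \<Sum>k\<in>K. b k *\<^sub>R \<phi> k x))^2 = (lint \<Omega> (%x. (\<Sum>j\<in>K. \<Sum>k\<in>K. b j * b k * (\<phi> j x * \<phi> k x))))"
  unfolding L2_norm_sq_inner L2_inner_def sum_product by (simp add: algebra_simps)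
 also have "\<dots> = (\<Sum>j\<in>K. \<Sum>k\<in>K. b j * b k * (if j = k then 1 else 0))"
  using i by (simp add: lint_sum o)
 also have "\<dots> = (\<Sum>j\<in>K. \<Sum>k\<in>K. if j = k then (b j)\<^sup>2 else 0)" by (intro sum.cong) (auto simp: power2_eq_square)
 also have "\<dots> = (\<Sum>k\<in>K. (b k)^2)" using K by (simp add: sum.delta)
 finally show ?thesis .
qed

lemma parseval:
 assumes q: "q \<in> LO"
 shows "(%k. (ip q (\<phi> k))^2) sums (NO q)\<^sup>2"
proof -
 let ?b = "%k. ip q (\<phi> k)"
 let ?S = "%m x. \<Sum>k<m. ?b k * \<phi> k x"
 have S: "?S m \<in> LO" for m using O.wL2_sum[of "{..<m}" "%k x. ?b k *\<^sub>R \<phi> k x", OF _ O.wL2_cmult(1)[OF phi_L2]] by simp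
 have lim: "null (%m. NO (%x. q x - ?S m x))"
  using eig q unfolding dirichlet_eigenpairs_def by blast
 have "null (%m. NO q - NO (?S m))"
  by (rule Lim_null_comparison[OF _ lim]) (use O.wL2_norm_triangle_diff[OF q S] in simp)
 from tendsto_diff[OF tendsto_const[of "NO q"] this] have "(%m. NO (?S m)) \<longlonglongrightarrow> NO q" by simp
 from tendsto_power[OF this, of 2] show ?thesis unfolding sums_def using phi_bessel[of "{..<_}" ?b] by simp
qed

section \<open>The elliptic operator on eigenfunction expansions\<close>

lemma form_diff_left:
 fixes G G' H :: "real^'n => real^'n"
 assumes "G \<in> LO" "G' \<in> LO" "H \<in> LO" "g \<in> LO" "g' \<in> LO" "h \<in> LO"
 shows "(lint \<Omega> (%x. (A x *v (r *\<^sub>R G x + t *\<^sub>R G' x)) \<bullet> H x + c x * (r * g x + t * g' x) * h x))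
  = r * (lint \<Omega> (%x. (A x *v G x) \<bullet> H x + c x * g x * h x)) + t * (lint \<Omega> (%x. (A x *v G' x) \<bullet> H x + c x * g' x * h x))"
proof -
 note I = intg_add[OF form_integrable(1,2)[OF assms(1,3,4,6)]]
  intg_add[OF form_integrable(1,2)[OF assms(2,3,5,6)]]
 have e: "(A x *v (r *\<^sub>R G x + t *\<^sub>R G' x)) \<bullet> H x + c x * (r * g x + t * g' x) * h x
  = r * ((A x *v G x) \<bullet> H x + c x * g x * h x) + t * ((A x *v G' x) \<bullet> H x + c x * g' x * h x)" for x
  by (simp add: matrix_vector_right_distrib matrix_vector_mult_scaleR inner_add_left algebra_simps)
 show ?thesis unfolding e
  using lint_add[OF integrable_mult_right[OF I(1), of r] integrable_mult_right[OF I(2), of t]] by simp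
qed

lemma form_cong:
 fixes G G' H :: "real^'n => real^'n"
 assumes "G \<in> LO" "H \<in> LO" "g \<in> LO" "h \<in> LO" "AE x in leb \<Omega>. G x = G' x"
 shows "(lint \<Omega> (%x. (A x *v G' x) \<bullet> H x + c x * g x * h x)) = (lint \<Omega> (%x. (A x *v G x) \<bullet> H x + c x * g x * h x))"
 by (rule integrable_AE_lebesgue_on(2)[OF open_\<Omega> intg_add[OF form_integrable(1,2)[OF assms(1-4)]]])
  (use assms(5) in eventually_elim, simp)

lemma dirichlet_op_lincomb:
 assumes v: "dop v g" and v': "dop v' g'"
 shows "dop (%x. r * v x + t * v' x) (%x. r * g x + t * g' x)"
proof -
 have H: "v \<in> H10 \<Omega>" "v' \<in> H10 \<Omega>" and g: "g \<in> LO" "g' \<in> LO" using v v' unfolding dirichlet_op_def by auto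
 have vH: "v \<in> wH1 \<Omega> (%_. 1)" "v' \<in> wH1 \<Omega> (%_. 1)" using H unfolding H10_def by auto
 note V = O.wH1_lincomb[OF vH, of r t] and W = O.wH1_weak_grad(1)[OF vH(1)] O.wH1_weak_grad(1)[OF vH(2)]
 note L = O.wH1_wL2[OF vH(1)] O.wH1_wL2[OF vH(2)]
 have gg: "(%x. r * g x + t * g' x) \<in> LO" using O.wL2_add(1)[OF O.wL2_cmult(1)[OF g(1), of r] O.wL2_cmult(1)[OF g(2), of t]] by simp
 have WW: "(%x. r *\<^sub>R wg v x + t *\<^sub>R wg v' x) \<in> LO" by (intro O.wL2_add(1) O.wL2_cmult(1) W)
 have "(lint \<Omega> (%x. (A x *v wg (%x. r * v x + t * v' x) x) \<bullet> wg q x + c x * (r * v x + t * v' x) * q x))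
   = ip (%x. r * g x + t * g' x) q" if q: "q \<in> H10 \<Omega>" for q
 proof -
  have qH: "q \<in> wH1 \<Omega> (%_. 1)" using q unfolding H10_def by auto
  note qL = O.wH1_wL2[OF qH] and qW = O.wH1_weak_grad(1)[OF qH]
  have "(lint \<Omega> (%x. (A x *v wg (%x. r * v x + t * v' x) x) \<bullet> wg q x + c x * (r * v x + t * v' x) * q x))
   = (lint \<Omega> (%x. (A x *v (r *\<^sub>R wg v x + t *\<^sub>R wg v' x)) \<bullet> wg q x + c x * (r * v x + t * v' x) * q x))"
   by (rule form_cong[OF O.wH1_weak_grad(1)[OF V(1)] qW O.wH1_wL2[OF V(1)] qL V(2), symmetric])
  also have "\<dots> = r * ip g q + t * ip g' q"
   unfolding form_diff_left[OF W qW L qL] using v v' q unfolding dirichlet_op_def by auto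
  also have "\<dots> = ip (%x. r * g x + t * g' x) q"
   using lint_add[OF integrable_mult_right[OF L2_inner_bound(1)[OF g(1) qL], of r] integrable_mult_right[OF L2_inner_bound(1)[OF g(2) qL], of t]]
   by (simp add: L2_inner_def algebra_simps)
  finally show ?thesis .
 qed
 then show ?thesis unfolding dirichlet_op_def using H10_lincomb[OF open_\<Omega> H] gg by blast
qed

text \<open>The equation is tested with v itself, and the nonnegative term with c is
  dropped.\<close>

lemma dirichlet_op_bound:
 assumes v: "dop v g"
 shows "a * (NO (wg v))^2 \<le> ip g v"
proof -
 have H: "v \<in> H10 \<Omega>" and eq: "(lint \<Omega> (%x. (A x *v wg v x) \<bullet> wg v x + c x * v x * v x)) = ip g v"
  using v unfolding dirichlet_op_def by auto
 have vH: "v \<in> wH1 \<Omega> (%_. 1)" using H unfolding H10_def by auto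
 note W = O.wH1_weak_grad(1)[OF vH] and L = O.wH1_wL2[OF vH]
 have "a * (NO (wg v))^2 = (lint \<Omega> (%x. a * (norm (wg v x))^2))"
  unfolding O.norm_sq by simp
 also have "\<dots> \<le> (lint \<Omega> (%x. (A x *v wg v x) \<bullet> wg v x + c x * v x * v x))"
 proof (rule integral_mono_AE)
  show "intg \<Omega> (%x. a * (norm (wg v x))^2)" using O.wL2D(2)[OF W] by simp
  show "intg \<Omega> (%x. (A x *v wg v x) \<bullet> wg v x + c x * v x * v x)"
   by (rule intg_add[OF form_integrable(1,2)[OF W W L L]])
  show "AE x in leb \<Omega>. a * (norm (wg v x))^2 \<le> (A x *v wg v x) \<bullet> wg v x + c x * v x * v x"
   using c_nonneg AE_space
  proof eventually_elim
   case (elim x)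
   have "0 \<le> c x * (v x * v x)" using elim(1) by simp
   then show ?case using A_pos[of x "wg v x"] elim(2) by (simp add: mult.assoc)
  qed
 qed
 finally show ?thesis unfolding eq .
qed

text \<open>Coercivity applied to differences makes the gradients Cauchy once v_n and g_n are, so
  convergence of both in L^2 suffices. The limit field is the weak gradient of v, v stays in the
  closure of the test functions, and the weak equation passes to the limit.\<close>

lemma dirichlet_op_closed:
 assumes vn: "\<And>n::nat. dop (vn n) (gn n)" and v: "v \<in> LO" and g: "g \<in> LO"
  and lv: "null (%n. NO (%x. v x - vn n x))" and lg: "null (%n. NO (%x. g x - gn n x))"
 shows "dop v g"
proof -
 have H: "vn n \<in> H10 \<Omega>" and gL: "gn n \<in> LO" for n using vn unfolding dirichlet_op_def by auto
 have vH: "vn n \<in> wH1 \<Omega> (%_. 1)" for n using H unfolding H10_def by auto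
 note W = O.wH1_weak_grad(1)[OF vH] and L = O.wH1_wL2[OF vH]
 let ?N = "NO :: (real^'n => real^'n) => real"
 define e where "e n = (NO (%x. v x - vn n x) + NO (%x. g x - gn n x)) / sqrt a" for n
 have "?N (%x. wg (vn m) x - wg (vn n) x) \<le> e m + e n" for m n
 proof -
  let ?d = "%x. vn m x - vn n x" and ?h = "%x. gn m x - gn n x"
  have op: "dop ?d ?h" using dirichlet_op_lincomb[OF vn[of m] vn[of n], of 1 "-1"] by simp
  have d: "NO ?d \<le> NO (%x. v x - vn m x) + NO (%x. v x - vn n x)"
   using O.wL2_norm_diff_triangle[OF L[of m] v L[of n]] O.wL2_norm_minus_commute[of "vn m" v] by simp
  have h: "NO ?h \<le> NO (%x. g x - gn m x) + NO (%x. g x - gn n x)"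
   using O.wL2_norm_diff_triangle[OF gL[of m] g gL[of n]] O.wL2_norm_minus_commute[of "gn m" g] by simp
  have "a * (?N (wg ?d))^2 \<le> NO ?h * NO ?d"
   using dirichlet_op_bound[OF op] L2_inner_bound(2)[OF O.wL2_diff(1)[OF gL[of m] gL[of n]] O.wL2_diff(1)[OF L[of m] L[of n]]] by linarith
  also have "\<dots> \<le> (NO ?h + NO ?d)^2"
  proof -
   have "0 \<le> NO ?h * NO ?d" by (intro mult_nonneg_nonneg O.norm_nonneg)
   moreover have "0 \<le> (NO ?h)^2 + (NO ?d)^2" by simp
   ultimately show ?thesis by (simp add: power2_sum)
  qed
  finally have "(sqrt a * ?N (wg ?d))^2 \<le> (NO ?h + NO ?d)^2" using a0 by (simp add: power_mult_distrib)
  then have "sqrt a * ?N (wg ?d) \<le> NO ?h + NO ?d"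
   by (rule power2_le_imp_le) (intro add_nonneg_nonneg O.norm_nonneg)
  then have "?N (wg ?d) \<le> (NO ?h + NO ?d) / sqrt a" using a0 by (simp add: field_simps)
  also have "\<dots> \<le> e m + e n" unfolding e_def add_divide_distrib[symmetric] using d h a0 by (intro divide_right_mono) auto
  finally show ?thesis unfolding O.wH1_diff_norm[OF vH vH] .
 qed
 moreover have "e \<longlonglongrightarrow> 0" unfolding e_def[abs_def] using tendsto_divide[OF tendsto_add[OF lv lg] tendsto_const[of "sqrt a"]] a0 by simp
 ultimately obtain Z where Z: "Z \<in> LO" "null (%n. ?N (%x. Z x - wg (vn n) x))"
  by (rule O.wL2_complete[OF W])
 have cl: "null (%n. NO (%x. Z x \<bullet> b - wg (vn n) x \<bullet> b))" if b: "b \<in> Basis" for b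
 proof (rule Lim_null_comparison[OF _ Z(2)], intro always_eventually allI)
  fix n
  show "norm (NO (%x. Z x \<bullet> b - wg (vn n) x \<bullet> b)) \<le> ?N (%x. Z x - wg (vn n) x)"
   unfolding real_norm_def abs_of_nonneg[OF O.norm_nonneg]
   using O.wL2_component(2)[OF O.wL2_diff(1)[OF Z(1) W] b, of n] by (simp only: inner_diff_left)
 qed
 have wd: "hwd \<Omega> b 1 v (%x. Z x \<bullet> b)" if b: "b \<in> Basis" for b
  by (rule hwd_limit[OF b O.pos_weight_axioms O.pos_weight_axioms v L lv O.wL2_component(1)[OF Z(1) b] O.wL2_component(1)[OF W b] cl[OF b]
     O.wH1_weak_grad(2)[OF vH b]])
 have V: "v \<in> wH1 \<Omega> (%_. 1)" "AE x in leb \<Omega>. wg v x = Z x"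
  by (rule O.wH1I[OF v Z(1)], erule wd)+
 note VW = O.wH1_weak_grad(1)[OF V(1)]
 have lW: "null (%n. ?N (%x. wg v x - wg (vn n) x))"
 proof -
  have "?N (%x. wg v x - wg (vn n) x) = ?N (%x. Z x - wg (vn n) x)" for n
   by (rule O.wL2_norm_cong_AE[OF _ O.wL2D(1)[OF O.wL2_diff(1)[OF VW W]] O.wL2D(1)[OF O.wL2_diff(1)[OF Z(1) W]]])
    (use V(2) in eventually_elim, simp)
  then show ?thesis using Z(2) by simp
 qed
 have vH10: "v \<in> H10 \<Omega>" by (rule H10_closed[OF open_\<Omega> V(1) H O.wH1_tendstoI[OF V(1) vH lv lW]])
 have "(lint \<Omega> (%x. (A x *v wg v x) \<bullet> wg q x + c x * v x * q x)) = ip g q" if q: "q \<in> H10 \<Omega>" for q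
 proof -
  have qH: "q \<in> wH1 \<Omega> (%_. 1)" using q unfolding H10_def by auto
  note qL = O.wH1_wL2[OF qH] and qW = O.wH1_weak_grad(1)[OF qH]
  let ?F = "%G h. lint \<Omega> (%x. (A x *v G x) \<bullet> wg q x + c x * h x * q x)"
  have F: "?F (wg (vn n)) (vn n) = ip (gn n) q" for n using vn q unfolding dirichlet_op_def by blast
  have "null (%n. ?F (wg v) v - ?F (wg (vn n)) (vn n))"
  proof (rule Lim_null_comparison)
   show "\<forall>\<^sub>F n in sequentially. norm (?F (wg v) v - ?F (wg (vn n)) (vn n))
    \<le> B * (?N (%x. wg v x - wg (vn n) x) * ?N (wg q)) + M * (NO (%x. v x - vn n x) * NO q)"
   proof (intro always_eventually allI)
    fix n
    note i = form_integrable[OF O.wL2_diff(1)[OF VW W[of n]] qW O.wL2_diff(1)[OF v L[of n]] qL]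
    have "?F (wg v) v - ?F (wg (vn n)) (vn n)
      = ?F (%x. wg v x - wg (vn n) x) (%x. v x - vn n x)"
     using form_diff_left[OF VW W[of n] qW v L[of n] qL, of 1 "-1"] by simp
    then show "norm (?F (wg v) v - ?F (wg (vn n)) (vn n))
     \<le> B * (?N (%x. wg v x - wg (vn n) x) * ?N (wg q)) + M * (NO (%x. v x - vn n x) * NO q)"
     using i(3,4) unfolding lint_add[OF i(1,2)] real_norm_def by linarith
   qed
   show "null (%n. B * (?N (%x. wg v x - wg (vn n) x) * ?N (wg q)) + M * (NO (%x. v x - vn n x) * NO q))"
    using tendsto_add[OF tendsto_mult_left[OF tendsto_mult_right[OF lW, of "?N (wg q)"], of B]
      tendsto_mult_left[OF tendsto_mult_right[OF lv, of "NO q"], of M]] by simp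
  qed
  moreover have "null (%n. ip g q - ip (gn n) q)"
  proof (rule Lim_null_comparison)
   show "\<forall>\<^sub>F n in sequentially. norm (ip g q - ip (gn n) q) \<le> NO (%x. g x - gn n x) * NO q"
    unfolding L2_inner_diff[OF g gL qL, symmetric] real_norm_def
    by (intro always_eventually allI L2_inner_bound(2) O.wL2_diff(1) g gL qL)
   show "null (%n. NO (%x. g x - gn n x) * NO q)" using tendsto_mult_right[OF lg, of "NO q"] by simp
  qed
  ultimately have "null (%n. (?F (wg v) v - ?F (wg (vn n)) (vn n)) - (ip g q - ip (gn n) q))"
   using tendsto_diff by fastforce
  then show ?thesis unfolding F by (simp add: LIMSEQ_const_iff)
 qed
 then show ?thesis unfolding dirichlet_op_def using vH10 g by blast
qed

lemma phi_sum_op: "dop (%x. \<Sum>k<m. b k * \<phi> k x) (%x. \<Sum>k<m. b k * (lam k * \<phi> k x))"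
proof (induction m)
 case 0
 show ?case using dirichlet_op_lincomb[OF phi_op[of 0] phi_op[of 0], of 0 0] by simp
next
 case (Suc m)
 show ?case using dirichlet_op_lincomb[OF Suc phi_op[of m], of 1 "b m"] by simp
qed

text \<open>The gradients are controlled through the form and not through orthogonality in L^2:
  coercivity for the finite sum bounds a times its squared gradient norm by the inner product of the
  operator with the sum, which by orthonormality is the sum of lam k b_k^2.\<close>

lemma grad_phi_bessel:
 assumes K: "finite K"
 shows "(NO (%x. \<Sum>k\<in>K. b k *\<^sub>R wg (\<phi> k) x))^2 \<le> (\<Sum>k\<in>K. (b k)^2 * (lam k / a))"
proof -
 \<comment> \<open>Extends the coefficients by 0 to an initial segment of the indices, the form in
   which \<open>phi_sum_op\<close> is stated.\<close>
 define b' where "b' k = (if k \<in> K then b k else 0)" for k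
 obtain m where m: "K \<subseteq> {..<m}" using finite_nat_iff_bounded[of K] K by blast
 have KM: "(\<Sum>k<m. F (b' k) k) = (\<Sum>k\<in>K. F (b k) k)" if "\<And>k. F 0 k = 0" for F :: "real => nat => 'z::comm_monoid_add"
  by (rule sum.mono_neutral_cong_right) (use m that in \<open>auto simp: b'_def\<close>)
 let ?v = "%x. \<Sum>k<m. b' k * \<phi> k x" and ?g = "%x. \<Sum>k<m. b' k * (lam k * \<phi> k x)"
 have W: "wg (\<phi> k) \<in> LO" for k by (rule O.wH1_weak_grad(1)[OF phi_wH1])
 have vL: "?v \<in> LO" using O.wL2_sum[of "{..<m}" "%k x. b' k *\<^sub>R \<phi> k x", OF _ O.wL2_cmult(1)[OF phi_L2]] by simp
 have WL: "(%x. \<Sum>k<m. b' k *\<^sub>R wg (\<phi> k) x) \<in> LO" by (intro O.wL2_sum O.wL2_cmult(1) W) simp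
 have wd: "hwd \<Omega> d 1 ?v (%x. (\<Sum>k<m. b' k *\<^sub>R wg (\<phi> k) x) \<bullet> d)" if d: "d \<in> Basis" for d
  unfolding inner_sum_left inner_scaleR_left
  by (intro hwd_sum[OF open_\<Omega> d] hwd_cmult O.wH1_weak_grad(2)[OF phi_wH1 d]) simp
 note V = O.wH1I[OF vL WL wd]
 have "NO (%x. \<Sum>k\<in>K. b k *\<^sub>R wg (\<phi> k) x) = NO (wg ?v)"
  using O.wL2_norm_cong_AE[OF V(2) O.wL2D(1)[OF O.wH1_weak_grad(1)[OF V(1)]] O.wL2D(1)[OF WL]] KM[of "%r k. r *\<^sub>R wg (\<phi> k) _"] by simp
 then have "a * (NO (%x. \<Sum>k\<in>K. b k *\<^sub>R wg (\<phi> k) x))^2 \<le> ip ?g ?v"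
  using dirichlet_op_bound[OF phi_sum_op[where b = b' and m = m]] by simp
 also have "\<dots> = (\<Sum>k<m. (b' k)^2 * lam k)"
 proof -
  have i: "intg \<Omega> (%x. b' j * lam j * b' k * (\<phi> j x * \<phi> k x))" for j k
   by (intro integrable_mult_right L2_inner_bound(1) phi_L2)
  have o: "(lint \<Omega> (%x. \<phi> j x * \<phi> k x)) = (if j = k then 1 else 0)" for j k
   using phi_ortho[of j k] by (simp add: L2_inner_def)
  have "ip ?g ?v = (lint \<Omega> (%x. (\<Sum>j<m. \<Sum>k<m. b' j * lam j * b' k * (\<phi> j x * \<phi> k x))))"
   unfolding L2_inner_def sum_product by (simp add: algebra_simps)
  also have "\<dots> = (\<Sum>j<m. \<Sum>k<m. b' j * lam j * b' k * (if j = k then 1 else 0))"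
   using i by (simp add: lint_sum o)
  also have "\<dots> = (\<Sum>j<m. \<Sum>k<m. if j = k then (b' j)\<^sup>2 * lam j else 0)" by (intro sum.cong) (auto simp: power2_eq_square)
  finally show ?thesis by simp
 qed
 also have "\<dots> = (\<Sum>k\<in>K. (b k)^2 * lam k)" by (rule KM[of "%r k. r\<^sup>2 * lam k"]) simp
 finally have "(NO (%x. \<Sum>k\<in>K. b k *\<^sub>R wg (\<phi> k) x))^2 \<le> (\<Sum>k\<in>K. (b k)^2 * lam k) / a"
  using a0 by (simp add: field_simps)
 then show ?thesis by (simp add: sum_divide_distrib)
qed

text \<open>Bookkeeping of powers of lam k: the squared coefficients contribute - s, the spatial
  factors i, the profile norms j, and the sum tau is the exponent at which the data are
  summed.\<close>

lemma cyl_series: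
 fixes W :: "nat => real^'n => 'b::euclidean_space"
 assumes T: "0 < T" and K: "0 \<le> K" and u: "\<And>k. u k \<in> meas {0<..<T}"
  and B: "AE t in leb {0<..<T}. \<forall>k. (u k t)^2 \<le> K * (lam k powr (- s) * D k)"
  and W: "\<And>k. W k \<in> LO"
  and n: "\<And>K b. finite K ==> (NO (%x. \<Sum>k\<in>K. b k *\<^sub>R W k x))\<^sup>2 \<le> (\<Sum>k\<in>K. (b k)^2 * n k)"
  and ni: "\<And>k. 0 \<le> n k" "\<And>k. n k \<le> r * lam k powr i"
  and e: "\<And>k. e k \<in> wL2 {0<..} (hw \<beta> \<theta>)" "\<And>k. (wL2_norm {0<..} (hw \<beta> \<theta>) (e k))^2 \<le> Q * lam k powr j"
  and D0: "\<And>k. 0 \<le> D k" and sum: "summable (%k. lam k powr \<tau> * D k)" and ij: "i + j - s = \<tau>"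
 obtains V where "V \<in> L2T T (LE \<beta> \<theta>) (NE \<beta> \<theta>)"
  "(L2T_norm T (NE \<beta> \<theta>) V)^2 \<le> T * (K * r * Q * (\<Sum>k. lam k powr \<tau> * D k))"
  "AE t in leb {0<..<T}. V t \<in> LE \<beta> \<theta> \<and>
   null (%m. NE \<beta> \<theta> (%z. V t z - (\<Sum>k<m. u k t *\<^sub>R (e k (snd z) *\<^sub>R W k (fst z)))))"
proof -
 interpret E: pos_weight "cyl \<Omega>" "exp_weight \<beta> \<theta>" by (rule pos_weight_exp[OF open_\<Omega>])
 let ?N = "%k. n k * (wL2_norm {0<..} (hw \<beta> \<theta>) (e k))^2"
 let ?B = "%k. K * (lam k powr (- s) * D k)"
 have N0: "0 \<le> ?N k" for k using ni(1) by simp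
 have le: "?B k * ?N k \<le> K * r * Q * (lam k powr \<tau> * D k)" for k
 proof -
  have "?N k \<le> (r * lam k powr i) * (Q * lam k powr j)"
   using ni(1)[of k] order_trans[OF ni] by (intro mult_mono ni(2) e(2)) auto
  then have "?B k * ?N k \<le> ?B k * ((r * lam k powr i) * (Q * lam k powr j))"
   using K D0[of k] by (intro mult_left_mono) auto
  also have "\<dots> = K * r * Q * ((lam k powr (- s) * lam k powr i * lam k powr j) * D k)" by (simp add: mult_ac)
  also have "lam k powr (- s) * lam k powr i * lam k powr j = lam k powr \<tau>"
   unfolding powr_add[symmetric] ij[symmetric] by (simp add: algebra_simps)
  finally show ?thesis .
 qed
 have B0: "0 \<le> ?B k" for k using K D0[of k] by simp
 have sN: "summable (%k. ?B k * ?N k)"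
  by (rule summable_comparison_test'[OF summable_mult[OF sum, of "K * r * Q"], of 0]) (use le B0 N0 in \<open>simp del: mult_eq_0_iff add: abs_of_nonneg\<close>)
 have "(\<Sum>k. ?B k * ?N k) \<le> (\<Sum>k. K * r * Q * (lam k powr \<tau> * D k))" by (rule suminf_le[OF le sN summable_mult[OF sum]])
 then have leS: "(\<Sum>k. ?B k * ?N k) \<le> K * r * Q * (\<Sum>k. lam k powr \<tau> * D k)" unfolding suminf_mult[OF sum] .
 show ?thesis
 proof (rule E.series_L2T[where u = u and \<Phi> = "%k z. e k (snd z) *\<^sub>R W k (fst z)" and N = ?N and B = ?B])
  show "(%z. e k (snd z) *\<^sub>R W k (fst z)) \<in> LE \<beta> \<theta>" for k by (rule wL2_tensor(1)[OF open_\<Omega> W e(1)])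
  show "(NE \<beta> \<theta> (%z. \<Sum>k\<in>K. b k *\<^sub>R (e k (snd z) *\<^sub>R W k (fst z))))^2 \<le> (\<Sum>k\<in>K. (b k)^2 * ?N k)"
   if "finite K" for K b by (rule tensor_bessel[OF W e(1) n that])
  fix V assume V: "V \<in> L2T T (LE \<beta> \<theta>) (NE \<beta> \<theta>)"
   "(L2T_norm T (NE \<beta> \<theta>) V)^2 \<le> T * (\<Sum>k. ?B k * ?N k)"
   "AE t in leb {0<..<T}. V t \<in> LE \<beta> \<theta> \<and>
   null (%m. NE \<beta> \<theta> (%z. V t z - (\<Sum>k<m. u k t *\<^sub>R (e k (snd z) *\<^sub>R W k (fst z)))))"
  from V(2) mult_left_mono[OF leS, of T] T
  have "(L2T_norm T (NE \<beta> \<theta>) V)^2 \<le> T * (K * r * Q * (\<Sum>k. lam k powr \<tau> * D k))" by linarith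
  then show thesis by (rule that[OF V(1) _ V(3)])
 qed (fact T u B N0 sN)+
qed

text \<open>The weight is tuned to the singularity of the derivative: twice 2s - 1 - l plus the
  exponent of the weight is 2s - 2 tau - 1 for every l, so all derivatives lead to the same Gamma
  integral and l enters through kappa^l l! alone. Convergence at 0 is tau < s. The integral
  contributes lam^(tau-s) and the squared profile bound lam^(2s).\<close>

lemma profile_norm_estimate:
 assumes \<theta>: "0 \<le> \<theta>" "\<theta> < 2 * sqrt (lam 0)" and \<tau>: "\<tau> < s"
 obtains Q \<kappa> where "0 < Q" "1 \<le> \<kappa>"
  "\<And>k l. Psi k (Suc l) \<in> wL2 {0<..} (hw (1 - 2 * s + 2 * real l - 2 * \<tau>) \<theta>)"
  "\<And>k l. (wL2_norm {0<..} (hw (1 - 2 * s + 2 * real l - 2 * \<tau>) \<theta>) (Psi k (Suc l)))^2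
   \<le> Q * (\<kappa> ^ l * fact l)^2 * lam k powr (s + \<tau>)"
proof -
 have q0: "0 < sqrt (lam 0)" using lam0 by simp
 \<comment> \<open>The midpoint between theta / (2 sqrt (lam 0)) and 1. As lam 0 is the least
   eigenvalue, 2 rho sqrt (lam k) - theta is at least epsilon sqrt (lam k) for all k, which makes
   the bound uniform in k.\<close>
 define \<rho> where "\<rho> = (1 + \<theta> / (2 * sqrt (lam 0))) / 2"
 define \<epsilon> where "\<epsilon> = 2 * \<rho> - \<theta> / sqrt (lam 0)"
 define m where "m = 2 * s - 2 * \<tau>"
 have t: "\<theta> / (2 * sqrt (lam 0)) < 1" "0 \<le> \<theta> / (2 * sqrt (lam 0))" using \<theta> q0 by (simp_all add: divide_simps)
 have \<rho>: "0 < \<rho>" "\<rho> < 1" using t by (simp_all add: \<rho>_def)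
 have \<epsilon>: "0 < \<epsilon>" unfolding \<epsilon>_def \<rho>_def using t by simp
 have m: "0 < m" using \<tau> by (simp add: m_def)
 obtain C \<kappa> where C: "0 < C" "1 \<le> \<kappa>" and P: "\<And>lam l y. 0 < lam ==> 0 < y ==> \<bar>scaled_profile s lam (Suc l) y\<bar>
   \<le> C * \<kappa> ^ l * fact l * lam powr s * (y powr (2 * s - 1 - real l) * exp (- (\<rho> * sqrt lam * y)))"
  by (rule scaled_profile_Suc_bound[OF s0 s1 \<rho>]) (rule that)
 have G: "0 < Gamma m" by (rule Gamma_real_pos[OF m])
 have main: "Psi k (Suc l) \<in> wL2 {0<..} (hw (1 - 2 * s + 2 * real l - 2 * \<tau>) \<theta>)"
  "(wL2_norm {0<..} (hw (1 - 2 * s + 2 * real l - 2 * \<tau>) \<theta>) (Psi k (Suc l)))^2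
   \<le> C\<^sup>2 * Gamma m * \<epsilon> powr (- m) * (\<kappa> ^ l * fact l)^2 * lam k powr (s + \<tau>)" for k l
 proof -
  let ?\<beta> = "1 - 2 * s + 2 * real l - 2 * \<tau>"
  interpret H: pos_weight "{0<..}" "hw ?\<beta> \<theta>" by (rule pos_weight_half_line)
  let ?p = "2 * s - 1 - real l" and ?q = "\<rho> * sqrt (lam k)"
  let ?c = "C * \<kappa> ^ l * fact l * lam k powr s"
  have l: "sqrt (lam 0) \<le> sqrt (lam k)" using eig unfolding dirichlet_eigenpairs_def by (simp add: monoD)
  have qk: "0 < sqrt (lam k)" using lam_pos by simp
  have "\<theta> \<le> \<theta> / sqrt (lam 0) * sqrt (lam k)" using mult_left_mono[OF l \<theta>(1)] q0 by (simp add: field_simps)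
  then have eq: "\<epsilon> * sqrt (lam k) \<le> 2 * ?q - \<theta>" by (simp add: \<epsilon>_def algebra_simps)
  have eq0: "0 < \<epsilon> * sqrt (lam k)" using \<epsilon> qk by simp
  have pm: "2 * ?p + ?\<beta> + 1 = m" by (simp add: m_def algebra_simps)
  have h: "2 * ?p + ?\<beta> > - 1" "\<theta> < 2 * ?q" using pm m eq eq0 by linarith+
  note E = powr_exp_wL2[OF h, unfolded pm]
  have c0: "0 \<le> ?c" using C by simp
  have b: "AE y in leb {0<..}. norm (Psi k (Suc l) y) \<le> ?c * norm (y powr ?p * exp (- (?q * y)))"
   by (rule AE_I2) (use P[OF lam_pos] in \<open>simp add: abs_mult\<close>)
  note B = H.wL2_bound[OF scaled_profile_measurable[OF s0 s1 lam_pos] E(1) b c0]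
  show "Psi k (Suc l) \<in> wL2 {0<..} (hw ?\<beta> \<theta>)" by (rule B(1))
  have "(wL2_norm {0<..} (hw ?\<beta> \<theta>) (Psi k (Suc l)))^2
    \<le> (?c * wL2_norm {0<..} (hw ?\<beta> \<theta>) (%y. y powr ?p * exp (- (?q * y))))^2" by (rule power_mono[OF B(2) H.norm_nonneg])
  also have "\<dots> \<le> ?c\<^sup>2 * (Gamma m * (2 * ?q - \<theta>) powr (- m))" unfolding power_mult_distrib[of ?c] by (intro mult_left_mono E(2)) simp
  also have "\<dots> \<le> ?c\<^sup>2 * (Gamma m * (\<epsilon> * sqrt (lam k)) powr (- m))"
   using G m eq eq0 by (intro mult_left_mono powr_mono2') auto
  also have "(\<epsilon> * sqrt (lam k)) powr (- m) = \<epsilon> powr (- m) * lam k powr (\<tau> - s)"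
   using \<epsilon> lam_pos[of k] by (simp add: powr_mult powr_half_sqrt[symmetric] powr_powr m_def diff_divide_distrib)
  also have "?c\<^sup>2 * (Gamma m * (\<epsilon> powr (- m) * lam k powr (\<tau> - s)))
    = C\<^sup>2 * Gamma m * \<epsilon> powr (- m) * (\<kappa> ^ l * fact l)^2 * ((lam k powr s)^2 * lam k powr (\<tau> - s))"
   by (simp add: power_mult_distrib mult_ac)
  also have "(lam k powr s)^2 * lam k powr (\<tau> - s) = lam k powr (s + \<tau>)"
   by (simp add: power2_eq_square powr_add[symmetric] algebra_simps)
  finally show "(wL2_norm {0<..} (hw ?\<beta> \<theta>) (Psi k (Suc l)))^2
   \<le> C\<^sup>2 * Gamma m * \<epsilon> powr (- m) * (\<kappa> ^ l * fact l)^2 * lam k powr (s + \<tau>)" .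
 qed
 show ?thesis
  by (rule that[of "C\<^sup>2 * Gamma m * \<epsilon> powr (- m)" \<kappa>]) (use C G \<epsilon> main in auto)
qed

section \<open>Weak derivatives of expansions on the cylinder\<close>

lemma proj_partial_sum:
 assumes "k < m"
 shows "proj k (%z. \<Sum>j<m. b j *\<^sub>R (e j (snd z) *\<^sub>R \<phi> j (fst z))) y = b k * e k y"
proof -
 have o: "(lint \<Omega> (%x. \<phi> j x * \<phi> k x)) = (if j = k then 1 else 0)" for j
  using phi_ortho[of j k] by (simp add: L2_inner_def)
 have i: "intg \<Omega> (%x. b j * e j y * (\<phi> j x * \<phi> k x))" for j
  by (intro integrable_mult_right L2_inner_bound(1) phi_L2)
 have "proj k (%z. \<Sum>j<m. b j *\<^sub>R (e j (snd z) *\<^sub>R \<phi> j (fst z))) y = (lint \<Omega> (%x. (\<Sum>j<m. b j * e j y * (\<phi> j x * \<phi> k x))))"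
  unfolding proj_def by (simp add: sum_distrib_right mult.assoc)
 also have "\<dots> = (\<Sum>j<m. if j = k then b j * e j y else 0)"
  unfolding lint_sum[OF i] by (intro sum.cong) (simp_all add: o)
 also have "\<dots> = b k * e k y" using assms by simp
 finally show ?thesis .
qed

lemma profile_0_norm:
 obtains Q where "0 \<le> Q" "\<And>k. (NR (Psi k 0))^2 \<le> Q * lam k powr (s - 1)"
proof -
 obtain K where K: "0 < K" and P: "\<And>lam y. 0 < lam ==> 0 < y ==> \<bar>scaled_profile s lam 0 y\<bar> \<le> K * exp (- (sqrt lam / 2 * y))"
  by (rule scaled_profile_0_bound[OF s0 s1]) (rule that)
 have G: "0 < Gamma (2 - 2 * s)" using s1 by (intro Gamma_real_pos) simp
 have "(NR (Psi k 0))^2 \<le> K\<^sup>2 * Gamma (2 - 2 * s) * lam k powr (s - 1)" for k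
 proof -
  let ?q = "sqrt (lam k) / 2"
  have pm: "2 * 0 + (1 - 2 * s) + 1 = 2 - 2 * s" by simp
  have h: "2 * 0 + (1 - 2 * s) > - 1" "0 < 2 * ?q" using s1 lam_pos[of k] by auto
  note E = powr_exp_wL2[OF h, unfolded pm]
  have b: "AE y in leb {0<..}. norm (Psi k 0 y) \<le> K * norm (y powr 0 * exp (- (?q * y)))"
   by (rule AE_I2) (use P[OF lam_pos] in simp)
  note B = R.wL2_bound[OF scaled_profile_measurable[OF s0 s1 lam_pos] E(1) b less_imp_le[OF K]]
  have "(NR (Psi k 0))^2
    \<le> (K * NR (%y. y powr 0 * exp (- (?q * y))))^2" by (rule power_mono[OF B(2) R.norm_nonneg])
  also have "\<dots> \<le> K\<^sup>2 * (Gamma (2 - 2 * s) * (2 * ?q - 0) powr (- (2 - 2 * s)))" unfolding power_mult_distrib[of K] by (intro mult_left_mono E(2)) simp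
  also have "(2 * ?q - 0) powr (- (2 - 2 * s)) = lam k powr (s - 1)"
   using lam_pos[of k] by (simp add: powr_half_sqrt[symmetric] powr_powr algebra_simps)
  finally show ?thesis by (simp add: mult.assoc)
 qed
 then show ?thesis using G by (intro that[of "K\<^sup>2 * Gamma (2 - 2 * s)"]) auto
qed

text \<open>The series converges to some v with the same projections as w, and by completeness of
  the eigenfunctions v and w agree.\<close>

lemma mode_expansion:
 assumes w: "w \<in> LC" and p: "\<And>k. AE y in leb {0<..}. proj k w y = b k * Psi k 0 y"
  and sum: "summable (%k. (b k)^2 * lam k powr (s - 1))"
 shows "null (%m. NC (%z. w z - (\<Sum>k<m. b k *\<^sub>R (Psi k 0 (snd z) *\<^sub>R \<phi> k (fst z)))))"
proof -
 let ?P = "%k. Psi k 0"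
 let ?N = "%k. 1 * (NR (?P k))^2"
 let ?S = "%m z. \<Sum>k<m. b k *\<^sub>R (?P k (snd z) *\<^sub>R \<phi> k (fst z))"
 note PL = scaled_profile_wL2(1)[OF s0 s1 lam_pos]
 obtain Q where Q: "0 \<le> Q" "\<And>k. (NR (?P k))^2 \<le> Q * lam k powr (s - 1)"
  by (rule profile_0_norm) (rule that)
 have sm: "summable (%k. (b k)^2 * ?N k)"
 proof (rule summable_comparison_test'[OF summable_mult[OF sum, of Q], of 0])
  show "norm ((b k)^2 * ?N k) \<le> Q * ((b k)^2 * lam k powr (s - 1))" for k
   using mult_left_mono[OF Q(2)[of k], of "(b k)^2"] by (simp add: mult_ac)
 qed
 have \<Phi>: "(%z. ?P k (snd z) *\<^sub>R \<phi> k (fst z)) \<in> LC" for k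
  unfolding ext_weight_eq by (rule wL2_tensor(1)[OF open_\<Omega> phi_L2 PL])
 have bes: "(NC (%z. \<Sum>k\<in>K. b k *\<^sub>R (?P k (snd z) *\<^sub>R \<phi> k (fst z))))^2 \<le> (\<Sum>k\<in>K. (b k)^2 * ?N k)"
  if "finite K" for K b unfolding ext_weight_eq by (rule tensor_bessel[OF phi_L2 PL _ that]) (simp add: phi_bessel[simplified])
 have N0: "0 \<le> ?N k" for k by simp
 obtain v where v: "v \<in> LC" "null (%m. NC (%z. v z - ?S m z))"
  by (rule C.wL2_series[where \<Phi> = "%k z. ?P k (snd z) *\<^sub>R \<phi> k (fst z)" and b = b and N = ?N, OF \<Phi> bes N0 sm], assumption) (rule that)
 have S: "?S m \<in> LC" for m by (intro C.wL2_sum C.wL2_cmult(1) \<Phi>) simp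
 have "AE y in leb {0<..}. proj k (%z. w z - v z) y = 0" for k
 proof -
  have bP: "(%y. b k * ?P k y) \<in> LR" using R.wL2_cmult(1)[OF PL, of "b k"] by simp
  have "null (%m. NR (%y. proj k v y - b k * ?P k y))"
  proof (rule Lim_transform_eventually[OF proj_tendsto[OF v(1) S v(2)]])
   show "\<forall>\<^sub>F m in sequentially. NR (%y. proj k v y - proj k (?S m) y)
     = NR (%y. proj k v y - b k * ?P k y)"
    using eventually_gt_at_top[of k] by eventually_elim (simp only: proj_partial_sum[where e = ?P])
  qed
  then have "NR (%y. proj k v y - b k * ?P k y) = 0" by (simp add: LIMSEQ_const_iff)
  from R.wL2_norm_eq_0[OF R.wL2_diff(1)[OF proj_bound(1)[OF v(1)] bP] this]
  show ?thesis using p[of k] proj_diff_AE[OF w v(1), of k] by eventually_elim simp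
 qed
 from proj_eq_0[OF C.wL2_diff(1)[OF w v(1)] this] have 0: "NC (%z. w z - v z) = 0" .
 show ?thesis
 proof (rule Lim_null_comparison[OF _ v(2)], intro always_eventually allI)
  show "norm (NC (%z. w z - ?S m z)) \<le> NC (%z. v z - ?S m z)" for m
   unfolding real_norm_def abs_of_nonneg[OF C.norm_nonneg] using C.wL2_norm_diff_triangle[OF w v(1) S[of m]] 0 by linarith
 qed
qed

lemma tensor_profile_deriv:
 "hwd (cyl \<Omega>) (0, 1) (Suc l) (%z. \<phi> k (fst z) * Psi k 0 (snd z)) (%z. \<phi> k (fst z) * Psi k (Suc l) (snd z))"
proof -
 have b: "(0, 1) \<in> (Basis :: ((real^'n) \<times> real) set)" by (simp add: Basis_cyl)
 have 1: "hwd (cyl \<Omega>) (0, 1) 1 (%z. \<phi> k (fst z) * Psi k l (snd z)) (%z. \<phi> k (fst z) * Psi k (Suc l) (snd z))" for l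
  unfolding cyl_def
  by (rule hwd_tensor_snd[OF open_\<Omega> open_greaterThan _ O.wL2_locally_integrable[OF phi_L2]
    hwd_real[OF open_greaterThan scaled_profile_deriv[OF s0 s1 lam_pos] scaled_profile_continuous[OF s0 s1 lam_pos]]]) auto
 show ?thesis
 proof (induction l)
  case 0 show ?case using 1[of 0] by simp
 next
  case (Suc l) show ?case by (rule hwd_Suc[OF b Suc 1])
 qed
qed

text \<open>The expansion of w converges in the space of the solution, that of v in a space with
  another weight. The partial sums are related through the classical derivatives of the profile, and
  weak derivatives survive this pair of limits.\<close>

lemma expansion_deriv:
 assumes w: "w \<in> LC" and p: "\<And>k. AE y in leb {0<..}. proj k w y = b k * Psi k 0 y"
  and sum: "summable (%k. (b k)^2 * lam k powr (s - 1))"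
  and e: "\<And>k. Psi k (Suc l) \<in> wL2 {0<..} (hw \<beta> \<theta>)" and v: "v \<in> LE \<beta> \<theta>"
  and lim: "null (%m. NE \<beta> \<theta> (%z. v z - (\<Sum>k<m. b k *\<^sub>R (Psi k (Suc l) (snd z) *\<^sub>R \<phi> k (fst z)))))"
 shows "hwd (cyl \<Omega>) (0, 1) (Suc l) w v"
proof -
 interpret E: pos_weight "cyl \<Omega>" "exp_weight \<beta> \<theta>" by (rule pos_weight_exp[OF open_\<Omega>])
 have bb: "(0, 1) \<in> (Basis :: ((real^'n) \<times> real) set)" by (simp add: Basis_cyl)
 have S: "(%z. \<Sum>k<m. b k *\<^sub>R (Psi k 0 (snd z) *\<^sub>R \<phi> k (fst z))) \<in> LC" for m
  unfolding ext_weight_eq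
  by (intro C.wL2_sum[unfolded ext_weight_eq] C.wL2_cmult(1)[unfolded ext_weight_eq] wL2_tensor(1)[OF open_\<Omega> phi_L2 scaled_profile_wL2(1)[OF s0 s1 lam_pos]]) simp
 have S': "(%z. \<Sum>k<m. b k *\<^sub>R (Psi k (Suc l) (snd z) *\<^sub>R \<phi> k (fst z))) \<in> LE \<beta> \<theta>" for m
  by (intro E.wL2_sum E.wL2_cmult(1) wL2_tensor(1)[OF open_\<Omega> phi_L2 e]) simp
 show ?thesis
 proof (rule hwd_limit[OF bb C.pos_weight_axioms E.pos_weight_axioms w S mode_expansion[OF w p sum] v S' lim])
  fix m
  have "hwd (cyl \<Omega>) (0, 1) (Suc l) (%z. \<Sum>k<m. b k * (\<phi> k (fst z) * Psi k 0 (snd z)))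
   (%z. \<Sum>k<m. b k * (\<phi> k (fst z) * Psi k (Suc l) (snd z)))"
   by (intro hwd_sum[OF open_cyl[OF open_\<Omega>] bb] hwd_cmult tensor_profile_deriv) simp
  then show "hwd (cyl \<Omega>) (0, 1) (Suc l) (%z. \<Sum>k<m. b k *\<^sub>R (Psi k 0 (snd z) *\<^sub>R \<phi> k (fst z)))
   (%z. \<Sum>k<m. b k *\<^sub>R (Psi k (Suc l) (snd z) *\<^sub>R \<phi> k (fst z)))"
   by (simp add: mult.commute)
 qed
qed

lemma expansion_grad:
 assumes e: "\<And>k. e k \<in> wL2 {0<..} (hw \<beta> \<theta>)" "\<And>k. locint {0<..} (e k)" and v: "v \<in> LE \<beta> \<theta>"
  and lim: "null (%m. NE \<beta> \<theta> (%z. v z - (\<Sum>k<m. b k *\<^sub>R (e k (snd z) *\<^sub>R \<phi> k (fst z)))))"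
  and e': "\<And>k. e k \<in> wL2 {0<..} (hw \<beta>' \<theta>)" and W: "W \<in> LE \<beta>' \<theta>"
  and lim': "null (%m. NE \<beta>' \<theta> (%z. W z - (\<Sum>k<m. b k *\<^sub>R (e k (snd z) *\<^sub>R wg (\<phi> k) (fst z)))))"
 shows "has_weak_grad_x' \<Omega> v W"
 unfolding has_weak_grad_x'_def
proof
 interpret E: pos_weight "cyl \<Omega>" "exp_weight \<beta> \<theta>" by (rule pos_weight_exp[OF open_\<Omega>])
 interpret E': pos_weight "cyl \<Omega>" "exp_weight \<beta>' \<theta>" by (rule pos_weight_exp[OF open_\<Omega>])
 fix d :: "real^'n" assume d: "d \<in> Basis"
 have bb: "(d, 0) \<in> (Basis :: ((real^'n) \<times> real) set)" using d by (simp add: Basis_cyl)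
 let ?S = "%m z. \<Sum>k<m. b k *\<^sub>R (e k (snd z) *\<^sub>R \<phi> k (fst z))" and ?S' = "%m z. \<Sum>k<m. b k *\<^sub>R (e k (snd z) *\<^sub>R wg (\<phi> k) (fst z))"
 note gW = O.wH1_weak_grad[OF phi_wH1]
 have S: "?S m \<in> LE \<beta> \<theta>" for m by (intro E.wL2_sum E.wL2_cmult(1) wL2_tensor(1)[OF open_\<Omega> phi_L2 e(1)]) simp
 have S': "?S' m \<in> LE \<beta>' \<theta>" for m by (intro E'.wL2_sum E'.wL2_cmult(1) wL2_tensor(1)[OF open_\<Omega> gW(1) e']) simp
 show "hwd (cyl \<Omega>) (d, 0) 1 v (%z. W z \<bullet> d)"
 proof (rule hwd_limit[OF bb E.pos_weight_axioms E'.pos_weight_axioms v S lim E'.wL2_component(1)[OF W d] E'.wL2_component(1)[OF S' d]])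
  show "null (%m. NE \<beta>' \<theta> (%z. W z \<bullet> d - ?S' m z \<bullet> d))"
  proof (rule Lim_null_comparison[OF _ lim'], intro always_eventually allI)
   show "norm (NE \<beta>' \<theta> (%z. W z \<bullet> d - ?S' m z \<bullet> d)) \<le> NE \<beta>' \<theta> (%z. W z - ?S' m z)" for m
    unfolding real_norm_def abs_of_nonneg[OF E'.norm_nonneg] using E'.wL2_component(2)[OF E'.wL2_diff(1)[OF W S'] d, of m] by (simp only: inner_diff_left)
  qed
  fix m
  have 1: "hwd (cyl \<Omega>) (d, 0) 1 (%z. \<phi> k (fst z) * e k (snd z)) (%z. (wg (\<phi> k) (fst z) \<bullet> d) * e k (snd z))" for k
   unfolding cyl_def by (rule hwd_tensor_fst[OF open_\<Omega> open_greaterThan d gW(2)[OF d] e(2)])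
  have "hwd (cyl \<Omega>) (d, 0) 1 (%z. \<Sum>k<m. b k * (\<phi> k (fst z) * e k (snd z))) (%z. \<Sum>k<m. b k * ((wg (\<phi> k) (fst z) \<bullet> d) * e k (snd z)))"
   by (intro hwd_sum[OF open_cyl[OF open_\<Omega>] bb] hwd_cmult 1) simp
  then show "hwd (cyl \<Omega>) (d, 0) 1 (?S m) (%z. ?S' m z \<bullet> d)"
   by (simp add: inner_sum_left mult_ac)
 qed
qed

text \<open>The claim concerns almost every slice. Two nested subsequences make the slices of both
  series converge in L^2 for almost every y, and for each such y the closedness of the operator
  applies.\<close>

lemma expansion_op:
 assumes e: "\<And>k. e k \<in> wL2 {0<..} (hw \<beta> \<theta>)" and v: "v \<in> LE \<beta> \<theta>"
  and lim: "null (%m. NE \<beta> \<theta> (%z. v z - (\<Sum>k<m. b k *\<^sub>R (e k (snd z) *\<^sub>R \<phi> k (fst z)))))"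
  and e': "\<And>k. e k \<in> wL2 {0<..} (hw \<beta>' \<theta>)" and g: "g \<in> LE \<beta>' \<theta>"
  and lim': "null (%m. NE \<beta>' \<theta> (%z. g z - (\<Sum>k<m. b k *\<^sub>R (e k (snd z) *\<^sub>R (lam k * \<phi> k (fst z))))))"
 shows "has_dirichlet_op_x' \<Omega> A c v g"
proof -
 interpret E: pos_weight "cyl \<Omega>" "exp_weight \<beta> \<theta>" by (rule pos_weight_exp[OF open_\<Omega>])
 interpret E': pos_weight "cyl \<Omega>" "exp_weight \<beta>' \<theta>" by (rule pos_weight_exp[OF open_\<Omega>])
 let ?S = "%m z. \<Sum>k<m. b k *\<^sub>R (e k (snd z) *\<^sub>R \<phi> k (fst z))" and ?S' = "%m z. \<Sum>k<m. b k *\<^sub>R (e k (snd z) *\<^sub>R (lam k * \<phi> k (fst z)))"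
 have lp: "(%x. lam k * \<phi> k x) \<in> LO" for k using O.wL2_cmult(1)[OF phi_L2, of "lam k" k] by simp
 have S: "(%z. v z - ?S m z) \<in> LE \<beta> \<theta>" for m by (intro E.wL2_diff(1) v E.wL2_sum E.wL2_cmult(1) wL2_tensor(1)[OF open_\<Omega> phi_L2 e]) simp
 have S': "(%z. g z - ?S' m z) \<in> LE \<beta>' \<theta>" for m by (intro E'.wL2_diff(1) g E'.wL2_sum E'.wL2_cmult(1) wL2_tensor(1)[OF open_\<Omega> lp e']) simp
 obtain q where q: "strict_mono q" "AE y in leb {0<..}. null (%m. NO (%x. v (x, y) - ?S (q m) (x, y)))"
  by (rule slice_tendsto[OF S lim]) (rule that)
 have "null (%m. NE \<beta>' \<theta> (%z. g z - ?S' (q m) z))"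
  using LIMSEQ_subseq_LIMSEQ[OF lim' q(1)] by (simp add: o_def)
 then obtain q' where q': "strict_mono q'" "AE y in leb {0<..}. null (%m. NO (%x. g (x, y) - ?S' (q (q' m)) (x, y)))"
  by (rule slice_tendsto[OF S']) (rule that)
 show ?thesis
  unfolding has_dirichlet_op_x'_def using q(2) q'(2) slice_L2[OF v] slice_L2[OF g]
 proof eventually_elim
  case (elim y)
  show ?case
  proof (rule dirichlet_op_closed[OF _ elim(3,4)])
   show "null (%m. NO (%x. v (x, y) - ?S (q (q' m)) (x, y)))" using LIMSEQ_subseq_LIMSEQ[OF elim(1) q'(1)] by (simp add: o_def)
   show "null (%m. NO (%x. g (x, y) - ?S' (q (q' m)) (x, y)))" by (rule elim(2))
   show "dop (%x. ?S (q (q' m)) (x, y)) (%x. ?S' (q (q' m)) (x, y))" for m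
    using phi_sum_op[of "%k. b k * e k y" "q (q' m)"] by (simp add: mult.assoc)
  qed
 qed
qed

end

section \<open>Time evolution of the modes\<close>

lemma functional_continuous_on:
 fixes z :: "real => 'a => 'b::real_vector"
 assumes z: "\<And>t. t \<in> S ==> z t \<in> X" "\<And>t. t \<in> S ==> ((%\<tau>. N (%x. z \<tau> x - z t x)) \<longlongrightarrow> 0) (at t within S)"
  and L: "\<And>v w. v \<in> X ==> w \<in> X ==> \<bar>L v - L w\<bar> \<le> K * N (%x. v x - w x)"
 shows "continuous_on S (%t. L (z t) :: real)"
 unfolding continuous_on
proof
 fix t assume t: "t \<in> S"
 have "((%\<tau>. L (z \<tau>) - L (z t)) \<longlongrightarrow> 0) (at t within S)"
 proof (rule Lim_null_comparison)
  have "L (z \<tau>) - L (z t) \<le> K * N (%x. z \<tau> x - z t x)" "L (z t) - L (z \<tau>) \<le> K * N (%x. z \<tau> x - z t x)" if "\<tau> \<in> S" for \<tau>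
   using L[OF z(1)[OF that] z(1)[OF t]] by linarith+
  then show "\<forall>\<^sub>F \<tau> in at t within S. norm (L (z \<tau>) - L (z t)) \<le> K * N (%x. z \<tau> x - z t x)"
   unfolding eventually_at_filter by (intro always_eventually) (simp add: abs_le_iff)
  show "((%\<tau>. K * N (%x. z \<tau> x - z t x)) \<longlongrightarrow> 0) (at t within S)" using tendsto_mult_left[OF z(2)[OF t], of K] by simp
 qed
 from tendsto_add[OF this tendsto_const[of "L (z t)"]] show "((%t. L (z t)) \<longlongrightarrow> L (z t)) (at t within S)" by simp
qed

context elliptic
begin

lemma phi_scaled_Hr:
 "(%x. b * \<phi> k x) \<in> HS r" "(NH r (%x. b * \<phi> k x))^2 = lam k powr r * b\<^sup>2"
proof -
 have L: "(%x. b * \<phi> k x) \<in> LO" using O.wL2_cmult(1)[OF phi_L2, of b k] by simp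
 have i: "ip (%x. b * \<phi> k x) (\<phi> j) = (if j = k then b else 0)" for j
  using phi_ortho[of k j] by (auto simp: L2_inner_def mult.assoc)
 show "(%x. b * \<phi> k x) \<in> HS r" unfolding Hr_def using L by (intro CollectI conjI summable_finite[of "{k}"]) (auto simp: i split: if_splits)
 have "(\<Sum>j. lam j powr r * (ip (%x. b * \<phi> k x) (\<phi> j))^2) = lam k powr r * b\<^sup>2"
  by (subst suminf_finite[of "{k}"]) (auto simp: i)
 then show "(NH r (%x. b * \<phi> k x))^2 = lam k powr r * b\<^sup>2" by (simp add: Hr_norm_def)
qed

lemma Hr_L2: "w \<in> HS r ==> w \<in> LO" by (simp add: Hr_def)

lemma Hr_norm_sq:
 assumes "w \<in> HS r"
 shows "summable (%k. lam k powr r * (ip w (\<phi> k))^2)" "0 \<le> NH r w"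
  "(NH r w)^2 = (\<Sum>k. lam k powr r * (ip w (\<phi> k))^2)"
proof -
 show 1: "summable (%k. lam k powr r * (ip w (\<phi> k))^2)" using assms by (simp add: Hr_def)
 have "0 \<le> (\<Sum>k. lam k powr r * (ip w (\<phi> k))^2)" by (rule suminf_nonneg[OF 1]) simp
 then show "0 \<le> NH r w" "(NH r w)^2 = (\<Sum>k. lam k powr r * (ip w (\<phi> k))^2)"
  by (simp_all add: Hr_norm_def)
qed

lemma L2_le_Hr:
 assumes w: "w \<in> HS s"
 shows "lam 0 powr (s / 2) * NO w \<le> NH s w"
proof (rule power2_le_imp_le[OF _ Hr_norm_sq(2)[OF w]])
 note P = parseval[OF Hr_L2[OF w]]
 have m: "lam 0 \<le> lam k" for k using eig unfolding dirichlet_eigenpairs_def by (simp add: monoD)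
 have "(lam 0 powr (s / 2) * NO w)^2 = lam 0 powr s * (\<Sum>k. (ip w (\<phi> k))^2)"
  unfolding sums_unique[OF P, symmetric] by (simp add: power_mult_distrib power2_eq_square powr_add[symmetric])
 also have "\<dots> = (\<Sum>k. lam 0 powr s * (ip w (\<phi> k))^2)" by (rule suminf_mult[OF sums_summable[OF P], symmetric])
 also have "\<dots> \<le> (\<Sum>k. lam k powr s * (ip w (\<phi> k))^2)"
  using m lam0 s0 by (intro suminf_le summable_mult sums_summable[OF P] Hr_norm_sq(1)[OF w] mult_right_mono powr_mono2) auto
 finally show "(lam 0 powr (s / 2) * NO w)^2 \<le> (NH s w)^2" unfolding Hr_norm_sq(3)[OF w] .
qed

lemma L2_dual:
 assumes v: "v \<in> LO"
 shows "ip v \<in> HD s"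
proof -
 have "ip v (%x. p * w x + q * w' x) = p * ip v w + q * ip v w'"
  if "w \<in> HS s" "w' \<in> HS s" for w w' p q
  using lint_add[OF integrable_mult_right[OF L2_inner_bound(1)[OF v Hr_L2[OF that(1)]], of p]
    integrable_mult_right[OF L2_inner_bound(1)[OF v Hr_L2[OF that(2)]], of q]]
  by (simp add: L2_inner_def algebra_simps)
 moreover have "\<bar>ip v w\<bar> \<le> NO v / lam 0 powr (s / 2) * NH s w" if w: "w \<in> HS s" for w
 proof -
  have l: "0 < lam 0 powr (s / 2)" using lam0 by simp
  have "NO w \<le> NH s w / lam 0 powr (s / 2)" using L2_le_Hr[OF w] l by (simp add: field_simps)
  then have "NO v * NO w \<le> NO v * (NH s w / lam 0 powr (s / 2))"
   by (rule mult_left_mono) (rule O.norm_nonneg)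
  then show ?thesis using L2_inner_bound(2)[OF v Hr_L2[OF w]] by simp
 qed
 ultimately show ?thesis unfolding Hr_dual_def by blast
qed

text \<open>The dual norm is a supremum over the unit ball of H^s, in which phi_k scaled by
  lam_k^(-s/2) has norm 1. Being a supremum of reals it has to be shown bounded, for which the
  constants of F and G serve.\<close>

lemma dual_eval:
 assumes F: "F \<in> HD s" and G: "G \<in> HD s"
 shows "\<bar>F (\<phi> k) - G (\<phi> k)\<bar> \<le> lam k powr (s / 2) * ND s (%w. F w - G w)"
proof -
 define b where "b = lam k powr (- (s / 2))"
 let ?q = "%x. b * \<phi> k x"
 let ?X = "{w \<in> HS s. NH s w \<le> 1}"
 have b: "0 < b" "lam k powr (s / 2) * b = 1" "lam k powr s * b\<^sup>2 = 1"
  using lam_pos[of k] by (simp_all add: b_def powr_add[symmetric] power2_eq_square)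
 have ph: "\<phi> k \<in> HS s" using phi_scaled_Hr(1)[of 1 k] by simp
 have lin: "E ?q = b * E (\<phi> k)" if "E \<in> HD s" for E
 proof -
  \<comment> \<open>Membership in the dual states linearity for two terms; homogeneity is the case
    with second coefficient 0.\<close>
  have "E (%x. b * \<phi> k x + 0 * \<phi> k x) = b * E (\<phi> k) + 0 * E (\<phi> k)" using that ph unfolding Hr_dual_def by blast
  then show ?thesis by simp
 qed
 have "(NH s ?q)^2 = 1" using phi_scaled_Hr(2)[of s b k] b(3) by simp
 then have q: "?q \<in> ?X" using phi_scaled_Hr(1)[of b k s] Hr_norm_sq(2)[OF phi_scaled_Hr(1)[of b k s]] by (simp add: power2_eq_1_iff)
 obtain KF KG where K: "\<And>w. w \<in> HS s ==> \<bar>F w\<bar> \<le> KF * NH s w" "\<And>w. w \<in> HS s ==> \<bar>G w\<bar> \<le> KG * NH s w"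
  using F G unfolding Hr_dual_def by blast
 have bdd: "bdd_above ((%w. \<bar>F w - G w\<bar>) ` ?X)"
 proof (rule bdd_aboveI2)
  fix w assume w: "w \<in> ?X"
  have h: "KH * NH s w \<le> \<bar>KH\<bar>" for KH
   using w Hr_norm_sq(2)[of w] mult_mono[of KH "\<bar>KH\<bar>" "NH s w" 1] by simp
  show "\<bar>F w - G w\<bar> \<le> \<bar>KF\<bar> + \<bar>KG\<bar>" using K(1)[of w] K(2)[of w] h[of KF] h[of KG] w by simp
 qed
 have "\<bar>F ?q - G ?q\<bar> \<le> ND s (%w. F w - G w)" unfolding Hr_dual_norm_def by (rule cSUP_upper[OF q bdd])
 moreover have "F ?q - G ?q = b * (F (\<phi> k) - G (\<phi> k))" unfolding lin[OF F] lin[OF G] by (simp add: right_diff_distrib)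
 ultimately have "b * \<bar>F (\<phi> k) - G (\<phi> k)\<bar> \<le> ND s (%w. F w - G w)" using b(1) by (simp add: abs_mult)
 from mult_left_mono[OF this, of "lam k powr (s / 2)"] show ?thesis using b(2) by (simp add: mult.assoc[symmetric])
qed

text \<open>The data of mode k as they enter the energy bound. The weight lam^s on g matches the
  potential energy, so that summation with lam^r leads to the norms of g in H^(r+s), of h in H^r,
  and of f in L^2 over time with values in H^r.\<close>

definition energy where
 "energy T f g h k = lam k powr s * (ip g (\<phi> k))^2 + (ip h (\<phi> k))^2 + (lint {0<..<T} (%t. (ip (f t) (\<phi> k))^2))"

lemma energy_nonneg: "0 \<le> energy T f g h k"
 unfolding energy_def by (intro add_nonneg_nonneg integral_nonneg_AE) auto

lemma coefficient_lipschitz: "v \<in> LO ==> w \<in> LO ==> \<bar>ip v (\<phi> k) - ip w (\<phi> k)\<bar> \<le> 1 * NO (%x. v x - w x)"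
 using L2_inner_bound(2)[OF O.wL2_diff(1) phi_L2, of v w k] by (simp add: L2_inner_diff phi_L2 phi_norm)

lemma coefficient_integrable:
 assumes f: "f \<in> L2T T (LO) (NO)"
 shows "(%t. ip (f t) (\<phi> k)) \<in> meas {0<..<T}"
  "intg {0<..<T} (%t. (ip (f t) (\<phi> k))^2)"
proof -
 have sm: "strongly_measurable T (LO) (NO) f" and i: "intg {0<..<T} (%t. (NO (f t))^2)"
  using f by (auto simp: L2T_def)
 show m[measurable]: "(%t. ip (f t) (\<phi> k)) \<in> meas {0<..<T}"
  by (rule strongly_measurable_functional[OF sm coefficient_lipschitz])
 have "AE t in leb {0<..<T}. f t \<in> LO" using sm by (simp add: strongly_measurable_def)
 then have b: "AE t in leb {0<..<T}. norm ((ip (f t) (\<phi> k))^2) \<le> norm ((NO (f t))^2)"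
 proof eventually_elim
  case (elim t)
  have "\<bar>ip (f t) (\<phi> k)\<bar>\<^sup>2 \<le> (NO (f t))^2"
   using L2_inner_bound(2)[OF elim phi_L2, of k] by (intro power_mono) (auto simp: phi_norm)
  then show ?case by simp
 qed
 show "intg {0<..<T} (%t. (ip (f t) (\<phi> k))^2)"
  by (rule intg_bound[OF i _ b]) measurable
qed

text \<open>Partial sums over k are exchanged with the time integral and compared there with the
  squared norm of f t; their uniform bound gives both claims.\<close>

lemma energy_summable:
 assumes f: "f \<in> L2T T (LO) (NO)" and fH: "AE t in leb {0<..<T}. f t \<in> HS r"
  and fI: "intg {0<..<T} (%t. (NH r (f t))^2)"
  and g: "g \<in> HS (r + s)" and h: "h \<in> HS r"
 shows "summable (%k. lam k powr r * energy T f g h k)"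
  "(\<Sum>k. lam k powr r * energy T f g h k) \<le> (NH (r + s) g)^2 + (NH r h)^2
   + (lint {0<..<T} (%t. (NH r (f t))^2))"
proof -
 let ?M = "leb {0<..<T}" and ?I = "lint {0<..<T} (%t. (NH r (f t))^2)"
 define x where "x k = lam k powr r * (\<integral>t. (ip (f t) (\<phi> k))^2 \<partial>?M)" for k
 have x0: "0 \<le> x k" for k unfolding x_def by (intro mult_nonneg_nonneg integral_nonneg_AE) auto
 have i: "integrable ?M (%t. lam k powr r * (ip (f t) (\<phi> k))^2)" for k
  by (intro integrable_mult_right coefficient_integrable(2)[OF f])
 have part: "(\<Sum>k<m. x k) \<le> ?I" for m
 proof -
  have "(\<Sum>k<m. x k) = (\<integral>t. (\<Sum>k<m. lam k powr r * (ip (f t) (\<phi> k))^2) \<partial>?M)"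
   unfolding lint_sum[OF i] x_def by simp
  also have "\<dots> \<le> ?I"
  proof (rule integral_mono_AE[OF intg_sum[OF i] fI])
   show "AE t in ?M. (\<Sum>k<m. lam k powr r * (ip (f t) (\<phi> k))^2) \<le> (NH r (f t))^2"
    using fH
   proof eventually_elim
    case (elim t)
    show ?case unfolding Hr_norm_sq(3)[OF elim] by (rule sum_le_suminf[OF Hr_norm_sq(1)[OF elim]]) auto
   qed
  qed
  finally show ?thesis .
 qed
 have xs: "summable x" by (rule summableI_nonneg_bounded[OF x0 part])
 have xI: "suminf x \<le> ?I" by (rule suminf_le_const[OF xs part])
 note G = Hr_norm_sq[OF g] and H = Hr_norm_sq[OF h]
 have e: "(%k. lam k powr r * energy T f g h k)
   = (%k. (lam k powr (r + s) * (ip g (\<phi> k))^2 + lam k powr r * (ip h (\<phi> k))^2) + x k)"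
  by (simp add: energy_def x_def powr_add algebra_simps)
 show "summable (%k. lam k powr r * energy T f g h k)" unfolding e by (intro summable_add G(1) H(1) xs)
 show "(\<Sum>k. lam k powr r * energy T f g h k) \<le> (NH (r + s) g)^2 + (NH r h)^2 + ?I"
  unfolding e suminf_add[OF summable_add[OF G(1) H(1)] xs, symmetric] suminf_add[OF G(1) H(1), symmetric] G(3) H(3) using xI by simp
qed

text \<open>The constant of \<open>mode_bound_arith\<close>; the denominator is the positive factor
  of lam^s in the equation of a mode.\<close>

definition mode_const where
 "mode_const T = 2 + (2 + 4 * T) / (flux_lim s / (profile_lim s * d_const s))"

lemma d_const_pos: "0 < d_const s"
 unfolding d_const_def using s0 s1 by (simp add: Gamma_real_pos)

text \<open>Testing with phi_k eta, whose trace is eta(0) phi_k, makes the values of F and of f'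
  multiples of eta(0), as \<open>mode_identification\<close> requires. F plays the second time
  derivative of the trace at a fixed time.\<close>

lemma mode_identity:
 assumes f: "f' \<in> LO" and F: "F \<in> HD s" and tr: "is_trace \<Omega> s w p"
  and eq: "\<And>v q. v \<in> H1L \<Omega> s ==> is_trace \<Omega> s v q ==> F q + ef w v = ip f' q"
 shows "F (\<phi> k) = ip f' (\<phi> k) - mode_flux s (lam k) / d_const s * ip p (\<phi> k)"
  "AE y in leb {0<..}. proj k w y = ip p (\<phi> k) * Psi k 0 y"
proof -
 have "ef w (%z. \<phi> k (fst z) * \<eta> (snd z)) = (ip f' (\<phi> k) - F (\<phi> k)) * \<eta> 0"
  if \<eta>: "\<eta> \<in> TF UNIV" for \<eta>
 proof -
  note t = tensor_trace[OF phi_H10 \<eta>, of k]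
  have v: "(%z. \<phi> k (fst z) * \<eta> (snd z)) \<in> H1L \<Omega> s" using t unfolding is_trace_def by blast
  have ph: "\<phi> k \<in> HS s" using phi_scaled_Hr(1)[of 1 k] by simp
  have "F (%x. \<eta> 0 * \<phi> k x + 0 * \<phi> k x) = \<eta> 0 * F (\<phi> k) + 0 * F (\<phi> k)" using F ph unfolding Hr_dual_def by blast
  moreover have "ip f' (%x. \<eta> 0 * \<phi> k x) = \<eta> 0 * ip f' (\<phi> k)"
   unfolding L2_inner_def by (subst integral_mult_right_zero[symmetric]) (simp add: mult_ac)
  ultimately show ?thesis using eq[OF v t] by (simp add: algebra_simps)
 qed
 note I = mode_identification[OF tr this]
 show "F (\<phi> k) = ip f' (\<phi> k) - mode_flux s (lam k) / d_const s * ip p (\<phi> k)"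
  using I(1) d_const_pos by (simp add: field_simps)
 show "AE y in leb {0<..}. proj k w y = ip p (\<phi> k) * Psi k 0 y" by (rule I(2))
qed

lemma mode_bound_arith:
 assumes "L * cs * z\<^sup>2 \<le> 2 * (h\<^sup>2 + L * cs * g\<^sup>2) + 4 * T * F" "0 < (L::real)" "0 < cs" "0 \<le> F" "0 < T"
 shows "z\<^sup>2 \<le> (2 + (2 + 4 * T) / cs) * (1 / L * (L * g\<^sup>2 + h\<^sup>2 + F))"
proof -
 let ?E = "L * g\<^sup>2 + h\<^sup>2 + F"
 have p: "0 \<le> L * g\<^sup>2" "0 \<le> h\<^sup>2" "0 \<le> cs * h\<^sup>2" "0 \<le> cs * F" "0 \<le> T * (L * g\<^sup>2)" "0 \<le> T * h\<^sup>2" using assms by simp_all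
 have "L * cs * z\<^sup>2 \<le> (2 * cs + 2 + 4 * T) * ?E" using assms(1,4) p by (simp add: algebra_simps)
 then have "z\<^sup>2 \<le> ((2 * cs + 2 + 4 * T) * ?E) / (L * cs)" using assms by (simp add: field_simps)
 also have "\<dots> = (2 + (2 + 4 * T) / cs) * (1 / L * ?E)" using assms by (simp add: field_simps)
 finally show ?thesis .
qed

text \<open>The equation and its derivatives are known almost everywhere in t, whereas the energy
  bound asks for continuous functions with values at 0. The continuous representatives z and w of u
  and u1 supply them: their coefficients agree with those of u and u1 almost everywhere, inherit the
  weak derivatives, and start from the coefficients of g and h.\<close>

lemma solution_modes:
 assumes T: "0 < T" and f: "f \<in> L2T T (LO) (NO)" and g: "g \<in> LO" and h: "h \<in> LO"
  and sol: "weak_solution \<Omega> A c lam \<phi> s T f g h U"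
 obtains u where "\<And>k. u k \<in> meas {0<..<T}"
  "AE t in leb {0<..<T}. \<forall>k. (u k t)^2 \<le> mode_const T * (lam k powr (- s) * energy T f g h k)"
  "AE t in leb {0<..<T}. U t \<in> LC \<and>
   (\<forall>k. AE y in leb {0<..}. proj k (U t) y = u k t * Psi k 0 y)"
proof -
 let ?M = "leb {0<..<T}"
 obtain u u1 u2 where tr: "AE t in ?M. is_trace \<Omega> s (U t) (u t)" and L1: "u1 \<in> LinfT T (LO) (NO)"
  and L2: "u2 \<in> L2T T (HD s) (ND s)"
  and d1: "\<forall>q \<in> LO. hwd {0<..<T} 1 1 (%t. ip (u t) q) (%t. ip (u1 t) q)"
  and d2: "\<forall>q \<in> HS s. hwd {0<..<T} 1 1 (%t. ip (u1 t) q) (%t. u2 t q)"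
  and iv0: "initial_value T (LO) (NO) u g"
  and iv1: "initial_value T (HD s) (ND s) (%t. ip (u1 t)) (ip h)"
  and eqn: "AE t in ?M. \<forall>v \<in> H1L \<Omega> s. \<forall>p. is_trace \<Omega> s v p \<longrightarrow> u2 t p + ef (U t) v = ip (f t) p"
  using sol[unfolded weak_solution_def, THEN conjunct2] by (elim exE conjE) (rule that)
 have u1L: "AE t in ?M. u1 t \<in> LO" using L1 by (simp add: LinfT_def strongly_measurable_def)
 have u2D: "AE t in ?M. u2 t \<in> HD s" using L2 by (simp add: L2T_def strongly_measurable_def)
 have fL: "AE t in ?M. f t \<in> LO" using f by (simp add: L2T_def strongly_measurable_def)
 have uL: "AE t in ?M. u t \<in> LO" using tr by eventually_elim (simp add: is_trace_def)
 have id: "AE t in ?M. (\<forall>k. u2 t (\<phi> k) = ip (f t) (\<phi> k) - mode_flux s (lam k) / d_const s * ip (u t) (\<phi> k)) \<and>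
   (\<forall>k. AE y in leb {0<..}. proj k (U t) y = ip (u t) (\<phi> k) * Psi k 0 y)"
  using tr u2D fL eqn
 proof eventually_elim
  case (elim t)
  have "u2 t q + ef (U t) v = ip (f t) q" if "v \<in> H1L \<Omega> s" "is_trace \<Omega> s v q" for v q
   using elim(4) that by blast
  from mode_identity[OF elim(3,2,1) this] show ?case by blast
 qed
 have UL: "AE t in ?M. U t \<in> LC"
  using tr by eventually_elim (auto simp: is_trace_def H1L_def intro: C.wH1_wL2)
 define cs where "cs = flux_lim s / (profile_lim s * d_const s)"
 have cs: "0 < cs" unfolding cs_def using profile_lim_pos[OF s0 s1] d_const_pos by simp
 have mf: "mode_flux s (lam k) / d_const s = lam k powr s * cs" for k by (simp add: mode_flux_def cs_def)
 obtain z where z: "\<And>t. t \<in> {0..T} ==> z t \<in> LO"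
  "\<And>t. t \<in> {0..T} ==> ((%\<tau>. NO (%x. z \<tau> x - z t x)) \<longlongrightarrow> 0) (at t within {0..T})"
  and zu: "AE t in ?M. NO (%x. z t x - u t x) = 0" and z0: "NO (%x. z 0 x - g x) = 0"
  using iv0 unfolding initial_value_def by blast
 obtain w where w: "\<And>t. t \<in> {0..T} ==> w t \<in> HD s"
  "\<And>t. t \<in> {0..T} ==> ((%\<tau>. ND s (%x. w \<tau> x - w t x)) \<longlongrightarrow> 0) (at t within {0..T})"
  and wu: "AE t in ?M. ND s (%x. w t x - ip (u1 t) x) = 0"
  and w0: "ND s (%x. w 0 x - ip h x) = 0"
  using iv1 unfolding initial_value_def by blast
 have T0: "0 \<in> {0..T}" using T by simp
 have zuk: "AE t in ?M. ip (z t) (\<phi> k) = ip (u t) (\<phi> k)" for k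
  using zu uL AE_space
 proof eventually_elim
  case (elim t)
  then have "z t \<in> LO" by (intro z(1)) auto
  from coefficient_lipschitz[OF this elim(2), of k] elim(1) show ?case by simp
 qed
 have wuk: "AE t in ?M. w t (\<phi> k) = ip (u1 t) (\<phi> k)" for k
  using wu u1L AE_space
 proof eventually_elim
  case (elim t)
  then have "w t \<in> HD s" by (intro w(1)) auto
  from dual_eval[OF this L2_dual[OF elim(2)], of k] elim(1) show ?case by simp
 qed
 have zc: "continuous_on {0..T} (%t. ip (z t) (\<phi> k))" for k
  by (rule functional_continuous_on[OF z coefficient_lipschitz])
 have wc: "continuous_on {0..T} (%t. w t (\<phi> k))" for k
  by (rule functional_continuous_on[where L = "%F. F (\<phi> k)" and z = w, OF w dual_eval])
 have fin: "(%t. ip (u t) (\<phi> k)) \<in> borel_measurable ?M \<and>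
  (AE t in ?M. (ip (u t) (\<phi> k))^2 \<le> mode_const T * (lam k powr (- s) * energy T f g h k))" for k
 proof
  let ?f = "%t. ip (f t) (\<phi> k)" and ?z = "%t. ip (z t) (\<phi> k)" and ?w = "%t. w t (\<phi> k)"
  have ph: "\<phi> k \<in> HS s" using phi_scaled_Hr(1)[of 1 k] by simp
  have "?z \<in> borel_measurable ?M"
   by (rule continuous_meas[OF continuous_on_subset[OF zc]]) auto
  then show "(%t. ip (u t) (\<phi> k)) \<in> borel_measurable ?M"
   by (rule borel_measurable_AE_lebesgue_on[OF open_ivl _ zuk])
  have uz: "AE t in ?M. ip (u t) (\<phi> k) = ?z t" using zuk[of k] by eventually_elim simp
  have uw: "AE t in ?M. ip (u1 t) (\<phi> k) = ?w t" using wuk[of k] by eventually_elim simp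
  have uf: "AE t in ?M. u2 t (\<phi> k) = ?f t - lam k powr s * cs * ?z t"
   using id zuk[of k] by eventually_elim (simp add: mf)
  have zw: "hwd {0<..<T} 1 1 ?z ?w"
   by (rule hwd_cong_AE[OF open_ivl d1[rule_format, OF phi_L2] _ uz uw]) simp
  have wf: "hwd {0<..<T} 1 1 ?w (%t. ?f t - lam k powr s * cs * ?z t)"
   by (rule hwd_cong_AE[OF open_ivl d2[rule_format, OF ph] _ uw uf]) simp
  have i0: "?z 0 = ip g (\<phi> k)" using coefficient_lipschitz[OF z(1)[OF T0] g, of k] z0 by simp
  have i1: "?w 0 = ip h (\<phi> k)" using dual_eval[OF w(1)[OF T0] L2_dual[OF h], of k] w0 by simp
  have L: "0 < lam k powr s" using lam_pos[of k] by simp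
  have mu: "0 \<le> lam k powr s * cs" using L cs by simp
  have F: "0 \<le> (\<integral>t. (?f t)^2 \<partial>?M)" by (rule integral_nonneg_AE) simp
  have "(?z t)^2 \<le> mode_const T * (lam k powr (- s) * energy T f g h k)" if t: "t \<in> {0..T}" for t
   using mode_bound_arith[OF wave_mode_bound[OF T mu zc wc zw wf coefficient_integrable[OF f] t, unfolded i0 i1] L cs F T]
   by (simp add: mode_const_def cs_def energy_def powr_minus_divide)
  note zb = this
  show "AE t in ?M. (ip (u t) (\<phi> k))^2 \<le> mode_const T * (lam k powr (- s) * energy T f g h k)"
   using uz AE_space
  proof eventually_elim
   case (elim t)
   then have "t \<in> {0..T}" by simp
   then show ?case unfolding elim(1) by (rule zb)
  qed
 qed
 show ?thesis
 proof (rule that[of "%k t. ip (u t) (\<phi> k)"])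
  show "(%t. ip (u t) (\<phi> k)) \<in> borel_measurable ?M" for k using fin[of k] ..
  show "AE t in ?M. \<forall>k. (ip (u t) (\<phi> k))^2 \<le> mode_const T * (lam k powr (- s) * energy T f g h k)"
   unfolding AE_all_countable using fin by simp
  show "AE t in ?M. U t \<in> LC \<and>
   (\<forall>k. AE y in leb {0<..}. proj k (U t) y = ip (u t) (\<phi> k) * Psi k 0 y)"
   using UL id by eventually_elim simp
 qed
qed

section \<open>Assembling the estimates with common constants\<close>

lemma regularity_constants:
 fixes T K r Q S E C \<kappa> \<kappa>0 :: real
 assumes "X \<le> T * (K * r * (Q * (\<kappa>0 ^ l * fact l)^2) * S)" "S \<le> E" "0 \<le> S" "0 \<le> T" "0 \<le> K" "0 \<le> r" "0 \<le> Q"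
  "T * K * r * Q \<le> C" "1 \<le> \<kappa>0" "\<kappa>0 \<le> \<kappa>"
 shows "X \<le> C * \<kappa> ^ (2 * (l + 1)) * (fact (l + 1))^2 * E"
proof -
 have "\<kappa>0 ^ l * fact l \<le> \<kappa> ^ (l + 1) * fact (l + 1)"
 proof (rule mult_mono)
  have "\<kappa>0 ^ l \<le> \<kappa> ^ l" using assms by (intro power_mono) auto
  also have "\<dots> \<le> \<kappa> ^ (l + 1)" using assms by (intro power_increasing) auto
  finally show "\<kappa>0 ^ l \<le> \<kappa> ^ (l + 1)" .
  show "fact l \<le> (fact (l + 1) :: real)" by (rule fact_mono) simp
 qed (use assms in auto)
 then have "(\<kappa>0 ^ l * fact l)^2 \<le> (\<kappa> ^ (l + 1) * fact (l + 1))^2" using assms by (intro power_mono) auto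
 also have "\<dots> = \<kappa> ^ (2 * (l + 1)) * (fact (l + 1))^2" by (simp only: power_mult_distrib power_mult[symmetric] mult.commute[of "l + 1" 2])
 finally have 1: "(\<kappa>0 ^ l * fact l)^2 \<le> \<kappa> ^ (2 * (l + 1)) * (fact (l + 1))^2" .
 have C0: "0 \<le> C" by (rule order_trans[OF _ assms(8)]) (use assms in simp)
 have "X \<le> (T * K * r * Q) * ((\<kappa>0 ^ l * fact l)^2 * S)" using assms(1) by (simp add: mult_ac)
 also have "\<dots> \<le> C * ((\<kappa> ^ (2 * (l + 1)) * (fact (l + 1))^2) * E)"
  using 1 assms C0 by (intro mult_mono) auto
 finally show ?thesis by (simp only: mult.assoc)
qed

definition regular_data where
 "regular_data T r f g h \<longleftrightarrow> g \<in> HS (r + s) \<and> h \<in> HS r \<and> f \<in> L2T T (HS r) (NH r)"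

definition estimate where
 "estimate T \<omega> K r f g h X \<longleftrightarrow> X \<in> L2T T (wL2 (cyl \<Omega>) \<omega>) (wL2_norm (cyl \<Omega>) \<omega>) \<and> (L2T_norm T (wL2_norm (cyl \<Omega>) \<omega>) X)\<^sup>2
  \<le> K * ((NH (r + s) g)^2 + (NH r h)^2 + (L2T_norm T (NH r) f)^2)"

text \<open>The profile bound is used with tau = sigma for the first estimate and with tau = nu - 1
  for the other two, since 2 (l + 1) - 2 nu = 2 l - 2 (nu - 1). The squared gradient norm brings one
  further power of lam k and that of the operator two, which gives the exponents nu and 1 + nu of
  the data.\<close>

lemma regularity:
 assumes T: "0 < T" and \<sigma>: "0 \<le> \<sigma>" "\<sigma> < s" and \<nu>: "0 \<le> \<nu>" "\<nu> < 1 + s" and \<theta>: "0 \<le> \<theta>" "\<theta> < 2 * sqrt (lam 0)"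
 shows "\<exists>\<kappa>>1. \<exists>C>0. \<forall>f g h U. f \<in> L2T T (LO) (NO) \<longrightarrow> g \<in> HS s \<longrightarrow> h \<in> LO \<longrightarrow>
  weak_solution \<Omega> A c lam \<phi> s T f g h U \<longrightarrow> (\<forall>l::nat. \<exists>V.
    (AE t in leb {0<..<T}. hwd (cyl \<Omega>) (0, 1) (l + 1) (U t) (V t)) \<and>
    (regular_data T \<sigma> f g h \<longrightarrow> estimate T (exp_weight (1 - 2 * s + 2 * real l - 2 * \<sigma>) \<theta>) (C * \<kappa> ^ (2 * (l + 1)) * (fact (l + 1))^2) \<sigma> f g h V) \<and>
    (regular_data T \<nu> f g h \<longrightarrow> (\<exists>W. (AE t in leb {0<..<T}. has_weak_grad_x' \<Omega> (V t) (W t)) \<and>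
     estimate T (exp_weight (1 - 2 * s + 2 * real (l + 1) - 2 * \<nu>) \<theta>) (C * \<kappa> ^ (2 * (l + 1)) * (fact (l + 1))^2) \<nu> f g h W)) \<and>
    (regular_data T (1 + \<nu>) f g h \<longrightarrow> (\<exists>G. (AE t in leb {0<..<T}. has_dirichlet_op_x' \<Omega> A c (V t) (G t)) \<and>
     estimate T (exp_weight (1 - 2 * s + 2 * real (l + 1) - 2 * \<nu>) \<theta>) (C * \<kappa> ^ (2 * (l + 1)) * (fact (l + 1))^2) (1 + \<nu>) f g h G)))"
proof -
 have \<nu>1: "\<nu> - 1 < s" using \<nu> by simp
 let ?e = "%l k. Psi k (Suc l)" and ?\<beta> = "%l \<tau>. 1 - 2 * s + 2 * real l - 2 * \<tau>"
 obtain Q1 \<kappa>1 where Q1: "0 < Q1" "1 \<le> \<kappa>1" and P1: "\<And>k l. ?e l k \<in> wL2 {0<..} (hw (?\<beta> l \<sigma>) \<theta>)"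
  and N1: "\<And>k l. (wL2_norm {0<..} (hw (?\<beta> l \<sigma>) \<theta>) (?e l k))^2 \<le> Q1 * (\<kappa>1 ^ l * fact l)^2 * lam k powr (s + \<sigma>)"
  by (rule profile_norm_estimate[OF \<theta> \<sigma>(2)]) (rule that)
 obtain Q2 \<kappa>2 where Q2: "0 < Q2" "1 \<le> \<kappa>2" and P2: "\<And>k l. ?e l k \<in> wL2 {0<..} (hw (?\<beta> l (\<nu> - 1)) \<theta>)"
  and N2: "\<And>k l. (wL2_norm {0<..} (hw (?\<beta> l (\<nu> - 1)) \<theta>) (?e l k))^2 \<le> Q2 * (\<kappa>2 ^ l * fact l)^2 * lam k powr (s + (\<nu> - 1))"
  by (rule profile_norm_estimate[OF \<theta> \<nu>1]) (rule that)
 \<comment> \<open>A third bound, with tau = 0, for data that are not regular of order sigma: the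
   derivative V has to exist for them too, though without the first estimate.\<close>
 obtain Q3 \<kappa>3 where Q3: "0 < Q3" "1 \<le> \<kappa>3" and P3: "\<And>k l. ?e l k \<in> wL2 {0<..} (hw (?\<beta> l 0) \<theta>)"
  and N3: "\<And>k l. (wL2_norm {0<..} (hw (?\<beta> l 0) \<theta>) (?e l k))^2 \<le> Q3 * (\<kappa>3 ^ l * fact l)^2 * lam k powr (s + 0)"
  by (rule profile_norm_estimate[OF \<theta> s0]) (rule that)
 let ?K = "mode_const T"
 have K: "0 < ?K" unfolding mode_const_def using profile_lim_pos[OF s0 s1] d_const_pos T by (intro add_pos_nonneg) auto
 define \<kappa> where "\<kappa> = \<kappa>1 + \<kappa>2"
 define C where "C = T * ?K * 1 * Q1 + T * ?K * (1 / a) * Q2 + T * ?K * 1 * Q2"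
 have Cp: "0 < T * ?K * 1 * Q1" "0 < T * ?K * (1 / a) * Q2" "0 < T * ?K * 1 * Q2" using T K Q1(1) Q2(1) a0 by simp_all
 have C: "0 < C" "T * ?K * 1 * Q1 \<le> C" "T * ?K * (1 / a) * Q2 \<le> C" "T * ?K * 1 * Q2 \<le> C" unfolding C_def using Cp by linarith+
 have \<kappa>: "1 < \<kappa>" "\<kappa>1 \<le> \<kappa>" "\<kappa>2 \<le> \<kappa>" unfolding \<kappa>_def using Q1(2) Q2(2) by linarith+
 have \<beta>2: "1 - 2 * s + 2 * real (l + 1) - 2 * \<nu> = ?\<beta> l (\<nu> - 1)" for l by simp
 have nT: "(L2T_norm T N f)^2 = (lint {0<..<T} (%t. (N (f t))^2))" for N and f :: "real => real^'n => real"
  unfolding L2T_norm_def by (intro real_sqrt_pow2 integral_nonneg_AE) simp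
 let ?c = "%l. C * \<kappa> ^ (2 * (l + 1)) * (fact (l + 1))^2"
 have "\<exists>V. (AE t in leb {0<..<T}. hwd (cyl \<Omega>) (0, 1) (l + 1) (U t) (V t)) \<and>
    (regular_data T \<sigma> f g h \<longrightarrow> estimate T (exp_weight (?\<beta> l \<sigma>) \<theta>) (?c l) \<sigma> f g h V) \<and>
    (regular_data T \<nu> f g h \<longrightarrow> (\<exists>W. (AE t in leb {0<..<T}. has_weak_grad_x' \<Omega> (V t) (W t)) \<and>
     estimate T (exp_weight (?\<beta> l (\<nu> - 1)) \<theta>) (?c l) \<nu> f g h W)) \<and>
    (regular_data T (1 + \<nu>) f g h \<longrightarrow> (\<exists>G. (AE t in leb {0<..<T}. has_dirichlet_op_x' \<Omega> A c (V t) (G t)) \<and>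
     estimate T (exp_weight (?\<beta> l (\<nu> - 1)) \<theta>) (?c l) (1 + \<nu>) f g h G))"
  if f: "f \<in> L2T T (LO) (NO)" and g: "g \<in> HS s" and h: "h \<in> LO"
   and sol: "weak_solution \<Omega> A c lam \<phi> s T f g h U" for f g h U l
 proof -
  let ?M = "leb {0<..<T}" and ?D = "energy T f g h" and ?q = "%\<kappa>. (\<kappa> ^ l * fact l)^2 :: real"
  obtain u where u: "\<And>k. u k \<in> borel_measurable ?M" and B: "AE t in ?M. \<forall>k. (u k t)^2 \<le> ?K * (lam k powr (- s) * ?D k)"
   and U: "AE t in ?M. U t \<in> LC \<and> (\<forall>k. AE y in leb {0<..}. proj k (U t) y = u k t * Psi k 0 y)"
   by (rule solution_modes[OF T f Hr_L2[OF g] h sol]) (rule that)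
  have E: "summable (%k. lam k powr r * ?D k)"
   "(\<Sum>k. lam k powr r * ?D k) \<le> (NH (r + s) g)^2 + (NH r h)^2 + (L2T_norm T (NH r) f)^2"
   if d: "regular_data T r f g h" for r
  proof -
   have "AE t in ?M. f t \<in> HS r" "integrable ?M (%t. (NH r (f t))^2)"
    using d by (auto simp: regular_data_def L2T_def strongly_measurable_def)
   from energy_summable[OF f this] d show "summable (%k. lam k powr r * ?D k)"
    "(\<Sum>k. lam k powr r * ?D k) \<le> (NH (r + s) g)^2 + (NH r h)^2 + (L2T_norm T (NH r) f)^2"
    unfolding nT regular_data_def by auto
  qed
  \<comment> \<open>H^0 is L^2, so the standing assumptions on f, g and h already make the energies
    summable with exponent 0.\<close>
  have S0: "summable (%k. lam k powr 0 * ?D k)"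
  proof -
   have H0: "q \<in> HS 0" "(NO q)^2 = (NH 0 q)^2" if q: "q \<in> LO" for q
   proof -
    have l0: "lam k powr 0 = 1" for k using lam_pos[of k] by simp
    show 1: "q \<in> HS 0" unfolding Hr_def mem_Collect_eq l0 using q sums_summable[OF parseval[OF q]] by simp
    show "(NO q)^2 = (NH 0 q)^2" unfolding Hr_norm_sq(3)[OF 1] l0 using sums_unique[OF parseval[OF q]] by simp
   qed
   have fL: "AE t in ?M. f t \<in> LO" and fi: "integrable ?M (%t. (NO (f t))^2)" using f by (auto simp: L2T_def strongly_measurable_def)
   have a: "AE t in ?M. f t \<in> HS 0" using fL by eventually_elim (rule H0)
   have b: "integrable ?M (%t. (NH 0 (f t))^2)"
    by (rule integrable_AE_lebesgue_on(1)[OF open_ivl fi]) (use fL in eventually_elim, rule H0)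
   show ?thesis using energy_summable(1)[OF f a b _ H0(1)[OF h]] g by simp
  qed
  have nn: "0 \<le> lam k powr r * ?D k" for k r by (intro mult_nonneg_nonneg energy_nonneg) simp
  let ?r = "regular_data T \<sigma> f g h"
  \<comment> \<open>The weighted space in which V is built depends on whether the first data
    condition holds; the gradient and operator estimates then refer to this same V in either
    case.\<close>
  define \<tau> where "\<tau> = (if ?r then \<sigma> else 0)"
  define Q where "Q = (if ?r then Q1 * ?q \<kappa>1 else Q3 * ?q \<kappa>3)"
  have P: "?e l k \<in> wL2 {0<..} (hw (?\<beta> l \<tau>) \<theta>)" for k using P1[of k l] P3[of k l] by (simp add: \<tau>_def)
  have N: "(wL2_norm {0<..} (hw (?\<beta> l \<tau>) \<theta>) (?e l k))^2 \<le> Q * lam k powr (s + \<tau>)" for k using N1[of l k] N3[of l k] by (simp add: \<tau>_def Q_def)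
  have S\<tau>: "summable (%k. lam k powr \<tau> * ?D k)" using E(1)[of \<sigma>] S0 by (auto simp: \<tau>_def)
  have n\<phi>: "(NO (%x. \<Sum>k\<in>K. b k *\<^sub>R \<phi> k x))^2 \<le> (\<Sum>k\<in>K. (b k)^2 * 1)" if "finite K" for K b using phi_bessel[OF that, of b] by simp
  have l0: "1 \<le> 1 * lam k powr 0" for k using lam_pos[of k] by simp
  obtain V where V: "V \<in> L2T T (LE (?\<beta> l \<tau>) \<theta>) (NE (?\<beta> l \<tau>) \<theta>)"
   "(L2T_norm T (NE (?\<beta> l \<tau>) \<theta>) V)^2 \<le> T * (?K * 1 * Q * (\<Sum>k. lam k powr \<tau> * ?D k))"
   and Vt: "AE t in ?M. V t \<in> LE (?\<beta> l \<tau>) \<theta> \<and>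
    null (%m. NE (?\<beta> l \<tau>) \<theta> (%z. V t z - (\<Sum>k<m. u k t *\<^sub>R (?e l k (snd z) *\<^sub>R \<phi> k (fst z)))))"
   by (rule cyl_series[where W = \<phi> and e = "?e l" and n = "%_. 1" and r = 1 and i = 0 and j = "s + \<tau>" and Q = Q and \<tau> = \<tau>,
      OF T less_imp_le[OF K] u B phi_L2 n\<phi> zero_le_one l0 P N energy_nonneg S\<tau>]) (assumption | simp | rule that)+
  have 0: "AE t in ?M. hwd (cyl \<Omega>) (0, 1) (l + 1) (U t) (V t)"
   using U Vt B
  proof eventually_elim
   case (elim t)
   \<comment> \<open>The coefficient bound with lam^(-s) and the profile norm with lam^(s-1) leave 1
     / lam k, which is at most 1 / lam 0.\<close>
   have "summable (%k. (u k t)^2 * lam k powr (s - 1))"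
   proof (rule summable_comparison_test'[OF summable_mult[OF S0, of "?K / lam 0"], of 0])
    fix k
    have m: "lam 0 \<le> lam k" using eig unfolding dirichlet_eigenpairs_def by (simp add: monoD)
    have "(u k t)^2 * lam k powr (s - 1) \<le> ?K * (lam k powr (- s) * ?D k) * lam k powr (s - 1)" using elim(3) by (intro mult_right_mono) auto
    also have "\<dots> = ?K * ?D k * (lam k powr (- s) * lam k powr (s - 1))" by (simp add: mult_ac)
    also have "lam k powr (- s) * lam k powr (s - 1) = 1 / lam k" using lam_pos[of k] by (simp add: powr_add[symmetric] powr_neg_one)
    also have "?K * ?D k * (1 / lam k) \<le> ?K * ?D k * (1 / lam 0)" using m lam0 K energy_nonneg[of T f g h k] by (intro mult_left_mono frac_le) auto
    finally show "norm ((u k t)^2 * lam k powr (s - 1)) \<le> ?K / lam 0 * (lam k powr 0 * ?D k)" using lam_pos[of k] by simp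
   qed
   then have "hwd (cyl \<Omega>) (0, 1) (Suc l) (U t) (V t)"
    using elim(1,2) by (intro expansion_deriv[where b = "%k. u k t" and \<beta> = "?\<beta> l \<tau>" and \<theta> = \<theta>] P) auto
   then show ?case by simp
  qed
  have 1: "estimate T (exp_weight (?\<beta> l \<sigma>) \<theta>) (?c l) \<sigma> f g h V" if ?r
  proof -
   have e: "\<tau> = \<sigma>" "Q = Q1 * ?q \<kappa>1" using that by (simp_all add: \<tau>_def Q_def)
   have S: "summable (%k. lam k powr \<sigma> * ?D k)" using S\<tau> e by simp
   show ?thesis using V(1) unfolding e estimate_def
    by (intro conjI regularity_constants[OF V(2)[unfolded e] E(2) suminf_nonneg[OF S nn]])
     (use that T K Q1 C \<kappa> in auto)
  qed
  have loc: "locint {0<..} (?e l k)" for k by (rule pos_weight.wL2_locally_integrable[OF pos_weight_half_line P])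
  have 2: "\<exists>W. (AE t in ?M. has_weak_grad_x' \<Omega> (V t) (W t)) \<and> estimate T (exp_weight (?\<beta> l (\<nu> - 1)) \<theta>) (?c l) \<nu> f g h W"
   if d: "regular_data T \<nu> f g h"
  proof -
   have n0: "0 \<le> lam k / a" "lam k / a \<le> 1 / a * lam k powr 1" for k using lam_pos[of k] a0 by simp_all
   have ij: "1 + (s + (\<nu> - 1)) - s = \<nu>" by simp
   obtain W where W: "W \<in> L2T T (LE (?\<beta> l (\<nu> - 1)) \<theta>) (NE (?\<beta> l (\<nu> - 1)) \<theta>)"
    "(L2T_norm T (NE (?\<beta> l (\<nu> - 1)) \<theta>) W)^2 \<le> T * (?K * (1 / a) * (Q2 * ?q \<kappa>2) * (\<Sum>k. lam k powr \<nu> * ?D k))"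
    and Wt: "AE t in ?M. W t \<in> LE (?\<beta> l (\<nu> - 1)) \<theta> \<and>
     null (%m. NE (?\<beta> l (\<nu> - 1)) \<theta> (%z. W t z - (\<Sum>k<m. u k t *\<^sub>R (?e l k (snd z) *\<^sub>R wg (\<phi> k) (fst z)))))"
    by (rule cyl_series[where W = "%k. wg (\<phi> k)" and e = "?e l" and n = "%k. lam k / a" and r = "1 / a" and i = 1 and j = "s + (\<nu> - 1)" and Q = "Q2 * ?q \<kappa>2" and \<tau> = \<nu>,
       OF T less_imp_le[OF K] u B O.wH1_weak_grad(1)[OF phi_wH1] grad_phi_bessel n0 P2 N2 energy_nonneg E(1)[OF d] ij]) (assumption | rule that)+
   have "AE t in ?M. has_weak_grad_x' \<Omega> (V t) (W t)"
    using Vt Wt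
   proof eventually_elim
    case (elim t)
    show ?case by (rule expansion_grad[where b = "%k. u k t", OF P loc elim(1)[THEN conjunct1] elim(1)[THEN conjunct2] P2
       elim(2)[THEN conjunct1] elim(2)[THEN conjunct2]])
   qed
   moreover have "estimate T (exp_weight (?\<beta> l (\<nu> - 1)) \<theta>) (?c l) \<nu> f g h W" unfolding estimate_def
    by (rule conjI[OF W(1)], rule regularity_constants[OF W(2) E(2)[OF d] suminf_nonneg[OF E(1)[OF d] nn]]) (use T K Q2 C \<kappa> a0 in auto)
   ultimately show ?thesis by blast
  qed
  have 3: "\<exists>G. (AE t in ?M. has_dirichlet_op_x' \<Omega> A c (V t) (G t)) \<and> estimate T (exp_weight (?\<beta> l (\<nu> - 1)) \<theta>) (?c l) (1 + \<nu>) f g h G"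
   if d: "regular_data T (1 + \<nu>) f g h"
  proof -
   have lp: "(%x. lam k * \<phi> k x) \<in> LO" for k using O.wL2_cmult(1)[OF phi_L2, of "lam k" k] by simp
   have nl: "(NO (%x. \<Sum>k\<in>K. b k *\<^sub>R (lam k * \<phi> k x)))^2 \<le> (\<Sum>k\<in>K. (b k)^2 * (lam k)^2)" if "finite K" for K b
    using phi_bessel[OF that, of "%k. b k * lam k"] by (simp add: mult.assoc power_mult_distrib)
   have n0: "0 \<le> (lam k)^2" "(lam k)^2 \<le> 1 * lam k powr 2" for k using lam_pos[of k] by simp_all
   have ij: "2 + (s + (\<nu> - 1)) - s = 1 + \<nu>" by simp
   obtain G where G: "G \<in> L2T T (LE (?\<beta> l (\<nu> - 1)) \<theta>) (NE (?\<beta> l (\<nu> - 1)) \<theta>)"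
    "(L2T_norm T (NE (?\<beta> l (\<nu> - 1)) \<theta>) G)^2 \<le> T * (?K * 1 * (Q2 * ?q \<kappa>2) * (\<Sum>k. lam k powr (1 + \<nu>) * ?D k))"
    and Gt: "AE t in ?M. G t \<in> LE (?\<beta> l (\<nu> - 1)) \<theta> \<and>
     null (%m. NE (?\<beta> l (\<nu> - 1)) \<theta> (%z. G t z - (\<Sum>k<m. u k t *\<^sub>R (?e l k (snd z) *\<^sub>R (lam k * \<phi> k (fst z))))))"
    by (rule cyl_series[where W = "%k x. lam k * \<phi> k x" and e = "?e l" and n = "%k. (lam k)^2" and r = 1 and i = 2 and j = "s + (\<nu> - 1)" and Q = "Q2 * ?q \<kappa>2" and \<tau> = "1 + \<nu>",
       OF T less_imp_le[OF K] u B lp nl n0 P2 N2 energy_nonneg E(1)[OF d] ij]) (assumption | rule that)+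
   have "AE t in ?M. has_dirichlet_op_x' \<Omega> A c (V t) (G t)"
    using Vt Gt
   proof eventually_elim
    case (elim t)
    show ?case by (rule expansion_op[where b = "%k. u k t", OF P elim(1)[THEN conjunct1] elim(1)[THEN conjunct2] P2
       elim(2)[THEN conjunct1] elim(2)[THEN conjunct2]])
   qed
   moreover have "estimate T (exp_weight (?\<beta> l (\<nu> - 1)) \<theta>) (?c l) (1 + \<nu>) f g h G" unfolding estimate_def
    by (rule conjI[OF G(1)], rule regularity_constants[OF G(2) E(2)[OF d] suminf_nonneg[OF E(1)[OF d] nn]]) (use T K Q2 C \<kappa> in auto)
   ultimately show ?thesis by blast
  qed
  show ?thesis by (rule exI[of _ V], intro conjI impI 0 1 2 3)
 qed
 then show ?thesis unfolding \<beta>2 by (intro exI[of _ \<kappa>] exI[of _ C] conjI allI impI \<kappa>(1) C(1))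
qed

end

section \<open>From the hypotheses of the theorem to the setting of the proof\<close>

lemma matrix_form_bound:
 fixes M :: "real^'n^'n"
 shows "\<bar>(M *v \<xi>) \<bullet> \<eta>\<bar> \<le> real CARD('n) * norm M * (norm \<xi> * norm \<eta>)"
proof -
 have "(M *v \<xi>) \<bullet> \<eta> = (\<Sum>i\<in>UNIV. (M $ i \<bullet> \<xi>) * \<eta> $ i)" by (simp add: inner_vec_def matrix_vector_mult_def)
 also have "\<bar>\<dots>\<bar> \<le> (\<Sum>i\<in>(UNIV :: 'n set). norm M * norm \<xi> * norm \<eta>)"
 proof (rule order_trans[OF sum_abs], rule sum_mono)
  fix i
  have "\<bar>M $ i \<bullet> \<xi>\<bar> \<le> norm M * norm \<xi>"
   using Cauchy_Schwarz_ineq2[of "M $ i" \<xi>] mult_right_mono[OF Finite_Cartesian_Product.norm_nth_le[of M i] norm_ge_zero[of \<xi>]] by linarith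
  then show "\<bar>(M $ i \<bullet> \<xi>) * \<eta> $ i\<bar> \<le> norm M * norm \<xi> * norm \<eta>"
   unfolding abs_mult using component_le_norm_cart[of \<eta> i] by (intro mult_mono) auto
 qed
 finally show ?thesis by (simp add: mult_ac)
qed

theorem proposition4p2:
  fixes P \<Omega> :: "(real^'n) set"
    and A :: "real^'n \<Rightarrow> real^'n^'n"
    and c :: "real^'n \<Rightarrow> real"
    and lam :: "nat \<Rightarrow> real"
    and \<phi> :: "nat \<Rightarrow> real^'n \<Rightarrow> real"
    and s T \<sigma> \<nu> \<theta> :: real
  assumes "polytope P" and "\<Omega> = interior P" and "\<Omega> \<noteq> {}"
    and "0 < T"
    and "\<exists>L. L-lipschitz_on \<Omega> A"
    and "\<And>x. x \<in> \<Omega> \<Longrightarrow> transpose (A x) = A x"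
    and "\<exists>a>0. \<forall>x\<in>\<Omega>. \<forall>\<xi>. a * (norm \<xi>)\<^sup>2 \<le> (A x *v \<xi>) \<bullet> \<xi>"
    and "c \<in> borel_measurable (lebesgue_on \<Omega>)"
    and "AE x in lebesgue_on \<Omega>. 0 \<le> c x"
    and "\<exists>M. AE x in lebesgue_on \<Omega>. c x \<le> M"
    and "dirichlet_eigenpairs \<Omega> A c lam \<phi>"
    and "0 < s" and "s < 1"
    and "0 \<le> \<sigma>" and "\<sigma> < s"
    and "0 \<le> \<nu>" and "\<nu> < 1 + s"
    and "0 \<le> \<theta>" and "\<theta> < 2 * sqrt (lam 0)"
  shows "\<exists>\<kappa>>1. \<exists>C>0. \<forall>f g h U.
    f \<in> L2T T (L2 \<Omega>) (L2_norm \<Omega>) \<longrightarrow> g \<in> Hr \<Omega> lam \<phi> s \<longrightarrow> h \<in> L2 \<Omega> \<longrightarrow>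
    weak_solution \<Omega> A c lam \<phi> s T f g h U \<longrightarrow>
    (\<forall>l::nat. \<exists>V.
       (AE t in lebesgue_on {0<..<T}. has_weak_deriv (cyl \<Omega>) (0, 1) (l + 1) (U t) (V t)) \<and>
       (let \<omega> = exp_weight (1 - 2 * s + 2 * real l - 2 * \<sigma>) \<theta>
        in g \<in> Hr \<Omega> lam \<phi> (\<sigma> + s) \<and> h \<in> Hr \<Omega> lam \<phi> \<sigma> \<and>
           f \<in> L2T T (Hr \<Omega> lam \<phi> \<sigma>) (Hr_norm \<Omega> lam \<phi> \<sigma>) \<longrightarrow>
           V \<in> L2T T (wL2 (cyl \<Omega>) \<omega>) (wL2_norm (cyl \<Omega>) \<omega>) \<and>
           (L2T_norm T (wL2_norm (cyl \<Omega>) \<omega>) V)\<^sup>2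
             \<le> C * \<kappa> ^ (2 * (l + 1)) * (fact (l + 1))\<^sup>2 *
               ((Hr_norm \<Omega> lam \<phi> (\<sigma> + s) g)\<^sup>2 + (Hr_norm \<Omega> lam \<phi> \<sigma> h)\<^sup>2
                + (L2T_norm T (Hr_norm \<Omega> lam \<phi> \<sigma>) f)\<^sup>2)) \<and>
       (let \<omega> = exp_weight (1 - 2 * s + 2 * real (l + 1) - 2 * \<nu>) \<theta>
        in g \<in> Hr \<Omega> lam \<phi> (\<nu> + s) \<and> h \<in> Hr \<Omega> lam \<phi> \<nu> \<and>
           f \<in> L2T T (Hr \<Omega> lam \<phi> \<nu>) (Hr_norm \<Omega> lam \<phi> \<nu>) \<longrightarrow>
           (\<exists>W. (AE t in lebesgue_on {0<..<T}. has_weak_grad_x' \<Omega> (V t) (W t)) \<and>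
             W \<in> L2T T (wL2 (cyl \<Omega>) \<omega>) (wL2_norm (cyl \<Omega>) \<omega>) \<and>
             (L2T_norm T (wL2_norm (cyl \<Omega>) \<omega>) W)\<^sup>2
               \<le> C * \<kappa> ^ (2 * (l + 1)) * (fact (l + 1))\<^sup>2 *
                 ((Hr_norm \<Omega> lam \<phi> (\<nu> + s) g)\<^sup>2 + (Hr_norm \<Omega> lam \<phi> \<nu> h)\<^sup>2
                  + (L2T_norm T (Hr_norm \<Omega> lam \<phi> \<nu>) f)\<^sup>2))) \<and>
       (let \<omega> = exp_weight (1 - 2 * s + 2 * real (l + 1) - 2 * \<nu>) \<theta>
        in g \<in> Hr \<Omega> lam \<phi> (1 + \<nu> + s) \<and> h \<in> Hr \<Omega> lam \<phi> (1 + \<nu>) \<and>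
           f \<in> L2T T (Hr \<Omega> lam \<phi> (1 + \<nu>)) (Hr_norm \<Omega> lam \<phi> (1 + \<nu>)) \<longrightarrow>
           (\<exists>G. (AE t in lebesgue_on {0<..<T}. has_dirichlet_op_x' \<Omega> A c (V t) (G t)) \<and>
             G \<in> L2T T (wL2 (cyl \<Omega>) \<omega>) (wL2_norm (cyl \<Omega>) \<omega>) \<and>
             (L2T_norm T (wL2_norm (cyl \<Omega>) \<omega>) G)\<^sup>2
               \<le> C * \<kappa> ^ (2 * (l + 1)) * (fact (l + 1))\<^sup>2 *
                 ((Hr_norm \<Omega> lam \<phi> (1 + \<nu> + s) g)\<^sup>2 + (Hr_norm \<Omega> lam \<phi> (1 + \<nu>) h)\<^sup>2
                  + (L2T_norm T (Hr_norm \<Omega> lam \<phi> (1 + \<nu>)) f)\<^sup>2))))"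
proof -
 have bd: "bounded \<Omega>" and op: "open \<Omega>" using polytope_imp_bounded[OF assms(1)] assms(2) by (auto simp: bounded_interior)
 obtain L where L: "L-lipschitz_on \<Omega> A" using assms(5) by blast
 obtain a where a: "0 < a" "\<And>x \<xi>. x \<in> \<Omega> ==> a * (norm \<xi>)^2 \<le> (A x *v \<xi>) \<bullet> \<xi>" using assms(7) by blast
 obtain M where M: "AE x in lebesgue_on \<Omega>. c x \<le> M" using assms(10) by blast
 have M': "AE x in lebesgue_on \<Omega>. c x \<le> max M 0" using M by eventually_elim simp
 \<comment> \<open>A is bounded as a uniformly continuous function on a bounded set.\<close>
 obtain N where N: "\<And>x. x \<in> \<Omega> ==> norm (A x) \<le> N"
  using bounded_uniformly_continuous_image[OF lipschitz_on_uniformly_continuous[OF L] bd] by (auto simp: bounded_iff)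
 define B where "B = real CARD('n) * max N 0"
 have B: "\<bar>(A x *v \<xi>) \<bullet> \<eta>\<bar> \<le> B * (norm \<xi> * norm \<eta>)" if "x \<in> \<Omega>" for x \<xi> \<eta>
 proof -
  have "real CARD('n) * norm (A x) \<le> B" unfolding B_def using N[OF that] by (intro mult_left_mono) auto
  then have "real CARD('n) * norm (A x) * (norm \<xi> * norm \<eta>) \<le> B * (norm \<xi> * norm \<eta>)" by (intro mult_right_mono) auto
  then show ?thesis using matrix_form_bound[of "A x" \<xi> \<eta>] by linarith
 qed
 have sym: "(A x *v \<xi>) \<bullet> \<eta> = (A x *v \<eta>) \<bullet> \<xi>" if "x \<in> \<Omega>" for x \<xi> \<eta>
 proof -
  have "(A x *v \<xi>) \<bullet> \<eta> = (\<eta> v* A x) \<bullet> \<xi>" unfolding dot_lmul_matrix by (rule inner_commute)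
  also have "\<eta> v* A x = A x *v \<eta>" using transpose_matrix_vector[of "A x" \<eta>] assms(6)[OF that] by simp
  finally show ?thesis .
 qed
 \<comment> \<open>The hypothesis 0 <= theta < 2 sqrt (lam 0) forces the least eigenvalue to be
   positive.\<close>
 have l0: "0 < lam 0"
 proof -
  have "0 < sqrt (lam 0)" using assms(18,19) by linarith
  then show ?thesis by simp
 qed
 interpret elliptic \<Omega> A c lam \<phi> s a B "max M 0"
  by unfold_locales (fact op lmeasurable_open[OF bd op] lipschitz_on_continuous_on[OF L] B sym a assms(8,9,11,12,13) M' l0 | simp add: B_def)+
 show ?thesis using regularity[OF assms(4,14-19)] unfolding regular_data_def estimate_def Let_def .
qed

end
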